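(* Let $W : \mathbb{R}^d \to [0,+\infty)$ be an interaction potential admitting a decomposition $W = W^\sharp+W^\flat$, with $W^\sharp : \mathbb{R}^d \to [0,+\infty)$ and $W^\flat : \mathbb{R}^d \to \mathbb{R}$ such that: - $W^\sharp$ is even and lower semicontinuous on $\mathbb{R}^d$, there exist $\ell \geq 1$ and $\kappa_\ell>0$ such that $W^\sharp(x) \geq 2\kappa_\ell|x|^\ell$ for all $x \in \mathbb{R}^d$, and $(1-\epsilon)W^\sharp(x) \geq W^\sharp((1-\epsilon)x)$ for all $\epsilon \in (0,1)$ and all $x \in \mathbb{R}^d$; - $W^\flat$ is even and continuous on $\mathbb{R}^d$ and, with the same $\ell$: if $\ell=1$, then $W^\flat$ is bounded; if $\ell>1$, then there exists $\ell' \in [0,\ell)$ such that $W^\flat(x)/(1+|x|^{\ell'})$ is bounded on $\mathbb{R}^d$. Define the energy functional \[ \mathscr{W}[\mu] = \frac12\iint_{x,y\in\mathbb{R}^d} W(x-y)\,\mathrm{d}\mu(x)\,\mathrm{d}\mu(y), \qquad \mu\in\mathcal{P}(\mathbb{R}^d). \] Then the associated sequence of probability measures $\widetilde{P}_n$, $n\ge2$, is well defined, and: (i) the sequence $\overline{\mathbb{P}}_n$ satisfies a large deviation principle (with speed $n$) on $\overline{\mathcal{P}}(\mathbb{R}^d)$ with good rate function $\overline{\mathscr{I}}[\overline\mu] := \overline{\mathscr{F}}[\overline\mu]-\mathscr{F}_\star$; (ii) if $\ell>1$, then for all $p \in [1,\ell)$, the sequence $\widetilde{\mathbb{P}}_n$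 satisfies a large deviation principle (with speed $n$) on $\widetilde{\mathcal{P}}_p(\mathbb{R}^d)$ with good rate function $\widetilde{\mathscr{I}}[\widetilde\mu] := \mathscr{F}[\widetilde\mu]-\mathscr{F}_\star$.
   Context: Throughout, $d \geq 1$ is an integer and $\sigma^2>0$ is fixed. Spaces. $\mathcal{P}(\mathbb{R}^d)$ is the set of Borel probability measures on $\mathbb{R}^d$ with the topology of weak convergence. For $p \geq 1$, $\mathcal{P}_p(\mathbb{R}^d)$ is the set of those with finite $p$-th moment, with the Wasserstein topology of order $p$, and $\widetilde{\mathcal{P}}_p(\mathbb{R}^d) \subset \mathcal{P}_p(\mathbb{R}^d)$ is the subset of centered measures ($\int x\,\mathrm{d}\mu(x)=0$), with the induced topology. For $y \in \mathbb{R}^d$, $\tau_y\mu$ is the pushforward of $\mu$ by $x \mapsto x+y$. $\overline{\mathcal{P}}(\mathbb{R}^d)$ is the orbit space of the action $(y,\mu)\mapsto\tau_y\mu$ of $\mathbb{R}^d$ on $\mathcal{P}(\mathbb{R}^d)$, $\rho(\mu)=\{\tau_y\mu : y\in\mathbb{R}^d\}$ is the orbit map, and $\overline{\mathcal{P}}(\mathbb{R}^d)$ carries the quotient topology (the strongest topology making $\rho$ continuous), which is metrisable. Gibbs measure. For $n \geq 2$ and $\mathbf{x} \in (\mathbb{R}^d)^n$, $\pi_n(\mathbf{x}) := \frac1n\sum_{i=1}^n \delta_{x_i}$ and $W_n(\mathbf{x}) := \mathscr{W}[\pi_n(\mathbf{x})]$. $M_{d,n} := \{\widetilde{\mathbf{x}}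 \in (\mathbb{R}^d)^n : \widetilde x_1+\cdots+\widetilde x_n=0\}$, with Lebesgue measure $\mathrm{d}\widetilde{\mathbf{x}}$. $\widetilde{P}_n$ is the probability measure on $(\mathbb{R}^d)^n$, concentrated on $M_{d,n}$, with density $\widetilde{Z}_n^{-1}\exp(-\frac{2n}{\sigma^2}W_n(\widetilde{\mathbf{x}}))$ with respect to $\mathrm{d}\widetilde{\mathbf{x}}$, where $\widetilde Z_n := \int_{M_{d,n}} \exp(-\frac{2n}{\sigma^2}W_n(\widetilde{\mathbf{x}}))\,\mathrm{d}\widetilde{\mathbf{x}}$; it is well defined when $\widetilde Z_n\in (0,+\infty)$. Set $\widetilde{\mathbb{P}}_n := \widetilde{P}_n \circ \pi_n^{-1}$ (regarded as a Borel probability measure on $\mathcal{P}(\mathbb{R}^d)$ or on $\widetilde{\mathcal{P}}_p(\mathbb{R}^d)$) and $\overline{\mathbb{P}}_n := \widetilde{\mathbb{P}}_n\circ\rho^{-1}$. Free energy. $\mathscr{S}[\mu] := \int p\log p\,\mathrm{d}x \in (-\infty,+\infty]$ if $\mu \in \mathcal{P}_1(\mathbb{R}^d)$ has Lebesgue density $p$, and $\mathscr{S}[\mu]:=+\infty$ otherwise. $\mathscr{F}[\mu] := \mathscr{S}[\mu]+\frac{2}{\sigma^2}\mathscr{W}[\mu]$, $\mathscr{F}_\star := \inf_{\mu\in\mathcal{P}(\mathbb{R}^d)}\mathscr{F}[\mu]$, and $\overline{\mathscr{F}}[\rho(\mu)]:=\mathscr{F}[\mu]$ (well defined by translation invariance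 of $\mathscr{F}$). A good rate function on a metric space is a proper function with compact level sets.
   Formalization: Parts (i) and (ii) are stated under the extra condition that F_* is finite; it does not follow from the hypotheses when d ≥ 2 (W can have infinite energy at every density), and without it the rate functions F − F_* are undefined. *)

theory Defs
  imports "HOL-Probability.Probability"
begin

section \<open>Topological preliminaries\<close>

definition lower_semicontinuous :: "('a::topological_space \<Rightarrow> real) \<Rightarrow> bool" where
  "lower_semicontinuous f \<longleftrightarrow> (\<forall>x. \<forall>c < f x. \<forall>\<^sub>F y in nhds x. c < f y)"

definition borel_of :: "'x topology \<Rightarrow> 'x measure" where
  "borel_of X = sigma (topspace X) {U. openin X U}"

definition quotient_topology :: "'x topology \<Rightarrow> ('x \<Rightarrow> 'y) \<Rightarrow> 'y topology" where
  "quotient_topology X q =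
     topology (\<lambda>V. V \<subseteq> q ` topspace X \<and> openin X {x \<in> topspace X. q x \<in> V})"

lemma openin_quotient_topology:
  "openin (quotient_topology X q) V \<longleftrightarrow>
     V \<subseteq> q ` topspace X \<and> openin X {x \<in> topspace X. q x \<in> V}"
proof -
  have "istopology (\<lambda>V. V \<subseteq> q ` topspace X \<and> openin X {x \<in> topspace X. q x \<in> V})"
    unfolding istopology_def
  proof (intro conjI allI impI)
    fix S T
    assume S: "S \<subseteq> q ` topspace X \<and> openin X {x \<in> topspace X. q x \<in> S}"
      and T: "T \<subseteq> q ` topspace X \<and> openin X {x \<in> topspace X. q x \<in> T}"
    have "{x \<in> topspace X. q x \<in> S \<inter> T}
        = {x \<in> topspace X. q x \<in> S} \<inter> {x \<in> topspace X. q x \<in> T}" by auto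
    with S T show "openin X {x \<in> topspace X. q x \<in> S \<inter> T}" by auto
    from S show "S \<inter> T \<subseteq> q ` topspace X" by auto
  next
    fix K
    assume K: "\<forall>S\<in>K. S \<subseteq> q ` topspace X \<and> openin X {x \<in> topspace X. q x \<in> S}"
    have "{x \<in> topspace X. q x \<in> \<Union>K} = (\<Union>S\<in>K. {x \<in> topspace X. q x \<in> S})" by auto
    with K show "openin X {x \<in> topspace X. q x \<in> \<Union>K}" by auto
    from K show "\<Union>K \<subseteq> q ` topspace X" by auto
  qed
  then show ?thesis by (simp add: quotient_topology_def)
qed

lemma topspace_quotient_topology: "topspace (quotient_topology X q) = q ` topspace X"
proof -
  have "{x \<in> topspace X. q x \<in> q ` topspace X} = topspace X" by auto
  then have "openin (quotient_topology X q) (q ` topspace X)"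
    by (simp add: openin_quotient_topology)
  then show ?thesis
    by (metis openin_quotient_topology openin_subset openin_topspace subset_antisym)
qed


section \<open>Large deviation principles\<close>

definition ln_ereal :: "real \<Rightarrow> ereal" where
  "ln_ereal t = (if t \<le> 0 then -\<infinity> else ereal (ln t))"

text \<open>Rate functions take values in \<open>[0, \<infinity>]\<close>; proper means not identically \<open>\<infinity>\<close>.\<close>

definition good_rate_function :: "'x topology \<Rightarrow> ('x \<Rightarrow> ereal) \<Rightarrow> bool" where
  "good_rate_function X I \<longleftrightarrow>
     (\<forall>x \<in> topspace X. 0 \<le> I x) \<and>
     (\<exists>x \<in> topspace X. I x \<noteq> \<infinity>) \<and>
     (\<forall>c::real. compactin X {x \<in> topspace X. I x \<le> ereal c})"

text \<open>Speed \<open>n\<close>. All sequences here start at index \<open>2\<close>, so nothing is required of \<open>P 0\<close> and \<open>P 1\<close>.\<close>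

definition satisfies_LDP :: "'x topology \<Rightarrow> (nat \<Rightarrow> 'x measure) \<Rightarrow> ('x \<Rightarrow> ereal) \<Rightarrow> bool" where
  "satisfies_LDP X P I \<longleftrightarrow>
     (\<forall>n\<ge>2. prob_space (P n) \<and> space (P n) = topspace X \<and> sets (P n) = sets (borel_of X)) \<and>
     (\<forall>G. openin X G \<longrightarrow>
        - (INF x\<in>G. I x) \<le> liminf (\<lambda>n. ereal (1 / real n) * ln_ereal (measure (P n) G))) \<and>
     (\<forall>C. closedin X C \<longrightarrow>
        limsup (\<lambda>n. ereal (1 / real n) * ln_ereal (measure (P n) C)) \<le> - (INF x\<in>C. I x))"


section \<open>Spaces of probability measures\<close>

definition prob_measures :: "'a::euclidean_space measure set" where
  "prob_measures = {\<mu>. sets \<mu> = sets borel \<and> prob_space \<mu>}"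

definition weak_topology :: "'a::euclidean_space measure topology" where
  "weak_topology = topology_generated_by
     {{\<mu> \<in> prob_measures. (\<integral>x. f x \<partial>\<mu>) \<in> U} | (f :: 'a \<Rightarrow> real) U.
        continuous_on UNIV f \<and> bounded (range f) \<and> open U}"

lemma topspace_weak_topology: "topspace weak_topology = prob_measures"
proof -
  have "\<exists>(f :: 'a \<Rightarrow> real) U.
      (prob_measures :: 'a measure set) = {\<mu> \<in> prob_measures. (\<integral>x. f x \<partial>\<mu>) \<in> U} \<and>
      continuous_on UNIV f \<and> bounded (range f) \<and> open U"
    by (rule exI[of _ "\<lambda>_. 0"], rule exI[of _ UNIV]) auto
  then show ?thesis
    unfolding weak_topology_def topology_generated_by_topspace by blast
qed

definition prob_measures_p :: "real \<Rightarrow> 'a::euclidean_space measure set" where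
  "prob_measures_p p = {\<mu> \<in> prob_measures. (\<integral>\<^sup>+x. ennreal (norm x powr p) \<partial>\<mu>) < \<infinity>}"

definition couplings ::
    "'a::euclidean_space measure \<Rightarrow> 'a measure \<Rightarrow> ('a \<times> 'a) measure set" where
  "couplings \<mu> \<nu> = {\<gamma>. sets \<gamma> = sets (borel \<Otimes>\<^sub>M borel) \<and> prob_space \<gamma> \<and>
     distr \<gamma> borel fst = \<mu> \<and> distr \<gamma> borel snd = \<nu>}"

definition wasserstein_dist ::
    "real \<Rightarrow> 'a::euclidean_space measure \<Rightarrow> 'a measure \<Rightarrow> real" where
  "wasserstein_dist p \<mu> \<nu> =
     enn2real (INF \<gamma>\<in>couplings \<mu> \<nu>. \<integral>\<^sup>+z. ennreal (dist (fst z) (snd z) powr p) \<partial>\<gamma>) powr (1 / p)"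

text \<open>
  This is what \<^const>\<open>Metric_space.mtopology\<close> unfolds to; the library constant itself is only
  usable once the metric axioms for the Wasserstein distance are available.
\<close>

definition wasserstein_topology :: "real \<Rightarrow> 'a::euclidean_space measure topology" where
  "wasserstein_topology p = topology (\<lambda>U. U \<subseteq> prob_measures_p p \<and>
     (\<forall>\<mu>\<in>U. \<exists>r>0. {\<nu> \<in> prob_measures_p p. wasserstein_dist p \<mu> \<nu> < r} \<subseteq> U))"

lemma openin_wasserstein_topology:
  fixes U :: "'a::euclidean_space measure set"
  shows "openin (wasserstein_topology p) U \<longleftrightarrow>
     U \<subseteq> prob_measures_p p \<and>
     (\<forall>\<mu>\<in>U. \<exists>r>0. {\<nu> \<in> prob_measures_p p. wasserstein_dist p \<mu> \<nu> < r} \<subseteq> U)"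
proof -
  let ?B = "\<lambda>\<mu> r. {\<nu> \<in> prob_measures_p p. wasserstein_dist p (\<mu> :: 'a measure) \<nu> < r}"
  let ?Q = "\<lambda>U. U \<subseteq> prob_measures_p p \<and> (\<forall>\<mu>\<in>U. \<exists>r>0. ?B \<mu> r \<subseteq> U)"
  have "istopology ?Q"
    unfolding istopology_def
  proof (intro conjI allI impI)
    fix S T assume S: "?Q S" and T: "?Q T"
    show "S \<inter> T \<subseteq> prob_measures_p p" using S by auto
    show "\<forall>\<mu>\<in>S \<inter> T. \<exists>r>0. ?B \<mu> r \<subseteq> S \<inter> T"
    proof
      fix \<mu> assume "\<mu> \<in> S \<inter> T"
      then obtain r s where "r > 0" "?B \<mu> r \<subseteq> S" "s > 0" "?B \<mu> s \<subseteq> T"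
        using S T by (meson IntD1 IntD2)
      then show "\<exists>r>0. ?B \<mu> r \<subseteq> S \<inter> T"
        by (intro exI[of _ "min r s"]) auto
    qed
  next
    fix K assume K: "\<forall>S\<in>K. ?Q S"
    then show "\<Union>K \<subseteq> prob_measures_p p" by auto
    show "\<forall>\<mu>\<in>\<Union>K. \<exists>r>0. ?B \<mu> r \<subseteq> \<Union>K"
      using K by (meson Sup_upper UnionE order_trans)
  qed
  then show ?thesis by (simp add: wasserstein_topology_def)
qed

lemma topspace_wasserstein_topology:
  "topspace (wasserstein_topology p) = prob_measures_p p"
proof -
  have "openin (wasserstein_topology p) (prob_measures_p p)"
    unfolding openin_wasserstein_topology by (auto intro: exI[of _ 1])
  then show ?thesis
    by (metis openin_wasserstein_topology openin_subset openin_topspace subset_antisym)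
qed

definition centered_prob_measures_p :: "real \<Rightarrow> 'a::euclidean_space measure set" where
  "centered_prob_measures_p p = {\<mu> \<in> prob_measures_p p. (\<integral>x. x \<partial>\<mu>) = 0}"

definition centered_wasserstein_topology :: "real \<Rightarrow> 'a::euclidean_space measure topology" where
  "centered_wasserstein_topology p =
     subtopology (wasserstein_topology p) (centered_prob_measures_p p)"

definition translate :: "'a::euclidean_space \<Rightarrow> 'a measure \<Rightarrow> 'a measure" where
  "translate y \<mu> = distr \<mu> borel (\<lambda>x. x + y)"

definition orbit :: "'a::euclidean_space measure \<Rightarrow> 'a measure set" where
  "orbit \<mu> = range (\<lambda>y. translate y \<mu>)"

definition orbit_topology :: "'a::euclidean_space measure set topology" where
  "orbit_topology = quotient_topology weak_topology orbit"


section \<open>Energy, entropy and free energy\<close>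

definition interaction_energy :: "('a::euclidean_space \<Rightarrow> real) \<Rightarrow> 'a measure \<Rightarrow> ennreal" where
  "interaction_energy W \<mu> = (\<integral>\<^sup>+x. (\<integral>\<^sup>+y. ennreal (W (x - y)) \<partial>\<mu>) \<partial>\<mu>) / 2"

text \<open>
  The integral of \<open>p log p\<close> is the integral of its positive part minus that of its negative part;
  for a measure with finite first moment the latter is finite, so the difference is never
  \<open>\<infinity> - \<infinity>\<close>.
\<close>

definition entropy_functional :: "'a::euclidean_space measure \<Rightarrow> ereal" where
  "entropy_functional \<mu> =
     (if \<mu> \<in> prob_measures_p 1 \<and> (\<exists>f \<in> borel_measurable lborel. density lborel f = \<mu>)
      then let p = (\<lambda>x. enn2real (RN_deriv lborel \<mu> x))
           in enn2ereal (\<integral>\<^sup>+x. ennreal (p x * ln (p x)) \<partial>lborel)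
              - enn2ereal (\<integral>\<^sup>+x. ennreal (- (p x * ln (p x))) \<partial>lborel)
      else \<infinity>)"

definition free_energy :: "('a::euclidean_space \<Rightarrow> real) \<Rightarrow> real \<Rightarrow> 'a measure \<Rightarrow> ereal" where
  "free_energy W \<sigma> \<mu> =
     entropy_functional \<mu> + ereal (2 / \<sigma>\<^sup>2) * enn2ereal (interaction_energy W \<mu>)"

text \<open>
  The rate functions \<open>\<F> - \<F>\<^sub>\<star>\<close> only make sense if \<open>\<F>\<^sub>\<star> < \<infinity>\<close>. In dimension \<open>d \<ge> 2\<close> lower
  semicontinuity, finiteness and superlinearity along rays of \<open>W\<^sup>\<sharp>\<close> do not imply this: a potential
  such as \<open>W(x) = |x| g(x/|x|)\<close>, with \<open>g \<ge> 1\<close> even, lower semicontinuous, finite and not integrable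
  over the unit sphere, has infinite energy at every measure with a density.
\<close>

definition min_free_energy :: "('a::euclidean_space \<Rightarrow> real) \<Rightarrow> real \<Rightarrow> ereal" where
  "min_free_energy W \<sigma> = (INF \<mu>\<in>prob_measures. free_energy W \<sigma> \<mu>)"

text \<open>
  The free energy is translation invariant, hence constant on each orbit; its common value is
  the unique element of the image of the orbit.
\<close>

definition orbit_free_energy ::
    "('a::euclidean_space \<Rightarrow> real) \<Rightarrow> real \<Rightarrow> 'a measure set \<Rightarrow> ereal" where
  "orbit_free_energy W \<sigma> A = the_elem (free_energy W \<sigma> ` A)"


section \<open>The Gibbs measure\<close>

text \<open>
  Points of \<open>(\<real>\<^sup>d)\<^sup>n\<close> are the extensional functions on \<open>{..<n}\<close>, i.e. the space of the product
  measure space \<open>\<Pi>\<^sub>M i\<in>{..<n}. borel\<close>.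
\<close>

definition empirical_measure :: "nat \<Rightarrow> (nat \<Rightarrow> 'a::euclidean_space) \<Rightarrow> 'a measure" where
  "empirical_measure n x = distr (uniform_count_measure {..<n}) borel x"

definition centered_configurations :: "nat \<Rightarrow> (nat \<Rightarrow> 'a::euclidean_space) set" where
  "centered_configurations n = {x \<in> {..<n} \<rightarrow>\<^sub>E UNIV. (\<Sum>i<n. x i) = 0}"

text \<open>
  Lebesgue measure on the linear subspace \<^const>\<open>centered_configurations\<close>, as a measure on
  \<open>(\<real>\<^sup>d)\<^sup>n\<close>: the image of Lebesgue measure on \<open>(\<real>\<^sup>d)\<^bsup>n-1\<^esup>\<close> under the linear parametrisation
  that recovers the last point from the others, times the area factor \<open>n\<^bsup>d/2\<^esup>\<close> (the square
  root of its Gram determinant).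
\<close>

definition centered_lebesgue :: "nat \<Rightarrow> (nat \<Rightarrow> 'a::euclidean_space) measure" where
  "centered_lebesgue n =
     scale_measure (ennreal (sqrt (real n) ^ DIM('a)))
       (distr (\<Pi>\<^sub>M i\<in>{..<n - 1}. lborel) (\<Pi>\<^sub>M i\<in>{..<n}. borel)
          (\<lambda>x. x(n - 1 := - (\<Sum>i<n - 1. x i))))"

text \<open>\<^const>\<open>enn2real\<close> is harmless below: empirical measures have finite energy as \<open>W\<close> is finite.\<close>

definition boltzmann_weight ::
    "('a::euclidean_space \<Rightarrow> real) \<Rightarrow> real \<Rightarrow> nat \<Rightarrow> (nat \<Rightarrow> 'a) \<Rightarrow> ennreal" where
  "boltzmann_weight W \<sigma> n x =
     ennreal (exp (- (2 * real n / \<sigma>\<^sup>2) * enn2real (interaction_energy W (empirical_measure n x))))"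

definition partition_function :: "('a::euclidean_space \<Rightarrow> real) \<Rightarrow> real \<Rightarrow> nat \<Rightarrow> ennreal" where
  "partition_function W \<sigma> n = (\<integral>\<^sup>+x. boltzmann_weight W \<sigma> n x \<partial>centered_lebesgue n)"

definition gibbs_measure ::
    "('a::euclidean_space \<Rightarrow> real) \<Rightarrow> real \<Rightarrow> nat \<Rightarrow> (nat \<Rightarrow> 'a) measure" where
  "gibbs_measure W \<sigma> n =
     density (centered_lebesgue n) (\<lambda>x. boltzmann_weight W \<sigma> n x / partition_function W \<sigma> n)"

text \<open>
  The law of the empirical measure under the Gibbs measure, as a Borel measure on a topological
  space \<open>X\<close> of probability measures. The Gibbs measure is first restricted to the centered
  configurations, which carry its full mass, because only these have their empirical measure
  in \<open>X\<close> when \<open>X\<close> consists of centered measures.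
\<close>

definition empirical_law ::
    "('a::euclidean_space \<Rightarrow> real) \<Rightarrow> real \<Rightarrow> 'a measure topology \<Rightarrow> nat \<Rightarrow> 'a measure measure" where
  "empirical_law W \<sigma> X n =
     distr (restrict_space (gibbs_measure W \<sigma> n) (centered_configurations n))
       (borel_of X) (empirical_measure n)"

definition orbit_law ::
    "('a::euclidean_space \<Rightarrow> real) \<Rightarrow> real \<Rightarrow> nat \<Rightarrow> 'a measure set measure" where
  "orbit_law W \<sigma> n = distr (empirical_law W \<sigma> weak_topology n) (borel_of orbit_topology) orbit"

end

theory Submission
  imports Defs
begin

text \<open>
  Everything is estimated for the unnormalised Gibbs mass of \<open>{x. \<pi>\<^sub>n(x) \<in> A}\<close>, using the
  growth \<open>W(x) \<ge> a|x|\<^sup>l - C\<close>.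

  Upper bound: on centered configurations the interaction dominates a multiple of \<open>\<Sum>|x\<^sub>i|\<^sup>l\<close>, so
  the mass outside a moment ball is exponentially small. Moment balls are compact, both weakly and
  for \<open>W\<^sub>p\<close> with \<open>p < l\<close>, which reduces closed sets to small weak neighbourhoods of one measure
  \<open>\<mu>\<close>; there the energy is nearly at least that of \<open>\<mu>\<close>, and an exponential Chebyshev
  inequality with test functions yields the entropy in its dual form.

  Lower bound: tilt Lebesgue measure to the product measure \<open>\<mu>\<^sup>n\<close> and apply the law of large numbers
  to the sample and to its log-density. Recentering a sample costs a polynomial factor, because
  the energy is translation invariant. In a moment ball, \<open>W\<^sub>p\<close>-neighbourhoods contain weak
  ones, so the same bound serves both topologies.

  Weak compactness of moment balls replaces Prokhorov's theorem: every Borel probability measure on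
  a cube is the law of a random point whose binary digits are drawn with prescribed conditional
  probabilities, and the space of these probabilities is a Tychonoff cube.
\<close>

text \<open>\<open>W\<close> is only lower semicontinuous and may be unbounded on compact sets, so
  the energy is not weakly continuous and the principle cannot be had by tilting a known one
  (Varadhan's lemma). The two directions use different information: lower semicontinuity bounds the
  energy from below near a measure, as an upper bound on mass requires, while the lower bound
  replaces continuity by the mean energy of an independent sample, which is that of
  \<open>\<mu>\<close> up to diagonal terms.

  There is no reference probability measure either: Lebesgue measure is infinite, and confinement
  comes only from the interaction of centered points. A small share of the interaction is therefore
  spent on integrability, and its cost is sent to zero at the end.

  Rates are found before normalising. The same bounds on the whole space identify the minimal free
  energy as the rate of the partition function, so dividing by it produces the subtraction in the
  rate functions. Boundedness below and compact level sets of the free energy are read off from the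
  mass bounds as well, in place of a direct study of the entropy functional.\<close>

section \<open>The weak topology and its subbasis\<close>

lemma prob_measuresD:
  assumes "\<mu> \<in> prob_measures"
  shows "sets \<mu> = sets borel" "prob_space \<mu>" "space \<mu> = UNIV"
  using assms sets_eq_imp_space_eq[of \<mu> borel] by (auto simp: prob_measures_def)

lemma prob_measures_measurable:
  assumes "\<mu> \<in> prob_measures"
  shows "measurable \<mu> N = measurable borel N"
  using prob_measuresD[OF assms] by (intro measurable_cong_sets) auto

lemma integrable_bounded_cont:
  fixes f :: "'a::euclidean_space \<Rightarrow> real"
  assumes "\<mu> \<in> prob_measures" "f \<in> borel_measurable borel" "bounded (range f)"
  shows "integrable \<mu> f"
proof -
  interpret prob_space \<mu> using prob_measuresD[OF assms(1)] by simp
  obtain B where "\<And>x. \<bar>f x\<bar> \<le> B" using assms(3) by (auto simp: bounded_iff)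
  then show ?thesis
    using assms prob_measures_measurable[OF assms(1)]
    by (intro integrable_const_bound[of _ B]) auto
qed

lemma openin_weak_basic:
  fixes f :: "'a::euclidean_space \<Rightarrow> real"
  assumes "continuous_on UNIV f" "bounded (range f)" "open U"
  shows "openin weak_topology {\<mu> \<in> prob_measures. (\<integral>x. f x \<partial>\<mu>) \<in> U}"
  unfolding weak_topology_def
  by (rule topology_generated_by_Basis) (use assms in blast)

text \<open>Open sets of a generated topology are accessible only through finite intersections and
  arbitrary unions of subbasic sets. Preimage and neighbourhood properties are stable under these
  operations, so they need to be checked for a single test function only.\<close>

lemma openin_weak_induct [consumes 1, case_names Empty Int Union Basis]:
  fixes U :: "'a::euclidean_space measure set"
  assumes U: "openin weak_topology U"
    and empty: "P {}"
    and Int: "\<And>A B. P A \<Longrightarrow> P B \<Longrightarrow> P (A \<inter> B)"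
    and Union: "\<And>K. (\<And>A. A \<in> K \<Longrightarrow> P A) \<Longrightarrow> P (\<Union>K)"
    and basis: "\<And>(f :: 'a \<Rightarrow> real) V. continuous_on UNIV f \<Longrightarrow> bounded (range f) \<Longrightarrow> open V \<Longrightarrow>
                  P {\<mu> \<in> prob_measures. (\<integral>x. f x \<partial>\<mu>) \<in> V}"
  shows "P U"
proof -
  have "generate_topology_on {{\<mu> \<in> prob_measures. (\<integral>x. f x \<partial>\<mu>) \<in> U} | (f :: 'a \<Rightarrow> real) U.
        continuous_on UNIV f \<and> bounded (range f) \<and> open U} U"
    using U by (simp add: weak_topology_def openin_topology_generated_by_iff)
  then show ?thesis
  proof (induction rule: generate_topology_on.induct)
    case (Basis s) then show ?case using basis by blast
  qed (auto intro: empty Int Union)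
qed

text \<open>Preimages commute with the operations generating the topology, so continuity may be
  tested against bounded continuous functions.\<close>

lemma continuous_map_into_weak:
  fixes g :: "'b \<Rightarrow> 'a::euclidean_space measure"
  assumes g: "\<And>x. x \<in> topspace X \<Longrightarrow> g x \<in> prob_measures"
    and cont: "\<And>f :: 'a \<Rightarrow> real. continuous_on UNIV f \<Longrightarrow> bounded (range f) \<Longrightarrow>
                 continuous_map X euclideanreal (\<lambda>x. \<integral>y. f y \<partial>g x)"
  shows "continuous_map X weak_topology g"
proof -
  have "openin X {x \<in> topspace X. g x \<in> U}" if "openin weak_topology U" for U
    using that
  proof (induction rule: openin_weak_induct)
    case Empty then show ?case by simp
  next
    case (Int A B)
    have "{x \<in> topspace X. g x \<in> A \<inter> B} = {x \<in> topspace X. g x \<in> A} \<inter> {x \<in> topspace X. g x \<in> B}"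
      by auto
    then show ?case using Int by auto
  next
    case (Union K)
    have "{x \<in> topspace X. g x \<in> \<Union>K} = (\<Union>A\<in>K. {x \<in> topspace X. g x \<in> A})"
      by auto
    then show ?case using Union by auto
  next
    case (Basis f V)
    then have "openin X {x \<in> topspace X. (\<integral>y. f y \<partial>g x) \<in> V}"
      using cont[of f] by (auto simp: continuous_map_def)
    moreover have "{x \<in> topspace X. (\<integral>y. f y \<partial>g x) \<in> V} =
        {x \<in> topspace X. g x \<in> {\<mu> \<in> prob_measures. (\<integral>x. f x \<partial>\<mu>) \<in> V}}"
      using g by auto
    ultimately show ?case by simp
  qed
  then show ?thesis
    using g by (auto simp: continuous_map_def topspace_weak_topology)
qed

text \<open>By monotone convergence the integral of \<open>G\<close> is a supremum of integrals of
  bounded continuous functions, and the superlevel set of a supremum is a union of superlevel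
  sets.\<close>

lemma openin_weak_nn_integral_gt:
  fixes g :: "nat \<Rightarrow> 'a::euclidean_space \<Rightarrow> real"
  assumes cont: "\<And>k. continuous_on UNIV (g k)" and bdd: "\<And>k. bounded (range (g k))"
    and nonneg: "\<And>k x. 0 \<le> g k x" and mono: "\<And>x. incseq (\<lambda>k. g k x)"
    and lim: "\<And>x. (SUP k. ennreal (g k x)) = G x"
  shows "openin weak_topology {\<mu> \<in> prob_measures. c < (\<integral>\<^sup>+x. G x \<partial>\<mu>)}"
proof -
  have eq: "(\<integral>\<^sup>+x. G x \<partial>\<mu>) = (SUP k. ennreal (\<integral>x. g k x \<partial>\<mu>))"
    if \<mu>: "\<mu> \<in> prob_measures" for \<mu>
  proof -
    have [measurable]: "g k \<in> borel_measurable \<mu>" for k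
      using borel_measurable_continuous_onI[OF cont[of k]] by (simp add: prob_measures_measurable[OF \<mu>])
    have "(\<integral>\<^sup>+x. G x \<partial>\<mu>) = (\<integral>\<^sup>+x. (SUP k. ennreal (g k x)) \<partial>\<mu>)"
      by (simp add: lim)
    also have "\<dots> = (SUP k. \<integral>\<^sup>+x. ennreal (g k x) \<partial>\<mu>)"
      using mono by (intro nn_integral_monotone_convergence_SUP)
        (auto simp: incseq_def le_fun_def intro!: ennreal_leI)
    also have "\<dots> = (SUP k. ennreal (\<integral>x. g k x \<partial>\<mu>))"
      using integrable_bounded_cont[OF \<mu> borel_measurable_continuous_onI[OF cont] bdd] nonneg
      by (intro SUP_cong nn_integral_eq_integral) auto
    finally show ?thesis .
  qed
  have Un: "{\<mu> \<in> prob_measures. c < (\<integral>\<^sup>+x. G x \<partial>\<mu>)}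
      = (\<Union>k. {\<mu> \<in> prob_measures. (\<integral>x. g k x \<partial>\<mu>) \<in> {r. c < ennreal r}})"
    using eq by (auto simp: less_SUP_iff)
  have "open {r. c < ennreal r}"
  proof (cases c)
    case (real e)
    then have "{r. c < ennreal r} = {e<..}" by (auto simp: ennreal_less_iff)
    then show ?thesis by simp
  qed simp
  then have "openin weak_topology {\<mu> \<in> prob_measures. c < ennreal (\<integral>x. g k x \<partial>\<mu>)}" for k
    using openin_weak_basic[OF cont bdd, of "{r. c < ennreal r}"] by simp
  then have "openin weak_topology (\<Union>k. {\<mu> \<in> prob_measures. c < ennreal (\<integral>x. g k x \<partial>\<mu>)})"
    by (intro openin_Union) auto
  with Un show ?thesis by simp
qed

section \<open>Lower semicontinuity of the interaction energy and of moments\<close>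

text \<open>The \<open>g k\<close> are inf-convolutions of \<open>min k W\<close> with a cone of
  slope \<open>k\<close> (Pasch-Hausdorff envelopes). The Lipschitz constant comes from the cone,
  boundedness from the truncation, and lower semicontinuity is what makes them increase to
  \<open>W\<close> itself.\<close>

lemma nonneg_lsc_lipschitz_approx:
  fixes W :: "'a::euclidean_space \<Rightarrow> real"
  assumes nonneg: "\<And>x. 0 \<le> W x" and lsc: "lower_semicontinuous W"
  obtains g :: "nat \<Rightarrow> 'a \<Rightarrow> real"
  where "\<And>k x. 0 \<le> g k x" "\<And>k x. g k x \<le> real k"
    "\<And>k x y. \<bar>g k x - g k y\<bar> \<le> real k * dist x y"
    "\<And>x. incseq (\<lambda>k. g k x)" "\<And>x. (SUP k. ennreal (g k x)) = ennreal (W x)"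
proof -
  define h where "h k x y = min (real k) (W y) + real k * dist x y" for k x y
  define g where "g k x = (INF y. h k x y)" for k x
  have h0: "0 \<le> h k x y" for k x y by (simp add: h_def nonneg)
  have bdd: "bdd_below (range (h k x))" for k x using h0 by (intro bdd_belowI[of _ 0]) auto
  have g_le: "g k x \<le> h k x y" for k x y unfolding g_def by (rule cINF_lower[OF bdd]) simp
  have g_ge: "c \<le> g k x" if "\<And>y. c \<le> h k x y" for k x c
    unfolding g_def by (rule cINF_greatest) (use that in auto)
  have g_self: "g k x \<le> min (real k) (W x)" for k x using g_le[of k x x] by (simp add: h_def)
  have lip: "g k x - g k y \<le> real k * dist x y" for k x y
  proof -
    have "g k x - real k * dist x y \<le> g k y"
    proof (rule g_ge)
      fix z
      have "real k * dist x z \<le> real k * (dist x y + dist y z)"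
        by (intro mult_left_mono dist_triangle) auto
      then show "g k x - real k * dist x y \<le> h k y z"
        using g_le[of k x z] by (simp add: h_def algebra_simps)
    qed
    then show ?thesis by simp
  qed
  show ?thesis
  proof
    show "0 \<le> g k x" for k x by (rule g_ge) (rule h0)
    show "g k x \<le> real k" for k x using g_self[of k x] by simp
    show "\<bar>g k x - g k y\<bar> \<le> real k * dist x y" for k x y
      using lip[of k x y] lip[of k y x] by (simp add: dist_commute abs_le_iff)
    show inc: "incseq (\<lambda>k. g k x)" for x
    proof (rule incseq_SucI, rule g_ge)
      fix k y show "g k x \<le> h (Suc k) x y"
        by (rule order_trans[OF g_le[of k x y]], unfold h_def, intro add_mono mult_right_mono) auto
    qed
    show "(SUP k. ennreal (g k x)) = ennreal (W x)" for x
    proof (rule antisym)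
      show "(SUP k. ennreal (g k x)) \<le> ennreal (W x)"
        using g_self by (intro SUP_least ennreal_leI) auto
      show "ennreal (W x) \<le> (SUP k. ennreal (g k x))"
      proof (rule ennreal_le_epsilon)
        fix e :: real assume e: "0 < e"
        define c where "c = W x - e"
        have "c < W x" using e by (simp add: c_def)
        then have "\<forall>\<^sub>F y in nhds x. c < W y"
          using lsc by (auto simp: lower_semicontinuous_def)
        then obtain d where d: "d > 0" "\<And>y. dist y x < d \<Longrightarrow> c < W y"
          by (auto simp: eventually_nhds_metric)
        \<comment> \<open>Within distance \<open>d\<close> the values of \<open>W\<close> exceed
          \<open>c\<close>, and truncation at \<open>k\<close> stays above \<open>c\<close>; farther
          away the cone alone contributes at least \<open>k * d\<close>, which is at least
          \<open>c\<close>.\<close>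
        obtain k :: nat where k: "real k \<ge> max c (c / d)" using real_arch_simple by blast
        have "c \<le> g k x"
        proof (rule g_ge)
          fix y
          show "c \<le> h k x y"
          proof (cases "dist y x < d")
            case True
            have "0 \<le> real k * dist x y" by simp
            then show ?thesis using True d(2)[of y] k unfolding h_def by linarith
          next
            case False
            have "c \<le> real k * d" using k d(1) by (simp add: field_simps)
            also have "\<dots> \<le> real k * dist x y"
              using False by (intro mult_left_mono) (auto simp: dist_commute)
            finally show ?thesis using nonneg[of y] unfolding h_def
              by (simp add: min_def)
          qed
        qed
        then have "ennreal (W x) \<le> ennreal (g k x + e)"
          by (intro ennreal_leI) (simp add: c_def)
        also have "\<dots> = ennreal (g k x) + ennreal e"
          using e g_ge[OF h0] by (intro ennreal_plus) auto
        also have "\<dots> \<le> (SUP k. ennreal (g k x)) + ennreal e"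
          by (intro add_right_mono SUP_upper) auto
        finally show "ennreal (W x) \<le> (SUP k. ennreal (g k x)) + ennreal e" .
      qed
    qed
  qed
qed

lemma lipschitz_imp_continuous:
  fixes f :: "'a::metric_space \<Rightarrow> real"
  assumes "\<And>x y. \<bar>f x - f y\<bar> \<le> L * dist x y"
  shows "continuous_on UNIV f"
proof -
  have "(max L 0)-lipschitz_on UNIV f"
  proof (rule lipschitz_onI)
    fix x y show "dist (f x) (f y) \<le> max L 0 * dist x y"
      using assms[of x y] mult_right_mono[of L "max L 0" "dist x y"] by (simp add: dist_real_def)
  qed simp
  then show ?thesis by (rule lipschitz_on_continuous_on)
qed

text \<open>A continuous substitute for the indicator of a ball, so that it can serve as a weak test
  function.\<close>

definition cutoff :: "real \<Rightarrow> 'a::euclidean_space \<Rightarrow> real" where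
  "cutoff T x = max 0 (min 1 (T + 1 - norm x))"

lemma cutoff_bounds [simp]: "0 \<le> cutoff T x" "cutoff T x \<le> 1" "\<bar>cutoff T x\<bar> \<le> 1"
  by (auto simp: cutoff_def)

lemma cutoff_eq_1: "norm x \<le> T \<Longrightarrow> cutoff T x = 1"
  by (auto simp: cutoff_def)

lemma cutoff_eq_0: "T + 1 \<le> norm x \<Longrightarrow> cutoff T x = 0"
  by (auto simp: cutoff_def)

lemma continuous_on_cutoff [continuous_intros]: "continuous_on S (cutoff T)"
  unfolding cutoff_def by (intro continuous_intros)

lemma borel_measurable_cutoff [measurable]: "cutoff T \<in> borel_measurable borel"
  by (intro borel_measurable_continuous_onI continuous_intros)

lemma cutoff_tendsto: "(\<lambda>n. cutoff (real n) x) \<longlonglongrightarrow> 1"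
proof -
  obtain N :: nat where "norm x \<le> real N" using real_arch_simple by blast
  then have "cutoff (real n) x = 1" if "n \<ge> N" for n
    using that by (intro cutoff_eq_1) linarith
  then show ?thesis by (intro tendsto_eventually eventually_sequentiallyI) auto
qed

text \<open>Weak closeness of \<open>\<nu>\<close> to \<open>\<mu>\<close> does not speak directly
  about the product measures. The inner integrals \<open>F \<nu>\<close> are however Lipschitz with
  one constant for all \<open>\<nu>\<close>, so finitely many test functions
  \<open>g (z - _)\<close> over a net control \<open>F \<nu>\<close> on a whole ball, and one more
  test function handles the outer integral. Outside the ball nonnegativity of \<open>F \<nu>\<close>
  is used, so the argument yields a bound from below.\<close>

lemma double_integral_lipschitz_lsc:
  fixes g :: "'a::euclidean_space \<Rightarrow> real"
  assumes nonneg: "\<And>x. 0 \<le> g x" and bdd: "\<And>x. g x \<le> B"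
    and lip: "\<And>x y. \<bar>g x - g y\<bar> \<le> L * dist x y"
    and \<mu>: "\<mu> \<in> prob_measures" and c: "c < (\<integral>x. \<integral>y. g (x - y) \<partial>\<mu> \<partial>\<mu>)"
  obtains U where "openin weak_topology U" "\<mu> \<in> U"
    "\<And>\<nu>. \<nu> \<in> U \<Longrightarrow> c < (\<integral>x. \<integral>y. g (x - y) \<partial>\<nu> \<partial>\<nu>)"
proof -
  define F where "F \<nu> x = (\<integral>y. g (x - y) \<partial>\<nu>)" for \<nu> :: "'a measure" and x
  have g_cont: "continuous_on UNIV g" by (rule lipschitz_imp_continuous[OF lip])
  have gs_cont: "continuous_on UNIV (\<lambda>y. g (x - y))" for x
    by (intro continuous_on_compose2[OF g_cont] continuous_intros) auto
  have gs_bdd: "bounded (range (\<lambda>y. g (x - y)))" for x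
    using bdd nonneg by (intro boundedI[of _ B]) auto
  have gs_int: "integrable \<nu> (\<lambda>y. g (x - y))" if "\<nu> \<in> prob_measures" for \<nu> x
    using integrable_bounded_cont[OF that _ gs_bdd] borel_measurable_continuous_onI[OF gs_cont]
    by auto
  have F0: "0 \<le> F \<nu> x" for \<nu> x
    unfolding F_def using nonneg by (intro integral_nonneg_AE) auto
  have FB: "F \<nu> x \<le> B" if \<nu>: "\<nu> \<in> prob_measures" for \<nu> x
  proof -
    interpret prob_space \<nu> using prob_measuresD[OF \<nu>] by simp
    show ?thesis unfolding F_def using gs_int[OF \<nu>] bdd by (intro integral_le_const) auto
  qed
  have Flip: "\<bar>F \<nu> x - F \<nu> z\<bar> \<le> L * dist x z" if \<nu>: "\<nu> \<in> prob_measures" for \<nu> x z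
  proof -
    interpret prob_space \<nu> using prob_measuresD[OF \<nu>] by simp
    have "F \<nu> x - F \<nu> z = (\<integral>y. g (x - y) - g (z - y) \<partial>\<nu>)"
      unfolding F_def using gs_int[OF \<nu>] by simp
    also have "\<bar>\<dots>\<bar> \<le> (\<integral>y. \<bar>g (x - y) - g (z - y)\<bar> \<partial>\<nu>)"
      by (rule integral_abs_bound)
    also have "\<dots> \<le> L * dist x z"
    proof (intro integral_le_const AE_I2)
      fix y show "\<bar>g (x - y) - g (z - y)\<bar> \<le> L * dist x z"
        using lip[of "x - y" "z - y"] by (simp add: dist_norm)
    qed (use gs_int[OF \<nu>] in auto)
    finally show ?thesis .
  qed
  have Fcont: "continuous_on UNIV (F \<nu>)" if "\<nu> \<in> prob_measures" for \<nu>
    by (rule lipschitz_imp_continuous[OF Flip[OF that]])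
  have Fc_cont: "continuous_on UNIV (\<lambda>x. F \<mu> x * cutoff T x)" for T
    by (intro continuous_intros Fcont \<mu>)
  have Fb: "bounded (range (F \<nu>))" if "\<nu> \<in> prob_measures" for \<nu>
    using F0 FB[OF that] by (intro boundedI[of _ B]) auto
  have Fc_bdd: "bounded (range (\<lambda>x. F \<nu> x * cutoff T x))" if "\<nu> \<in> prob_measures" for T \<nu>
    using F0 order_trans[OF mult_left_le FB[OF that]] by (intro boundedI[of _ B]) auto
  have Fint: "integrable \<nu> (F \<nu>')" "integrable \<nu> (\<lambda>x. F \<nu>' x * cutoff T x)"
    if "\<nu> \<in> prob_measures" "\<nu>' \<in> prob_measures" for \<nu> \<nu>' T
    using integrable_bounded_cont[OF that(1) _ Fb[OF that(2)]]
      integrable_bounded_cont[OF that(1) _ Fc_bdd[OF that(2)]]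
      borel_measurable_continuous_onI[OF Fcont[OF that(2)]]
    by auto
  have "(\<lambda>n. \<integral>x. F \<mu> x * cutoff (real n) x \<partial>\<mu>) \<longlonglongrightarrow> (\<integral>x. F \<mu> x * 1 \<partial>\<mu>)"
  proof (rule integral_dominated_convergence[where w = "F \<mu>"])
    show "AE x in \<mu>. (\<lambda>n. F \<mu> x * cutoff (real n) x) \<longlonglongrightarrow> F \<mu> x * 1"
      by (intro AE_I2 tendsto_mult tendsto_const cutoff_tendsto)
    show "AE x in \<mu>. norm (F \<mu> x * cutoff (real n) x) \<le> F \<mu> x" for n
      using F0 by (auto intro!: mult_left_le)
  qed (use Fint[OF \<mu> \<mu>] in auto)
  moreover have "c < (\<integral>x. F \<mu> x * 1 \<partial>\<mu>)" using c by (simp add: F_def)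
  ultimately obtain n where n: "c < (\<integral>x. F \<mu> x * cutoff (real n) x \<partial>\<mu>)"
    using order_tendstoD(1)[of _ _ sequentially c] eventually_happens'[OF sequentially_bot] by blast
  define T where "T = real n"
  define m where "m = (\<integral>x. F \<mu> x * cutoff T x \<partial>\<mu>)"
  \<comment> \<open>Of the gap \<open>m - c\<close>, \<open>3 * \<eta>\<close> is lost in the
    pointwise comparison below and \<open>\<eta>\<close> in the outer integral.\<close>
  define \<eta> where "\<eta> = (m - c) / 4"
  have \<eta>: "\<eta> > 0" using n by (simp add: \<eta>_def m_def T_def)
  have L0: "0 \<le> L * dist x y" for x y :: 'a using lip[of x y] by (meson abs_ge_zero order_trans)
  define r where "r = \<eta> / (\<bar>L\<bar> + 1)"
  have r: "r > 0" using \<eta> by (simp add: r_def)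
  obtain k where k: "finite k" "cball (0::'a) (T + 1) \<subseteq> (\<Union>z\<in>k. ball z r)"
    using compact_cball[of "0::'a" "T + 1"] r unfolding compact_eq_totally_bounded by blast
  define U where "U = {\<nu> \<in> prob_measures. (\<integral>x. F \<mu> x * cutoff T x \<partial>\<nu>) \<in> {m - \<eta><..}} \<inter>
      ((\<Inter>z\<in>k. {\<nu> \<in> prob_measures. (\<integral>y. g (z - y) \<partial>\<nu>) \<in> {F \<mu> z - \<eta><..}}) \<inter> topspace weak_topology)"
  show ?thesis
  proof
    show "openin weak_topology U"
      unfolding U_def using k(1)
      by (intro openin_Int openin_INT openin_weak_basic Fc_cont Fc_bdd \<mu> gs_cont gs_bdd) auto
    show "\<mu> \<in> U"
      using \<eta> \<mu> by (auto simp: U_def m_def F_def topspace_weak_topology)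
    fix \<nu> assume \<nu>U: "\<nu> \<in> U"
    then have \<nu>: "\<nu> \<in> prob_measures" by (auto simp: U_def)
    interpret prob_space \<nu> using prob_measuresD[OF \<nu>] by simp
    \<comment> \<open>One \<open>\<eta>\<close> comes from the neighbourhood condition at the net
      point \<open>z\<close>, the other two from moving \<open>F \<mu>\<close> and
      \<open>F \<nu>\<close> between \<open>x\<close> and \<open>z\<close>.\<close>
    have pt: "F \<mu> x * cutoff T x - 3 * \<eta> \<le> F \<nu> x" for x
    proof (cases "norm x \<le> T + 1")
      case True
      then obtain z where z: "z \<in> k" "dist z x < r" using k(2) by (auto simp: subset_iff)
      have "L * dist x z \<le> (\<bar>L\<bar> + 1) * r"
        using z(2) r by (intro mult_mono) (auto simp: dist_commute)
      also have "\<dots> = \<eta>" by (simp add: r_def)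
      finally have Lz: "L * dist x z \<le> \<eta>" .
      have "F \<nu> z > F \<mu> z - \<eta>" using \<nu>U z(1) by (auto simp: U_def F_def)
      moreover have "F \<mu> x * cutoff T x \<le> F \<mu> x" using F0 by (intro mult_left_le) auto
      ultimately show ?thesis using Lz Flip[OF \<nu>, of x z] Flip[OF \<mu>, of x z] by linarith
    next
      case False
      then show ?thesis using F0[of \<nu> x] \<eta> by (simp add: cutoff_eq_0)
    qed
    have "c < (\<integral>x. F \<mu> x * cutoff T x \<partial>\<nu>) - 3 * \<eta>"
      using \<nu>U by (auto simp: U_def \<eta>_def field_simps)
    also have "\<dots> = (\<integral>x. F \<mu> x * cutoff T x - 3 * \<eta> \<partial>\<nu>)"
      using Fint[OF \<nu> \<mu>] by (simp add: prob_space)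
    also have "\<dots> \<le> (\<integral>x. F \<nu> x \<partial>\<nu>)"
      using Fint[OF \<nu> \<mu>] Fint[OF \<nu> \<nu>] pt by (intro integral_mono) auto
    finally show "c < (\<integral>x. \<integral>y. g (x - y) \<partial>\<nu> \<partial>\<nu>)" by (simp add: F_def)
  qed
qed

text \<open>Two applications of monotone convergence exhibit the energy as the supremum of the
  energies of the Lipschitz minorants; one of these already exceeds \<open>c\<close> at
  \<open>\<mu>\<close>, and it is lower semicontinuous.\<close>

lemma interaction_energy_weak_lsc:
  fixes W :: "'a::euclidean_space \<Rightarrow> real"
  assumes nonneg: "\<And>x. 0 \<le> W x" and lsc: "lower_semicontinuous W"
    and \<mu>: "\<mu> \<in> prob_measures" and c: "c < interaction_energy W \<mu>"
  obtains U where "openin weak_topology U" "\<mu> \<in> U"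
    "\<And>\<nu>. \<nu> \<in> U \<Longrightarrow> c < interaction_energy W \<nu>"
proof -
  obtain g :: "nat \<Rightarrow> 'a \<Rightarrow> real" where g: "\<And>k x. 0 \<le> g k x" "\<And>k x. g k x \<le> real k"
    "\<And>k x y. \<bar>g k x - g k y\<bar> \<le> real k * dist x y"
    "\<And>x. incseq (\<lambda>k. g k x)" "\<And>x. (SUP k. ennreal (g k x)) = ennreal (W x)"
    using nonneg_lsc_lipschitz_approx[OF nonneg lsc] by blast
  have gc: "continuous_on UNIV (g k)" for k by (rule lipschitz_imp_continuous[OF g(3)])
  have [measurable]: "g k \<in> borel_measurable borel" for k
    by (rule borel_measurable_continuous_onI[OF gc])
  have mono: "ennreal (g i x) \<le> ennreal (g j x)" if "i \<le> j" for i j x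
    using g(4)[of x] that by (auto simp: incseq_def intro: ennreal_leI)
  have key: "(\<integral>\<^sup>+x. \<integral>\<^sup>+y. ennreal (W (x - y)) \<partial>\<nu> \<partial>\<nu>)
      = (SUP k. ennreal (\<integral>x. \<integral>y. g k (x - y) \<partial>\<nu> \<partial>\<nu>))" if \<nu>: "\<nu> \<in> prob_measures" for \<nu>
  proof -
    interpret prob_space \<nu> using prob_measuresD[OF \<nu>] by simp
    note [measurable_cong] = prob_measuresD(1)[OF \<nu>]
    have int: "integrable \<nu> (\<lambda>y. g k (x - y))" for k x
      using g(1,2) by (intro integrable_const_bound[of _ "real k"]) auto
    have int2: "integrable \<nu> (\<lambda>x. \<integral>y. g k (x - y) \<partial>\<nu>)" for k
    proof (intro integrable_const_bound[of _ "real k"] AE_I2)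
      fix x
      have "(\<integral>y. g k (x - y) \<partial>\<nu>) \<le> real k" using int g(2) by (intro integral_le_const) auto
      moreover have "0 \<le> (\<integral>y. g k (x - y) \<partial>\<nu>)" using g(1) by (intro integral_nonneg_AE) auto
      ultimately show "norm (\<integral>y. g k (x - y) \<partial>\<nu>) \<le> real k" by simp
    qed measurable
    have "(\<integral>\<^sup>+x. \<integral>\<^sup>+y. ennreal (W (x - y)) \<partial>\<nu> \<partial>\<nu>)
        = (\<integral>\<^sup>+x. \<integral>\<^sup>+y. (SUP k. ennreal (g k (x - y))) \<partial>\<nu> \<partial>\<nu>)" by (simp add: g(5))
    also have "\<dots> = (\<integral>\<^sup>+x. (SUP k. \<integral>\<^sup>+y. ennreal (g k (x - y)) \<partial>\<nu>) \<partial>\<nu>)"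
      by (intro nn_integral_cong nn_integral_monotone_convergence_SUP)
         (auto simp: incseq_def le_fun_def mono)
    also have "\<dots> = (SUP k. \<integral>\<^sup>+x. \<integral>\<^sup>+y. ennreal (g k (x - y)) \<partial>\<nu> \<partial>\<nu>)"
      by (intro nn_integral_monotone_convergence_SUP)
         (auto simp: incseq_def le_fun_def intro!: nn_integral_mono mono)
    also have "\<dots> = (SUP k. ennreal (\<integral>x. \<integral>y. g k (x - y) \<partial>\<nu> \<partial>\<nu>))"
    proof (intro SUP_cong refl)
      fix k
      have "(\<integral>\<^sup>+x. \<integral>\<^sup>+y. ennreal (g k (x - y)) \<partial>\<nu> \<partial>\<nu>) = (\<integral>\<^sup>+x. ennreal (\<integral>y. g k (x - y) \<partial>\<nu>) \<partial>\<nu>)"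
        using int g(1) by (intro nn_integral_cong nn_integral_eq_integral) auto
      also have "\<dots> = ennreal (\<integral>x. \<integral>y. g k (x - y) \<partial>\<nu> \<partial>\<nu>)"
        using int2 g(1) by (intro nn_integral_eq_integral) auto
      finally show "(\<integral>\<^sup>+x. \<integral>\<^sup>+y. ennreal (g k (x - y)) \<partial>\<nu> \<partial>\<nu>) = ennreal (\<integral>x. \<integral>y. g k (x - y) \<partial>\<nu> \<partial>\<nu>)" .
    qed
    finally show ?thesis .
  qed
  have two: "c < x / 2 \<longleftrightarrow> c * 2 < x" for x :: ennreal
  proof -
    have "(x / 2) * 2 = x" "(c * 2) / 2 = c"
      by (simp_all add: ennreal_divide_times ennreal_times_divide mult_divide_eq_ennreal)
    then show ?thesis
      by (metis divide_right_mono_ennreal leD linorder_le_less_linear mult_right_mono zero_le)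
  qed
  obtain k where k: "c * 2 < ennreal (\<integral>x. \<integral>y. g k (x - y) \<partial>\<mu> \<partial>\<mu>)"
    using c unfolding interaction_energy_def key[OF \<mu>] two by (auto simp: less_SUP_iff)
  define e where "e = enn2real (c * 2)"
  have e: "c * 2 = ennreal e" "0 \<le> e"
    using k by (auto simp: e_def ennreal_enn2real_if)
  then have "e < (\<integral>x. \<integral>y. g k (x - y) \<partial>\<mu> \<partial>\<mu>)" using k by (simp add: ennreal_less_iff)
  then obtain U where U: "openin weak_topology U" "\<mu> \<in> U"
      "\<And>\<nu>. \<nu> \<in> U \<Longrightarrow> e < (\<integral>x. \<integral>y. g k (x - y) \<partial>\<nu> \<partial>\<nu>)"
    using double_integral_lipschitz_lsc[OF g(1,2,3) \<mu>] by blast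
  show ?thesis
  proof
    show "openin weak_topology U" "\<mu> \<in> U" by fact+
    fix \<nu> assume "\<nu> \<in> U"
    then have "\<nu> \<in> prob_measures" using openin_subset[OF U(1)] by (auto simp: topspace_weak_topology)
    have "c * 2 < ennreal (\<integral>x. \<integral>y. g k (x - y) \<partial>\<nu> \<partial>\<nu>)"
      using U(3)[OF \<open>\<nu> \<in> U\<close>] e by (simp add: ennreal_less_iff)
    then show "c < interaction_energy W \<nu>"
      unfolding interaction_energy_def key[OF \<open>\<nu> \<in> prob_measures\<close>] two
      by (meson SUP_upper UNIV_I order_less_le_trans)
  qed
qed

text \<open>The truncated powers are bounded and continuous, so the moment is weakly lower
  semicontinuous. This makes moment balls closed.\<close>

lemma openin_weak_moment_gt:
  fixes c :: ennreal
  assumes l: "0 < l"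
  shows "openin weak_topology {\<mu> \<in> (prob_measures :: 'a::euclidean_space measure set).
           c < (\<integral>\<^sup>+x. ennreal (norm x powr l) \<partial>\<mu>)}"
proof (rule openin_weak_nn_integral_gt[where g = "\<lambda>k x. min (real k) (norm x powr l)"])
  show "(SUP k. ennreal (min (real k) (norm x powr l))) = ennreal (norm x powr l)" for x :: 'a
  proof (rule antisym)
    obtain k :: nat where "norm x powr l \<le> real k" using real_arch_simple by blast
    then show "ennreal (norm x powr l) \<le> (SUP k. ennreal (min (real k) (norm x powr l)))"
      by (intro SUP_upper2[of k]) (auto simp: min_def)
  qed (auto intro!: SUP_least ennreal_leI)
  show "bounded (range (\<lambda>x::'a. min (real k) (norm x powr l)))" for k
    by (intro boundedI[of _ "real k"]) auto
  show "continuous_on UNIV (\<lambda>x::'a. min (real k) (norm x powr l))" for k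
    using l by (intro continuous_intros continuous_on_powr') auto
qed (auto simp: incseq_def min_def)

subsection \<open>Random binary expansions\<close>

text \<open>One independent uniform variable for each finite bit string, that is, for each node of
  the infinite binary tree. All laws are realised on this single probability space, so that only the
  deterministic parameter \<open>\<theta>\<close> varies.\<close>

definition uniform_tree :: "(bool list \<Rightarrow> real) measure" where
  "uniform_tree = (\<Pi>\<^sub>M s\<in>UNIV. uniform_measure lborel {0..1})"

definition unit_tree :: "(bool list \<Rightarrow> real) set" where
  "unit_tree = {\<theta>. \<forall>s. \<theta> s \<in> {0..1}}"

text \<open>As \<open>u s\<close> is uniform, the bit appended at a node \<open>s\<close> is
  \<open>True\<close> with conditional probability \<open>\<theta> s\<close>. Every law on bit
  sequences arises from a suitable \<open>\<theta>\<close>.\<close>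

primrec branch :: "(bool list \<Rightarrow> real) \<Rightarrow> (bool list \<Rightarrow> real) \<Rightarrow> nat \<Rightarrow> bool list" where
  "branch \<theta> u 0 = []"
| "branch \<theta> u (Suc k) = branch \<theta> u k @ [u (branch \<theta> u k) < \<theta> (branch \<theta> u k)]"

definition branch_prob :: "(bool list \<Rightarrow> real) \<Rightarrow> bool list \<Rightarrow> real" where
  "branch_prob \<theta> s = (\<Prod>j<length s. if s ! j then \<theta> (take j s) else 1 - \<theta> (take j s))"

lemma length_branch [simp]: "length (branch \<theta> u k) = k"
  by (induction k) auto

lemma nth_branch: "i < k \<Longrightarrow> branch \<theta> u k ! i = (u (branch \<theta> u i) < \<theta> (branch \<theta> u i))"
  by (induction k) (auto simp: nth_append less_Suc_eq)

lemma branch_prob_Nil [simp]: "branch_prob \<theta> [] = 1"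
  by (simp add: branch_prob_def)

lemma branch_prob_snoc:
  "branch_prob \<theta> (s @ [b]) = branch_prob \<theta> s * (if b then \<theta> s else 1 - \<theta> s)"
  unfolding branch_prob_def
  by (simp add: nth_append) (auto intro!: prod.cong)

text \<open>Turns an event about a recursively defined path into conditions on the separate
  coordinates \<open>take j s\<close>, which are independent.\<close>

lemma branch_eq_iff:
  "branch \<theta> u (length s) = s \<longleftrightarrow> (\<forall>j<length s. (u (take j s) < \<theta> (take j s)) = s ! j)"
proof (induction s rule: rev_induct)
  case (snoc b s)
  have "branch \<theta> u (length (s @ [b])) = s @ [b] \<longleftrightarrow>
      branch \<theta> u (length s) = s \<and> (u s < \<theta> s) = b"
    by auto
  also have "\<dots> \<longleftrightarrow> (\<forall>j<length (s @ [b]). (u (take j (s @ [b])) < \<theta> (take j (s @ [b]))) = (s @ [b]) ! j)"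
    unfolding snoc.IH by (auto simp: nth_append less_Suc_eq)
  finally show ?case .
qed simp

interpretation uniform_tree: product_prob_space "\<lambda>_::bool list. uniform_measure lborel {0..1::real}" UNIV
  rewrites "(\<Pi>\<^sub>M s\<in>UNIV. uniform_measure lborel {0..1::real}) = uniform_tree"
proof -
  have "prob_space (uniform_measure lborel {0..1::real})"
    by (rule prob_space_uniform_measure) auto
  then show "product_prob_space (\<lambda>_::bool list. uniform_measure lborel {0..1::real})"
    by (intro product_prob_spaceI) auto
qed (simp add: uniform_tree_def)

lemma space_uniform_tree [simp]: "space uniform_tree = UNIV"
  by (simp add: uniform_tree_def space_PiM)

lemma measure_uniform_less:
  assumes "0 \<le> t" "t \<le> 1"
  shows "measure (uniform_measure lborel {0..1::real}) {..<t} = t"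
    and "measure (uniform_measure lborel {0..1::real}) {t..} = 1 - t"
proof -
  have "{0..1} \<inter> {..<t} = {0..<t}" "{0..1} \<inter> {t..} = {t..1}" using assms by auto
  then show "measure (uniform_measure lborel {0..1::real}) {..<t} = t"
    "measure (uniform_measure lborel {0..1::real}) {t..} = 1 - t"
    using assms by (simp_all add: measure_uniform_measure)
qed

text \<open>Following \<open>s\<close> is a condition on finitely many independent coordinates, so
  the probabilities of the single turns multiply.\<close>

lemma
  shows sets_branch_eq: "{u. branch \<theta> u (length s) = s} \<in> sets uniform_tree" (is ?th1)
    and measure_branch_eq: "\<theta> \<in> unit_tree \<Longrightarrow>
      measure uniform_tree {u. branch \<theta> u (length s) = s} = branch_prob \<theta> s" (is "_ \<Longrightarrow> ?th2")
proof -
  define X where "X t = (if s ! length t then {..<\<theta> t} else {\<theta> t..})" for t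
  define J where "J = (\<lambda>j. take j s) ` {..<length s}"
  \<comment> \<open>Proper prefixes of different lengths are different nodes, hence different
    coordinates of the product space.\<close>
  have inj: "inj_on (\<lambda>j. take j s) {..<length s}"
    by (rule inj_onI) (metis length_take lessThan_iff min.absorb4)
  have J: "finite J" by (simp add: J_def)
  have eq: "{u. branch \<theta> u (length s) = s} = {u \<in> space uniform_tree. \<forall>t\<in>J. u t \<in> X t}"
  proof -
    have "(u (take j s) < \<theta> (take j s)) = s ! j \<longleftrightarrow> u (take j s) \<in> X (take j s)"
      if "j < length s" for u j using that by (auto simp: X_def min_absorb2)
    then show ?thesis unfolding branch_eq_iff J_def by auto
  qed
  show ?th1 unfolding eq uniform_tree_def
    by (intro sets.sets_Collect_finite_All J measurable_sets_Collect[OF measurable_component_singleton])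
      (auto simp: X_def)
  assume \<theta>: "\<theta> \<in> unit_tree"
  have "emeasure uniform_tree {u. branch \<theta> u (length s) = s}
      = (\<Prod>t\<in>J. emeasure (uniform_measure lborel {0..1}) (X t))"
    unfolding eq by (rule uniform_tree.emeasure_PiM_Collect) (auto simp: J X_def)
  also have "\<dots> = (\<Prod>j<length s. emeasure (uniform_measure lborel {0..1}) (X (take j s)))"
    unfolding J_def by (subst prod.reindex[OF inj]) simp
  also have "\<dots> = (\<Prod>j<length s. ennreal (if s ! j then \<theta> (take j s) else 1 - \<theta> (take j s)))"
  proof (intro prod.cong refl)
    fix j assume "j \<in> {..<length s}"
    moreover have "0 \<le> \<theta> (take j s)" "\<theta> (take j s) \<le> 1" using \<theta> by (auto simp: unit_tree_def)
    ultimately show "emeasure (uniform_measure lborel {0..1}) (X (take j s)) =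
        ennreal (if s ! j then \<theta> (take j s) else 1 - \<theta> (take j s))"
      using measure_uniform_less[of "\<theta> (take j s)"]
      by (cases "s ! j") (simp_all add: X_def uniform_tree.M.emeasure_eq_measure min_absorb2
        del: measure_uniform_measure)
  qed
  also have "\<dots> = ennreal (branch_prob \<theta> s)"
    unfolding branch_prob_def using \<theta> by (intro prod_ennreal) (auto simp: unit_tree_def)
  finally show ?th2
    using \<theta> by (simp add: measure_def branch_prob_def unit_tree_def prod_nonneg)
qed

lemma measurable_branch [measurable]: "(\<lambda>u. branch \<theta> u k) \<in> measurable uniform_tree (count_space UNIV)"
proof (rule measurable_count_space_eq2_countable[THEN iffD2], simp_all, safe)
  fix s :: "bool list"
  have "(\<lambda>u. branch \<theta> u k) -` {s} = (if length s = k then {u. branch \<theta> u (length s) = s} else {})"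
    by auto
  then show "(\<lambda>u. branch \<theta> u k) -` {s} \<in> sets uniform_tree" using sets_branch_eq by auto
qed

lemma integral_list_valued:
  fixes X :: "'b \<Rightarrow> bool list" and g :: "bool list \<Rightarrow> real"
  assumes "prob_space M" and X: "X \<in> measurable M (count_space UNIV)" and len: "\<And>u. length (X u) = k"
  shows "(\<integral>u. g (X u) \<partial>M) = (\<Sum>s | length s = k. measure M {u \<in> space M. X u = s} * g s)"
proof -
  interpret prob_space M by fact
  have fin: "finite {s :: bool list. length s = k}"
    using finite_lists_length_eq[of "UNIV :: bool set" k] by simp
  have [measurable]: "{u \<in> space M. X u = s} \<in> sets M" for s
    using measurable_sets[OF X, of "{s}"] by (simp add: vimage_def Int_def conj_commute)
  have "(\<integral>u. g (X u) \<partial>M) = (\<integral>u. (\<Sum>s | length s = k. indicator {u \<in> space M. X u = s} u * g s) \<partial>M)"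
  proof (rule Bochner_Integration.integral_cong[OF refl])
    fix u assume u: "u \<in> space M"
    have "(\<Sum>s | length s = k. indicator {u \<in> space M. X u = s} u * g s)
        = (\<Sum>s | length s = k. if X u = s then g s else 0)"
      using u by (intro sum.cong) auto
    then show "g (X u) = (\<Sum>s | length s = k. indicator {u \<in> space M. X u = s} u * g s)"
      using fin len by (simp add: sum.delta)
  qed
  also have "\<dots> = (\<Sum>s | length s = k. \<integral>u. indicator {u \<in> space M. X u = s} u * g s \<partial>M)"
    by (intro Bochner_Integration.integral_sum integrable_mult_left integrable_real_indicator)
       (auto simp: less_top[symmetric])
  finally show ?thesis by simp
qed

lemma compact_unit_tree: "compact unit_tree"
proof -
  have "compactin (product_topology (\<lambda>_::bool list. euclideanreal) UNIV) (PiE UNIV (\<lambda>_. {0..1}))"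
    by (simp add: compactin_PiE)
  moreover have "PiE UNIV (\<lambda>_. {0..1}) = unit_tree" by (auto simp: unit_tree_def PiE_def)
  ultimately show ?thesis by (simp add: euclidean_product_topology)
qed

lemma continuous_on_branch_prob: "continuous_on S (\<lambda>\<theta>. branch_prob \<theta> s)"
proof -
  have "continuous_on S (\<lambda>\<theta>. \<theta> t)" for t :: "bool list"
    by (rule continuous_on_subset[OF continuous_on_product_coordinates]) simp
  then have "continuous_on S (\<lambda>\<theta>. if s ! j then \<theta> (take j s) else 1 - \<theta> (take j s))" for j
    by (cases "s ! j") (auto intro!: continuous_intros)
  then show ?thesis unfolding branch_prob_def by (intro continuous_on_prod)
qed

section \<open>Random points given by binary series\<close>

text \<open>Points are encoded as subseries of \<open>v\<close>, one bit per term. Absolute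
  summability makes the truncation error uniform over all bit sequences, whatever their law.\<close>

locale binary_series =
  fixes v :: "nat \<Rightarrow> 'a::euclidean_space"
  assumes summable_v: "summable (\<lambda>i. norm (v i))"
begin

definition partial :: "bool list \<Rightarrow> 'a" where
  "partial s = (\<Sum>i<length s. if s ! i then v i else 0)"

definition limit_point :: "(bool list \<Rightarrow> real) \<Rightarrow> (bool list \<Rightarrow> real) \<Rightarrow> 'a" where
  "limit_point \<theta> u = (\<Sum>i. if u (branch \<theta> u i) < \<theta> (branch \<theta> u i) then v i else 0)"

definition total where "total = (\<Sum>i. norm (v i))"
definition tail where "tail k = (\<Sum>i. norm (v (i + k)))"

lemma tail_tendsto: "tail \<longlonglongrightarrow> 0"
  unfolding tail_def by (rule suminf_exist_split2[OF summable_v])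

lemma series_bounds:
  fixes c :: "nat \<Rightarrow> bool"
  shows "summable (\<lambda>i. if c i then v i else 0)"
    and "norm (\<Sum>i. if c i then v i else 0) \<le> total"
    and "norm (\<Sum>i<k. if c i then v i else 0) \<le> total"
    and "norm ((\<Sum>i. if c i then v i else 0) - (\<Sum>i<k. if c i then v i else 0)) \<le> tail k"
proof -
  let ?w = "\<lambda>i. if c i then v i else 0"
  have le: "norm (?w i) \<le> norm (v i)" for i by simp
  have sn: "summable (\<lambda>i. norm (?w i))"
    by (rule summable_comparison_test'[OF summable_v, of 0]) simp
  then show s: "summable ?w" by (rule summable_norm_cancel)
  show "norm (suminf ?w) \<le> total"
    unfolding total_def by (rule order_trans[OF summable_norm[OF sn] suminf_le[OF le sn summable_v]])
  have "norm (sum ?w {..<k}) \<le> (\<Sum>i<k. norm (v i))" by (rule sum_norm_le) simp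
  also have "\<dots> \<le> total" unfolding total_def by (rule sum_le_suminf[OF summable_v]) auto
  finally show "norm (sum ?w {..<k}) \<le> total" .
  have "suminf ?w - sum ?w {..<k} = (\<Sum>i. ?w (i + k))"
    using suminf_minus_initial_segment[OF s, of k] by simp
  also have "norm \<dots> \<le> (\<Sum>i. norm (v (i + k)))"
    using sn summable_v by (intro order_trans[OF summable_norm suminf_le]) (auto simp: summable_iff_shift[of "\<lambda>i. norm (?w i)"] summable_iff_shift[of "\<lambda>i. norm (v i)"])
  finally show "norm (suminf ?w - sum ?w {..<k}) \<le> tail k" unfolding tail_def .
qed

lemma partial_branch:
  "partial (branch \<theta> u k) = (\<Sum>i<k. if u (branch \<theta> u i) < \<theta> (branch \<theta> u i) then v i else 0)"
  unfolding partial_def by (intro sum.cong) (auto simp: nth_branch)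

lemma limit_point_bounds:
  "norm (limit_point \<theta> u) \<le> total" "norm (limit_point \<theta> u - partial (branch \<theta> u k)) \<le> tail k"
  unfolding limit_point_def partial_branch by (rule series_bounds)+

lemma norm_partial: "norm (partial s) \<le> total"
  unfolding partial_def by (rule series_bounds)

lemma measurable_limit_point [measurable]: "limit_point \<theta> \<in> borel_measurable uniform_tree"
proof (rule borel_measurable_LIMSEQ_metric[where f = "\<lambda>k u. partial (branch \<theta> u k)"])
  show "(\<lambda>k. partial (branch \<theta> u k)) \<longlonglongrightarrow> limit_point \<theta> u" for u
    unfolding partial_branch limit_point_def
    using series_bounds(1) by (rule summable_LIMSEQ)
qed measurable

lemma uniform_modulus:
  fixes h :: "'a \<Rightarrow> real"
  assumes h: "continuous_on UNIV h" and e: "0 < e"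
  shows "\<forall>\<^sub>F k in sequentially. \<forall>x y. norm x \<le> total \<longrightarrow> norm y \<le> total \<longrightarrow>
           norm (x - y) \<le> tail k \<longrightarrow> \<bar>h x - h y\<bar> < e"
proof -
  have "uniformly_continuous_on (cball 0 total) h"
    using h by (intro compact_uniformly_continuous continuous_on_subset[OF h]) auto
  then obtain d where d: "d > 0" "\<And>x y. norm x \<le> total \<Longrightarrow> norm y \<le> total \<Longrightarrow> dist x y < d \<Longrightarrow> dist (h x) (h y) < e"
    using e unfolding uniformly_continuous_on_def by (metis mem_cball_0)
  have "\<forall>\<^sub>F k in sequentially. tail k < d" using order_tendstoD(2)[OF tail_tendsto d(1)] .
  then show ?thesis
    by eventually_elim (auto simp: dist_norm dist_real_def intro!: d(2)[unfolded dist_real_def])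
qed

lemma bounded_on_total:
  fixes h :: "'a \<Rightarrow> real"
  assumes h: "continuous_on UNIV h"
  shows "\<exists>B. \<forall>x. norm x \<le> total \<longrightarrow> \<bar>h x\<bar> \<le> B"
proof -
  have "bounded (h ` cball 0 total)"
    by (intro compact_imp_bounded compact_continuous_image continuous_on_subset[OF h]) auto
  then obtain B where "\<forall>y\<in>h ` cball 0 total. norm y \<le> B" unfolding bounded_iff by blast
  then have "\<forall>x. norm x \<le> total \<longrightarrow> \<bar>h x\<bar> \<le> B" by simp
  then show ?thesis ..
qed

text \<open>Truncation after \<open>k\<close> bits leaves a finite sum of products of coordinates of
  \<open>\<theta>\<close>, hence a continuous function. The error depends only on
  \<open>tail k\<close> and on the modulus of continuity of \<open>h\<close> on a fixed ball, not on
  \<open>\<theta>\<close>, so the limit is uniform.\<close>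

lemma continuous_on_integral_limit_point:
  fixes h :: "'a \<Rightarrow> real"
  assumes h: "continuous_on UNIV h"
  shows "continuous_on unit_tree (\<lambda>\<theta>. \<integral>u. h (limit_point \<theta> u) \<partial>uniform_tree)"
proof (rule uniform_limit_theorem)
  define A where "A k \<theta> = (\<Sum>s | length s = k. branch_prob \<theta> s * h (partial s))" for k \<theta>
  note [measurable] = borel_measurable_continuous_onI[OF h]
  obtain B where B: "\<And>x. norm x \<le> total \<Longrightarrow> \<bar>h x\<bar> \<le> B"
    using bounded_on_total[OF h] by blast
  have A: "A k \<theta> = (\<integral>u. h (partial (branch \<theta> u k)) \<partial>uniform_tree)" if "\<theta> \<in> unit_tree" for k \<theta>
    unfolding A_def
    by (subst integral_list_valued[OF uniform_tree.P.prob_space_axioms measurable_branch, where k = k])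
       (auto intro!: sum.cong simp: measure_branch_eq[OF that, symmetric])
  show "\<forall>\<^sub>F k in sequentially. continuous_on unit_tree (A k)"
    unfolding A_def by (intro always_eventually allI continuous_intros continuous_on_branch_prob)
  show "uniform_limit unit_tree A (\<lambda>\<theta>. \<integral>u. h (limit_point \<theta> u) \<partial>uniform_tree) sequentially"
  proof (rule uniform_limitI)
    fix e :: real assume e: "0 < e"
    show "\<forall>\<^sub>F k in sequentially. \<forall>\<theta>\<in>unit_tree. dist (A k \<theta>) (\<integral>u. h (limit_point \<theta> u) \<partial>uniform_tree) < e"
      using uniform_modulus[OF h half_gt_zero[OF e]]
    proof eventually_elim
      case (elim k)
      show ?case
      proof
        fix \<theta> assume \<theta>: "\<theta> \<in> unit_tree"
        have int: "integrable uniform_tree (\<lambda>u. h (partial (branch \<theta> u k)))"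
             "integrable uniform_tree (\<lambda>u. h (limit_point \<theta> u))"
          using B[OF norm_partial] B[OF limit_point_bounds(1)]
          by (auto intro!: uniform_tree.P.integrable_const_bound[of _ B])
        have "\<bar>A k \<theta> - (\<integral>u. h (limit_point \<theta> u) \<partial>uniform_tree)\<bar>
            = \<bar>\<integral>u. h (partial (branch \<theta> u k)) - h (limit_point \<theta> u) \<partial>uniform_tree\<bar>"
          using int by (simp add: A[OF \<theta>])
        also have "\<dots> \<le> (\<integral>u. \<bar>h (partial (branch \<theta> u k)) - h (limit_point \<theta> u)\<bar> \<partial>uniform_tree)"
          by (rule integral_abs_bound)
        also have "\<dots> \<le> e / 2"
          using int elim norm_partial limit_point_bounds(1)[of \<theta>] limit_point_bounds(2)[of \<theta> _ k]
          by (intro uniform_tree.P.integral_le_const AE_I2) (auto simp: norm_minus_commute less_imp_le)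
        finally show "dist (A k \<theta>) (\<integral>u. h (limit_point \<theta> u) \<partial>uniform_tree) < e"
          using e by (simp add: dist_real_def)
      qed
    qed
  qed
qed simp

text \<open>Disintegrate \<open>\<mu>\<close> along the digits: \<open>\<theta> s\<close> is the
  conditional probability that the digit after the prefix \<open>s\<close> is \<open>True\<close>.
  The random path then has the law of the digit sequence under \<open>\<mu>\<close> at every finite
  level, and both truncated integrals converge.\<close>

lemma exists_branching_law:
  fixes J :: "'a \<Rightarrow> 'a" and code :: "nat \<Rightarrow> 'a \<Rightarrow> bool"
  assumes \<mu>: "\<mu> \<in> prob_measures" and code [measurable]: "\<And>i. Measurable.pred borel (code i)"
    and J [measurable]: "J \<in> borel_measurable borel"
    and expand: "\<And>x. J x = (\<Sum>i. if code i x then v i else 0)"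
  obtains \<theta> where "\<theta> \<in> unit_tree" "\<And>h :: 'a \<Rightarrow> real. continuous_on UNIV h \<Longrightarrow>
      (\<integral>u. h (limit_point \<theta> u) \<partial>uniform_tree) = (\<integral>x. h (J x) \<partial>\<mu>)"
proof -
  interpret prob_space \<mu> using prob_measuresD[OF \<mu>] by simp
  note [measurable_cong] = prob_measuresD(1)[OF \<mu>]
  note sp = prob_measuresD(3)[OF \<mu>]
  define pre where "pre k x = map (\<lambda>i. code i x) [0..<k]" for k x
  define m where "m s = measure \<mu> {x. pre (length s) x = s}" for s
  \<comment> \<open>A node of mass \<open>0\<close> is reached with probability \<open>0\<close>;
    the value \<open>0\<close> there keeps \<open>\<theta>\<close> inside
    \<open>unit_tree\<close>.\<close>
  define \<theta> where "\<theta> s = (if m s = 0 then 0 else m (s @ [True]) / m s)" for s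
  have len: "length (pre k x) = k" for k x by (simp add: pre_def)
  have pre_eq: "pre (length s) x = s \<longleftrightarrow> (\<forall>i<length s. code i x = s ! i)" for s x
    unfolding list_eq_iff_nth_eq by (simp add: pre_def)
  have meas: "{x. pre (length s) x = s} \<in> sets \<mu>" for s
  proof -
    have "Measurable.pred borel (\<lambda>x. code i x = s ! i)" for i
      by (cases "s ! i") auto
    then have "Measurable.pred borel (\<lambda>x. \<forall>i\<in>{..<length s}. code i x = s ! i)"
      by (intro pred_intros_finite) auto
    then show ?thesis
      unfolding pre_eq pred_def using prob_measuresD(1)[OF \<mu>] by simp
  qed
  have pre_snoc: "pre (Suc (length s)) x = s @ [b] \<longleftrightarrow> pre (length s) x = s \<and> code (length s) x = b" for s x b
    by (auto simp: pre_def)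
  have split: "m s = m (s @ [True]) + m (s @ [False])" for s
  proof -
    have "{x. pre (length s) x = s} = {x. pre (length (s @ [True])) x = s @ [True]} \<union> {x. pre (length (s @ [False])) x = s @ [False]}"
      by (auto simp: pre_snoc)
    moreover have "{x. pre (length (s @ [True])) x = s @ [True]} \<inter> {x. pre (length (s @ [False])) x = s @ [False]} = {}"
      by auto
    ultimately show ?thesis unfolding m_def
      using finite_measure_Union[OF meas[of "s @ [True]"] meas[of "s @ [False]"]] by simp
  qed
  have m0: "0 \<le> m s" for s by (simp add: m_def)
  have \<theta>: "\<theta> \<in> unit_tree"
  proof -
    have "0 \<le> \<theta> s \<and> \<theta> s \<le> 1" for s
    proof (cases "m s = 0")
      case False
      then have "0 < m s" using m0[of s] by simp
      then show ?thesis
        using split[of s] m0[of "s @ [True]"] m0[of "s @ [False]"] by (simp add: \<theta>_def divide_le_eq_1)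
    qed (simp add: \<theta>_def)
    then show ?thesis by (simp add: unit_tree_def)
  qed
  have bp: "branch_prob \<theta> s = m s" for s
  proof (induction s rule: rev_induct)
    case Nil show ?case using prob_space by (simp add: m_def pre_def sp)
  next
    case (snoc b s)
    show ?case
    proof (cases "m s = 0")
      case True
      then have "m (s @ [b]) = 0" using split[of s] m0[of "s @ [True]"] m0[of "s @ [False]"] by (cases b) auto
      then show ?thesis using True snoc by (simp add: branch_prob_snoc)
    next
      case False
      then have *: "m s * \<theta> s = m (s @ [True])" by (simp add: \<theta>_def)
      show ?thesis
        unfolding branch_prob_snoc snoc using * split[of s] by (cases b) (simp_all add: right_diff_distrib)
    qed
  qed
  show ?thesis
  proof
    show "\<theta> \<in> unit_tree" by (rule \<theta>)
    fix h :: "'a \<Rightarrow> real" assume h: "continuous_on UNIV h"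
    note [measurable] = borel_measurable_continuous_onI[OF h]
    obtain B where B: "\<And>x. norm x \<le> total \<Longrightarrow> \<bar>h x\<bar> \<le> B"
      using bounded_on_total[OF h] by blast
    have pre_meas: "pre k \<in> measurable \<mu> (count_space UNIV)" for k
    proof (rule measurable_count_space_eq2_countable[THEN iffD2], simp_all, safe)
      fix s :: "bool list"
      have "pre k -` {s} \<inter> space \<mu> = (if length s = k then {x. pre (length s) x = s} else {})"
        by (auto simp: len sp)
      then show "pre k -` {s} \<inter> space \<mu> \<in> sets \<mu>" using meas by auto
    qed
    have part: "partial (pre k x) = (\<Sum>i<k. if code i x then v i else 0)" for k x
      unfolding partial_def pre_def by (intro sum.cong) auto
    have hlim: "(\<lambda>k. h (z k)) \<longlonglongrightarrow> h y" if "z \<longlonglongrightarrow> y" for z y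
      by (rule continuous_on_tendsto_compose[OF h that]) auto
    have nJ: "norm (J x) \<le> total" for x unfolding expand by (rule series_bounds)
    have "(\<lambda>k. \<integral>u. h (partial (branch \<theta> u k)) \<partial>uniform_tree) \<longlonglongrightarrow> (\<integral>u. h (limit_point \<theta> u) \<partial>uniform_tree)"
    proof (rule integral_dominated_convergence[where w = "\<lambda>_. B"])
      show "AE u in uniform_tree. (\<lambda>k. h (partial (branch \<theta> u k))) \<longlonglongrightarrow> h (limit_point \<theta> u)"
        unfolding partial_branch limit_point_def
        by (intro AE_I2 hlim summable_LIMSEQ series_bounds)
    qed (use B[OF norm_partial] in auto)
    moreover have "(\<lambda>k. \<integral>x. h (partial (pre k x)) \<partial>\<mu>) \<longlonglongrightarrow> (\<integral>x. h (J x) \<partial>\<mu>)"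
    proof (rule integral_dominated_convergence[where w = "\<lambda>_. B"])
      show "AE x in \<mu>. (\<lambda>k. h (partial (pre k x))) \<longlonglongrightarrow> h (J x)"
        unfolding part expand by (intro AE_I2 hlim summable_LIMSEQ series_bounds)
      show "(\<lambda>x. h (partial (pre k x))) \<in> borel_measurable \<mu>" for k
        using pre_meas[of k] by measurable
    qed (use B[OF norm_partial] in auto)
    moreover have "(\<integral>x. h (partial (pre k x)) \<partial>\<mu>) = (\<integral>u. h (partial (branch \<theta> u k)) \<partial>uniform_tree)" for k
      by (subst integral_list_valued[OF prob_space_axioms pre_meas len],
          subst integral_list_valued[OF uniform_tree.P.prob_space_axioms measurable_branch, where k = k])
         (auto intro!: sum.cong simp: measure_branch_eq[OF \<theta>] bp m_def[symmetric] sp)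
    ultimately show "(\<integral>u. h (limit_point \<theta> u) \<partial>uniform_tree) = (\<integral>x. h (J x) \<partial>\<mu>)"
      using LIMSEQ_unique by simp
  qed
qed

end

subsection \<open>Compactness of moment balls\<close>

text \<open>The test functions vanish outside a ball because those are the ones that extend
  continuously by zero from the open cube. They still determine a probability measure: the indicator
  of an open set is a limit of truncated distance functions, cut off at radius
  \<open>k\<close>.\<close>

lemma prob_measures_eqI:
  fixes \<mu> \<nu> :: "'a::euclidean_space measure"
  assumes \<mu>: "\<mu> \<in> prob_measures" and \<nu>: "\<nu> \<in> prob_measures"
    and eq: "\<And>(f :: 'a \<Rightarrow> real) T. continuous_on UNIV f \<Longrightarrow> (\<And>x. T \<le> norm x \<Longrightarrow> f x = 0) \<Longrightarrow>
               (\<integral>x. f x \<partial>\<mu>) = (\<integral>x. f x \<partial>\<nu>)"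
  shows "\<mu> = \<nu>"
proof (rule measure_eqI_generator_eq[where E = "{U. open U}" and \<Omega> = UNIV and A = "\<lambda>_. UNIV"])
  show "Int_stable {U :: 'a set. open U}" by (auto simp: Int_stable_def)
  show "sets \<mu> = sigma_sets UNIV {U. open U}" "sets \<nu> = sigma_sets UNIV {U. open U}"
    using prob_measuresD(1)[OF \<mu>] prob_measuresD(1)[OF \<nu>] by (simp_all add: borel_def)
  interpret \<mu>: prob_space \<mu> using prob_measuresD[OF \<mu>] by simp
  interpret \<nu>: prob_space \<nu> using prob_measuresD[OF \<nu>] by simp
  show "emeasure \<mu> UNIV \<noteq> \<infinity>" using \<mu>.emeasure_finite by auto
  fix U :: "'a set" assume "U \<in> {U. open U}"
  then have U: "open U" by simp
  show "emeasure \<mu> U = emeasure \<nu> U"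
  \<comment> \<open>The distance to the empty set is \<open>0\<close> by convention, so
    approximation by distances to the complement presupposes a nonempty complement.\<close>
  proof (cases "U = UNIV")
    case True
    then show ?thesis
      using \<mu>.emeasure_space_1 \<nu>.emeasure_space_1 prob_measuresD(3)[OF \<mu>] prob_measuresD(3)[OF \<nu>] by simp
  next
    case False
    define f where "f k x = min 1 (real k * infdist x (- U)) * cutoff (real k) x" for k x
    have fc: "continuous_on UNIV (f k)" for k
      unfolding f_def by (intro continuous_intros)
    have flim: "(\<lambda>k. f k x) \<longlonglongrightarrow> indicator U x" for x
    proof (cases "x \<in> U")
      case True
      then have pos: "infdist x (- U) > 0"
        using U False by (intro infdist_pos_not_in_closed) auto
      have "\<forall>\<^sub>F k in sequentially. 1 / infdist x (- U) \<le> real k"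
        by (rule eventually_sequentiallyI[of "nat \<lceil>1 / infdist x (- U)\<rceil>"]) linarith
      then have "\<forall>\<^sub>F k in sequentially. cutoff (real k) x = f k x"
        by eventually_elim (use pos in \<open>simp add: f_def field_simps min_absorb1\<close>)
      then have "(\<lambda>k. f k x) \<longlonglongrightarrow> 1"
        by (rule Lim_transform_eventually[OF cutoff_tendsto])
      then show ?thesis using True by simp
    next
      case False
      then have "f k x = 0" for k by (simp add: f_def)
      then show ?thesis using False by simp
    qed
    have bd: "\<bar>f k x\<bar> \<le> 1" for k x
      unfolding f_def abs_mult by (intro mult_le_one) (auto simp: infdist_nonneg)
    have lim: "(\<lambda>k. \<integral>x. f k x \<partial>\<rho>) \<longlonglongrightarrow> measure \<rho> U" if \<rho>: "\<rho> \<in> prob_measures" for \<rho>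
    proof -
      interpret prob_space \<rho> using prob_measuresD[OF \<rho>] by simp
      note [measurable_cong] = prob_measuresD(1)[OF \<rho>]
      have [measurable]: "U \<in> sets borel" using U by simp
      have "(\<lambda>k. \<integral>x. f k x \<partial>\<rho>) \<longlonglongrightarrow> (\<integral>x. indicator U x \<partial>\<rho>)"
        by (rule integral_dominated_convergence[where w = "\<lambda>_. 1"])
           (use borel_measurable_continuous_onI[OF fc] bd flim in auto)
      then show ?thesis using prob_measuresD(3)[OF \<rho>] by simp
    qed
    have "(\<integral>x. f k x \<partial>\<mu>) = (\<integral>x. f k x \<partial>\<nu>)" for k
      by (rule eq[OF fc, of "real k + 1"]) (simp add: f_def cutoff_eq_0)
    then have "measure \<mu> U = measure \<nu> U"
      using lim[OF \<mu>] lim[OF \<nu>] LIMSEQ_unique by simp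
    then show ?thesis by (simp add: \<mu>.emeasure_eq_measure \<nu>.emeasure_eq_measure)
  qed
qed auto

section \<open>A chart onto the open unit cube and its binary digits\<close>

definition to_cube :: "'a::euclidean_space \<Rightarrow> 'a" where
  "to_cube x = (\<Sum>b\<in>Basis. (1/2 + arctan (x \<bullet> b) / pi) *\<^sub>R b)"

definition of_cube :: "'a::euclidean_space \<Rightarrow> 'a" where
  "of_cube y = (\<Sum>b\<in>Basis. tan (pi * (y \<bullet> b - 1/2)) *\<^sub>R b)"

lemma cube_inner:
  assumes "b \<in> Basis"
  shows "to_cube x \<bullet> b = 1/2 + arctan (x \<bullet> b) / pi" "of_cube x \<bullet> b = tan (pi * (x \<bullet> b - 1/2))"
  using assms by (simp_all add: to_cube_def of_cube_def inner_sum_left inner_Basis if_distrib cong: if_cong)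

lemma of_cube_to_cube [simp]: "of_cube (to_cube x) = x"
  by (rule euclidean_eqI) (simp add: cube_inner tan_arctan)

lemma to_cube_in_box: "to_cube x \<in> box 0 One"
proof -
  have *: "0 < 1/2 + arctan t / pi" "1/2 + arctan t / pi < 1" for t
    using arctan_lbound[of t] arctan_ubound[of t] by (simp_all add: field_simps)
  show ?thesis unfolding mem_box
  proof (intro ballI)
    fix b :: 'a assume b: "b \<in> Basis"
    then show "0 \<bullet> b < to_cube x \<bullet> b \<and> to_cube x \<bullet> b < One \<bullet> b"
      using * by (simp only: cube_inner inner_zero_left inner_sum_left_Basis) simp
  qed
qed

lemma box_angle:
  assumes "y \<in> box 0 One" "b \<in> Basis"
  shows "- (pi/2) < pi * (y \<bullet> b - 1/2)" "pi * (y \<bullet> b - 1/2) < pi/2"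
proof -
  have y: "0 < y \<bullet> b" "y \<bullet> b < 1" using assms by (auto simp: mem_box)
  then have "pi * 0 < pi * (y \<bullet> b)" "pi * (y \<bullet> b) < pi * 1" by (intro mult_strict_left_mono; simp)+
  then show "- (pi/2) < pi * (y \<bullet> b - 1/2)" "pi * (y \<bullet> b - 1/2) < pi/2"
    by (simp_all add: algebra_simps)
qed

lemma to_cube_of_cube: "y \<in> box 0 One \<Longrightarrow> to_cube (of_cube y) = y"
  by (rule euclidean_eqI) (simp only: cube_inner arctan_tan[OF box_angle], simp)

lemma continuous_on_to_cube: "continuous_on S to_cube"
  unfolding to_cube_def by (intro continuous_intros) simp_all

lemma continuous_on_of_cube: "continuous_on (box 0 One) of_cube"
proof -
  have "continuous_on (box 0 One) (\<lambda>x :: 'a. tan (pi * (x \<bullet> b - 1/2)))" if b: "b \<in> Basis" for b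
  proof (rule continuous_on_compose2[of "{t. cos t \<noteq> 0}" tan])
    show "continuous_on {t :: real. cos t \<noteq> 0} tan"
      by (rule continuous_on_tan) (auto intro: continuous_intros)
    show "continuous_on (box 0 One) (\<lambda>x :: 'a. pi * (x \<bullet> b - 1/2))" by (intro continuous_intros)
    show "(\<lambda>x. pi * (x \<bullet> b - 1/2)) ` box 0 One \<subseteq> {t. cos t \<noteq> 0}"
      using cos_gt_zero_pi[OF box_angle[OF _ b]] by (force simp del: One_nat_def)
  qed
  then show ?thesis unfolding of_cube_def
    by (intro continuous_on_sum continuous_on_scaleR continuous_on_const)
qed

lemma borel_measurable_of_cube [measurable]: "of_cube \<in> borel_measurable borel"
proof -
  have [measurable]: "(sin :: real \<Rightarrow> real) \<in> borel_measurable borel" "(cos :: real \<Rightarrow> real) \<in> borel_measurable borel"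
    by (intro borel_measurable_continuous_onI continuous_intros)+
  show ?thesis unfolding of_cube_def tan_def by measurable
qed

text \<open>Transports a test function to the cube. The value \<open>0\<close> off the open box
  matters since the random binary point may land on the boundary.\<close>

definition cube_ext :: "('a::euclidean_space \<Rightarrow> real) \<Rightarrow> 'a \<Rightarrow> real" where
  "cube_ext f y = (if y \<in> box 0 One then f (of_cube y) else 0)"

lemma cube_ext_to_cube [simp]: "cube_ext f (to_cube x) = f x"
  by (simp add: cube_ext_def to_cube_in_box)

text \<open>Two open sets cover the space: the open box, where the function is a composition of
  continuous maps, and the complement of the compact image of the ball of radius \<open>T\<close>,
  where it is \<open>0\<close>.\<close>

lemma continuous_on_cube_ext:
  assumes f: "continuous_on UNIV f" and T: "\<And>x. T \<le> norm x \<Longrightarrow> f x = 0"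
  shows "continuous_on UNIV (cube_ext f)"
proof -
  let ?V = "- (to_cube ` cball (0::'a) T)"
  have "compact (to_cube ` cball (0::'a) T)"
    by (intro compact_continuous_image continuous_on_to_cube) auto
  then have V: "open ?V" by (simp add: compact_imp_closed open_Compl)
  have "continuous_on (box 0 One) (\<lambda>y. f (of_cube y))"
    by (intro continuous_on_compose2[OF f] continuous_on_of_cube) auto
  then have 1: "continuous_on (box 0 One) (cube_ext f)"
    by (rule continuous_on_eq) (simp add: cube_ext_def)
  have "cube_ext f y = 0" if "y \<in> ?V" for y
  proof (cases "y \<in> box 0 One")
    case True
    then have "of_cube y \<notin> cball 0 T" using that to_cube_of_cube[OF True] by (metis ComplD image_eqI)
    then show ?thesis using T by (simp add: cube_ext_def)
  qed (simp add: cube_ext_def)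
  then have 2: "continuous_on ?V (cube_ext f)"
    by (intro continuous_on_eq[OF continuous_on_const[of ?V 0]]) auto
  have "box 0 One \<union> ?V = UNIV" using to_cube_in_box by auto
  then show ?thesis using continuous_on_open_Un[OF open_box V 1 2] by simp
qed

text \<open>The digits are read off as parities of floors; the induction rests on
  \<open>floor (2 * z)\<close> being \<open>2 * floor z\<close> plus the next digit.\<close>

lemma binary_expansion_partial:
  fixes y :: real
  assumes "0 \<le> y" "y < 1"
  shows "(\<Sum>j<k. if odd \<lfloor>2 ^ Suc j * y\<rfloor> then (1/2) ^ Suc j else 0) = real_of_int \<lfloor>2 ^ k * y\<rfloor> / 2 ^ k"
proof (induction k)
  case 0
  then show ?case using assms by (simp add: floor_eq_iff)
next
  case (Suc k)
  define z where "z = 2 ^ k * y"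
  have z2: "2 ^ Suc k * y = 2 * z" by (simp add: z_def)
  have "\<lfloor>2 * z\<rfloor> = 2 * \<lfloor>z\<rfloor> \<or> \<lfloor>2 * z\<rfloor> = 2 * \<lfloor>z\<rfloor> + 1" by linarith
  then have *: "real_of_int \<lfloor>2 * z\<rfloor> = (if odd \<lfloor>2 * z\<rfloor> then 1 else 0) + 2 * real_of_int \<lfloor>z\<rfloor>" by auto
  have "real_of_int \<lfloor>z\<rfloor> / 2 ^ k + (if odd \<lfloor>2 * z\<rfloor> then (1/2) ^ Suc k else 0) = real_of_int \<lfloor>2 * z\<rfloor> / 2 ^ Suc k"
    unfolding * by (cases "odd \<lfloor>2 * z\<rfloor>") (simp_all add: field_simps power_one_over)
  then show ?case unfolding sum.lessThan_Suc Suc z2 z_def[symmetric] .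
qed

lemma binary_expansion_tendsto:
  fixes y :: real
  shows "(\<lambda>k. real_of_int \<lfloor>2 ^ k * y\<rfloor> / 2 ^ k) \<longlonglongrightarrow> y"
proof (rule LIM_zero_cancel, rule Lim_null_comparison)
  show "\<forall>\<^sub>F k in sequentially. norm (real_of_int \<lfloor>2 ^ k * y\<rfloor> / 2 ^ k - y) \<le> (1/2) ^ k"
  proof (intro always_eventually allI)
    fix k
    have "\<bar>real_of_int \<lfloor>2 ^ k * y\<rfloor> - 2 ^ k * y\<bar> \<le> 1" by linarith
    moreover have "real_of_int \<lfloor>2 ^ k * y\<rfloor> / 2 ^ k - y = (real_of_int \<lfloor>2 ^ k * y\<rfloor> - 2 ^ k * y) / 2 ^ k"
      by (simp add: field_simps)
    ultimately show "norm (real_of_int \<lfloor>2 ^ k * y\<rfloor> / 2 ^ k - y) \<le> (1/2) ^ k"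
      by (simp add: abs_divide power_one_over divide_le_cancel divide_right_mono)
  qed
qed (rule LIMSEQ_power_zero, simp)

text \<open>The binary expansions of the coordinates are interleaved: with \<open>d\<close> the
  dimension, index \<open>j * d + m\<close> carries the \<open>j\<close>-th digit of coordinate
  \<open>m\<close>.\<close>

lemma cube_binary_series:
  obtains v :: "nat \<Rightarrow> 'a::euclidean_space" and code :: "nat \<Rightarrow> 'a \<Rightarrow> bool"
  where "summable (\<lambda>i. norm (v i))" "\<And>i. Measurable.pred borel (code i)"
    "\<And>x. to_cube x = (\<Sum>i. if code i x then v i else 0)"
proof -
  define d where "d = DIM('a)"
  have d: "d > 0" by (simp add: d_def)
  obtain b :: "nat \<Rightarrow> 'a" where b: "bij_betw b {..<d} Basis"
    using ex_bij_betw_nat_finite[of "Basis :: 'a set"] by (auto simp: d_def atLeast0LessThan)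
  have bB: "b m \<in> Basis" if "m < d" for m using b that by (auto simp: bij_betw_def)
  define v where "v i = (1/2 :: real) ^ Suc (i div d) *\<^sub>R b (i mod d)" for i
  define code where "code i x = odd \<lfloor>2 ^ Suc (i div d) * (to_cube x \<bullet> b (i mod d))\<rfloor>" for i x
  have block: "(\<Sum>i<k * d. f i) = (\<Sum>j<k. \<Sum>m<d. f (j * d + m))" for f :: "nat \<Rightarrow> 'b::comm_monoid_add" and k
    unfolding sum.nat_group[symmetric]
    by (simp add: sum.atLeastLessThan_shift_0[of _ "_ * d"] atLeast0LessThan)
  have dm: "(j * d + m) div d = j" "(j * d + m) mod d = m" if "m < d" for j m
    using that by auto
  have norm_v: "norm (v i) = (1/2) ^ Suc (i div d)" for i
    using bB[of "i mod d"] d by (simp add: v_def)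
  have sv: "summable (\<lambda>i. norm (v i))"
  proof (rule summableI_nonneg_bounded)
    fix n
    have "(\<Sum>i<n. norm (v i)) \<le> (\<Sum>i<n * d. norm (v i))"
      using d by (intro sum_mono2) auto
    also have "\<dots> = (\<Sum>j<n. real d * (1/2) ^ Suc j)"
      unfolding block norm_v by (intro sum.cong refl) (simp add: dm)
    also have "\<dots> = real d * (\<Sum>j<n. (1/2) ^ Suc j)" by (simp add: sum_distrib_left)
    also have "\<dots> \<le> real d * (\<Sum>j. (1/2) ^ Suc j)"
      by (intro mult_left_mono sum_le_suminf) (auto simp: summable_geometric)
    finally show "(\<Sum>i<n. norm (v i)) \<le> real d * (\<Sum>j. (1/2) ^ Suc j)" .
  qed simp
  have meas: "Measurable.pred borel (code i)" for i
  proof -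
    have [measurable]: "to_cube \<in> borel_measurable borel"
      by (intro borel_measurable_continuous_onI continuous_on_to_cube)
    show ?thesis unfolding code_def by measurable
  qed
  have exp: "to_cube x = (\<Sum>i. if code i x then v i else 0)" for x
  proof (rule LIMSEQ_unique)
    let ?w = "\<lambda>i. if code i x then v i else 0"
    have "summable (\<lambda>i. norm (?w i))" by (rule summable_comparison_test'[OF sv, of 0]) simp
    then have "(\<lambda>n. sum ?w {..<n}) \<longlonglongrightarrow> suminf ?w"
      by (rule summable_LIMSEQ[OF summable_norm_cancel])
    \<comment> \<open>The partial sums are explicit only at the ends of complete blocks; as the
      series is already known to converge, this subsequence determines its sum.\<close>
    from LIMSEQ_subseq_LIMSEQ[OF this, of "\<lambda>k. k * d"]
    show "(\<lambda>k. sum ?w {..<k * d}) \<longlonglongrightarrow> suminf ?w"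
      using d by (auto simp: strict_mono_def comp_def)
    have y: "0 \<le> to_cube x \<bullet> b m" "to_cube x \<bullet> b m < 1" if "m < d" for m
      using to_cube_in_box[of x] bB[OF that] by (auto simp: mem_box less_imp_le)
    have "sum ?w {..<k * d} = (\<Sum>m<d. (real_of_int \<lfloor>2 ^ k * (to_cube x \<bullet> b m)\<rfloor> / 2 ^ k) *\<^sub>R b m)" for k
    proof -
      have "sum ?w {..<k * d} = (\<Sum>j<k. \<Sum>m<d. (if odd \<lfloor>2 ^ Suc j * (to_cube x \<bullet> b m)\<rfloor> then (1/2) ^ Suc j else 0) *\<^sub>R b m)"
        unfolding block by (intro sum.cong refl) (simp add: code_def v_def dm)
      also have "\<dots> = (\<Sum>m<d. (\<Sum>j<k. if odd \<lfloor>2 ^ Suc j * (to_cube x \<bullet> b m)\<rfloor> then (1/2) ^ Suc j else 0) *\<^sub>R b m)"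
        by (subst sum.swap) (simp add: scaleR_left.sum)
      also have "\<dots> = (\<Sum>m<d. (real_of_int \<lfloor>2 ^ k * (to_cube x \<bullet> b m)\<rfloor> / 2 ^ k) *\<^sub>R b m)"
        by (intro sum.cong refl) (simp only: binary_expansion_partial y lessThan_iff)
      finally show ?thesis .
    qed
    moreover have "(\<lambda>k. \<Sum>m<d. (real_of_int \<lfloor>2 ^ k * (to_cube x \<bullet> b m)\<rfloor> / 2 ^ k) *\<^sub>R b m) \<longlonglongrightarrow>
        (\<Sum>m<d. (to_cube x \<bullet> b m) *\<^sub>R b m)"
      by (intro tendsto_sum tendsto_scaleR binary_expansion_tendsto tendsto_const)
    moreover have "(\<Sum>m<d. (to_cube x \<bullet> b m) *\<^sub>R b m) = to_cube x"
      by (subst sum.reindex_bij_betw[OF b, of "\<lambda>c. (to_cube x \<bullet> c) *\<^sub>R c"]) (rule euclidean_representation)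
    ultimately show "(\<lambda>k. sum ?w {..<k * d}) \<longlonglongrightarrow> to_cube x" by simp
  qed
  show ?thesis by (rule that[OF sv meas exp])
qed

section \<open>Moment balls are weakly compact\<close>

definition moment_ball :: "real \<Rightarrow> real \<Rightarrow> 'a::euclidean_space measure set" where
  "moment_ball l R = {\<mu> \<in> prob_measures. (\<integral>\<^sup>+x. ennreal (norm x powr l) \<partial>\<mu>) \<le> ennreal R}"

lemma closedin_moment_ball:
  "0 < l \<Longrightarrow> closedin weak_topology (moment_ball l R :: 'a::euclidean_space measure set)"
proof -
  assume "0 < l"
  have "topspace weak_topology - moment_ball l R =
      {\<mu> \<in> prob_measures :: 'a measure set. ennreal R < (\<integral>\<^sup>+x. ennreal (norm x powr l) \<partial>\<mu>)}"
    by (auto simp: topspace_weak_topology moment_ball_def)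
  then show ?thesis using openin_weak_moment_gt[OF \<open>0 < l\<close>, of "ennreal R"]
    by (auto simp: closedin_def topspace_weak_topology moment_ball_def)
qed

text \<open>Markov's inequality, with \<open>n \<le> norm x powr l\<close> for
  \<open>norm x > n \<ge> 1\<close>. The bound is uniform over the moment ball and so expresses
  tightness.\<close>

lemma moment_ball_tail:
  assumes \<mu>: "\<mu> \<in> moment_ball l R" and l: "1 \<le> l" and n: "1 \<le> n" and R: "0 \<le> R"
  shows "measure \<mu> {x. n < norm x} \<le> R / n"
proof -
  have \<mu>': "\<mu> \<in> prob_measures" using \<mu> by (simp add: moment_ball_def)
  interpret prob_space \<mu> using prob_measuresD[OF \<mu>'] by simp
  note [measurable_cong] = prob_measuresD(1)[OF \<mu>']
  have "ennreal n * emeasure \<mu> {x. n < norm x} = (\<integral>\<^sup>+x. ennreal n * indicator {x. n < norm x} x \<partial>\<mu>)"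
    using prob_measuresD(1)[OF \<mu>'] by (subst nn_integral_cmult_indicator) auto
  also have "\<dots> \<le> (\<integral>\<^sup>+x. ennreal (norm x powr l) \<partial>\<mu>)"
  proof (intro nn_integral_mono)
    fix x
    have "n \<le> norm x powr l" if "n < norm x"
      using that n l powr_mono[of 1 l "norm x"] by simp
    then show "ennreal n * indicator {x. n < norm x} x \<le> ennreal (norm x powr l)"
      by (auto simp: indicator_def intro!: ennreal_leI)
  qed
  also have "\<dots> \<le> ennreal R" using \<mu> by (simp add: moment_ball_def)
  finally have "ennreal (n * measure \<mu> {x. n < norm x}) \<le> ennreal R"
    using n by (simp add: emeasure_eq_measure ennreal_mult)
  then have "n * measure \<mu> {x. n < norm x} \<le> R" using R by simp
  then show ?thesis using n by (simp add: field_simps)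
qed

text \<open>The laws on the cube obtained from all of \<open>unit_tree\<close> may charge its
  boundary, which corresponds to mass lost at infinity. The parameter set \<open>K\<close> is cut
  out by a closed form of the moment bound, and this bound also excludes the boundary. The moment
  ball is then the image of the compact set \<open>K\<close> under the continuous map
  \<open>law\<close>.\<close>

theorem compactin_moment_ball:
  assumes l: "1 \<le> l" and R: "0 \<le> R"
  shows "compactin weak_topology (moment_ball l R :: 'a::euclidean_space measure set)"
proof -
  obtain v :: "nat \<Rightarrow> 'a" and code :: "nat \<Rightarrow> 'a \<Rightarrow> bool"
    where v: "summable (\<lambda>i. norm (v i))" "\<And>i. Measurable.pred borel (code i)"
    "\<And>x. to_cube x = (\<Sum>i. if code i x then v i else 0)"
    using cube_binary_series by blast
  interpret binary_series v by unfold_locales (rule v(1))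
  define A where "A f \<theta> = (\<integral>u. cube_ext f (limit_point \<theta> u) \<partial>uniform_tree)" for f \<theta>
  \<comment> \<open>What is missing to \<open>k\<close> in the truncated moment
    \<open>min k (norm x powr l)\<close>. Unlike the latter it vanishes outside a ball, so it
    extends continuously by zero from the cube.\<close>
  define g where "g k x = max 0 (real k - norm x powr l)" for k :: nat and x :: 'a
  define K where "K = {\<theta> \<in> unit_tree. \<forall>k. real k - R \<le> A (g k) \<theta>}"
  define law where "law \<theta> = distr uniform_tree borel (\<lambda>u. of_cube (limit_point \<theta> u))" for \<theta>
  have g_cont: "continuous_on UNIV (g k)" for k
    unfolding g_def using l by (intro continuous_intros continuous_on_powr') auto
  have g_zero: "g k x = 0" if "real k + 1 \<le> norm x" for k x
    using that l powr_mono[of 1 l "norm x"] by (simp add: g_def)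
  have g_bd: "0 \<le> g k x" "g k x \<le> real k" for k x by (auto simp: g_def)
  have [measurable]: "g k \<in> borel_measurable borel" for k
    by (rule borel_measurable_continuous_onI[OF g_cont])
  have g_min: "real k - g k x = min (real k) (norm x powr l)" for k x by (auto simp: g_def)
  have A_cont: "continuous_on unit_tree (A f)"
    if "continuous_on UNIV f" "\<And>x. T \<le> norm x \<Longrightarrow> f x = 0" for f :: "'a \<Rightarrow> real" and T
    unfolding A_def by (intro continuous_on_integral_limit_point continuous_on_cube_ext[of f T] that)
  have K: "compact K"
  proof (rule closedin_compact[OF compact_unit_tree])
    have "closedin (top_of_set unit_tree) (unit_tree \<inter> A (g k) -` {real k - R..})" for k
      by (intro continuous_closedin_preimage A_cont[of _ "real k + 1"] g_cont g_zero) auto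
    then have "closedin (top_of_set unit_tree) (\<Inter>k. unit_tree \<inter> A (g k) -` {real k - R..})"
      by (intro closedin_Inter) auto
    moreover have "(\<Inter>k. unit_tree \<inter> A (g k) -` {real k - R..}) = K" by (auto simp: K_def)
    ultimately show "closedin (top_of_set unit_tree) K" by simp
  qed
  have law_pm: "law \<theta> \<in> prob_measures" for \<theta>
    unfolding prob_measures_def law_def
    by (auto intro!: uniform_tree.P.prob_space_distr)
  \<comment> \<open>\<open>g k\<close> is at most \<open>k\<close> and its extension is
    \<open>0\<close> off the box, so \<open>A (g k) \<theta> \<ge> k - R\<close> forces the box to
    have probability at least \<open>1 - R / k\<close>, for every positive \<open>k\<close>.\<close>
  have in_box: "AE u in uniform_tree. limit_point \<theta> u \<in> box 0 One" if \<theta>: "\<theta> \<in> K" for \<theta>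
  proof -
    let ?B = "{u. limit_point \<theta> u \<in> box 0 One}"
    have B: "?B \<in> sets uniform_tree"
      using measurable_sets[OF measurable_limit_point[of \<theta>], of "box 0 One"] by (simp add: vimage_def)
    have "1 - R / real k \<le> measure uniform_tree ?B" if "0 < k" for k
    proof -
      have "real k - R \<le> A (g k) \<theta>" using \<theta> by (simp add: K_def)
      also have "\<dots> \<le> (\<integral>u. real k * indicator ?B u \<partial>uniform_tree)"
        unfolding A_def
      proof (rule integral_mono_AE')
        show "integrable uniform_tree (\<lambda>u. real k * indicator ?B u)"
          using B by (intro integrable_mult_right integrable_real_indicator) (auto simp: less_top[symmetric])
        show "AE u in uniform_tree. cube_ext (g k) (limit_point \<theta> u) \<le> real k * indicator ?B u"
          by (auto simp: cube_ext_def g_bd)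
      qed (auto simp: cube_ext_def g_bd)
      also have "\<dots> = real k * measure uniform_tree ?B" by simp
      finally show ?thesis using that by (simp add: field_simps)
    qed
    moreover have "(\<lambda>k. 1 - R / real k) \<longlonglongrightarrow> 1 - 0"
      by (intro tendsto_intros tendsto_divide_0[OF tendsto_const] filterlim_real_at_infinity_sequentially)
    ultimately have "1 \<le> measure uniform_tree ?B"
      by (intro LIMSEQ_le_const2[of "\<lambda>k. 1 - R / real k" 1]) (auto intro!: exI[of _ 1])
    then have "measure uniform_tree ?B = 1" using uniform_tree.P.prob_le_1[of ?B] by linarith
    then show ?thesis using uniform_tree.P.prob_eq_1[OF B] by simp
  qed
  have law_int: "(\<integral>x. f x \<partial>law \<theta>) = A f \<theta>" if \<theta>: "\<theta> \<in> K" and [measurable]: "f \<in> borel_measurable borel" for f \<theta>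
  proof -
    have "(\<integral>x. f x \<partial>law \<theta>) = (\<integral>u. f (of_cube (limit_point \<theta> u)) \<partial>uniform_tree)"
      unfolding law_def by (rule integral_distr) auto
    also have "\<dots> = A f \<theta>"
      unfolding A_def
    proof (rule integral_cong_AE)
      show "(\<lambda>u. cube_ext f (limit_point \<theta> u)) \<in> borel_measurable uniform_tree"
        unfolding cube_ext_def by measurable
      show "AE u in uniform_tree. f (of_cube (limit_point \<theta> u)) = cube_ext f (limit_point \<theta> u)"
        using in_box[OF \<theta>] by eventually_elim (simp add: cube_ext_def)
    qed measurable
    finally show ?thesis .
  qed
  have g_int: "integrable \<mu> (g k)" if "\<mu> \<in> prob_measures" for \<mu> k
    using g_bd by (intro integrable_bounded_cont[OF that]) (auto intro!: boundedI[of _ "real k"])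
  have trunc: "ennreal (real k - (\<integral>x. g k x \<partial>\<mu>)) = (\<integral>\<^sup>+x. ennreal (min (real k) (norm x powr l)) \<partial>\<mu>)"
    if \<mu>: "\<mu> \<in> prob_measures" for k \<mu>
  proof -
    interpret prob_space \<mu> using prob_measuresD[OF \<mu>] by simp
    have "(\<integral>\<^sup>+x. ennreal (min (real k) (norm x powr l)) \<partial>\<mu>) = ennreal (\<integral>x. real k - g k x \<partial>\<mu>)"
      unfolding g_min[symmetric] using g_int[OF \<mu>] g_bd by (intro nn_integral_eq_integral) auto
    then show ?thesis using g_int[OF \<mu>] by (simp add: prob_space)
  qed
  have moment_iff: "\<mu> \<in> moment_ball l R \<longleftrightarrow> (\<forall>k. real k - R \<le> (\<integral>x. g k x \<partial>\<mu>))"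
    if \<mu>: "\<mu> \<in> prob_measures" for \<mu>
  proof -
    note [measurable_cong] = prob_measuresD(1)[OF \<mu>]
    have sup: "ennreal (norm x powr l) = (SUP k::nat. ennreal (min (real k) (norm x powr l)))" for x :: 'a
    proof (rule antisym)
      obtain k :: nat where "norm x powr l \<le> real k" using real_arch_simple by blast
      then show "ennreal (norm x powr l) \<le> (SUP k. ennreal (min (real k) (norm x powr l)))"
        by (intro SUP_upper2[of k]) (auto simp: min_def)
    qed (auto intro!: SUP_least ennreal_leI)
    have "(\<integral>\<^sup>+x. ennreal (norm x powr l) \<partial>\<mu>) = (SUP k::nat. \<integral>\<^sup>+x. ennreal (min (real k) (norm x powr l)) \<partial>\<mu>)"
      unfolding sup by (intro nn_integral_monotone_convergence_SUP)
        (auto simp: incseq_def le_fun_def intro!: ennreal_leI)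
    then have "\<mu> \<in> moment_ball l R \<longleftrightarrow> (\<forall>k. ennreal (real k - (\<integral>x. g k x \<partial>\<mu>)) \<le> ennreal R)"
      using \<mu> by (simp add: moment_ball_def trunc SUP_le_iff)
    also have "\<dots> \<longleftrightarrow> (\<forall>k. real k - R \<le> (\<integral>x. g k x \<partial>\<mu>))"
      using R by (simp add: ennreal_le_iff algebra_simps)
    finally show ?thesis .
  qed
  have law_ball: "law \<theta> \<in> moment_ball l R" if "\<theta> \<in> K" for \<theta>
    using that by (simp add: moment_iff[OF law_pm] law_int) (simp add: K_def)
  have img: "law ` K = moment_ball l R"
  proof (intro equalityI subsetI)
    fix \<mu> :: "'a measure" assume \<mu>: "\<mu> \<in> moment_ball l R"
    then have \<mu>p: "\<mu> \<in> prob_measures" by (simp add: moment_ball_def)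
    have [measurable]: "to_cube \<in> borel_measurable borel"
      by (intro borel_measurable_continuous_onI continuous_on_to_cube)
    obtain \<theta> where \<theta>: "\<theta> \<in> unit_tree" "\<And>h :: 'a \<Rightarrow> real. continuous_on UNIV h \<Longrightarrow>
      (\<integral>u. h (limit_point \<theta> u) \<partial>uniform_tree) = (\<integral>x. h (to_cube x) \<partial>\<mu>)"
      using exists_branching_law[OF \<mu>p v(2) _ v(3)] by auto
    have Aeq: "A f \<theta> = (\<integral>x. f x \<partial>\<mu>)"
      if "continuous_on UNIV f" "\<And>x. T \<le> norm x \<Longrightarrow> f x = 0" for f :: "'a \<Rightarrow> real" and T
      unfolding A_def using \<theta>(2)[OF continuous_on_cube_ext[of f T]] that by simp
    have "\<theta> \<in> K"
      using \<theta>(1) \<mu> Aeq[OF g_cont g_zero] by (simp add: K_def moment_iff[OF \<mu>p])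
    moreover have "\<mu> = law \<theta>"
    proof (rule prob_measures_eqI[OF \<mu>p law_pm])
      fix f :: "'a \<Rightarrow> real" and T assume f: "continuous_on UNIV f" "\<And>x. T \<le> norm x \<Longrightarrow> f x = 0"
      show "(\<integral>x. f x \<partial>\<mu>) = (\<integral>x. f x \<partial>law \<theta>)"
        using law_int[OF \<open>\<theta> \<in> K\<close> borel_measurable_continuous_onI[OF f(1)]] Aeq[OF f] by simp
    qed
    ultimately show "\<mu> \<in> law ` K" by blast
  qed (use law_ball in auto)
  have "continuous_map (top_of_set K) weak_topology law"
  proof (rule continuous_map_into_weak)
    fix f :: "'a \<Rightarrow> real" assume f: "continuous_on UNIV f" "bounded (range f)"
    obtain B where B: "\<And>x. \<bar>f x\<bar> \<le> B" using f(2) by (auto simp: bounded_iff)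
    have B0: "0 \<le> B" using B[of 0] by linarith
    note [measurable] = borel_measurable_continuous_onI[OF f(1)]
    \<comment> \<open>A bounded continuous \<open>f\<close> need not extend to the boundary of the
      cube. Its cut-offs at radius \<open>n\<close> do, and by the tail bound the error is at most
      \<open>B * R / n\<close>, uniformly on \<open>K\<close>.\<close>
    have "continuous_on K (\<lambda>\<theta>. \<integral>x. f x \<partial>law \<theta>)"
    proof (rule uniform_limit_theorem)
      show "\<forall>\<^sub>F n in sequentially. continuous_on K (\<lambda>\<theta>. \<integral>x. f x * cutoff (real n) x \<partial>law \<theta>)"
      proof (intro always_eventually allI)
        fix n
        have "continuous_on unit_tree (A (\<lambda>x. f x * cutoff (real n) x))"
          by (rule A_cont[of _ "real n + 1"]) (auto simp: cutoff_eq_0 intro!: continuous_intros f)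
        then have "continuous_on K (A (\<lambda>x. f x * cutoff (real n) x))"
          by (rule continuous_on_subset) (auto simp: K_def)
        then show "continuous_on K (\<lambda>\<theta>. \<integral>x. f x * cutoff (real n) x \<partial>law \<theta>)"
          by (rule continuous_on_eq) (simp add: law_int)
      qed
      show "uniform_limit K (\<lambda>n \<theta>. \<integral>x. f x * cutoff (real n) x \<partial>law \<theta>) (\<lambda>\<theta>. \<integral>x. f x \<partial>law \<theta>) sequentially"
      proof (rule uniform_limitI)
        fix e :: real assume e: "0 < e"
        show "\<forall>\<^sub>F n in sequentially. \<forall>\<theta>\<in>K. dist (\<integral>x. f x * cutoff (real n) x \<partial>law \<theta>) (\<integral>x. f x \<partial>law \<theta>) < e"
        proof (rule eventually_sequentiallyI[of "max 1 (nat \<lceil>B * R / e\<rceil> + 1)"], safe)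
          fix n \<theta> assume n: "max 1 (nat \<lceil>B * R / e\<rceil> + 1) \<le> n" and \<theta>: "\<theta> \<in> K"
          then have n1: "1 \<le> real n" and n2: "B * R / e < real n" by linarith+
          interpret prob_space "law \<theta>" using prob_measuresD[OF law_pm] by simp
          note [measurable_cong] = prob_measuresD(1)[OF law_pm[of \<theta>]]
          have int: "integrable (law \<theta>) f" "integrable (law \<theta>) (\<lambda>x. f x * cutoff (real n) x)"
          proof -
            show "integrable (law \<theta>) f" using B by (intro integrable_const_bound[of _ B]) auto
            have "\<bar>f x * cutoff (real n) x\<bar> \<le> B" for x
              unfolding abs_mult using order_trans[OF mult_left_le B[of x]] by simp
            then show "integrable (law \<theta>) (\<lambda>x. f x * cutoff (real n) x)"
              by (intro integrable_const_bound[of _ B]) auto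
          qed
          have "\<bar>(\<integral>x. f x * cutoff (real n) x \<partial>law \<theta>) - (\<integral>x. f x \<partial>law \<theta>)\<bar>
              = \<bar>\<integral>x. f x * cutoff (real n) x - f x \<partial>law \<theta>\<bar>" using int by simp
          also have "\<dots> \<le> (\<integral>x. \<bar>f x * cutoff (real n) x - f x\<bar> \<partial>law \<theta>)" by (rule integral_abs_bound)
          also have "\<dots> \<le> (\<integral>x. B * indicator {x. real n < norm x} x \<partial>law \<theta>)"
          proof (rule integral_mono)
            fix x
            have "\<bar>f x * cutoff (real n) x - f x\<bar> = \<bar>f x\<bar> * \<bar>1 - cutoff (real n) x\<bar>"
              unfolding abs_mult[symmetric] by (simp add: algebra_simps abs_minus_commute)
            also have "\<dots> \<le> B * indicator {x. real n < norm x} x"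
            proof (cases "real n < norm x")
              case True
              have "\<bar>1 - cutoff (real n) x\<bar> \<le> 1" using cutoff_bounds[of "real n" x] by linarith
              then show ?thesis using True B[of x] B0 by (simp add: order_trans[OF mult_left_le])
            qed (simp add: cutoff_eq_1)
            finally show "\<bar>f x * cutoff (real n) x - f x\<bar> \<le> B * indicator {x. real n < norm x} x" .
          qed (use int in \<open>auto intro!: integrable_real_indicator simp: less_top[symmetric]\<close>)
          also have "\<dots> = B * measure (law \<theta>) {x. real n < norm x}"
            using prob_measuresD(3)[OF law_pm[of \<theta>]] by simp
          also have "\<dots> \<le> B * (R / real n)"
            using moment_ball_tail[OF law_ball[OF \<theta>] l n1 R] B0 by (intro mult_left_mono)
          also have "\<dots> < e" using n1 n2 e by (simp add: field_simps)
          finally show "dist (\<integral>x. f x * cutoff (real n) x \<partial>law \<theta>) (\<integral>x. f x \<partial>law \<theta>) < e"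
            by (simp add: dist_real_def)
        qed
      qed
    qed simp
    then show "continuous_map (top_of_set K) euclideanreal (\<lambda>\<theta>. \<integral>x. f x \<partial>law \<theta>)"
      by simp
  qed (use law_pm in auto)
  moreover have "compactin (top_of_set K) K" using K by (simp add: compactin_subtopology)
  ultimately have "compactin weak_topology (law ` K)" by (metis image_compactin)
  then show ?thesis by (simp add: img)
qed

subsection \<open>Wasserstein topologies\<close>

lemma prob_measures_pD:
  "\<mu> \<in> prob_measures_p p \<Longrightarrow> \<mu> \<in> prob_measures"
  "\<mu> \<in> prob_measures_p p \<Longrightarrow> (\<integral>\<^sup>+x. ennreal (norm x powr p) \<partial>\<mu>) < \<infinity>"
  by (auto simp: prob_measures_p_def)

lemma integrable_moment:
  assumes "\<mu> \<in> prob_measures_p p"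
  shows "integrable \<mu> (\<lambda>x. norm x powr p)"
proof -
  note [measurable_cong] = prob_measuresD(1)[OF prob_measures_pD(1)[OF assms]]
  show ?thesis using prob_measures_pD(2)[OF assms] by (intro integrableI_nonneg) auto
qed

lemma norm_add_powr_le:
  fixes x y :: "'a::real_normed_vector"
  assumes "0 \<le> p"
  shows "norm (x + y) powr p \<le> 2 powr p * (norm x powr p + norm y powr p)"
proof -
  define m where "m = max (norm x) (norm y)"
  have "norm (x + y) powr p \<le> (2 * m) powr p"
    using assms norm_triangle_ineq[of x y] by (intro powr_mono2) (auto simp: m_def)
  also have "\<dots> = 2 powr p * m powr p" by (subst powr_mult) (auto simp: m_def)
  also have "\<dots> \<le> 2 powr p * (norm x powr p + norm y powr p)"
    by (intro mult_left_mono) (auto simp: m_def max_def)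
  finally show ?thesis .
qed

lemma prob_measures_p_1:
  assumes "1 \<le> p" shows "prob_measures_p p \<subseteq> (prob_measures_p 1 :: 'a::euclidean_space measure set)"
proof
  fix \<mu> :: "'a measure" assume \<mu>: "\<mu> \<in> prob_measures_p p"
  note \<mu>' = prob_measures_pD[OF \<mu>]
  interpret prob_space \<mu> using prob_measuresD[OF \<mu>'(1)] by simp
  note [measurable_cong] = prob_measuresD(1)[OF \<mu>'(1)]
  have "(\<integral>\<^sup>+x. ennreal (norm x powr 1) \<partial>\<mu>) \<le> (\<integral>\<^sup>+x. 1 + ennreal (norm x powr p) \<partial>\<mu>)"
  proof (intro nn_integral_mono)
    fix x :: 'a
    have "norm x powr 1 \<le> 1 + norm x powr p"
    proof (cases "norm x \<le> 1")
      case False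
      then show ?thesis using powr_mono[of 1 p "norm x"] assms by simp
    qed (simp add: add_increasing2)
    then have "ennreal (norm x powr 1) \<le> ennreal (1 + norm x powr p)" by (rule ennreal_leI)
    then show "ennreal (norm x powr 1) \<le> 1 + ennreal (norm x powr p)"
      by (subst (asm) ennreal_plus) auto
  qed
  also have "\<dots> = 1 + (\<integral>\<^sup>+x. ennreal (norm x powr p) \<partial>\<mu>)"
    by (subst nn_integral_add) (auto simp: emeasure_space_1)
  also have "\<dots> < \<infinity>" using \<mu>'(2) by simp
  finally show "\<mu> \<in> prob_measures_p 1" using \<mu>'(1) by (simp add: prob_measures_p_def)
qed

lemma integrable_id:
  assumes "\<mu> \<in> prob_measures_p p" "1 \<le> p"
  shows "integrable \<mu> (\<lambda>x. x)"
proof -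
  have \<mu>: "\<mu> \<in> prob_measures_p 1" using assms prob_measures_p_1 by blast
  have "integrable \<mu> (\<lambda>x. norm x)" using integrable_moment[OF \<mu>] by simp
  moreover note [measurable_cong] = prob_measuresD(1)[OF prob_measures_pD(1)[OF \<mu>]]
  have "(\<lambda>x. x) \<in> borel_measurable \<mu>" by measurable
  ultimately show ?thesis by (simp add: integrable_norm_iff)
qed

lemma couplingsD:
  assumes "\<gamma> \<in> couplings \<mu> \<nu>"
  shows "prob_space \<gamma>" "sets \<gamma> = sets (borel \<Otimes>\<^sub>M borel)"
    "distr \<gamma> borel fst = \<mu>" "distr \<gamma> borel snd = \<nu>"
  using assms by (auto simp: couplings_def)

lemma wasserstein_dist_less:
  assumes "\<gamma> \<in> couplings \<mu> \<nu>" "0 < r" "1 \<le> p"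
    and "(\<integral>\<^sup>+z. ennreal (dist (fst z) (snd z) powr p) \<partial>\<gamma>) < ennreal (r powr p)"
  shows "wasserstein_dist p \<mu> \<nu> < r"
proof -
  let ?I = "INF \<gamma>\<in>couplings \<mu> \<nu>. \<integral>\<^sup>+z. ennreal (dist (fst z) (snd z) powr p) \<partial>\<gamma>"
  have "?I < ennreal (r powr p)" using assms(1,4) by (auto simp: INF_less_iff)
  then have "enn2real ?I < r powr p"
    by (cases ?I) (auto simp: ennreal_less_iff)
  then have "enn2real ?I powr (1 / p) < (r powr p) powr (1 / p)"
    using assms(3) by (intro powr_less_mono2) auto
  also have "\<dots> = r" using assms(2,3) by (simp add: powr_powr)
  finally show ?thesis by (simp add: wasserstein_dist_def)
qed

text \<open>\<open>enn2real\<close> would turn an infinite infimum into \<open>0\<close>. Finite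
  \<open>p\<close>-th moments rule this out, because the product coupling has finite cost; a small
  distance is therefore witnessed by a coupling of small cost.\<close>

lemma wasserstein_distD:
  assumes \<mu>: "\<mu> \<in> prob_measures_p p" and \<nu>: "\<nu> \<in> prob_measures_p p" and p: "1 \<le> p"
    and less: "wasserstein_dist p \<mu> \<nu> < r"
  obtains \<gamma> where "\<gamma> \<in> couplings \<mu> \<nu>"
    "(\<integral>\<^sup>+z. ennreal (dist (fst z) (snd z) powr p) \<partial>\<gamma>) < ennreal (r powr p)"
proof -
  let ?c = "\<lambda>\<gamma>. \<integral>\<^sup>+z. ennreal (dist (fst z) (snd z) powr p) \<partial>\<gamma>"
  let ?I = "INF \<gamma>\<in>couplings \<mu> \<nu>. ?c \<gamma>"
  interpret \<mu>: prob_space \<mu> using prob_measuresD[OF prob_measures_pD(1)[OF \<mu>]] by simp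
  interpret \<nu>: prob_space \<nu> using prob_measuresD[OF prob_measures_pD(1)[OF \<nu>]] by simp
  interpret pair_prob_space \<mu> \<nu> ..
  note [measurable_cong] = prob_measuresD(1)[OF prob_measures_pD(1)[OF \<mu>]]
    prob_measuresD(1)[OF prob_measures_pD(1)[OF \<nu>]]
  have cpl: "\<mu> \<Otimes>\<^sub>M \<nu> \<in> couplings \<mu> \<nu>"
    unfolding couplings_def
  proof (intro CollectI conjI)
    show "sets (\<mu> \<Otimes>\<^sub>M \<nu>) = sets (borel \<Otimes>\<^sub>M borel)"
      using prob_measuresD(1)[OF prob_measures_pD(1)[OF \<mu>]] prob_measuresD(1)[OF prob_measures_pD(1)[OF \<nu>]]
      by (rule sets_pair_measure_cong)
    show "prob_space (\<mu> \<Otimes>\<^sub>M \<nu>)" by unfold_locales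
    note sp = prob_measuresD(3)[OF prob_measures_pD(1)[OF \<mu>]] prob_measuresD(3)[OF prob_measures_pD(1)[OF \<nu>]]
    show "distr (\<mu> \<Otimes>\<^sub>M \<nu>) borel fst = \<mu>"
    proof (rule measure_eqI)
      fix A assume "A \<in> sets (distr (\<mu> \<Otimes>\<^sub>M \<nu>) borel fst)"
      then have A: "A \<in> sets borel" by simp
      have "fst -` A \<inter> space (\<mu> \<Otimes>\<^sub>M \<nu>) = A \<times> space \<nu>" by (auto simp: space_pair_measure sp)
      then show "emeasure (distr (\<mu> \<Otimes>\<^sub>M \<nu>) borel fst) A = emeasure \<mu> A"
        using A prob_measuresD(1)[OF prob_measures_pD(1)[OF \<mu>]]
        by (subst emeasure_distr) (auto simp: \<nu>.emeasure_pair_measure_Times \<nu>.emeasure_space_1)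
    qed (use prob_measuresD(1)[OF prob_measures_pD(1)[OF \<mu>]] in simp)
    show "distr (\<mu> \<Otimes>\<^sub>M \<nu>) borel snd = \<nu>"
    proof (rule measure_eqI)
      fix A assume "A \<in> sets (distr (\<mu> \<Otimes>\<^sub>M \<nu>) borel snd)"
      then have A: "A \<in> sets borel" by simp
      have "snd -` A \<inter> space (\<mu> \<Otimes>\<^sub>M \<nu>) = space \<mu> \<times> A" by (auto simp: space_pair_measure sp)
      then show "emeasure (distr (\<mu> \<Otimes>\<^sub>M \<nu>) borel snd) A = emeasure \<nu> A"
        using A prob_measuresD(1)[OF prob_measures_pD(1)[OF \<nu>]]
        by (subst emeasure_distr) (auto simp: \<nu>.emeasure_pair_measure_Times \<mu>.emeasure_space_1)
    qed (use prob_measuresD(1)[OF prob_measures_pD(1)[OF \<nu>]] in simp)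
  qed
  have "?c (\<mu> \<Otimes>\<^sub>M \<nu>) \<le> (\<integral>\<^sup>+z. ennreal (2 powr p) * (ennreal (norm (fst z) powr p) + ennreal (norm (snd z) powr p)) \<partial>(\<mu> \<Otimes>\<^sub>M \<nu>))"
  proof (intro nn_integral_mono)
    fix z :: "'a \<times> 'a"
    have "dist (fst z) (snd z) powr p \<le> 2 powr p * (norm (fst z) powr p + norm (snd z) powr p)"
      using norm_add_powr_le[of p "fst z" "- snd z"] p by (simp add: dist_norm)
    then show "ennreal (dist (fst z) (snd z) powr p) \<le> ennreal (2 powr p) * (ennreal (norm (fst z) powr p) + ennreal (norm (snd z) powr p))"
      by (simp add: ennreal_plus[symmetric] ennreal_mult[symmetric] ennreal_leI del: ennreal_plus)
  qed
  also have "\<dots> = ennreal (2 powr p) * ((\<integral>\<^sup>+x. ennreal (norm x powr p) \<partial>\<mu>) + (\<integral>\<^sup>+x. ennreal (norm x powr p) \<partial>\<nu>))"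
    by (simp add: nn_integral_cmult nn_integral_add \<nu>.nn_integral_fst[symmetric]
         \<mu>.emeasure_space_1 \<nu>.emeasure_space_1)
  also have "\<dots> < \<infinity>" using prob_measures_pD(2)[OF \<mu>] prob_measures_pD(2)[OF \<nu>]
    by (simp add: ennreal_mult_less_top)
  finally have "?c (\<mu> \<Otimes>\<^sub>M \<nu>) < \<infinity>" .
  moreover have "?I \<le> ?c (\<mu> \<Otimes>\<^sub>M \<nu>)" by (rule INF_lower[OF cpl])
  ultimately have "?I < top" by (simp only: infinity_ennreal_def order_le_less_trans)
  then have fin: "?I = ennreal (enn2real ?I)" by (rule ennreal_enn2real[symmetric])
  have "enn2real ?I powr (1 / p) < r" using less by (simp add: wasserstein_dist_def)
  then have "(enn2real ?I powr (1 / p)) powr p < r powr p" using p by (intro powr_less_mono2) auto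
  then have "enn2real ?I < r powr p" using p by (simp add: powr_powr)
  then have "?I < ennreal (r powr p)" by (subst fin) (simp add: ennreal_less_iff)
  then show ?thesis using that by (auto simp: INF_less_iff)
qed

lemma coupling_integral_diff:
  fixes f :: "'a::euclidean_space \<Rightarrow> 'b::{banach,second_countable_topology}"
  assumes \<gamma>: "\<gamma> \<in> couplings \<mu> \<nu>" and [measurable]: "f \<in> borel_measurable borel"
    and "integrable \<mu> f" "integrable \<nu> f" "integrable \<gamma> g"
    and g: "\<And>z. norm (f (fst z) - f (snd z)) \<le> g z"
  shows "norm ((\<integral>x. f x \<partial>\<mu>) - (\<integral>x. f x \<partial>\<nu>)) \<le> (\<integral>z. g z \<partial>\<gamma>)"
proof -
  note [measurable_cong] = couplingsD(2)[OF \<gamma>]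
  have int: "integrable \<gamma> (\<lambda>z. f (fst z))" "integrable \<gamma> (\<lambda>z. f (snd z))"
    using assms(3,4) unfolding couplingsD(3,4)[OF \<gamma>, symmetric]
    by (auto simp: integrable_distr_eq)
  have "(\<integral>x. f x \<partial>\<mu>) = (\<integral>z. f (fst z) \<partial>\<gamma>)"
    by (subst couplingsD(3)[OF \<gamma>, symmetric], rule integral_distr) auto
  moreover have "(\<integral>x. f x \<partial>\<nu>) = (\<integral>z. f (snd z) \<partial>\<gamma>)"
    by (subst couplingsD(4)[OF \<gamma>, symmetric], rule integral_distr) auto
  ultimately have "norm ((\<integral>x. f x \<partial>\<mu>) - (\<integral>x. f x \<partial>\<nu>)) = norm (\<integral>z. f (fst z) - f (snd z) \<partial>\<gamma>)"
    using int by simp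
  also have "\<dots> \<le> (\<integral>z. g z \<partial>\<gamma>)"
    by (rule Bochner_Integration.integral_norm_bound_integral) (use int assms in auto)
  finally show ?thesis .
qed

lemma coupling_cost_integral:
  assumes \<gamma>: "\<gamma> \<in> couplings \<mu> \<nu>"
    and c: "(\<integral>\<^sup>+z. ennreal (dist (fst z) (snd z) powr p) \<partial>\<gamma>) < ennreal (r powr p)"
  shows "integrable \<gamma> (\<lambda>z. dist (fst z) (snd z) powr p)"
    and "(\<integral>z. dist (fst z) (snd z) powr p \<partial>\<gamma>) \<le> r powr p"
proof -
  note [measurable_cong] = couplingsD(2)[OF \<gamma>]
  show int: "integrable \<gamma> (\<lambda>z. dist (fst z) (snd z) powr p)"
    by (intro integrableI_nonneg) (use c order_less_trans[OF c ennreal_less_top] in auto)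
  have "ennreal (\<integral>z. dist (fst z) (snd z) powr p \<partial>\<gamma>) \<le> ennreal (r powr p)"
    using c by (subst nn_integral_eq_integral[symmetric]) (use int in auto)
  then show "(\<integral>z. dist (fst z) (snd z) powr p \<partial>\<gamma>) \<le> r powr p" by simp
qed

section \<open>Comparison of Wasserstein and weak open sets\<close>

text \<open>Along a coupling, a bounded continuous \<open>f\<close> changes little if the two points
  are close and the first lies in a large ball, by uniform continuity there. The remaining pairs are
  rare: distant ones are paid for by the transport cost, and the first point leaves the ball with
  small \<open>\<mu>\<close>-probability.\<close>

lemma openin_wasserstein_of_weak:
  fixes U :: "'a::euclidean_space measure set"
  assumes U: "openin weak_topology U" and p: "1 \<le> p"
  shows "openin (wasserstein_topology p) (U \<inter> prob_measures_p p)"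
  using U
proof (induction rule: openin_weak_induct)
  case Empty then show ?case by simp
next
  case (Int A B)
  have "A \<inter> B \<inter> prob_measures_p p = (A \<inter> prob_measures_p p) \<inter> (B \<inter> prob_measures_p p)" by auto
  then show ?case using Int by auto
next
  case (Union K)
  have eq: "\<Union>K \<inter> prob_measures_p p = \<Union>((\<lambda>A. A \<inter> prob_measures_p p) ` K)" by auto
  show ?case unfolding eq using Union by (intro openin_Union) auto
next
  case (Basis f V)
  note [measurable] = borel_measurable_continuous_onI[OF Basis(1)]
  obtain B where B: "\<And>x. \<bar>f x\<bar> \<le> B" using Basis(2) by (auto simp: bounded_iff)
  have B0: "0 \<le> B" using B[of 0] by linarith
  show ?case
    unfolding openin_wasserstein_topology
  proof (intro conjI ballI)
    fix \<mu> assume "\<mu> \<in> {\<mu> \<in> prob_measures. (\<integral>x. f x \<partial>\<mu>) \<in> V} \<inter> prob_measures_p p"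
    then have \<mu>: "\<mu> \<in> prob_measures_p p" and V: "(\<integral>x. f x \<partial>\<mu>) \<in> V" by auto
    obtain e where e: "e > 0" "ball (\<integral>x. f x \<partial>\<mu>) e \<subseteq> V"
      using \<open>open V\<close> V by (meson openE)
    note \<mu>p = prob_measures_pD(1)[OF \<mu>]
    interpret prob_space \<mu> using prob_measuresD[OF \<mu>p] by simp
    note [measurable_cong] = prob_measuresD(1)[OF \<mu>p]
    \<comment> \<open>Each of the two exceptional events costs \<open>2 * B * q\<close>, together at
      most \<open>e / 2\<close>; uniform continuity adds \<open>e / 4\<close>.\<close>
    define q where "q = e / (8 * (B + 1))"
    have q: "0 < q" using e B0 by (simp add: q_def)
    have "(B + 1) * q = e / 8" using B0 by (simp add: q_def field_simps)
    then have Bq: "B * q \<le> e / 8" using q by (simp add: algebra_simps)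
    have "(\<lambda>n. \<integral>x. 1 - cutoff (real n) x \<partial>\<mu>) \<longlonglongrightarrow> (\<integral>x. 1 - 1 \<partial>\<mu>)"
    proof (rule integral_dominated_convergence[where w = "\<lambda>_. 1"])
      show "AE x in \<mu>. (\<lambda>n. 1 - cutoff (real n) x) \<longlonglongrightarrow> 1 - 1"
        by (intro AE_I2 tendsto_diff tendsto_const cutoff_tendsto)
    qed (auto simp: abs_le_iff)
    then have "\<forall>\<^sub>F n in sequentially. (\<integral>x. 1 - cutoff (real n) x \<partial>\<mu>) < q"
      using q by (intro order_tendstoD(2)) auto
    then obtain n where n: "(\<integral>x. 1 - cutoff (real n) x \<partial>\<mu>) < q"
      using eventually_happens'[OF sequentially_bot] by blast
    \<comment> \<open>The cutoff vanishes from radius \<open>n + 1\<close> on, and the partner of a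
      point inside that radius is at distance at most \<open>1\<close>.\<close>
    have "uniformly_continuous_on (cball 0 (real n + 2)) f"
      by (intro compact_uniformly_continuous continuous_on_subset[OF Basis(1)]) auto
    then obtain d' where d': "d' > 0" "\<And>x y. norm x \<le> real n + 2 \<Longrightarrow> norm y \<le> real n + 2 \<Longrightarrow> dist y x < d' \<Longrightarrow> dist (f y) (f x) < e / 4"
      using e unfolding uniformly_continuous_on_def by (metis mem_cball_0 divide_pos_pos zero_less_numeral)
    define d where "d = min d' 1"
    have d: "d > 0" "d \<le> 1" using d' by (auto simp: d_def)
    \<comment> \<open>With this \<open>r\<close>, a cost below \<open>r powr p\<close> leaves
      probability at most \<open>q\<close> for pairs at distance \<open>d\<close> or more.\<close>
    define r where "r = (d powr p * q) powr (1 / p)"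
    have r: "r > 0" using d q by (simp add: r_def)
    have rp: "r powr p = d powr p * q" using p d q by (simp add: r_def powr_powr)
    have "{\<nu> \<in> prob_measures_p p. wasserstein_dist p \<mu> \<nu> < r}
        \<subseteq> {\<mu> \<in> prob_measures. (\<integral>x. f x \<partial>\<mu>) \<in> V} \<inter> prob_measures_p p"
    proof safe
      fix \<nu> assume \<nu>: "\<nu> \<in> prob_measures_p p" and w: "wasserstein_dist p \<mu> \<nu> < r"
      show \<nu>p: "\<nu> \<in> prob_measures" by (rule prob_measures_pD(1)[OF \<nu>])
      obtain \<gamma> where \<gamma>: "\<gamma> \<in> couplings \<mu> \<nu>"
        and c: "(\<integral>\<^sup>+z. ennreal (dist (fst z) (snd z) powr p) \<partial>\<gamma>) < ennreal (r powr p)"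
        using wasserstein_distD[OF \<mu> \<nu> p w] by blast
      interpret \<gamma>: prob_space \<gamma> using couplingsD[OF \<gamma>] by simp
      note [measurable_cong] = couplingsD(2)[OF \<gamma>]
      have cut_int: "integrable \<gamma> (\<lambda>z. 1 - cutoff (real n) (fst z))"
        by (intro \<gamma>.integrable_const_bound[of _ 1]) (auto simp: abs_le_iff)
      have cut_eq: "(\<integral>z. 1 - cutoff (real n) (fst z) \<partial>\<gamma>) = (\<integral>x. 1 - cutoff (real n) x \<partial>\<mu>)"
        by (subst couplingsD(3)[OF \<gamma>, symmetric], rule integral_distr[symmetric]) auto
      let ?g = "\<lambda>z. e / 4 + 2 * B * (1 - cutoff (real n) (fst z)) + 2 * B / d powr p * dist (fst z) (snd z) powr p"
      have "norm ((\<integral>x. f x \<partial>\<mu>) - (\<integral>x. f x \<partial>\<nu>)) \<le> (\<integral>z. ?g z \<partial>\<gamma>)"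
      proof (rule coupling_integral_diff[OF \<gamma>])
        show "integrable \<mu> f" "integrable \<nu> f"
          using integrable_bounded_cont[OF _ _ Basis(2)] \<mu>p \<nu>p by auto
        show "integrable \<gamma> ?g" using cut_int coupling_cost_integral[OF \<gamma> c] by auto
        fix z :: "'a \<times> 'a"
        have f2: "\<bar>f (fst z) - f (snd z)\<bar> \<le> 2 * B" using B[of "fst z"] B[of "snd z"] by linarith
        have nn: "0 \<le> 2 * B * (1 - cutoff (real n) (fst z))" "0 \<le> 2 * B / d powr p * dist (fst z) (snd z) powr p"
          using B0 by auto
        consider "dist (fst z) (snd z) < d" "norm (fst z) < real n + 1" | "d \<le> dist (fst z) (snd z)"
          | "real n + 1 \<le> norm (fst z)" by linarith
        then show "norm (f (fst z) - f (snd z)) \<le> ?g z"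
        proof cases
          case 1
          have "norm (snd z) \<le> norm (fst z) + dist (fst z) (snd z)"
            using norm_triangle_ineq2[of "snd z" "fst z"] by (simp add: dist_norm norm_minus_commute)
          then have "dist (f (fst z)) (f (snd z)) < e / 4"
            using 1 d by (intro d'(2)) (auto simp: d_def)
          then show ?thesis using nn by (simp add: dist_real_def)
        next
          case 2
          then have "d powr p \<le> dist (fst z) (snd z) powr p" using d p by (intro powr_mono2) auto
          then have "2 * B * 1 \<le> 2 * B * (dist (fst z) (snd z) powr p / d powr p)"
            using B0 d by (intro mult_left_mono) auto
          then have "2 * B \<le> 2 * B / d powr p * dist (fst z) (snd z) powr p" by simp
          then show ?thesis unfolding real_norm_def using f2 nn(1) e by linarith
        next
          case 3
          then have "2 * B * (1 - cutoff (real n) (fst z)) = 2 * B" by (simp add: cutoff_eq_0)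
          then show ?thesis unfolding real_norm_def using f2 nn(2) e by linarith
        qed
      qed simp
      also have "\<dots> = e / 4 + 2 * B * (\<integral>x. 1 - cutoff (real n) x \<partial>\<mu>) + 2 * B / d powr p * (\<integral>z. dist (fst z) (snd z) powr p \<partial>\<gamma>)"
        using cut_int coupling_cost_integral(1)[OF \<gamma> c] cut_eq by (simp add: \<gamma>.prob_space)
      also have "\<dots> \<le> e / 4 + 2 * B * (q) + 2 * B / d powr p * (d powr p * q)"
      proof -
        have "2 * B * (\<integral>x. 1 - cutoff (real n) x \<partial>\<mu>) \<le> 2 * B * (q)"
          by (rule mult_left_mono[OF less_imp_le[OF n]]) (simp add: B0)
        moreover have "2 * B / d powr p * (\<integral>z. dist (fst z) (snd z) powr p \<partial>\<gamma>)
            \<le> 2 * B / d powr p * (d powr p * q)"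
          by (rule mult_left_mono[OF coupling_cost_integral(2)[OF \<gamma> c, unfolded rp]]) (simp add: B0)
        ultimately show ?thesis by linarith
      qed
      also have "\<dots> = e / 4 + 4 * (B * q)" using d by simp
      also have "\<dots> < e" using Bq e(1) by linarith
      finally have "(\<integral>x. f x \<partial>\<nu>) \<in> ball (\<integral>x. f x \<partial>\<mu>) e" by (simp add: dist_real_def)
      then show "(\<integral>x. f x \<partial>\<nu>) \<in> V" using e(2) by blast
    qed
    then show "\<exists>r>0. {\<nu> \<in> prob_measures_p p. wasserstein_dist p \<mu> \<nu> < r}
        \<subseteq> {\<mu> \<in> prob_measures. (\<integral>x. f x \<partial>\<mu>) \<in> V} \<inter> prob_measures_p p" using r by blast
  qed auto
qed

text \<open>Shows that the centered measures form a closed set. By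
  \<open>t \<le> r + r powr (1 - p) * t powr p\<close>, a coupling of cost at most
  \<open>r powr p\<close> moves the mean by at most \<open>2 * r\<close>, and \<open>r\<close> is a
  third of the norm of the mean of \<open>\<mu>\<close>.\<close>

lemma openin_wasserstein_noncentered:
  assumes p: "1 \<le> p"
  shows "openin (wasserstein_topology p) {\<mu> \<in> prob_measures_p p. (\<integral>x. x \<partial>\<mu>) \<noteq> (0 :: 'a::euclidean_space)}"
  unfolding openin_wasserstein_topology
proof (intro conjI ballI)
  fix \<mu> :: "'a measure" assume "\<mu> \<in> {\<mu> \<in> prob_measures_p p. (\<integral>x. x \<partial>\<mu>) \<noteq> 0}"
  then have \<mu>: "\<mu> \<in> prob_measures_p p" and ne: "(\<integral>x. x \<partial>\<mu>) \<noteq> 0" by auto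
  define r where "r = norm (\<integral>x. x \<partial>\<mu>) / 3"
  have r: "r > 0" using ne by (simp add: r_def)
  have "(\<integral>x. x \<partial>\<nu>) \<noteq> 0" if \<nu>: "\<nu> \<in> prob_measures_p p" and w: "wasserstein_dist p \<mu> \<nu> < r" for \<nu>
  proof -
    obtain \<gamma> where \<gamma>: "\<gamma> \<in> couplings \<mu> \<nu>"
      and c: "(\<integral>\<^sup>+z. ennreal (dist (fst z) (snd z) powr p) \<partial>\<gamma>) < ennreal (r powr p)"
      using wasserstein_distD[OF \<mu> \<nu> p w] by blast
    interpret \<gamma>: prob_space \<gamma> using couplingsD[OF \<gamma>] by simp
    have "norm ((\<integral>x. x \<partial>\<mu>) - (\<integral>x. x \<partial>\<nu>)) \<le> (\<integral>z. r + r powr (1 - p) * dist (fst z) (snd z) powr p \<partial>\<gamma>)"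
    proof (rule coupling_integral_diff[OF \<gamma>])
      fix z :: "'a \<times> 'a"
      let ?d = "dist (fst z) (snd z)"
      show "norm (fst z - snd z) \<le> r + r powr (1 - p) * ?d powr p"
      proof (cases "?d \<le> r")
        case True
        then show ?thesis by (simp add: dist_norm add_increasing2)
      next
        case False
        then have "?d powr (1 - p) \<le> r powr (1 - p)" using r p by (intro powr_mono2') auto
        then have "?d powr (1 - p) * ?d powr p \<le> r powr (1 - p) * ?d powr p" by (rule mult_right_mono) simp
        moreover have "?d powr (1 - p) * ?d powr p = ?d" using False r by (simp add: powr_add[symmetric])
        ultimately show ?thesis using r by (simp add: dist_norm)
      qed
    qed (use integrable_id \<mu> \<nu> p coupling_cost_integral[OF \<gamma> c] in auto)
    also have "\<dots> = r + r powr (1 - p) * (\<integral>z. dist (fst z) (snd z) powr p \<partial>\<gamma>)"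
      using coupling_cost_integral[OF \<gamma> c] by (simp add: \<gamma>.prob_space)
    also have "\<dots> \<le> r + r powr (1 - p) * r powr p"
      using coupling_cost_integral[OF \<gamma> c] by (intro add_left_mono mult_left_mono) auto
    also have "\<dots> = 2 * r" using r by (simp add: powr_add[symmetric])
    finally have "norm ((\<integral>x. x \<partial>\<mu>) - (\<integral>x. x \<partial>\<nu>)) \<le> 2 * r" .
    then show ?thesis using r by (auto simp: r_def)
  qed
  then show "\<exists>r>0. {\<nu> \<in> prob_measures_p p. wasserstein_dist p \<mu> \<nu> < r} \<subseteq> {\<mu> \<in> prob_measures_p p. (\<integral>x. x \<partial>\<mu>) \<noteq> 0}"
    using r by blast
qed auto

lemma moment_ballD:
  assumes \<mu>: "\<mu> \<in> moment_ball l R" and R: "0 \<le> R"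
  shows "\<mu> \<in> prob_measures" "\<mu> \<in> prob_measures_p l" "integrable \<mu> (\<lambda>x. norm x powr l)"
    "(\<integral>x. norm x powr l \<partial>\<mu>) \<le> R"
proof -
  show \<mu>l: "\<mu> \<in> prob_measures_p l" using \<mu> order_le_less_trans[OF _ ennreal_less_top[of R]]
    by (auto simp: moment_ball_def prob_measures_p_def)
  show "\<mu> \<in> prob_measures" using \<mu> by (simp add: moment_ball_def)
  show int: "integrable \<mu> (\<lambda>x. norm x powr l)" by (rule integrable_moment[OF \<mu>l])
  have "ennreal (\<integral>x. norm x powr l \<partial>\<mu>) \<le> ennreal R"
    using \<mu> nn_integral_eq_integral[OF int] by (simp add: moment_ball_def)
  then show "(\<integral>x. norm x powr l \<partial>\<mu>) \<le> R" using R by simp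
qed

text \<open>The place where \<open>p < l\<close> is exploited: beyond \<open>T\<close> the
  \<open>p\<close>-th power is at most the fraction \<open>T powr (p - l)\<close> of the
  \<open>l\<close>-th power, and this fraction tends to \<open>0\<close> as \<open>T\<close>
  grows.\<close>

lemma powr_le_tail:
  fixes s T :: real
  assumes "0 < T" "1 \<le> p" "p < l" "0 \<le> s"
  shows "s powr p \<le> T powr p + T powr (p - l) * s powr l"
    and "T \<le> s \<Longrightarrow> s powr p \<le> T powr (p - l) * s powr l"
proof -
  show 1: "s powr p \<le> T powr (p - l) * s powr l" if "T \<le> s"
  proof -
    have "s powr (p - l) \<le> T powr (p - l)" using assms that by (intro powr_mono2') auto
    then have "s powr (p - l) * s powr l \<le> T powr (p - l) * s powr l" by (rule mult_right_mono) simp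
    then show ?thesis using assms that by (simp add: powr_add[symmetric])
  qed
  show "s powr p \<le> T powr p + T powr (p - l) * s powr l"
  proof (cases "T \<le> s")
    case False
    then have "s powr p \<le> T powr p" using assms by (intro powr_mono2) auto
    then show ?thesis by (simp add: add_increasing2)
  qed (use 1 in \<open>simp add: add_increasing\<close>)
qed

text \<open>Controls, uniformly over a moment ball, the part of the \<open>p\<close>-th moment seen
  by a weight \<open>\<phi>\<close>. For large \<open>T\<close> it is small if \<open>\<phi>\<close>
  has small mass or is supported far out; these are the two kinds of mass that a coupling cannot
  match locally.\<close>

lemma weighted_moment_bounds:
  assumes \<mu>: "\<mu> \<in> moment_ball l R" and R: "0 \<le> R" and T: "0 < T" and p: "1 \<le> p" "p < l"
    and [measurable]: "\<phi> \<in> borel_measurable borel" and \<phi>: "\<And>x. 0 \<le> \<phi> x" "\<And>x. \<phi> x \<le> 1"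
  shows "integrable \<mu> \<phi>" "integrable \<mu> (\<lambda>x. \<phi> x * norm x powr p)"
    and "(\<integral>x. \<phi> x * norm x powr p \<partial>\<mu>) \<le> T powr p * (\<integral>x. \<phi> x \<partial>\<mu>) + T powr (p - l) * R"
    and "(\<And>x. 0 < \<phi> x \<Longrightarrow> T \<le> norm x) \<Longrightarrow> (\<integral>x. \<phi> x * norm x powr p \<partial>\<mu>) \<le> T powr (p - l) * R"
proof -
  note mb = moment_ballD[OF \<mu> R]
  interpret prob_space \<mu> using prob_measuresD[OF mb(1)] by simp
  note [measurable_cong] = prob_measuresD(1)[OF mb(1)]
  show int\<phi>: "integrable \<mu> \<phi>" by (intro integrable_const_bound[of _ 1]) (use \<phi> in auto)
  have bound: "\<phi> x * norm x powr p \<le> T powr p * \<phi> x + T powr (p - l) * norm x powr l" for x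
  proof -
    have "\<phi> x * norm x powr p \<le> \<phi> x * (T powr p + T powr (p - l) * norm x powr l)"
      using powr_le_tail(1)[OF T p] \<phi> by (intro mult_left_mono) auto
    also have "\<dots> = T powr p * \<phi> x + \<phi> x * (T powr (p - l) * norm x powr l)" by (simp add: algebra_simps)
    also have "\<dots> \<le> T powr p * \<phi> x + 1 * (T powr (p - l) * norm x powr l)"
      using \<phi> by (intro add_left_mono mult_right_mono) auto
    finally show ?thesis by simp
  qed
  have int_b: "integrable \<mu> (\<lambda>x. T powr p * \<phi> x + T powr (p - l) * norm x powr l)"
    using int\<phi> mb(3) by auto
  show int: "integrable \<mu> (\<lambda>x. \<phi> x * norm x powr p)"
    by (rule Bochner_Integration.integrable_bound[OF int_b]) (use bound \<phi> in \<open>auto simp: abs_mult intro: order_trans[OF bound abs_ge_self]\<close>)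
  have Rle: "T powr (p - l) * (\<integral>x. norm x powr l \<partial>\<mu>) \<le> T powr (p - l) * R"
    using mb(4) by (intro mult_left_mono) auto
  have "(\<integral>x. \<phi> x * norm x powr p \<partial>\<mu>) \<le> (\<integral>x. T powr p * \<phi> x + T powr (p - l) * norm x powr l \<partial>\<mu>)"
    using int int_b bound by (rule integral_mono)
  also have "\<dots> = T powr p * (\<integral>x. \<phi> x \<partial>\<mu>) + T powr (p - l) * (\<integral>x. norm x powr l \<partial>\<mu>)"
    using int\<phi> mb(3) by simp
  finally show "(\<integral>x. \<phi> x * norm x powr p \<partial>\<mu>) \<le> T powr p * (\<integral>x. \<phi> x \<partial>\<mu>) + T powr (p - l) * R"
    using Rle by linarith
  assume supp: "\<And>x. 0 < \<phi> x \<Longrightarrow> T \<le> norm x"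
  have "(\<integral>x. \<phi> x * norm x powr p \<partial>\<mu>) \<le> (\<integral>x. T powr (p - l) * norm x powr l \<partial>\<mu>)"
  proof (rule integral_mono[OF int])
    fix x
    show "\<phi> x * norm x powr p \<le> T powr (p - l) * norm x powr l"
    proof (cases "0 < \<phi> x")
      case True
      have "\<phi> x * norm x powr p \<le> 1 * norm x powr p" using \<phi> by (intro mult_right_mono) auto
      also have "\<dots> \<le> T powr (p - l) * norm x powr l"
        using powr_le_tail(2)[OF T p] supp[OF True] by simp
      finally show ?thesis .
    qed (use \<phi>[of x] in simp)
  qed (use mb(3) in simp)
  then show "(\<integral>x. \<phi> x * norm x powr p \<partial>\<mu>) \<le> T powr (p - l) * R"
    using Rle by simp
qed

text \<open>Normalised tents around a finite net, together with the cell \<open>None\<close> for the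
  outside. Continuous cells have masses that depend weakly continuously on the measure, which
  indicators of a partition into sets would not guarantee.\<close>

lemma tent_partition:
  fixes \<delta> T :: real
  assumes \<delta>: "0 < \<delta>" and T: "0 < T"
  obtains I :: "'a::euclidean_space option set" and \<phi> :: "'a option \<Rightarrow> 'a \<Rightarrow> real"
  where "finite I" "None \<in> I" "\<And>i. continuous_on UNIV (\<phi> i)" "\<And>i x. 0 \<le> \<phi> i x" "\<And>i x. \<phi> i x \<le> 1"
    "\<And>x. (\<Sum>i\<in>I. \<phi> i x) = 1" "\<And>z x. 0 < \<phi> (Some z) x \<Longrightarrow> dist x z < \<delta>" "\<And>x. 0 < \<phi> None x \<Longrightarrow> T \<le> norm x"
proof -
  \<comment> \<open>The net covers up to radius \<open>T + 1\<close>, while the outer tent already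
    rises at \<open>T\<close>; the overlap keeps the sum of the tents positive everywhere.\<close>
  obtain k where k: "finite k" "cball (0::'a) (T + 1) \<subseteq> (\<Union>z\<in>k. ball z \<delta>)"
    using compact_cball[of "0::'a" "T + 1"] \<delta> unfolding compact_eq_totally_bounded by blast
  define I where "I = insert None (Some ` k)"
  define \<psi> where "\<psi> i x = (case i of None \<Rightarrow> max 0 (norm x - T) | Some z \<Rightarrow> if z \<in> k then max 0 (\<delta> - dist x z) else 0)"
    for i and x :: 'a
  define \<phi> where "\<phi> i x = \<psi> i x / (\<Sum>i\<in>I. \<psi> i x)" for i x
  have I: "finite I" using k by (simp add: I_def)
  have \<psi>0: "0 \<le> \<psi> i x" for i x by (auto simp: \<psi>_def split: option.split)
  have cont\<psi>: "continuous_on UNIV (\<psi> i)" for i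
  proof (cases i)
    case (Some z)
    then show ?thesis unfolding \<psi>_def by (cases "z \<in> k") (auto intro!: continuous_intros)
  qed (auto simp: \<psi>_def intro!: continuous_intros)
  have pos: "0 < (\<Sum>i\<in>I. \<psi> i x)" for x
  proof (cases "norm x \<le> T + 1")
    case True
    then obtain z where "z \<in> k" "dist z x < \<delta>" using k(2) by (auto simp: subset_iff)
    then have "0 < \<psi> (Some z) x" "Some z \<in> I" by (auto simp: \<psi>_def I_def dist_commute)
    then show ?thesis using I \<psi>0 by (intro sum_pos2)
  next
    case False
    then have "0 < \<psi> None x" "None \<in> I" by (auto simp: \<psi>_def I_def)
    then show ?thesis using I \<psi>0 by (intro sum_pos2)
  qed
  have zero_out: "\<psi> i x = 0" if "i \<notin> I" for i x
    using that by (cases i) (auto simp: \<psi>_def I_def)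
  show ?thesis
  proof (rule that[OF I])
    show "None \<in> I" by (simp add: I_def)
    show "continuous_on UNIV (\<phi> i)" for i
      unfolding \<phi>_def using pos by (intro continuous_intros cont\<psi>) (auto simp: less_imp_neq[symmetric])
    show "0 \<le> \<phi> i x" for i x using \<psi>0 pos[of x] by (simp add: \<phi>_def)
    show "\<phi> i x \<le> 1" for i x
    proof (cases "i \<in> I")
      case True
      then have "\<psi> i x \<le> (\<Sum>i\<in>I. \<psi> i x)" using I \<psi>0 by (intro member_le_sum) auto
      then show ?thesis using pos[of x] by (simp add: \<phi>_def)
    qed (simp add: \<phi>_def zero_out)
    show "(\<Sum>i\<in>I. \<phi> i x) = 1" for x
      using pos[of x] by (simp add: \<phi>_def sum_divide_distrib[symmetric])
    show "dist x z < \<delta>" if "0 < \<phi> (Some z) x" for z x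
      using that pos[of x] by (auto simp: \<phi>_def \<psi>_def zero_less_divide_iff split: if_splits)
    show "T \<le> norm x" if "0 < \<phi> None x" for x
      using that pos[of x] by (auto simp: \<phi>_def \<psi>_def zero_less_divide_iff)
  qed
qed


lemma moment_ball_subset_p:
  assumes "1 \<le> p" "p < l" "0 \<le> R"
  shows "moment_ball l R \<subseteq> (prob_measures_p p :: 'a::euclidean_space measure set)"
proof
  fix \<mu> :: "'a measure" assume \<mu>: "\<mu> \<in> moment_ball l R"
  have "integrable \<mu> (\<lambda>x. 1 * norm x powr p)"
    by (rule weighted_moment_bounds(2)[OF \<mu> assms(3) zero_less_one assms(1,2)]) auto
  then have "(\<integral>\<^sup>+x. ennreal (norm x powr p) \<partial>\<mu>) < \<infinity>"
    by (auto dest!: integrableD(2) simp: less_top)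
  then show "\<mu> \<in> prob_measures_p p" using moment_ballD(1)[OF \<mu> assms(3)] by (simp add: prob_measures_p_def)
qed

text \<open>
  Weak closeness gives a cheap coupling: transport as much mass as possible within the cells of a
  partition of unity, and couple the excess masses independently. The slack \<open>t\<close> keeps the
  excess mass \<open>\<eta>\<close> positive.
\<close>

lemma cell_coupling:
  fixes \<phi> :: "'a::euclidean_space option \<Rightarrow> 'a \<Rightarrow> real"
  assumes \<mu>: "\<mu> \<in> moment_ball l R" and \<nu>: "\<nu> \<in> moment_ball l R" and R: "0 \<le> R"
    and p: "1 \<le> p" "p < l" and \<delta>: "0 < \<delta>" and T: "0 < T" and t: "0 < t" "t < 1"
    and I: "finite I" "None \<in> I" and cont: "\<And>i. continuous_on UNIV (\<phi> i)"
    and \<phi>0: "\<And>i x. 0 \<le> \<phi> i x" and \<phi>1: "\<And>i x. \<phi> i x \<le> 1" and sum1: "\<And>x. (\<Sum>i\<in>I. \<phi> i x) = 1"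
    and near: "\<And>z x. 0 < \<phi> (Some z) x \<Longrightarrow> dist x z < \<delta>" and far: "\<And>x. 0 < \<phi> None x \<Longrightarrow> T \<le> norm x"
  defines "\<eta> \<equiv> t + (\<Sum>i\<in>I. \<bar>(\<integral>x. \<phi> i x \<partial>\<mu>) - (\<integral>x. \<phi> i x \<partial>\<nu>)\<bar>)"
  shows "\<exists>\<gamma>\<in>couplings \<mu> \<nu>. (\<integral>\<^sup>+z. ennreal (dist (fst z) (snd z) powr p) \<partial>\<gamma>) \<le>
      ennreal ((2 * \<delta>) powr p + 2 powr p * (4 * (T powr (p - l) * R) + 2 * (T powr p * \<eta>)))"
proof -
  note \<mu>p = moment_ballD(1)[OF \<mu> R] and \<nu>p = moment_ballD(1)[OF \<nu> R]
  interpret \<mu>: prob_space \<mu> using prob_measuresD[OF \<mu>p] by simp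
  interpret \<nu>: prob_space \<nu> using prob_measuresD[OF \<nu>p] by simp
  interpret pair_prob_space \<mu> \<nu> ..
  note [measurable_cong] = prob_measuresD(1)[OF \<mu>p] prob_measuresD(1)[OF \<nu>p]
  have \<phi>meas [measurable]: "\<phi> i \<in> borel_measurable borel" for i by (rule borel_measurable_continuous_onI[OF cont])
  define m where "m i = (\<integral>x. \<phi> i x \<partial>\<mu>)" for i
  define n where "n i = (\<integral>x. \<phi> i x \<partial>\<nu>)" for i
  \<comment> \<open>The factor for which cell \<open>i\<close> couples the mass
    \<open>min (m i) (n i)\<close>; for an empty cell division by zero gives
    \<open>0\<close>.\<close>
  define c where "c i = min (m i) (n i) / (m i * n i)" for i
  \<comment> \<open>\<open>e\<close> and \<open>e'\<close> are the densities, with respect to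
    \<open>\<mu>\<close> and \<open>\<nu>\<close>, of the mass left over by the cells. Both have
    total mass \<open>\<eta>'\<close>, which is positive thanks to the factor
    \<open>1 - t\<close>.\<close>
  define e where "e x = 1 - (1 - t) * (\<Sum>i\<in>I. c i * n i * \<phi> i x)" for x
  define e' where "e' y = 1 - (1 - t) * (\<Sum>i\<in>I. c i * m i * \<phi> i y)" for y
  define \<eta>' where "\<eta>' = 1 - (1 - t) * (\<Sum>i\<in>I. min (m i) (n i))"
  \<comment> \<open>Density of the coupling with respect to the product measure: the cellwise part
    plus the product of the two residual densities, normalised by their common mass so that the
    marginals come out right.\<close>
  define K where "K x y = (1 - t) * (\<Sum>i\<in>I. c i * \<phi> i x * \<phi> i y) + e x * e' y / \<eta>'" for x y
  note w\<mu> = weighted_moment_bounds[OF \<mu> R T p] and w\<nu> = weighted_moment_bounds[OF \<nu> R T p]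
  have int_\<phi>: "integrable \<mu> (\<phi> i)" "integrable \<nu> (\<phi> i)" for i
    using w\<mu>(1)[OF \<phi>meas \<phi>0 \<phi>1] w\<nu>(1)[OF \<phi>meas \<phi>0 \<phi>1] by auto
  have mn0: "0 \<le> m i" "0 \<le> n i" for i
    unfolding m_def n_def using \<phi>0 by (auto intro!: integral_nonneg_AE)
  have c0: "0 \<le> c i" for i using mn0 by (simp add: c_def)
  have cn: "0 \<le> c i * n i" "c i * n i \<le> 1" and cm: "0 \<le> c i * m i" "c i * m i \<le> 1"
    and cmn: "c i * m i * n i = min (m i) (n i)" for i
    using mn0[of i] by (auto simp: c_def min_def field_simps)
  have summ: "(\<Sum>i\<in>I. m i) = 1"
    unfolding m_def using int_\<phi> by (subst Bochner_Integration.integral_sum[symmetric]) (auto simp: sum1 \<mu>.prob_space)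
  have conv: "0 \<le> (\<Sum>i\<in>I. a i * \<phi> i x)" "(\<Sum>i\<in>I. a i * \<phi> i x) \<le> 1"
    if "\<And>i. 0 \<le> a i" "\<And>i. a i \<le> 1" for a x
  proof -
    show "0 \<le> (\<Sum>i\<in>I. a i * \<phi> i x)" using that \<phi>0 by (intro sum_nonneg) auto
    have "(\<Sum>i\<in>I. a i * \<phi> i x) \<le> (\<Sum>i\<in>I. 1 * \<phi> i x)"
      using that \<phi>0 by (intro sum_mono mult_right_mono) auto
    then show "(\<Sum>i\<in>I. a i * \<phi> i x) \<le> 1" using sum1[of x] by simp
  qed
  have slack: "0 \<le> (1 - t) * s" "(1 - t) * s \<le> 1" if "0 \<le> s" "s \<le> 1" for s
    using that t mult_le_one[of "1 - t" s] by auto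
  have e01: "0 \<le> e x" "e x \<le> 1" for x
    unfolding e_def using slack[OF conv[of "\<lambda>i. c i * n i" x]] cn by auto
  have e'01: "0 \<le> e' x" "e' x \<le> 1" for x
    unfolding e'_def using slack[OF conv[of "\<lambda>i. c i * m i" x]] cm by auto
  have emeas [measurable]: "e \<in> borel_measurable borel" "e' \<in> borel_measurable borel"
    unfolding e_def e'_def by measurable
  have int_e: "integrable \<mu> e" "integrable \<nu> e'"
    using w\<mu>(1)[OF emeas(1) e01] w\<nu>(1)[OF emeas(2) e'01] by auto
  have int_sum: "integrable \<mu> (\<lambda>x. \<Sum>i\<in>I. a i * \<phi> i x)" "integrable \<nu> (\<lambda>x. \<Sum>i\<in>I. a i * \<phi> i x)"
    "(\<integral>x. (\<Sum>i\<in>I. a i * \<phi> i x) \<partial>\<mu>) = (\<Sum>i\<in>I. a i * m i)"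
    "(\<integral>x. (\<Sum>i\<in>I. a i * \<phi> i x) \<partial>\<nu>) = (\<Sum>i\<in>I. a i * n i)" for a
    using int_\<phi> by (simp_all add: m_def n_def Bochner_Integration.integral_sum)
  have Ie: "(\<integral>x. e x \<partial>\<mu>) = \<eta>'" "(\<integral>y. e' y \<partial>\<nu>) = \<eta>'"
  proof -
    have "(\<integral>x. e x \<partial>\<mu>) = 1 - (1 - t) * (\<Sum>i\<in>I. c i * n i * m i)"
      unfolding e_def using int_sum(1,3)[of "\<lambda>i. c i * n i"] by (simp add: \<mu>.prob_space)
    also have "(\<Sum>i\<in>I. c i * n i * m i) = (\<Sum>i\<in>I. min (m i) (n i))"
      unfolding cmn[symmetric] by (intro sum.cong) (simp_all add: mult_ac)
    finally show "(\<integral>x. e x \<partial>\<mu>) = \<eta>'" by (simp add: \<eta>'_def)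
    have "(\<integral>x. e' x \<partial>\<nu>) = 1 - (1 - t) * (\<Sum>i\<in>I. c i * m i * n i)"
      unfolding e'_def using int_sum(2,4)[of "\<lambda>i. c i * m i"] by (simp add: \<nu>.prob_space)
    then show "(\<integral>x. e' x \<partial>\<nu>) = \<eta>'" by (simp add: \<eta>'_def cmn)
  qed
  have "(\<Sum>i\<in>I. min (m i) (n i)) \<le> 1" unfolding summ[symmetric] by (intro sum_mono) auto
  moreover have "0 \<le> (\<Sum>i\<in>I. min (m i) (n i))" using mn0 by (intro sum_nonneg) auto
  ultimately have \<eta>'0: "0 < \<eta>'"
    unfolding \<eta>'_def using t mult_left_le[of "\<Sum>i\<in>I. min (m i) (n i)" "1 - t"] by linarith
  have \<eta>'\<eta>: "\<eta>' \<le> \<eta>"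
  proof -
    have "1 - (\<Sum>i\<in>I. min (m i) (n i)) = (\<Sum>i\<in>I. m i - min (m i) (n i))"
      by (simp add: sum_subtractf summ)
    also have "\<dots> \<le> (\<Sum>i\<in>I. \<bar>m i - n i\<bar>)" by (intro sum_mono) auto
    finally have "1 - (\<Sum>i\<in>I. min (m i) (n i)) \<le> \<eta> - t" by (simp add: \<eta>_def m_def n_def)
    moreover have "\<eta>' = 1 - (\<Sum>i\<in>I. min (m i) (n i)) + t * (\<Sum>i\<in>I. min (m i) (n i))"
      by (simp add: \<eta>'_def algebra_simps)
    moreover have "t * (\<Sum>i\<in>I. min (m i) (n i)) \<le> t * 1"
      using \<open>(\<Sum>i\<in>I. min (m i) (n i)) \<le> 1\<close> t by (intro mult_left_mono) auto
    ultimately show ?thesis by simp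
  qed
  have K0: "0 \<le> K x y" for x y
    unfolding K_def using t c0 \<phi>0 e01 e'01 \<eta>'0 by (intro add_nonneg_nonneg mult_nonneg_nonneg sum_nonneg divide_nonneg_pos) auto
  have [measurable]: "(\<lambda>z. K (fst z) (snd z)) \<in> borel_measurable (borel \<Otimes>\<^sub>M borel)"
    unfolding K_def by measurable
  have Ky: "integrable \<nu> (\<lambda>y. K x y)" "(\<integral>y. K x y \<partial>\<nu>) = 1" for x
  proof -
    have K': "K x y = (1 - t) * (\<Sum>i\<in>I. (c i * \<phi> i x) * \<phi> i y) + e x / \<eta>' * e' y" for y by (simp add: K_def)
    show "integrable \<nu> (\<lambda>y. K x y)" unfolding K' using int_sum(2) int_e by auto
    have "(\<integral>y. K x y \<partial>\<nu>) = (1 - t) * (\<Sum>i\<in>I. c i * \<phi> i x * n i) + e x / \<eta>' * \<eta>'"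
      unfolding K' using int_sum(2,4)[of "\<lambda>i. c i * \<phi> i x"] int_e Ie by simp
    also have "\<dots> = 1" using \<eta>'0 by (simp add: e_def mult_ac)
    finally show "(\<integral>y. K x y \<partial>\<nu>) = 1" .
  qed
  have Kx: "integrable \<mu> (\<lambda>x. K x y)" "(\<integral>x. K x y \<partial>\<mu>) = 1" for y
  proof -
    have K': "K x y = (1 - t) * (\<Sum>i\<in>I. (c i * \<phi> i y) * \<phi> i x) + e' y / \<eta>' * e x" for x by (simp add: K_def mult_ac)
    show "integrable \<mu> (\<lambda>x. K x y)" unfolding K' using int_sum(1) int_e by auto
    have "(\<integral>x. K x y \<partial>\<mu>) = (1 - t) * (\<Sum>i\<in>I. c i * \<phi> i y * m i) + e' y / \<eta>' * \<eta>'"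
      unfolding K' using int_sum(1,3)[of "\<lambda>i. c i * \<phi> i y"] int_e Ie by simp
    also have "\<dots> = 1" using \<eta>'0 by (simp add: e'_def mult_ac)
    finally show "(\<integral>x. K x y \<partial>\<mu>) = 1" .
  qed
  define \<gamma> where "\<gamma> = density (\<mu> \<Otimes>\<^sub>M \<nu>) (\<lambda>z. ennreal (K (fst z) (snd z)))"
  have sets_prod: "sets (\<mu> \<Otimes>\<^sub>M \<nu>) = sets (borel \<Otimes>\<^sub>M borel)"
    using prob_measuresD(1)[OF \<mu>p] prob_measuresD(1)[OF \<nu>p] by (rule sets_pair_measure_cong)
  have sp: "space \<mu> = UNIV" "space \<nu> = UNIV" using prob_measuresD(3) \<mu>p \<nu>p by auto
  have fstA: "emeasure \<gamma> (A \<times> UNIV) = emeasure \<mu> A" if A [measurable]: "A \<in> sets borel" for A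
  proof -
    have "emeasure \<gamma> (A \<times> UNIV) = (\<integral>\<^sup>+z. ennreal (K (fst z) (snd z)) * indicator A (fst z) \<partial>(\<mu> \<Otimes>\<^sub>M \<nu>))"
      unfolding \<gamma>_def by (subst emeasure_density) (auto intro!: nn_integral_cong simp: indicator_def)
    also have "\<dots> = (\<integral>\<^sup>+x. \<integral>\<^sup>+y. ennreal (K x y) * indicator A x \<partial>\<nu> \<partial>\<mu>)"
      by (subst \<nu>.nn_integral_fst[symmetric]) auto
    also have "\<dots> = (\<integral>\<^sup>+x. indicator A x \<partial>\<mu>)"
    proof (intro nn_integral_cong)
      fix x
      have "(\<integral>\<^sup>+y. ennreal (K x y) \<partial>\<nu>) = 1" using Ky K0 by (subst nn_integral_eq_integral) auto
      moreover have "(\<lambda>y. ennreal (K x y)) \<in> borel_measurable \<nu>" using Ky(1)[of x] by measurable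
      ultimately show "(\<integral>\<^sup>+y. ennreal (K x y) * indicator A x \<partial>\<nu>) = indicator A x"
        by (subst nn_integral_multc) auto
    qed
    finally show ?thesis by simp
  qed
  have sndA: "emeasure \<gamma> (UNIV \<times> A) = emeasure \<nu> A" if A [measurable]: "A \<in> sets borel" for A
  proof -
    have "emeasure \<gamma> (UNIV \<times> A) = (\<integral>\<^sup>+z. ennreal (K (fst z) (snd z)) * indicator A (snd z) \<partial>(\<mu> \<Otimes>\<^sub>M \<nu>))"
      unfolding \<gamma>_def by (subst emeasure_density) (auto intro!: nn_integral_cong simp: indicator_def)
    also have "\<dots> = (\<integral>\<^sup>+y. \<integral>\<^sup>+x. ennreal (K x y) * indicator A y \<partial>\<mu> \<partial>\<nu>)"
      by (subst nn_integral_snd[symmetric]) auto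
    also have "\<dots> = (\<integral>\<^sup>+y. indicator A y \<partial>\<nu>)"
    proof (intro nn_integral_cong)
      fix y
      have "(\<integral>\<^sup>+x. ennreal (K x y) \<partial>\<mu>) = 1" using Kx K0 by (subst nn_integral_eq_integral) auto
      moreover have "(\<lambda>x. ennreal (K x y)) \<in> borel_measurable \<mu>" using Kx(1)[of y] by measurable
      ultimately show "(\<integral>\<^sup>+x. ennreal (K x y) * indicator A y \<partial>\<mu>) = indicator A y"
        by (subst nn_integral_multc) auto
    qed
    finally show ?thesis by simp
  qed
  have sets_\<gamma>: "sets \<gamma> = sets (borel \<Otimes>\<^sub>M borel)" and sp_\<gamma>: "space \<gamma> = UNIV"
    using sets_prod by (auto simp: \<gamma>_def space_pair_measure sp)
  have \<gamma>_in: "\<gamma> \<in> couplings \<mu> \<nu>"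
    unfolding couplings_def
  proof (intro CollectI conjI)
    show "sets \<gamma> = sets (borel \<Otimes>\<^sub>M borel)" by (rule sets_\<gamma>)
    show "prob_space \<gamma>"
      using fstA[of UNIV] \<mu>.emeasure_space_1 sp by (intro prob_spaceI) (simp add: sp_\<gamma>)
    note [measurable_cong] = sets_\<gamma>
    show "distr \<gamma> borel fst = \<mu>"
      using prob_measuresD(1)[OF \<mu>p] fstA by (intro measure_eqI) (auto simp: emeasure_distr vimage_fst sp_\<gamma>)
    show "distr \<gamma> borel snd = \<nu>"
      using prob_measuresD(1)[OF \<nu>p] sndA by (intro measure_eqI) (auto simp: emeasure_distr vimage_snd sp_\<gamma>)
  qed
  define M where "M = (\<integral>x. \<phi> None x * norm x powr p \<partial>\<mu>)"
  define N where "N = (\<integral>x. \<phi> None x * norm x powr p \<partial>\<nu>)"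
  define Me where "Me = (\<integral>x. e x * norm x powr p \<partial>\<mu>)"
  define Ne where "Ne = (\<integral>x. e' x * norm x powr p \<partial>\<nu>)"
  have int_mom: "integrable \<mu> (\<lambda>x. \<phi> None x * norm x powr p)" "integrable \<nu> (\<lambda>x. \<phi> None x * norm x powr p)"
    "integrable \<mu> (\<lambda>x. e x * norm x powr p)" "integrable \<nu> (\<lambda>x. e' x * norm x powr p)"
    using w\<mu>(2)[OF \<phi>meas \<phi>0 \<phi>1] w\<nu>(2)[OF \<phi>meas \<phi>0 \<phi>1] w\<mu>(2)[OF emeas(1) e01] w\<nu>(2)[OF emeas(2) e'01] by auto
  have M_le: "M \<le> T powr (p - l) * R" "N \<le> T powr (p - l) * R"
    unfolding M_def N_def using w\<mu>(4)[OF \<phi>meas \<phi>0 \<phi>1] w\<nu>(4)[OF \<phi>meas \<phi>0 \<phi>1] far by auto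
  have Me_le: "Me \<le> T powr p * \<eta>' + T powr (p - l) * R" "Ne \<le> T powr p * \<eta>' + T powr (p - l) * R"
    unfolding Me_def Ne_def using w\<mu>(3)[OF emeas(1) e01] w\<nu>(3)[OF emeas(2) e'01] Ie by auto
  have MN0: "0 \<le> M" "0 \<le> N" "0 \<le> Me" "0 \<le> Ne"
    unfolding M_def N_def Me_def Ne_def using \<phi>0 e01 e'01 by (auto intro!: integral_nonneg_AE)
  \<comment> \<open>A majorant of cost times density that is a sum of products in \<open>x\<close>
    and \<open>y\<close>, so that both integrations are explicit. In a bounded cell both points are
    within \<open>\<delta>\<close> of one centre; in the cell \<open>None\<close> and in the
    residual part the cost is split by \<open>norm_add_powr_le\<close>.\<close>
  define h where "h x y = (2 * \<delta>) powr p * (\<Sum>i\<in>I. (c i * \<phi> i x) * \<phi> i y)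
      + 2 powr p * c None * \<phi> None x * norm x powr p * \<phi> None y
      + 2 powr p * c None * \<phi> None x * (\<phi> None y * norm y powr p)
      + 2 powr p / \<eta>' * (e x * norm x powr p) * e' y + 2 powr p / \<eta>' * e x * (e' y * norm y powr p)" for x y
  have pt: "dist x y powr p * K x y \<le> h x y" and h0: "0 \<le> h x y" for x y
  proof -
    have d2: "dist x y powr p \<le> 2 powr p * (norm x powr p + norm y powr p)"
      using norm_add_powr_le[of p x "- y"] p by (simp add: dist_norm)
    let ?d = "dist x y powr p"
    have cellw: "?d * (c i * \<phi> i x * \<phi> i y) \<le> (2 * \<delta>) powr p * (c i * \<phi> i x * \<phi> i y)
       + (if i = None then 2 powr p * (norm x powr p + norm y powr p) * (c None * \<phi> None x * \<phi> None y) else 0)" for i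
    proof (cases i)
      case None
      have "?d * (c None * \<phi> None x * \<phi> None y) \<le> 2 powr p * (norm x powr p + norm y powr p) * (c None * \<phi> None x * \<phi> None y)"
        using d2 c0 \<phi>0 by (intro mult_right_mono) auto
      moreover have "0 \<le> (2 * \<delta>) powr p * (c None * \<phi> None x * \<phi> None y)" using c0 \<phi>0 by auto
      ultimately show ?thesis using None by simp
    next
      case (Some z)
      show ?thesis
      proof (cases "0 < \<phi> i x \<and> 0 < \<phi> i y")
        case True
        then have "dist x z < \<delta>" "dist y z < \<delta>" using near Some by auto
        then have "dist x y \<le> 2 * \<delta>" using dist_triangle2[of x y z] by linarith
        then have "?d \<le> (2 * \<delta>) powr p" using p by (intro powr_mono2) auto
        then show ?thesis using Some c0 \<phi>0 by (auto intro!: mult_right_mono)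
      next
        case False
        then have "\<phi> i x * \<phi> i y = 0" using \<phi>0[of i x] \<phi>0[of i y] by auto
        then show ?thesis using Some by (auto simp: mult.assoc)
      qed
    qed
    have sum0: "0 \<le> (\<Sum>i\<in>I. c i * \<phi> i x * \<phi> i y)" using c0 \<phi>0 by (intro sum_nonneg) auto
    have "?d * (\<Sum>i\<in>I. c i * \<phi> i x * \<phi> i y) \<le> (\<Sum>i\<in>I. (2 * \<delta>) powr p * (c i * \<phi> i x * \<phi> i y)
       + (if i = None then 2 powr p * (norm x powr p + norm y powr p) * (c None * \<phi> None x * \<phi> None y) else 0))"
      unfolding sum_distrib_left by (rule sum_mono) (rule cellw)
    also have "\<dots> = (2 * \<delta>) powr p * (\<Sum>i\<in>I. c i * \<phi> i x * \<phi> i y)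
       + 2 powr p * (norm x powr p + norm y powr p) * (c None * \<phi> None x * \<phi> None y)"
      using I by (simp add: sum.distrib sum_distrib_left sum.delta)
    finally have A: "?d * (\<Sum>i\<in>I. c i * \<phi> i x * \<phi> i y) \<le> \<dots>" .
    have B: "?d * (e x * e' y / \<eta>') \<le> 2 powr p * (norm x powr p + norm y powr p) * (e x * e' y / \<eta>')"
      using d2 e01 e'01 \<eta>'0 by (intro mult_right_mono) auto
    have "(1 - t) * (?d * (\<Sum>i\<in>I. c i * \<phi> i x * \<phi> i y)) \<le> ?d * (\<Sum>i\<in>I. c i * \<phi> i x * \<phi> i y)"
      using t sum0 by (intro mult_left_le_one_le) auto
    then have "?d * K x y \<le> ?d * (\<Sum>i\<in>I. c i * \<phi> i x * \<phi> i y) + ?d * (e x * e' y / \<eta>')"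
      by (simp add: K_def algebra_simps)
    then show "?d * K x y \<le> h x y" using A B by (simp add: h_def algebra_simps)
    show "0 \<le> h x y" unfolding h_def using sum0 c0 \<phi>0 e01 e'01 \<eta>'0
      by (intro add_nonneg_nonneg mult_nonneg_nonneg) auto
  qed
  define H where "H x = (2 * \<delta>) powr p * (\<Sum>i\<in>I. (c i * n i) * \<phi> i x)
      + 2 powr p * c None * n None * (\<phi> None x * norm x powr p)
      + 2 powr p * c None * N * \<phi> None x
      + 2 powr p * (e x * norm x powr p) + 2 powr p / \<eta>' * Ne * e x" for x
  have hy: "integrable \<nu> (\<lambda>y. h x y)" "(\<integral>y. h x y \<partial>\<nu>) = H x" for x
  proof -
    show "integrable \<nu> (\<lambda>y. h x y)" unfolding h_def using int_sum(2) int_\<phi> int_mom int_e by auto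
    show "(\<integral>y. h x y \<partial>\<nu>) = H x"
    proof -
      have "(\<integral>y. h x y \<partial>\<nu>) = (2 * \<delta>) powr p * (\<Sum>i\<in>I. (c i * \<phi> i x) * n i)
        + 2 powr p * c None * \<phi> None x * norm x powr p * n None
        + 2 powr p * c None * \<phi> None x * N
        + 2 powr p / \<eta>' * (e x * norm x powr p) * \<eta>' + 2 powr p / \<eta>' * e x * Ne"
        unfolding h_def using int_sum(2,4)[of "\<lambda>i. c i * \<phi> i x"] int_\<phi> int_mom int_e Ie
        by (simp add: n_def[symmetric] N_def[symmetric] Ne_def[symmetric])
      also have "\<dots> = H x" unfolding H_def using \<eta>'0 by (simp add: mult_ac)
      finally show ?thesis .
    qed
  qed
  have Hx: "integrable \<mu> H" "(\<integral>x. H x \<partial>\<mu>) = (2 * \<delta>) powr p * (\<Sum>i\<in>I. min (m i) (n i))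
      + 2 powr p * (c None * n None * M + c None * m None * N + Me + Ne)"
  proof -
    show "integrable \<mu> H" unfolding H_def using int_sum(1) int_\<phi> int_mom int_e by auto
    show "(\<integral>x. H x \<partial>\<mu>) = (2 * \<delta>) powr p * (\<Sum>i\<in>I. min (m i) (n i))
      + 2 powr p * (c None * n None * M + c None * m None * N + Me + Ne)"
    proof -
      have "(\<integral>x. H x \<partial>\<mu>) = (2 * \<delta>) powr p * (\<Sum>i\<in>I. (c i * n i) * m i)
        + 2 powr p * c None * n None * M + 2 powr p * c None * N * m None
        + 2 powr p * Me + 2 powr p / \<eta>' * Ne * \<eta>'"
        unfolding H_def using int_sum(1,3)[of "\<lambda>i. c i * n i"] int_\<phi> int_mom int_e Ie
        by (simp add: m_def[symmetric] M_def[symmetric] Me_def[symmetric])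
      also have "(\<Sum>i\<in>I. (c i * n i) * m i) = (\<Sum>i\<in>I. min (m i) (n i))"
        unfolding cmn[symmetric] by (intro sum.cong) (simp_all add: mult_ac)
      finally show ?thesis using \<eta>'0 by (simp add: algebra_simps)
    qed
  qed
  have H0: "0 \<le> H x" for x unfolding hy(2)[symmetric] using h0 by (intro integral_nonneg_AE) auto
  have "(\<integral>\<^sup>+z. ennreal (dist (fst z) (snd z) powr p) \<partial>\<gamma>)
      = (\<integral>\<^sup>+z. ennreal (K (fst z) (snd z)) * ennreal (dist (fst z) (snd z) powr p) \<partial>(\<mu> \<Otimes>\<^sub>M \<nu>))"
    unfolding \<gamma>_def by (rule nn_integral_density) auto
  also have "\<dots> = (\<integral>\<^sup>+x. \<integral>\<^sup>+y. ennreal (K x y) * ennreal (dist x y powr p) \<partial>\<nu> \<partial>\<mu>)"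
    by (subst \<nu>.nn_integral_fst[symmetric]) auto
  also have "\<dots> \<le> (\<integral>\<^sup>+x. \<integral>\<^sup>+y. ennreal (h x y) \<partial>\<nu> \<partial>\<mu>)"
    using pt K0 by (intro nn_integral_mono) (simp add: ennreal_mult[symmetric] mult.commute ennreal_leI)
  also have "\<dots> = (\<integral>\<^sup>+x. ennreal (H x) \<partial>\<mu>)"
    using hy h0 by (intro nn_integral_cong) (simp add: nn_integral_eq_integral)
  also have "\<dots> = ennreal (\<integral>x. H x \<partial>\<mu>)" using Hx(1) H0 by (intro nn_integral_eq_integral) auto
  \<comment> \<open>\<open>M\<close> and \<open>N\<close> stem from the outer cell,
    \<open>Me\<close> and \<open>Ne\<close> from the residual mass. All four contribute a tail term,
    the last two in addition a term with \<open>\<eta>\<close>.\<close>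
  also have "\<dots> \<le> ennreal ((2 * \<delta>) powr p + 2 powr p * (4 * (T powr (p - l) * R) + 2 * (T powr p * \<eta>)))"
  proof (rule ennreal_leI)
    have "c None * n None * M \<le> M" "c None * m None * N \<le> N"
      using mult_right_mono[OF cn(2)[of None] MN0(1)] mult_right_mono[OF cm(2)[of None] MN0(2)] by auto
    moreover have "T powr p * \<eta>' \<le> T powr p * \<eta>" using \<eta>'\<eta> by (intro mult_left_mono) auto
    ultimately have "c None * n None * M + c None * m None * N + Me + Ne \<le> 4 * (T powr (p - l) * R) + 2 * (T powr p * \<eta>)"
      using M_le Me_le by linarith
    then have "2 powr p * (c None * n None * M + c None * m None * N + Me + Ne) \<le> 2 powr p * (4 * (T powr (p - l) * R) + 2 * (T powr p * \<eta>))"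
      by (intro mult_left_mono) auto
    moreover have "(2 * \<delta>) powr p * (\<Sum>i\<in>I. min (m i) (n i)) \<le> (2 * \<delta>) powr p"
      using \<open>(\<Sum>i\<in>I. min (m i) (n i)) \<le> 1\<close> by (intro mult_left_le) auto
    ultimately show "(\<integral>x. H x \<partial>\<mu>) \<le> (2 * \<delta>) powr p + 2 powr p * (4 * (T powr (p - l) * R) + 2 * (T powr p * \<eta>))"
      unfolding Hx(2) by linarith
  qed
  finally show ?thesis using \<gamma>_in by blast
qed

text \<open>The cost of the cell coupling depends on \<open>\<nu>\<close> only through finitely many
  cell masses, which are weakly continuous. Parameters are fixed in the order
  \<open>\<delta>\<close>, \<open>T\<close>, \<open>t\<close>, neighbourhood, since the admissible
  excess mass depends on \<open>T\<close>.\<close>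

lemma weak_nbhd_in_wasserstein_ball:
  fixes \<mu> :: "'a::euclidean_space measure"
  assumes \<mu>: "\<mu> \<in> moment_ball l R" and R: "0 \<le> R" and p: "1 \<le> p" "p < l" and r: "0 < r"
  obtains V where "openin weak_topology V" "\<mu> \<in> V"
    "\<And>\<nu>. \<nu> \<in> V \<Longrightarrow> \<nu> \<in> moment_ball l R \<Longrightarrow> wasserstein_dist p \<mu> \<nu> < r"
proof -
  \<comment> \<open>Half of \<open>r powr p\<close> is reserved for the diameter of the cells; the
    other half equals \<open>2 powr p * (2 * \<rho>)\<close> and is shared by tails and excess
    mass.\<close>
  define \<rho> where "\<rho> = r powr p / (4 * 2 powr p)"
  have \<rho>: "\<rho> > 0" using r by (simp add: \<rho>_def)
  define \<delta> where "\<delta> = r / 4"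
  have \<delta>: "0 < \<delta>" using r by (simp add: \<delta>_def)
  have "((\<lambda>T. 4 * (T powr (p - l) * R)) \<longlongrightarrow> 4 * (0 * R)) at_top"
    using p by (intro tendsto_intros tendsto_neg_powr filterlim_ident) auto
  then have "\<forall>\<^sub>F T in at_top. 4 * (T powr (p - l) * R) < \<rho>"
    using \<rho> by (intro order_tendstoD(2)) auto
  then obtain T where T: "0 < T" "4 * (T powr (p - l) * R) < \<rho>"
    using eventually_happens'[OF _ eventually_conj[OF eventually_gt_at_top[of 0]]] by (metis trivial_limit_at_top_linorder)
  \<comment> \<open>In the neighbourhood constructed below the excess mass is at most
    \<open>2 * t\<close>, and it then contributes at most \<open>\<rho>\<close>.\<close>
  define t where "t = min (1/2) (\<rho> / (8 * T powr p))"
  have t: "0 < t" "t < 1" "2 * (T powr p * (2 * t)) \<le> \<rho>"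
    using \<rho> T by (auto simp: t_def min_def field_simps)
  obtain I :: "'a option set" and \<phi> :: "'a option \<Rightarrow> 'a \<Rightarrow> real" where \<phi>: "finite I" "None \<in> I" "\<And>i. continuous_on UNIV (\<phi> i)" "\<And>i x. 0 \<le> \<phi> i x" "\<And>i x. \<phi> i x \<le> 1"
    "\<And>x. (\<Sum>i\<in>I. \<phi> i x) = 1" "\<And>z x. 0 < \<phi> (Some z) x \<Longrightarrow> dist x z < \<delta>" "\<And>x. 0 < \<phi> None x \<Longrightarrow> T \<le> norm x"
    by (rule tent_partition[OF \<delta> T(1)], rule that)
  define m where "m i = (\<integral>x. \<phi> i x \<partial>\<mu>)" for i
  define V where "V = (\<Inter>i\<in>I. {\<nu> \<in> prob_measures. (\<integral>x. \<phi> i x \<partial>\<nu>) \<in> ball (m i) (t / card I)}) \<inter> topspace weak_topology"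
  have cI: "0 < card I" using \<phi>(1,2) by (auto simp: card_gt_0_iff)
  show ?thesis
  proof
    have "bounded (range (\<phi> i))" for i using \<phi>(4,5) by (intro boundedI[of _ 1]) auto
    then show "openin weak_topology V"
      unfolding V_def using \<phi>(1,3) by (intro openin_INT openin_weak_basic) auto
    show "\<mu> \<in> V"
      using moment_ballD(1)[OF \<mu> R] t cI by (auto simp: V_def topspace_weak_topology m_def)
    fix \<nu> assume \<nu>V: "\<nu> \<in> V" and \<nu>: "\<nu> \<in> moment_ball l R"
    have "(\<Sum>i\<in>I. \<bar>(\<integral>x. \<phi> i x \<partial>\<mu>) - (\<integral>x. \<phi> i x \<partial>\<nu>)\<bar>) \<le> (\<Sum>i\<in>I. t / card I)"
      using \<nu>V by (intro sum_mono) (auto simp: V_def m_def dist_real_def less_imp_le)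
    then have sum_le: "t + (\<Sum>i\<in>I. \<bar>(\<integral>x. \<phi> i x \<partial>\<mu>) - (\<integral>x. \<phi> i x \<partial>\<nu>)\<bar>) \<le> 2 * t"
      using cI by simp
    obtain \<gamma> where \<gamma>: "\<gamma> \<in> couplings \<mu> \<nu>" and cost: "(\<integral>\<^sup>+z. ennreal (dist (fst z) (snd z) powr p) \<partial>\<gamma>) \<le>
      ennreal ((2 * \<delta>) powr p + 2 powr p * (4 * (T powr (p - l) * R) + 2 * (T powr p * (t + (\<Sum>i\<in>I. \<bar>(\<integral>x. \<phi> i x \<partial>\<mu>) - (\<integral>x. \<phi> i x \<partial>\<nu>)\<bar>)))))"
      using cell_coupling[OF \<mu> \<nu> R p \<delta> T(1) t(1,2) \<phi>] by blast
    have "2 * (T powr p * (t + (\<Sum>i\<in>I. \<bar>(\<integral>x. \<phi> i x \<partial>\<mu>) - (\<integral>x. \<phi> i x \<partial>\<nu>)\<bar>))) \<le> 2 * (T powr p * (2 * t))"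
      using sum_le by (intro mult_left_mono) auto
    then have "4 * (T powr (p - l) * R) + 2 * (T powr p * (t + (\<Sum>i\<in>I. \<bar>(\<integral>x. \<phi> i x \<partial>\<mu>) - (\<integral>x. \<phi> i x \<partial>\<nu>)\<bar>))) < 2 * \<rho>"
      using T(2) t(3) by linarith
    then have "2 powr p * (4 * (T powr (p - l) * R) + 2 * (T powr p * (t + (\<Sum>i\<in>I. \<bar>(\<integral>x. \<phi> i x \<partial>\<mu>) - (\<integral>x. \<phi> i x \<partial>\<nu>)\<bar>)))) < 2 powr p * (2 * \<rho>)"
      by (rule mult_strict_left_mono) simp
    moreover have "2 powr p * (2 * \<rho>) = r powr p / 2" by (simp add: \<rho>_def)
    moreover have "(2 * \<delta>) powr p \<le> r powr p / 2"
    proof -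
      have "(2 * \<delta>) powr p = r powr p / 2 powr p" using r by (simp add: \<delta>_def powr_divide)
      also have "\<dots> \<le> r powr p / 2" using p powr_mono[of 1 p 2] by (intro divide_left_mono) auto
      finally show ?thesis .
    qed
    ultimately have "(2 * \<delta>) powr p + 2 powr p * (4 * (T powr (p - l) * R) + 2 * (T powr p * (t + (\<Sum>i\<in>I. \<bar>(\<integral>x. \<phi> i x \<partial>\<mu>) - (\<integral>x. \<phi> i x \<partial>\<nu>)\<bar>)))) < r powr p"
      by linarith
    then have "(\<integral>\<^sup>+z. ennreal (dist (fst z) (snd z) powr p) \<partial>\<gamma>) < ennreal (r powr p)"
      using r by (intro order_le_less_trans[OF cost] ennreal_lessI) auto
    then show "wasserstein_dist p \<mu> \<nu> < r" by (rule wasserstein_dist_less[OF \<gamma> r p(1)])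
  qed
qed

text \<open>On a moment ball of order \<open>l > p\<close> the weak topology is at least as fine as
  the Wasserstein topology of order \<open>p\<close>, so the identity map transports weak
  compactness.\<close>

lemma compactin_wasserstein_moment_ball:
  assumes R: "0 \<le> R" and p: "1 \<le> p" "p < l"
  shows "compactin (wasserstein_topology p) (moment_ball l R :: 'a::euclidean_space measure set)"
proof -
  let ?B = "moment_ball l R :: 'a measure set"
  have sub: "?B \<subseteq> prob_measures_p p" by (rule moment_ball_subset_p[OF p R])
  have Bpm: "?B \<subseteq> topspace weak_topology" by (auto simp: moment_ball_def topspace_weak_topology)
  have "continuous_map (subtopology weak_topology ?B) (wasserstein_topology p) id"
    unfolding continuous_map_def
  proof (intro conjI allI impI)
    show "id \<in> topspace (subtopology weak_topology ?B) \<rightarrow> topspace (wasserstein_topology p)"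
      using sub by (auto simp: topspace_wasserstein_topology)
    fix U :: "'a measure set" assume U: "openin (wasserstein_topology p) U"
    show "openin (subtopology weak_topology ?B) {x \<in> topspace (subtopology weak_topology ?B). id x \<in> U}"
      unfolding openin_subopen[of _ "Collect _"]
    proof (intro ballI)
      fix \<mu> assume "\<mu> \<in> {x \<in> topspace (subtopology weak_topology ?B). id x \<in> U}"
      then have \<mu>: "\<mu> \<in> ?B" "\<mu> \<in> U" by auto
      then obtain r where r: "r > 0" "{\<nu> \<in> prob_measures_p p. wasserstein_dist p \<mu> \<nu> < r} \<subseteq> U"
        using U unfolding openin_wasserstein_topology by blast
      obtain V where V: "openin weak_topology V" "\<mu> \<in> V"
        "\<And>\<nu>. \<nu> \<in> V \<Longrightarrow> \<nu> \<in> ?B \<Longrightarrow> wasserstein_dist p \<mu> \<nu> < r"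
        using weak_nbhd_in_wasserstein_ball[OF \<mu>(1) R p r(1)] by blast
      have "openin (subtopology weak_topology ?B) (?B \<inter> V)"
        using V(1) by (auto simp: openin_subtopology Int_commute)
      moreover have "?B \<inter> V \<subseteq> {x \<in> topspace (subtopology weak_topology ?B). id x \<in> U}"
        using V(3) r(2) sub Bpm by auto
      ultimately show "\<exists>T. openin (subtopology weak_topology ?B) T \<and> \<mu> \<in> T \<and>
          T \<subseteq> {x \<in> topspace (subtopology weak_topology ?B). id x \<in> U}"
        using V(2) \<mu>(1) by blast
    qed
  qed
  moreover have "compactin (subtopology weak_topology ?B) ?B"
    using compactin_moment_ball[of l R] p R by (simp add: compactin_subtopology)
  ultimately have "compactin (wasserstein_topology p) (id ` ?B)" by (metis image_compactin)
  then show ?thesis by simp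
qed

lemma topspace_centered_wasserstein:
  "topspace (centered_wasserstein_topology p) = centered_prob_measures_p p"
  by (auto simp: centered_wasserstein_topology_def topspace_wasserstein_topology centered_prob_measures_p_def)

lemma compactin_centered_wasserstein_moment_ball:
  assumes R: "0 \<le> R" and p: "1 \<le> p" "p < l"
  shows "compactin (centered_wasserstein_topology p)
    (moment_ball l R \<inter> (centered_prob_measures_p p :: 'a::euclidean_space measure set))"
proof -
  have "topspace (wasserstein_topology p) - centered_prob_measures_p p
      = {\<mu> \<in> prob_measures_p p. (\<integral>x. x \<partial>\<mu>) \<noteq> (0 :: 'a)}"
    by (auto simp: topspace_wasserstein_topology centered_prob_measures_p_def)
  then have "closedin (wasserstein_topology p) (centered_prob_measures_p p :: 'a measure set)"
    using openin_wasserstein_noncentered[OF p(1)]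
    by (auto simp: closedin_def topspace_wasserstein_topology centered_prob_measures_p_def)
  then have "compactin (wasserstein_topology p) (centered_prob_measures_p p \<inter> moment_ball l R :: 'a measure set)"
    using compactin_wasserstein_moment_ball[OF R p] by (rule closed_Int_compactin)
  then show ?thesis
    by (simp add: centered_wasserstein_topology_def compactin_subtopology Int_commute)
qed

subsection \<open>Configurations\<close>

abbreviation config_space :: "nat \<Rightarrow> (nat \<Rightarrow> 'a::euclidean_space) measure" where
  "config_space n \<equiv> (\<Pi>\<^sub>M i\<in>{..<n}. borel)"

abbreviation config_lborel :: "nat \<Rightarrow> (nat \<Rightarrow> 'a::euclidean_space) measure" where
  "config_lborel n \<equiv> (\<Pi>\<^sub>M i\<in>{..<n}. lborel)"

interpretation lborel_product: product_sigma_finite "\<lambda>_::nat. lborel :: 'a::euclidean_space measure"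
  by standard

lemma sets_PiM_lborel:
  "sets (\<Pi>\<^sub>M i\<in>I. lborel :: 'a::euclidean_space measure) = sets (\<Pi>\<^sub>M i\<in>I. borel)"
  by (intro sets_PiM_cong) auto

lemma measurable_PiM_lborel [simp]:
  "measurable (\<Pi>\<^sub>M i\<in>I. lborel :: 'a::euclidean_space measure) N = measurable (\<Pi>\<^sub>M i\<in>I. borel) N"
  "measurable N (\<Pi>\<^sub>M i\<in>I. lborel :: 'a::euclidean_space measure) = measurable N (\<Pi>\<^sub>M i\<in>I. borel)"
  "measurable ((\<Pi>\<^sub>M i\<in>I. lborel :: 'a::euclidean_space measure) \<Otimes>\<^sub>M lborel) N'
     = measurable ((\<Pi>\<^sub>M i\<in>I. borel) \<Otimes>\<^sub>M borel) N'"
  by (auto intro!: measurable_cong_sets sets_pair_measure_cong sets_PiM_cong)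

section \<open>Empirical measures\<close>

lemma empirical_cong: "(\<And>i. i < n \<Longrightarrow> x i = y i) \<Longrightarrow> empirical_measure n x = empirical_measure n y"
  unfolding empirical_measure_def by (intro distr_cong) (auto simp: space_uniform_count_measure)

lemma empirical_in_prob_measures [simp]: "0 < n \<Longrightarrow> empirical_measure n x \<in> prob_measures"
  unfolding prob_measures_def empirical_measure_def
  by (auto intro!: prob_space.prob_space_distr prob_space_uniform_count_measure
      simp: measurable_def sets_uniform_count_measure space_uniform_count_measure)

lemma measurable_uniform_count [simp]: "f \<in> measurable (uniform_count_measure A) borel"
  by (simp add: measurable_def sets_uniform_count_measure space_uniform_count_measure)

lemma integral_empirical:
  fixes f :: "'a::euclidean_space \<Rightarrow> real"
  assumes [measurable]: "f \<in> borel_measurable borel"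
  shows "(\<integral>y. f y \<partial>empirical_measure n x) = (\<Sum>i<n. f (x i)) / real n"
  unfolding empirical_measure_def
  by (subst integral_distr) (auto simp: integral_uniform_count_measure)

lemma integral_id_empirical:
  fixes x :: "nat \<Rightarrow> 'a::euclidean_space"
  shows "(\<integral>y. y \<partial>empirical_measure n x) = (\<Sum>i<n. x i) /\<^sub>R real n"
proof -
  have "(\<integral>y. y \<partial>empirical_measure n x) = (\<integral>i. x i \<partial>uniform_count_measure {..<n})"
    unfolding empirical_measure_def by (rule integral_distr) auto
  also have "\<dots> = (\<Sum>i<n. (1 / real n) *\<^sub>R x i)"
    unfolding uniform_count_measure_def by (subst lebesgue_integral_point_measure_finite) auto
  finally show ?thesis by (simp add: scaleR_sum_right inverse_eq_divide)
qed

lemma nn_integral_empirical: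
  fixes f :: "'a::euclidean_space \<Rightarrow> real"
  assumes [measurable]: "f \<in> borel_measurable borel" and f: "\<And>x. 0 \<le> f x"
  shows "(\<integral>\<^sup>+y. ennreal (f y) \<partial>empirical_measure n x) = ennreal ((\<Sum>i<n. f (x i)) / real n)"
proof -
  have "(\<integral>\<^sup>+y. ennreal (f y) \<partial>empirical_measure n x) = (\<Sum>i<n. ennreal (1 / real n) * ennreal (f (x i)))"
    unfolding empirical_measure_def uniform_count_measure_def
    by (subst nn_integral_distr) (auto simp: nn_integral_point_measure_finite uniform_count_measure_def[symmetric])
  also have "\<dots> = ennreal (\<Sum>i<n. 1 / real n * f (x i))"
    using f by (subst sum_ennreal[symmetric]) (auto simp: ennreal_mult[symmetric])
  finally show ?thesis by (simp add: sum_divide_distrib)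
qed

text \<open>The energy of an empirical measure as a real number. The diagonal terms
  \<open>W 0\<close> are present because the double integral charges them.\<close>

definition pair_energy :: "('a::euclidean_space \<Rightarrow> real) \<Rightarrow> nat \<Rightarrow> (nat \<Rightarrow> 'a) \<Rightarrow> real" where
  "pair_energy W n x = (\<Sum>i<n. \<Sum>j<n. W (x i - x j)) / (2 * (real n)\<^sup>2)"

lemma interaction_energy_empirical:
  assumes [measurable]: "W \<in> borel_measurable borel" and W: "\<And>x. 0 \<le> W x"
  shows "interaction_energy W (empirical_measure n x) = ennreal (pair_energy W n x)"
proof -
  have "(\<integral>\<^sup>+y. \<integral>\<^sup>+z. ennreal (W (y - z)) \<partial>empirical_measure n x \<partial>empirical_measure n x)
      = (\<integral>\<^sup>+y. ennreal ((\<Sum>j<n. W (y - x j)) / real n) \<partial>empirical_measure n x)"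
    using W by (intro nn_integral_cong nn_integral_empirical) auto
  also have "\<dots> = ennreal ((\<Sum>i<n. (\<Sum>j<n. W (x i - x j)) / real n) / real n)"
    using W by (intro nn_integral_empirical) (auto intro!: sum_nonneg divide_nonneg_nonneg)
  also have "\<dots> / 2 = ennreal ((\<Sum>i<n. (\<Sum>j<n. W (x i - x j)) / real n) / real n / 2)"
    using W by (intro divide_ennreal[of _ 2, simplified]) (auto intro!: sum_nonneg divide_nonneg_nonneg)
  finally show ?thesis
    by (simp add: interaction_energy_def pair_energy_def sum_divide_distrib power2_eq_square field_simps)
qed

lemma boltzmann_weight_eq:
  assumes "W \<in> borel_measurable borel" and "\<And>x. 0 \<le> W x"
  shows "boltzmann_weight W \<sigma> n x = ennreal (exp (- (2 * real n / \<sigma>\<^sup>2) * pair_energy W n x))"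
  using assms by (simp add: boltzmann_weight_def interaction_energy_empirical pair_energy_def sum_nonneg)

text \<open>Configurations are \<open>undefined\<close> off \<open>{..<n}\<close>, whereas
  continuity is stated on all functions with the product topology. Padding by \<open>0\<close> maps
  the former measurably into the latter and leaves the empirical measure unchanged.\<close>

lemma measurable_empirical_preimage:
  fixes X :: "'a::euclidean_space measure topology"
  assumes cont: "continuous_map euclidean X (empirical_measure n)" and U: "openin X U"
  shows "{x \<in> space (config_space n). empirical_measure n x \<in> U} \<in> sets (config_space n)"
proof -
  define ext where "ext x = (\<lambda>i. if i < n then x i else (0 :: 'a))" for x :: "nat \<Rightarrow> 'a"
  have "open {x. empirical_measure n x \<in> U}"
    using openin_continuous_map_preimage[OF cont U] by simp
  then have 1: "{x. empirical_measure n x \<in> U} \<in> sets (\<Pi>\<^sub>M i\<in>UNIV. borel)"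
    unfolding sets_PiM_equal_borel by simp
  have "(\<lambda>x. if i < n then x i else 0) \<in> borel_measurable (config_space n :: (nat \<Rightarrow> 'a) measure)" for i
    by (cases "i < n") auto
  then have "ext \<in> measurable (config_space n) (\<Pi>\<^sub>M i\<in>UNIV. borel)"
    unfolding ext_def by (intro measurable_PiM_single') (auto simp: space_PiM)
  from measurable_sets[OF this 1]
  have "{x \<in> space (config_space n). empirical_measure n (ext x) \<in> U} \<in> sets (config_space n)"
    by (simp add: vimage_def Int_def conj_commute)
  moreover have "empirical_measure n (ext x) = empirical_measure n x" for x
    by (rule empirical_cong) (simp add: ext_def)
  ultimately show ?thesis by simp
qed

lemma continuous_map_empirical_weak:
  assumes n: "0 < n"
  shows "continuous_map euclidean weak_topology (empirical_measure n :: (nat \<Rightarrow> 'a::euclidean_space) \<Rightarrow> _)"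
proof (rule continuous_map_into_weak)
  fix f :: "'a \<Rightarrow> real" assume f: "continuous_on UNIV f" "bounded (range f)"
  have "continuous_on UNIV (\<lambda>x :: nat \<Rightarrow> 'a. (\<Sum>i<n. f (x i)) / real n)"
    using n by (intro continuous_intros continuous_on_compose2[OF f(1)] continuous_on_product_coordinates) auto
  then show "continuous_map euclidean euclideanreal (\<lambda>x. \<integral>y. f y \<partial>empirical_measure n x)"
    by (simp add: integral_empirical borel_measurable_continuous_onI[OF f(1)])
qed (use n in auto)

lemma empirical_in_prob_measures_p: "0 < n \<Longrightarrow> empirical_measure n x \<in> prob_measures_p p"
  by (simp add: prob_measures_p_def nn_integral_empirical)

lemma empirical_coupling:
  assumes n: "0 < n"
  shows "distr (uniform_count_measure {..<n}) (borel \<Otimes>\<^sub>M borel) (\<lambda>i. (x i, y i))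
    \<in> couplings (empirical_measure n x) (empirical_measure n y)"
proof -
  have m: "(\<lambda>i. (x i, y i)) \<in> measurable (uniform_count_measure {..<n}) (borel \<Otimes>\<^sub>M borel)"
    by measurable
  then show ?thesis unfolding couplings_def empirical_measure_def
    using n by (auto intro!: prob_space.prob_space_distr[OF _ m] prob_space_uniform_count_measure
      simp: distr_distr[OF _ m] comp_def)
qed

text \<open>Matching atoms of equal index bounds the transport cost by a function of the
  configuration that is continuous and vanishes at the base point.\<close>

lemma continuous_map_empirical_wasserstein:
  assumes n: "0 < n" and p: "1 \<le> p"
  shows "continuous_map euclidean (wasserstein_topology p) (empirical_measure n :: (nat \<Rightarrow> 'a::euclidean_space) \<Rightarrow> _)"
  unfolding continuous_map_def
proof (intro conjI allI impI)
  show "empirical_measure n \<in> topspace euclidean \<rightarrow> topspace (wasserstein_topology p)"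
    using n by (auto simp: topspace_wasserstein_topology empirical_in_prob_measures_p)
  fix U :: "'a measure set" assume U: "openin (wasserstein_topology p) U"
  have "open {x. empirical_measure n x \<in> U}"
  proof (subst open_subopen, safe)
    fix x assume x: "empirical_measure n x \<in> U"
    then obtain r where r: "r > 0" "{\<nu> \<in> prob_measures_p p. wasserstein_dist p (empirical_measure n x) \<nu> < r} \<subseteq> U"
      using U unfolding openin_wasserstein_topology by blast
    define T where "T = {y. (\<Sum>i<n. dist (x i) (y i) powr p) / real n < r powr p}"
    have "open T" unfolding T_def
      using n p by (intro open_Collect_less continuous_intros continuous_on_powr' continuous_on_product_coordinates) auto
    moreover have "x \<in> T" using r by (simp add: T_def)
    moreover have "empirical_measure n y \<in> U" if y: "y \<in> T" for y
    proof -
      let ?\<gamma> = "distr (uniform_count_measure {..<n}) (borel \<Otimes>\<^sub>M borel) (\<lambda>i. (x i, y i))"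
      have "(\<integral>\<^sup>+z. ennreal (dist (fst z) (snd z) powr p) \<partial>?\<gamma>)
          = (\<Sum>i<n. ennreal (1 / real n) * ennreal (dist (x i) (y i) powr p))"
        unfolding uniform_count_measure_def
        by (subst nn_integral_distr) (auto simp: space_pair_measure nn_integral_point_measure_finite uniform_count_measure_def[symmetric])
      also have "\<dots> = ennreal ((\<Sum>i<n. dist (x i) (y i) powr p) / real n)"
        by (subst sum_divide_distrib, subst sum_ennreal[symmetric]) (auto simp: ennreal_mult[symmetric])
      also have "\<dots> < ennreal (r powr p)"
        using y r by (intro ennreal_lessI) (auto simp: T_def)
      finally have "wasserstein_dist p (empirical_measure n x) (empirical_measure n y) < r"
        by (rule wasserstein_dist_less[OF empirical_coupling[OF n] r(1) p])
      then show ?thesis using r(2) n by (auto simp: empirical_in_prob_measures_p)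
    qed
    ultimately show "\<exists>T. open T \<and> x \<in> T \<and> T \<subseteq> {x. empirical_measure n x \<in> U}" by blast
  qed
  then show "openin euclidean {x \<in> topspace euclidean. empirical_measure n x \<in> U}" by simp
qed

section \<open>Lebesgue measure on centered configurations\<close>

definition fill_last :: "nat \<Rightarrow> (nat \<Rightarrow> 'a::euclidean_space) \<Rightarrow> nat \<Rightarrow> 'a" where
  "fill_last n x = x(n - 1 := - (\<Sum>i<n - 1. x i))"

lemma measurable_fill_last [measurable]:
  assumes "0 < n"
  shows "fill_last n \<in> measurable (config_lborel (n - 1)) (config_space n)"
proof -
  have eq: "{..<n} = insert (n - 1) {..<n - 1}" using assms by auto
  show ?thesis unfolding fill_last_def eq
    by (intro measurable_fun_upd[where J = "{..<n - 1}"]) auto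
qed

lemma nn_integral_centered_lebesgue:
  fixes f :: "(nat \<Rightarrow> 'a::euclidean_space) \<Rightarrow> ennreal"
  assumes n: "0 < n" and [measurable]: "f \<in> borel_measurable (config_space n)"
  shows "(\<integral>\<^sup>+x. f x \<partial>centered_lebesgue n)
    = ennreal (sqrt (real n) ^ DIM('a)) * (\<integral>\<^sup>+x. f (fill_last n x) \<partial>config_lborel (n - 1))"
  unfolding centered_lebesgue_def fill_last_def[symmetric]
  by (subst nn_integral_scale_measure) (simp_all add: nn_integral_distr[OF measurable_fill_last[OF n, unfolded One_nat_def]])

lemma sets_centered_lebesgue [measurable_cong, simp]: "sets (centered_lebesgue n) = sets (config_space n)"
  by (simp add: centered_lebesgue_def)

lemma space_centered_lebesgue [simp]: "space (centered_lebesgue n) = space (config_space n)"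
  by (rule sets_eq_imp_space_eq) simp

lemma centered_configurations_sets [measurable]:
  "(centered_configurations n :: (nat \<Rightarrow> 'a::euclidean_space) set) \<in> sets (config_space n)"
proof -
  have "{x \<in> space (config_space n). (\<Sum>i<n. x i) = (0 :: 'a)} \<in> sets (config_space n)" by measurable
  then show ?thesis by (simp add: centered_configurations_def space_PiM)
qed

lemma fill_last_centered:
  assumes "0 < n" "x \<in> space (config_lborel (n - 1))"
  shows "fill_last n x \<in> centered_configurations n"
proof -
  have "fill_last n x \<in> {..<n} \<rightarrow>\<^sub>E UNIV"
    using assms by (auto simp: fill_last_def space_PiM PiE_def extensional_def)
  moreover have "(\<Sum>i<n. fill_last n x i) = 0"
  proof -
    obtain m where n: "n = Suc m" using assms(1) by (cases n) auto
    have "(\<Sum>i<m. fill_last n x i) = (\<Sum>i<m. x i)" by (intro sum.cong) (auto simp: fill_last_def n)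
    then show ?thesis by (simp add: n) (simp add: fill_last_def)
  qed
  ultimately show ?thesis by (simp add: centered_configurations_def)
qed

text \<open>Only \<open>n - 1\<close> points are free: the factor at the dependent point is bounded
  by \<open>B\<close>, and the others integrate independently.\<close>

lemma nn_integral_centered_prod_le:
  fixes g :: "'a::euclidean_space \<Rightarrow> ennreal"
  assumes n: "0 < n" and [measurable]: "g \<in> borel_measurable borel" and B: "\<And>x. g x \<le> B"
  shows "(\<integral>\<^sup>+x. (\<Prod>i<n. g (x i)) \<partial>centered_lebesgue n)
    \<le> ennreal (sqrt (real n) ^ DIM('a)) * (B * (\<integral>\<^sup>+x. g x \<partial>lborel) ^ (n - 1))"
proof -
  obtain m where m: "n = Suc m" using n by (cases n) auto
  have "(\<integral>\<^sup>+x. (\<Prod>i<n. g (fill_last n x i)) \<partial>config_lborel (n - 1))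
      \<le> (\<integral>\<^sup>+x. B * (\<Prod>i<n - 1. g (x i)) \<partial>config_lborel (n - 1))"
  proof (intro nn_integral_mono)
    fix x
    have "(\<Prod>i<n. g (fill_last n x i)) = (\<Prod>i<m. g (x i)) * g (fill_last n x m)"
      unfolding m prod.lessThan_Suc by (intro arg_cong2[where f = "(*)"] prod.cong) (auto simp: fill_last_def)
    then show "(\<Prod>i<n. g (fill_last n x i)) \<le> B * (\<Prod>i<n - 1. g (x i))"
      using mult_left_mono[OF B, of "\<Prod>i<m. g (x i)"] by (simp add: m mult.commute)
  qed
  also have "\<dots> = B * (\<integral>\<^sup>+x. g x \<partial>lborel) ^ (n - 1)"
    using lborel_product.product_nn_integral_prod[of "{..<n - 1}" "\<lambda>_. g"]
    by (subst nn_integral_cmult) auto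
  finally show ?thesis
    using n by (subst nn_integral_centered_lebesgue) (auto intro!: mult_left_mono)
qed

lemma config_lborel_shift:
  fixes t :: "'a::euclidean_space"
  assumes [measurable]: "g \<in> borel_measurable (config_space n)"
  shows "(\<integral>\<^sup>+x. g (\<lambda>i\<in>{..<n}. x i + t) \<partial>config_lborel n) = (\<integral>\<^sup>+x. g x \<partial>config_lborel n)"
proof -
  let ?s = "\<lambda>x :: nat \<Rightarrow> 'a. \<lambda>i\<in>{..<n}. x i + t"
  have [measurable]: "?s \<in> measurable (config_lborel n) (config_lborel n)"
    by (intro measurable_restrict) auto
  have "distr (config_lborel n) (config_lborel n) ?s = config_lborel n"
  proof (rule lborel_product.PiM_eqI)
    fix A :: "nat \<Rightarrow> 'a set" assume A: "\<And>i. i \<in> {..<n} \<Longrightarrow> A i \<in> sets lborel"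
    have "?s -` Pi\<^sub>E {..<n} A \<inter> space (config_lborel n) = Pi\<^sub>E {..<n} (\<lambda>i. (\<lambda>y. y + t) -` A i)"
      by (auto simp: space_PiM PiE_def Pi_def restrict_def extensional_def)
    moreover have "(\<lambda>y. y + t) -` A i \<in> sets lborel \<and> emeasure lborel ((\<lambda>y. y + t) -` A i) = emeasure lborel (A i)"
      if "i < n" for i
    proof -
      have "emeasure lborel (A i) = emeasure (distr lborel borel ((+) t)) (A i)"
        by (simp add: lborel_distr_plus)
      also have "\<dots> = emeasure lborel ((\<lambda>y. y + t) -` A i)"
        using A[of i] that by (subst emeasure_distr) (auto intro!: arg_cong2[where f = emeasure] simp: add.commute)
      finally show ?thesis using A[of i] that measurable_sets[of "\<lambda>y. y + t" borel borel "A i"] by auto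
    qed
    moreover from this have "emeasure (config_lborel n) (Pi\<^sub>E {..<n} (\<lambda>i. (\<lambda>y. y + t) -` A i)) = (\<Prod>i<n. emeasure lborel (A i))"
      by (subst lborel_product.emeasure_PiM) auto
    ultimately show "emeasure (distr (config_lborel n) (config_lborel n) ?s) (Pi\<^sub>E {..<n} A) = (\<Prod>i<n. emeasure lborel (A i))"
      using A by (subst emeasure_distr) (auto intro!: sets_PiM_I_finite)
  qed auto
  then have "(\<integral>\<^sup>+x. g x \<partial>config_lborel n) = (\<integral>\<^sup>+x. g x \<partial>distr (config_lborel n) (config_lborel n) ?s)" by simp
  also have "\<dots> = (\<integral>\<^sup>+x. g (?s x) \<partial>config_lborel n)" by (rule nn_integral_distr) auto
  finally show ?thesis by simp
qed

lemma nn_integral_lborel_affine: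
  fixes h :: "'a::euclidean_space \<Rightarrow> ennreal" and c :: real
  assumes [measurable]: "h \<in> borel_measurable borel" and c: "0 < c"
  shows "(\<integral>\<^sup>+x. h x \<partial>lborel) = ennreal (c ^ DIM('a)) * (\<integral>\<^sup>+x. h (t + c *\<^sub>R x) \<partial>lborel)"
proof -
  have "(\<integral>\<^sup>+x. h x \<partial>lborel) = (\<integral>\<^sup>+x. h x \<partial>density (distr lborel borel (\<lambda>x. t + c *\<^sub>R x)) (\<lambda>_. ennreal (\<bar>c\<bar> ^ DIM('a))))"
    using lborel_affine[of c t] c by simp
  also have "\<dots> = (\<integral>\<^sup>+x. ennreal (c ^ DIM('a)) * h (t + c *\<^sub>R x) \<partial>lborel)"
    using c by (subst nn_integral_density) (auto simp: nn_integral_distr)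
  finally show ?thesis by (simp add: nn_integral_cmult)
qed

lemma measurable_append_coordinate [measurable]:
  "(\<lambda>(x, y). x(k := y)) \<in> measurable (config_space k \<Otimes>\<^sub>M borel) (config_space (Suc k) :: (nat \<Rightarrow> 'a::euclidean_space) measure)"
  unfolding lessThan_Suc split_beta' by (intro measurable_fun_upd[where J = "{..<k}"]) auto

text \<open>
  For a translation invariant function, integrating out the centre of mass amounts to
  anchoring the last point. The change of variables is done one coordinate block at a time:
  replace the first coordinate by the total translation, shift the others by it, and rescale.
\<close>

lemma centered_disintegration:
  fixes f :: "(nat \<Rightarrow> 'a::euclidean_space) \<Rightarrow> ennreal"
  assumes n: "2 \<le> n" and f [measurable]: "f \<in> borel_measurable (config_space n)"
    and inv: "\<And>x t. x \<in> space (config_space n) \<Longrightarrow> f (\<lambda>i\<in>{..<n}. x i + t) = f x"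
    and q [measurable]: "q \<in> borel_measurable borel" and q1: "(\<integral>\<^sup>+x. q x \<partial>lborel) = 1"
  shows "(\<integral>\<^sup>+x. f x * q (x (n - 1)) \<partial>config_lborel n)
    = ennreal (real n ^ DIM('a)) * (\<integral>\<^sup>+x. f (fill_last n x) \<partial>config_lborel (n - 1))"
proof -
  obtain k where k: "n = Suc (Suc k)" using n by (metis add_2_eq_Suc le_Suc_ex)
  define m where "m = Suc k"
  have nm: "n = Suc m" "n - 1 = m" by (simp_all add: k m_def)
  note [measurable] = f[unfolded nm]
  \<comment> \<open>\<open>f\<close> with the last point moved to the origin; invariance recovers
    all values of \<open>f\<close> from it.\<close>
  define A where "A x = f (x(m := 0))" for x
  have [measurable]: "A \<in> borel_measurable (config_space m)"
  proof -
    have "(\<lambda>x :: nat \<Rightarrow> 'a. x(m := 0)) \<in> measurable (config_space m) (config_space (Suc m))"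
      unfolding lessThan_Suc by (intro measurable_fun_upd[where J = "{..<m}"]) auto
    then show ?thesis unfolding A_def by measurable
  qed
  have anchor: "f (x(m := t)) = A (\<lambda>i\<in>{..<m}. x i + - t)" if x: "x \<in> space (config_lborel m)" for x :: "nat \<Rightarrow> 'a" and t
  proof -
    have "x(m := t) \<in> space (config_space n)"
      using x by (auto simp: space_PiM nm PiE_def extensional_def)
    note inv[OF this, of "- t"]
    moreover have "(\<lambda>i\<in>{..<n}. (x(m := t)) i + - t) = (\<lambda>i\<in>{..<m}. x i + - t)(m := 0)"
      by (rule ext) (auto simp: nm(1) restrict_def)
    ultimately show ?thesis unfolding A_def by (simp only:)
  qed
  \<comment> \<open>With the last point fixed at \<open>t\<close>, shifting the other points by
    \<open>t\<close> removes the dependence on \<open>t\<close>, so the density \<open>q\<close>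
    integrates to \<open>1\<close>.\<close>
  have lhs: "(\<integral>\<^sup>+x. f x * q (x (n - 1)) \<partial>config_lborel n) = (\<integral>\<^sup>+x. A x \<partial>config_lborel m)"
  proof -
    have "(\<integral>\<^sup>+x. f x * q (x (n - 1)) \<partial>config_lborel n) = (\<integral>\<^sup>+t. \<integral>\<^sup>+x. f (x(m := t)) * q t \<partial>config_lborel m \<partial>lborel)"
      unfolding nm lessThan_Suc
      by (subst lborel_product.product_nn_integral_insert_rev) (auto simp: lessThan_Suc[symmetric])
    also have "\<dots> = (\<integral>\<^sup>+t. (\<integral>\<^sup>+x. A x \<partial>config_lborel m) * q t \<partial>lborel)"
    proof (intro nn_integral_cong)
      fix t :: 'a
      have "(\<integral>\<^sup>+x. f (x(m := t)) * q t \<partial>config_lborel m) = (\<integral>\<^sup>+x. A (\<lambda>i\<in>{..<m}. x i + - t) * q t \<partial>config_lborel m)"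
        by (intro nn_integral_cong) (simp only: anchor)
      also have "\<dots> = (\<integral>\<^sup>+x. A x * q t \<partial>config_lborel m)"
        by (rule config_lborel_shift[where g = "\<lambda>x. A x * q t"]) measurable
      also have "\<dots> = (\<integral>\<^sup>+x. A x \<partial>config_lborel m) * q t" by (rule nn_integral_multc) simp
      finally show "(\<integral>\<^sup>+x. f (x(m := t)) * q t \<partial>config_lborel m) = (\<integral>\<^sup>+x. A x \<partial>config_lborel m) * q t" .
    qed
    also have "\<dots> = (\<integral>\<^sup>+x. A x \<partial>config_lborel m) * 1" by (subst nn_integral_cmult) (auto simp: q1)
    finally show ?thesis by simp
  qed
  define G where "G y s = A (\<lambda>i\<in>{..<m}. (y(k := s)) i)" for y :: "nat \<Rightarrow> 'a" and s
  have upd_meas: "(\<lambda>(y, s). y(k := s)) \<in> measurable (config_lborel k \<Otimes>\<^sub>M lborel) (config_space m :: (nat \<Rightarrow> 'a) measure)"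
    unfolding m_def by simp
  let ?S = "\<lambda>y :: nat \<Rightarrow> 'a. \<Sum>i<k. y i"
  interpret pk: sigma_finite_measure "config_lborel k :: (nat \<Rightarrow> 'a) measure"
    by (rule lborel_product.sigma_finite) simp
  interpret pair: pair_sigma_finite "config_lborel k :: (nat \<Rightarrow> 'a) measure" "lborel :: 'a measure" ..
  have A_pair: "(\<lambda>(y, s). A ((\<lambda>i\<in>{..<k}. y i + a s)(k := b y s))) \<in> borel_measurable (config_lborel k \<Otimes>\<^sub>M lborel)"
    if [measurable]: "a \<in> borel_measurable borel" "(\<lambda>(y, s). b y s) \<in> borel_measurable (config_lborel k \<Otimes>\<^sub>M lborel)"
    for a :: "'a \<Rightarrow> 'a" and b :: "(nat \<Rightarrow> 'a) \<Rightarrow> 'a \<Rightarrow> 'a"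
  proof -
    have "(\<lambda>(y, s). ((\<lambda>i\<in>{..<k}. y i + a s)(k := b y s))) \<in> measurable (config_lborel k \<Otimes>\<^sub>M lborel) (config_space m)"
      unfolding m_def lessThan_Suc
      by (simp add: split_beta', intro measurable_fun_upd[where J = "{..<k}"] measurable_restrict) auto
    then show ?thesis by (simp add: split_beta' measurable_compose[OF _ \<open>A \<in> _\<close>, of "\<lambda>z. _ z", simplified comp_def])
  qed
  have A_upd: "(\<lambda>(z, s). A (z(k := real n *\<^sub>R s - ?S z))) \<in> borel_measurable (config_lborel k \<Otimes>\<^sub>M lborel)"
  proof -
    have "(\<lambda>p :: (nat \<Rightarrow> 'a) \<times> 'a. (fst p)(k := real n *\<^sub>R snd p - ?S (fst p))) \<in> measurable (config_space k \<Otimes>\<^sub>M borel) (config_space m)"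
      unfolding m_def lessThan_Suc by (intro measurable_fun_upd[where J = "{..<k}"]) auto
    then have "(\<lambda>p. A ((fst p)(k := real n *\<^sub>R snd p - ?S (fst p)))) \<in> borel_measurable (config_space k \<Otimes>\<^sub>M borel)"
      by measurable
    then show ?thesis unfolding measurable_PiM_lborel split_beta' .
  qed
  have "(\<integral>\<^sup>+x. f (fill_last n x) \<partial>config_lborel (n - 1))
      = (\<integral>\<^sup>+x. A (\<lambda>i\<in>{..<m}. x i + (\<Sum>j<m. x j)) \<partial>config_lborel m)"
    unfolding nm(2)
  proof (intro nn_integral_cong)
    fix x :: "nat \<Rightarrow> 'a" assume "x \<in> space (config_lborel m)"
    from anchor[OF this, of "- (\<Sum>j<m. x j)"]
    show "f (fill_last n x) = A (\<lambda>i\<in>{..<m}. x i + (\<Sum>j<m. x j))" by (simp add: fill_last_def nm(1))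
  qed
  also have "\<dots> = (\<integral>\<^sup>+y. \<integral>\<^sup>+a. A ((\<lambda>i\<in>{..<k}. y i + (?S y + a))(k := a + (?S y + a))) \<partial>lborel \<partial>config_lborel k)"
  proof -
    have "(\<lambda>x :: nat \<Rightarrow> 'a. A (\<lambda>i\<in>{..<m}. x i + (\<Sum>j<m. x j))) \<in> borel_measurable (config_lborel m)"
    proof -
      have "(\<lambda>x :: nat \<Rightarrow> 'a. \<lambda>i\<in>{..<m}. x i + (\<Sum>j<m. x j)) \<in> measurable (config_space m) (config_space m)"
        by (intro measurable_restrict) measurable
      then show ?thesis by simp
    qed
    then have "(\<integral>\<^sup>+x. A (\<lambda>i\<in>{..<m}. x i + (\<Sum>j<m. x j)) \<partial>config_lborel m)
        = (\<integral>\<^sup>+y. \<integral>\<^sup>+a. A (\<lambda>i\<in>{..<m}. (y(k := a)) i + (\<Sum>j<m. (y(k := a)) j)) \<partial>lborel \<partial>config_lborel k)"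
      unfolding m_def lessThan_Suc by (subst lborel_product.product_nn_integral_insert) auto
    also have "\<dots> = (\<integral>\<^sup>+y. \<integral>\<^sup>+a. A ((\<lambda>i\<in>{..<k}. y i + (?S y + a))(k := a + (?S y + a))) \<partial>lborel \<partial>config_lborel k)"
    proof (intro nn_integral_cong arg_cong[where f = A])
      fix y :: "nat \<Rightarrow> 'a" and a
      have "(\<Sum>j<m. (y(k := a)) j) = ?S y + a" by (simp add: m_def)
      then show "(\<lambda>i\<in>{..<m}. (y(k := a)) i + (\<Sum>j<m. (y(k := a)) j)) = (\<lambda>i\<in>{..<k}. y i + (?S y + a))(k := a + (?S y + a))"
        by (auto simp: fun_eq_iff m_def)
    qed
    finally show ?thesis .
  qed
  \<comment> \<open>Substitution \<open>s = ?S y + a\<close>, a translation in the single coordinate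
    \<open>a\<close>. Here \<open>s\<close> is the sum of all free points, which is the shift that
    anchoring the last point at the origin produces.\<close>
  also have "\<dots> = (\<integral>\<^sup>+y. \<integral>\<^sup>+s. A ((\<lambda>i\<in>{..<k}. y i + s)(k := s - ?S y + s)) \<partial>lborel \<partial>config_lborel k)"
  proof (rule nn_integral_cong)
    fix y :: "nat \<Rightarrow> 'a" assume y: "y \<in> space (config_lborel k)"
    let ?h = "\<lambda>s. A ((\<lambda>i\<in>{..<k}. y i + s)(k := s - ?S y + s))"
    have "(\<lambda>s. (\<lambda>i\<in>{..<k}. y i + s)(k := s - ?S y + s)) \<in> measurable borel (config_space m)"
      unfolding m_def lessThan_Suc by (intro measurable_fun_upd[where J = "{..<k}"] measurable_restrict) auto
    then have [measurable]: "?h \<in> borel_measurable borel" by measurable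
    show "(\<integral>\<^sup>+a. A ((\<lambda>i\<in>{..<k}. y i + (?S y + a))(k := a + (?S y + a))) \<partial>lborel) = (\<integral>\<^sup>+s. ?h s \<partial>lborel)"
      using nn_integral_lborel_affine[of ?h 1 "?S y"]
      by (simp only: scaleR_one add_diff_cancel_left' power_one ennreal_1 mult_1 zero_less_one \<open>?h \<in> _\<close>)
  qed
  also have "\<dots> = (\<integral>\<^sup>+s. \<integral>\<^sup>+y. A ((\<lambda>i\<in>{..<k}. y i + s)(k := s - ?S y + s)) \<partial>config_lborel k \<partial>lborel)"
    by (rule pair.Fubini'[symmetric]) (use A_pair[of "\<lambda>s. s" "\<lambda>y s. s - ?S y + s"] in auto)
  \<comment> \<open>The other coordinates are shifted by \<open>s\<close>. In terms of the shifted
    points \<open>z\<close>, the remaining coordinate \<open>2 * s - ?S y\<close> reads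
    \<open>n * s - ?S z\<close>, because \<open>n = k + 2\<close>.\<close>
  also have "\<dots> = (\<integral>\<^sup>+s. \<integral>\<^sup>+z. A (z(k := real n *\<^sub>R s - ?S z)) \<partial>config_lborel k \<partial>lborel)"
  proof (rule nn_integral_cong)
    fix s :: 'a
    let ?g = "\<lambda>z. A (z(k := real n *\<^sub>R s - ?S z))"
    have "(\<lambda>z :: nat \<Rightarrow> 'a. z(k := real n *\<^sub>R s - ?S z)) \<in> measurable (config_space k) (config_space m)"
      unfolding m_def lessThan_Suc by (intro measurable_fun_upd[where J = "{..<k}"]) auto
    then have "?g \<in> borel_measurable (config_space k)" by measurable
    from config_lborel_shift[OF this, of s]
    have "(\<integral>\<^sup>+z. ?g z \<partial>config_lborel k) = (\<integral>\<^sup>+y. ?g (\<lambda>i\<in>{..<k}. y i + s) \<partial>config_lborel k)" by simp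
    also have "\<dots> = (\<integral>\<^sup>+y. A ((\<lambda>i\<in>{..<k}. y i + s)(k := s - ?S y + s)) \<partial>config_lborel k)"
    proof (intro nn_integral_cong arg_cong[where f = A] arg_cong[where f = "\<lambda>a. _(k := a)"])
      fix y :: "nat \<Rightarrow> 'a"
      have "(\<Sum>i<k. (\<lambda>i\<in>{..<k}. y i + s) i) = ?S y + real k *\<^sub>R s" by (simp add: sum.distrib scaleR_conv_of_real sum_constant_scaleR)
      then show "real n *\<^sub>R s - (\<Sum>i<k. (\<lambda>i\<in>{..<k}. y i + s) i) = s - ?S y + s"
        by (simp add: k algebra_simps scaleR_2)
    qed
    finally show "(\<integral>\<^sup>+y. A ((\<lambda>i\<in>{..<k}. y i + s)(k := s - ?S y + s)) \<partial>config_lborel k) = (\<integral>\<^sup>+z. ?g z \<partial>config_lborel k)" by simp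
  qed
  finally have "(\<integral>\<^sup>+x. f (fill_last n x) \<partial>config_lborel (n - 1))
      = (\<integral>\<^sup>+s. \<integral>\<^sup>+z. A (z(k := real n *\<^sub>R s - ?S z)) \<partial>config_lborel k \<partial>lborel)" .
  also have "\<dots> = (\<integral>\<^sup>+z. \<integral>\<^sup>+s. A (z(k := real n *\<^sub>R s - ?S z)) \<partial>lborel \<partial>config_lborel k)"
    by (rule pair.Fubini'[OF A_upd])
  finally have 2: "ennreal (real n ^ DIM('a)) * (\<integral>\<^sup>+x. f (fill_last n x) \<partial>config_lborel (n - 1))
      = ennreal (real n ^ DIM('a)) * (\<integral>\<^sup>+z. \<integral>\<^sup>+s. A (z(k := real n *\<^sub>R s - ?S z)) \<partial>lborel \<partial>config_lborel k)" by simp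
  have meas_z: "(\<lambda>z :: nat \<Rightarrow> 'a. \<integral>\<^sup>+s. A (z(k := real n *\<^sub>R s - ?S z)) \<partial>lborel) \<in> borel_measurable (config_lborel k)"
    using lborel.borel_measurable_nn_integral[OF A_upd] by simp
  \<comment> \<open>Rescaling \<open>s\<close> by \<open>n\<close> is the only change of variables
    whose determinant is not \<open>1\<close>.\<close>
  have "ennreal (real n ^ DIM('a)) * (\<integral>\<^sup>+z. \<integral>\<^sup>+s. A (z(k := real n *\<^sub>R s - ?S z)) \<partial>lborel \<partial>config_lborel k)
      = (\<integral>\<^sup>+z. ennreal (real n ^ DIM('a)) * (\<integral>\<^sup>+s. A (z(k := real n *\<^sub>R s - ?S z)) \<partial>lborel) \<partial>config_lborel k)"
    by (rule nn_integral_cmult[symmetric, OF meas_z])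
  also have "\<dots> = (\<integral>\<^sup>+z. \<integral>\<^sup>+s. A (z(k := s)) \<partial>lborel \<partial>config_lborel k)"
  proof (rule nn_integral_cong)
    fix z :: "nat \<Rightarrow> 'a" assume z: "z \<in> space (config_lborel k)"
    have "z \<in> space (config_space k)" using z by (simp add: space_PiM)
    then have "(\<lambda>s. z(k := s)) \<in> measurable borel (config_space m)"
      unfolding m_def lessThan_Suc by (intro measurable_fun_upd[where J = "{..<k}"]) auto
    then have "(\<lambda>s. A (z(k := s))) \<in> borel_measurable borel" by measurable
    from nn_integral_lborel_affine[OF this, of "real n" "- ?S z"] n
    show "ennreal (real n ^ DIM('a)) * (\<integral>\<^sup>+s. A (z(k := real n *\<^sub>R s - ?S z)) \<partial>lborel) = (\<integral>\<^sup>+s. A (z(k := s)) \<partial>lborel)"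
      by simp
  qed
  also have "\<dots> = (\<integral>\<^sup>+x. A x \<partial>config_lborel m)"
    unfolding m_def lessThan_Suc
    by (subst lborel_product.product_nn_integral_insert) (auto simp: lessThan_Suc[symmetric] m_def[symmetric])
  finally show ?thesis using lhs 2 by simp
qed

text \<open>In a centered configuration \<open>x i\<close> is the average of the differences
  \<open>x i - x j\<close>. Instead of Jensen's inequality, the bound
  \<open>s powr (l - 1) * v - s powr l \<le> v powr l\<close> is summed over \<open>j\<close>. With
  \<open>s\<close> half of \<open>norm (x i)\<close>, the left-hand sides add up to at least
  \<open>n * s powr l\<close>.\<close>

lemma centered_pair_moment:
  fixes x :: "nat \<Rightarrow> 'a::euclidean_space"
  assumes x: "(\<Sum>i<n. x i) = 0" and i: "i < n" and l: "1 \<le> l"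
  shows "(norm (x i) / 2) powr l \<le> (\<Sum>j<n. norm (x i - x j) powr l) / real n"
proof (cases "norm (x i) = 0")
  case True
  then show ?thesis using l by (simp add: sum_nonneg)
next
  case False
  define s where "s = norm (x i) / 2"
  have s: "s > 0" using False by (simp add: s_def)
  have n: "real n > 0" using i by simp
  have pt: "s powr (l - 1) * v - s powr l \<le> v powr l" if "0 \<le> v" for v
  proof (cases "s \<le> v")
    case True
    have "s powr (l - 1) * v \<le> v powr (l - 1) * v" using True s l by (intro mult_right_mono powr_mono2) auto
    also have "\<dots> = v powr l" using True s by (simp add: powr_mult_base mult.commute[of "_ powr _"])
    finally show ?thesis using powr_ge_zero[of s l] by linarith
  next
    case False
    then have "s powr (l - 1) * v \<le> s powr (l - 1) * s" by (intro mult_left_mono) auto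
    also have "\<dots> = s powr l" using s by (simp add: powr_mult_base mult.commute[of "_ powr _"])
    finally show ?thesis using powr_ge_zero[of v l] by linarith
  qed
  have "real n * norm (x i) = norm (\<Sum>j<n. x i - x j)"
    using x by (simp add: sum_subtractf sum_constant_scaleR)
  also have "\<dots> \<le> (\<Sum>j<n. norm (x i - x j))" by (rule norm_sum)
  finally have "s powr (l - 1) * (real n * norm (x i)) - real n * s powr l
      \<le> s powr (l - 1) * (\<Sum>j<n. norm (x i - x j)) - real n * s powr l"
    by (intro diff_right_mono mult_left_mono) auto
  also have "\<dots> = (\<Sum>j<n. s powr (l - 1) * norm (x i - x j) - s powr l)"
    by (simp add: sum_subtractf sum_distrib_left)
  also have "\<dots> \<le> (\<Sum>j<n. norm (x i - x j) powr l)" by (intro sum_mono pt) simp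
  finally have "s powr (l - 1) * (real n * norm (x i)) - real n * s powr l \<le> (\<Sum>j<n. norm (x i - x j) powr l)" .
  moreover have "s powr (l - 1) * (real n * norm (x i)) = 2 * real n * (s powr (l - 1) * s)"
    by (simp add: s_def)
  moreover have "s powr (l - 1) * s = s powr l" using s by (simp add: powr_mult_base mult.commute[of "_ powr _"])
  ultimately have "real n * s powr l \<le> (\<Sum>j<n. norm (x i - x j) powr l)" by simp
  then show ?thesis using n by (simp add: s_def field_simps)
qed

subsection \<open>Entropy and its dual description\<close>

lemma nn_integral_exp_abs:
  fixes c :: real
  assumes c: "0 < c"
  shows "(\<integral>\<^sup>+t. ennreal (exp (- c * \<bar>t\<bar>)) \<partial>lborel) < \<infinity>"
proof -
  let ?e = "\<lambda>t. ennreal (exponential_density c t)"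
  interpret prob_space "density lborel (exponential_density c)"
    by (rule prob_space_exponential_density[OF c])
  have 1: "(\<integral>\<^sup>+t. ?e t \<partial>lborel) = 1"
    using emeasure_space_1 by (simp add: emeasure_density)
  have 2: "(\<integral>\<^sup>+t. ?e (- t) \<partial>lborel) = 1"
    using nn_integral_real_affine[of ?e "-1" 0] 1 by simp
  have "(\<integral>\<^sup>+t. ennreal (exp (- c * \<bar>t\<bar>)) \<partial>lborel) \<le> (\<integral>\<^sup>+t. ennreal (1 / c) * (?e t + ?e (- t)) \<partial>lborel)"
  proof (intro nn_integral_mono)
    fix t
    have "exp (- c * \<bar>t\<bar>) \<le> 1 / c * (exponential_density c t + exponential_density c (- t))"
      using c by (auto simp: exponential_density_def abs_if field_simps)
    then have "ennreal (exp (- c * \<bar>t\<bar>)) \<le> ennreal (1 / c * (exponential_density c t + exponential_density c (- t)))"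
      by (rule ennreal_leI)
    also have "\<dots> = ennreal (1 / c) * (?e t + ?e (- t))"
      using c by (subst ennreal_mult) (auto simp: exponential_density_def intro!: add_nonneg_nonneg)
    finally show "ennreal (exp (- c * \<bar>t\<bar>)) \<le> ennreal (1 / c) * (?e t + ?e (- t))" .
  qed
  also have "\<dots> = ennreal (1 / c) * (1 + 1)"
    by (subst nn_integral_cmult) (auto simp: nn_integral_add 1 2)
  also have "\<dots> < \<infinity>" by (simp add: ennreal_mult_less_top)
  finally show ?thesis .
qed

text \<open>The sum of the absolute coordinates is at most \<open>d * norm x\<close>, so the
  integrand is dominated by a product of one-dimensional exponentials.\<close>

lemma nn_integral_exp_norm:
  fixes c :: real
  assumes c: "0 < c"
  shows "(\<integral>\<^sup>+x. ennreal (exp (- c * norm (x :: 'a::euclidean_space))) \<partial>lborel) < \<infinity>"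
proof -
  define d where "d = real DIM('a)"
  have d: "d > 0" by (simp add: d_def)
  let ?f = "\<lambda>t. ennreal (exp (- (c / d) * \<bar>t\<bar>))"
  have "(\<integral>\<^sup>+x. ennreal (exp (- c * norm (x :: 'a))) \<partial>lborel) \<le> (\<integral>\<^sup>+(x::'a). (\<Prod>b\<in>Basis. ?f (x \<bullet> b)) \<partial>lborel)"
  proof (intro nn_integral_mono)
    fix x :: 'a
    have "(\<Sum>b\<in>Basis. \<bar>x \<bullet> b\<bar>) \<le> (\<Sum>b\<in>(Basis :: 'a set). norm x)" by (intro sum_mono Basis_le_norm)
    then have "c * (\<Sum>b\<in>Basis. \<bar>x \<bullet> b\<bar>) \<le> c * (d * norm x)" using c by (intro mult_left_mono) (auto simp: d_def)
    then have "c / d * (\<Sum>b\<in>Basis. \<bar>x \<bullet> b\<bar>) \<le> c * norm x" using d by (simp add: field_simps)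
    moreover have "(\<Sum>b\<in>Basis. - (c / d) * \<bar>x \<bullet> b\<bar>) = - (c / d * (\<Sum>b\<in>Basis. \<bar>x \<bullet> b\<bar>))"
      by (simp only: sum_distrib_left mult_minus_left sum_negf)
    ultimately have "- c * norm x \<le> (\<Sum>b\<in>Basis. - (c / d) * \<bar>x \<bullet> b\<bar>)" by simp
    then have "exp (- c * norm x) \<le> (\<Prod>b\<in>Basis. exp (- (c / d) * \<bar>x \<bullet> b\<bar>))"
      by (simp add: exp_sum[symmetric])
    then have "ennreal (exp (- c * norm x)) \<le> ennreal (\<Prod>b\<in>Basis. exp (- (c / d) * \<bar>x \<bullet> b\<bar>))"
      by (rule ennreal_leI)
    also have "\<dots> = (\<Prod>b\<in>Basis. ?f (x \<bullet> b))" by (subst prod_ennreal) auto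
    finally show "ennreal (exp (- c * norm x)) \<le> (\<Prod>b\<in>Basis. ?f (x \<bullet> b))" .
  qed
  also have "\<dots> = (\<Prod>b\<in>(Basis :: 'a set). \<integral>\<^sup>+t. ?f t \<partial>lborel)"
    by (rule nn_integral_lborel_prod) auto
  also have "\<dots> < \<infinity>"
    using nn_integral_exp_abs[of "c / d"] c d by (simp add: power_less_top_ennreal)
  finally show ?thesis .
qed

lemma norm_le_powr:
  fixes r l :: real
  assumes "0 \<le> r" "1 \<le> l" shows "r - 1 \<le> r powr l"
proof (cases "r \<le> 1")
  case False
  then show ?thesis using powr_mono[of 1 l r] assms by simp
qed (use powr_ge_zero[of r l] in linarith)

text \<open>Unnormalised density of the finite reference measure that takes the place of Lebesgue
  measure in the exponential estimates.\<close>

definition stretched_exp :: "real \<Rightarrow> real \<Rightarrow> 'a::euclidean_space \<Rightarrow> real" where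
  "stretched_exp b l x = exp (- b * norm x powr l)"

lemma stretched_exp_bounds: "0 < stretched_exp b l x" "0 \<le> b \<Longrightarrow> stretched_exp b l x \<le> 1"
  by (auto simp: stretched_exp_def)

lemma borel_measurable_stretched_exp [measurable]: "stretched_exp b l \<in> borel_measurable borel"
  unfolding stretched_exp_def by measurable

lemma integrable_exp_stretched:
  assumes b: "0 \<le> s" "s < b" and l: "1 \<le> l"
  shows "integrable lborel (\<lambda>x :: 'a::euclidean_space. exp (s * norm x) * stretched_exp b l x)"
proof (rule integrableI_nonneg)
  have "(\<integral>\<^sup>+(x::'a). ennreal (exp (s * norm x) * stretched_exp b l x) \<partial>lborel)
      \<le> (\<integral>\<^sup>+(x::'a). ennreal (exp b) * ennreal (exp (- (b - s) * norm x)) \<partial>lborel)"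
  proof (intro nn_integral_mono)
    fix x :: 'a
    have "b * (norm x - 1) \<le> b * norm x powr l" using norm_le_powr[OF _ l, of "norm x"] b by (intro mult_left_mono) auto
    then have "exp (s * norm x) * stretched_exp b l x \<le> exp b * exp (- (b - s) * norm x)"
      by (simp add: stretched_exp_def exp_add[symmetric] algebra_simps)
    then show "ennreal (exp (s * norm x) * stretched_exp b l x) \<le> ennreal (exp b) * ennreal (exp (- (b - s) * norm x))"
      by (simp add: ennreal_mult[symmetric] ennreal_leI)
  qed
  also have "\<dots> = ennreal (exp b) * (\<integral>\<^sup>+(x::'a). ennreal (exp (- (b - s) * norm x)) \<partial>lborel)"
    by (rule nn_integral_cmult) measurable
  also have "\<dots> < \<infinity>" using nn_integral_exp_norm[of "b - s", where 'a = 'a] b by (simp add: ennreal_mult_less_top)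
  finally show "(\<integral>\<^sup>+(x::'a). ennreal (exp (s * norm x) * stretched_exp b l x) \<partial>lborel) < \<infinity>" .
qed (auto simp: stretched_exp_def)

lemma integrable_stretched_exp:
  assumes "0 < b" "1 \<le> l"
  shows "integrable lborel (stretched_exp b l :: 'a::euclidean_space \<Rightarrow> real)"
  using integrable_exp_stretched[of 0 b l] assms by simp

definition dens :: "'a::euclidean_space measure \<Rightarrow> 'a \<Rightarrow> real" where
  "dens \<mu> x = enn2real (RN_deriv lborel \<mu> x)"

lemma dens_nonneg [simp]: "0 \<le> dens \<mu> x" by (simp add: dens_def)

lemma borel_measurable_dens [measurable]: "dens \<mu> \<in> borel_measurable borel"
proof -
  have "dens \<mu> \<in> borel_measurable lborel" unfolding dens_def by measurable
  then show ?thesis by simp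
qed

lemma density_dens:
  assumes \<mu>: "\<mu> \<in> prob_measures" and ex: "\<exists>f\<in>borel_measurable lborel. density lborel f = \<mu>"
  shows "density lborel (\<lambda>x. ennreal (dens \<mu> x)) = \<mu>"
proof -
  interpret prob_space \<mu> using prob_measuresD[OF \<mu>] by simp
  obtain f where f: "f \<in> borel_measurable lborel" "density lborel f = \<mu>" using ex by blast
  have ac: "absolutely_continuous lborel \<mu>" using absolutely_continuousI_density[OF f(1)] f(2) by simp
  have sets: "sets \<mu> = sets lborel" using prob_measuresD[OF \<mu>] by simp
  have "AE x in lborel. RN_deriv lborel \<mu> x \<noteq> \<infinity>"
    by (rule sigma_finite_measure.RN_deriv_finite[OF lborel.sigma_finite_measure_axioms _ ac sets]) unfold_locales
  then have "AE x in lborel. RN_deriv lborel \<mu> x = ennreal (dens \<mu> x)"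
    by eventually_elim (auto simp: dens_def ennreal_enn2real_if)
  then have "density lborel (RN_deriv lborel \<mu>) = density lborel (\<lambda>x. ennreal (dens \<mu> x))"
    by (intro density_cong) auto
  then show ?thesis using sigma_finite_measure.density_RN_deriv[OF lborel.sigma_finite_measure_axioms ac sets] by simp
qed

lemma integrable_density_iff:
  assumes \<mu>: "\<mu> \<in> prob_measures" and ex: "\<exists>f\<in>borel_measurable lborel. density lborel f = \<mu>"
    and [measurable]: "f \<in> borel_measurable borel"
  shows "integrable \<mu> f \<longleftrightarrow> integrable lborel (\<lambda>x. dens \<mu> x * f x)"
    and "(\<integral>x. f x \<partial>\<mu>) = (\<integral>x. dens \<mu> x * f x \<partial>lborel)"
  by (subst density_dens[OF \<mu> ex, symmetric], subst integrable_density integral_density; simp)+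

text \<open>Two regimes with \<open>r = norm x\<close>. If \<open>t \<ge> exp (- r)\<close>, then
  \<open>- ln t \<le> r\<close> and the first moment gives the bound; otherwise
  \<open>- (t * ln t) \<le> 2 * sqrt t\<close>, which is at most \<open>2 * exp (- r / 2)\<close>
  and hence integrable.\<close>

lemma neg_entropy_finite:
  assumes \<mu>: "\<mu> \<in> prob_measures_p 1" and ex: "\<exists>f\<in>borel_measurable lborel. density lborel f = \<mu>"
  shows "(\<integral>\<^sup>+x. ennreal (- (dens \<mu> x * ln (dens \<mu> x))) \<partial>lborel) < \<infinity>"
proof -
  note \<mu>p = prob_measures_pD(1)[OF \<mu>]
  have pt: "- (t * ln t) \<le> t * r + 2 * exp (- (1/2) * r)" if t: "0 \<le> t" and r: "0 \<le> r" for t r :: real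
  proof (cases "t = 0")
    case False
    then have t: "0 < t" using t by simp
    show ?thesis
    proof (cases "exp (- r) \<le> t")
      case True
      then have "- r \<le> ln t" using t by (simp add: ln_ge_iff)
      then have "t * (- ln t) \<le> t * r" using t by (intro mult_left_mono) auto
      moreover have "t * (- ln t) = - (t * ln t)" "0 \<le> 2 * exp (- (1/2) * r)" by simp_all
      ultimately show ?thesis by linarith
    next
      case False
      define s where "s = sqrt t"
      have s: "0 < s" "t = s * s" using t by (auto simp: s_def)
      have "ln (1 / s) \<le> 1 / s - 1" using s by (intro ln_le_minus_one) auto
      then have "s * (- ln s) \<le> s * (1 / s)" using s by (intro mult_left_mono) (auto simp: ln_div)
      then have "2 * s * (s * (- ln s)) \<le> 2 * s * 1" using s by (intro mult_left_mono) auto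
      then have "- (t * ln t) \<le> 2 * s" using s by (simp add: ln_mult algebra_simps)
      also have "s \<le> exp (- (1/2) * r)"
      proof -
        have "s * s \<le> exp (- (1/2) * r) * exp (- (1/2) * r)"
          using False s by (simp add: exp_add[symmetric])
        then show ?thesis using s by (meson exp_ge_zero less_le_not_le mult_strict_mono not_le)
      qed
      finally have "- (t * ln t) \<le> 2 * exp (- (1/2) * r)" by simp
      moreover have "0 \<le> t * r" using t r by simp
      ultimately show ?thesis by linarith
    qed
  qed simp
  have int1: "integrable lborel (\<lambda>x. dens \<mu> x * norm x)"
    using integrable_moment[OF \<mu>] integrable_density_iff(1)[OF \<mu>p ex, of norm] by simp
  have "(\<integral>\<^sup>+x. ennreal (- (dens \<mu> x * ln (dens \<mu> x))) \<partial>lborel)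
      \<le> (\<integral>\<^sup>+x. ennreal (dens \<mu> x * norm x) + 2 * ennreal (exp (- (1/2) * norm x)) \<partial>lborel)"
  proof (intro nn_integral_mono)
    fix x
    have "ennreal (- (dens \<mu> x * ln (dens \<mu> x))) \<le> ennreal (dens \<mu> x * norm x + 2 * exp (- (1/2) * norm x))"
      by (intro ennreal_leI pt) auto
    also have "\<dots> = ennreal (dens \<mu> x * norm x) + 2 * ennreal (exp (- (1/2) * norm x))"
      by (subst ennreal_plus) (auto simp: ennreal_mult)
    finally show "ennreal (- (dens \<mu> x * ln (dens \<mu> x))) \<le> ennreal (dens \<mu> x * norm x) + 2 * ennreal (exp (- (1/2) * norm x))" .
  qed
  also have "\<dots> = (\<integral>\<^sup>+x. ennreal (dens \<mu> x * norm x) \<partial>lborel) + 2 * (\<integral>\<^sup>+(x::'a). ennreal (exp (- (1/2) * norm x)) \<partial>lborel)"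
    by (subst nn_integral_add) (auto simp: nn_integral_cmult)
  also have "\<dots> < \<infinity>"
    using nn_integral_exp_norm[of "1/2", where 'a = 'a] integrableD(2)[OF int1]
    by (simp add: ennreal_mult_less_top less_top)
  finally show ?thesis .
qed

lemma entropy_functional_unfold:
  assumes "\<mu> \<in> prob_measures_p 1" "\<exists>f\<in>borel_measurable lborel. density lborel f = \<mu>"
  shows "entropy_functional \<mu> = enn2ereal (\<integral>\<^sup>+x. ennreal (dens \<mu> x * ln (dens \<mu> x)) \<partial>lborel)
              - enn2ereal (\<integral>\<^sup>+x. ennreal (- (dens \<mu> x * ln (dens \<mu> x))) \<partial>lborel)"
  using assms by (simp add: entropy_functional_def dens_def)

lemma entropy_functional_gt_MInf: "entropy_functional \<mu> \<noteq> - \<infinity>"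
proof (cases "\<mu> \<in> prob_measures_p 1 \<and> (\<exists>f\<in>borel_measurable lborel. density lborel f = \<mu>)")
  case True
  then have "(\<integral>\<^sup>+x. ennreal (- (dens \<mu> x * ln (dens \<mu> x))) \<partial>lborel) < \<infinity>"
    by (intro neg_entropy_finite) auto
  then obtain r where "0 \<le> r" "(\<integral>\<^sup>+x. ennreal (- (dens \<mu> x * ln (dens \<mu> x))) \<partial>lborel) = ennreal r"
    by (auto simp: less_top_ennreal)
  then show ?thesis
    using True entropy_functional_unfold[of \<mu>]
    by (cases "\<integral>\<^sup>+x. ennreal (dens \<mu> x * ln (dens \<mu> x)) \<partial>lborel") auto
next
  case False
  then have "entropy_functional \<mu> = \<infinity>" unfolding entropy_functional_def by (rule if_not_P)
  then show ?thesis by simp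
qed

lemma entropy_functional_finiteD:
  assumes fin: "entropy_functional \<mu> < \<infinity>"
  shows "\<mu> \<in> prob_measures_p 1" "\<exists>f\<in>borel_measurable lborel. density lborel f = \<mu>"
    "integrable \<mu> (\<lambda>x. ln (dens \<mu> x))" "entropy_functional \<mu> = ereal (\<integral>x. ln (dens \<mu> x) \<partial>\<mu>)"
proof -
  have *: "\<mu> \<in> prob_measures_p 1 \<and> (\<exists>f\<in>borel_measurable lborel. density lborel f = \<mu>)"
  proof (rule ccontr)
    assume "\<not> ?thesis"
    then have "entropy_functional \<mu> = \<infinity>" unfolding entropy_functional_def by (rule if_not_P)
    then show False using fin by simp
  qed
  then show \<mu>: "\<mu> \<in> prob_measures_p 1" and ex: "\<exists>f\<in>borel_measurable lborel. density lborel f = \<mu>" by auto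
  note \<mu>p = prob_measures_pD(1)[OF \<mu>]
  let ?g = "\<lambda>x. dens \<mu> x * ln (dens \<mu> x)"
  have neg: "(\<integral>\<^sup>+x. ennreal (- ?g x) \<partial>lborel) < \<infinity>" by (rule neg_entropy_finite[OF \<mu> ex])
  have pos: "(\<integral>\<^sup>+x. ennreal (?g x) \<partial>lborel) < \<infinity>"
  proof (rule ccontr)
    assume "\<not> ?thesis"
    then have "(\<integral>\<^sup>+x. ennreal (?g x) \<partial>lborel) = \<infinity>" by (simp add: less_top[symmetric])
    then have "entropy_functional \<mu> = \<infinity>" using neg by (simp add: entropy_functional_unfold[OF \<mu> ex])
    then show False using fin by simp
  qed
  have int: "integrable lborel ?g"
    using pos neg by (simp add: real_integrable_def less_top)
  then show int': "integrable \<mu> (\<lambda>x. ln (dens \<mu> x))" by (subst integrable_density_iff[OF \<mu>p ex]) auto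
  have "(\<integral>x. ln (dens \<mu> x) \<partial>\<mu>) = (\<integral>x. ?g x \<partial>lborel)" by (subst integrable_density_iff(2)[OF \<mu>p ex]) auto
  also have "\<dots> = enn2real (\<integral>\<^sup>+x. ennreal (?g x) \<partial>lborel) - enn2real (\<integral>\<^sup>+x. ennreal (- ?g x) \<partial>lborel)"
    by (rule real_lebesgue_integral_def[OF int])
  also have "ereal \<dots> = entropy_functional \<mu>"
    unfolding entropy_functional_unfold[OF \<mu> ex] using pos neg
    by (cases "\<integral>\<^sup>+x. ennreal (?g x) \<partial>lborel"; cases "\<integral>\<^sup>+x. ennreal (- ?g x) \<partial>lborel") auto
  finally show "entropy_functional \<mu> = ereal (\<integral>x. ln (dens \<mu> x) \<partial>\<mu>)" by simp
qed

section \<open>From the dual inequality to the entropy\<close>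

text \<open>\<open>dual\<close> is a Donsker-Varadhan inequality relative to the density
  \<open>stretched_exp b l\<close>, available for continuous test functions only. Everything that
  enters the definition of the entropy has to be extracted from it: the first moment, the existence
  of a density, and the bound itself.\<close>

locale dual_entropy_bound =
  fixes \<mu> :: "'a::euclidean_space measure" and b l c :: real
  assumes \<mu>: "\<mu> \<in> prob_measures" and b: "0 < b" and l: "1 \<le> l"
    and dual: "\<And>\<phi> :: 'a \<Rightarrow> real. continuous_on UNIV \<phi> \<Longrightarrow> bounded (range \<phi>) \<Longrightarrow>
      (\<integral>x. \<phi> x \<partial>\<mu>) \<le> c + ln (\<integral>x. exp (\<phi> x) * stretched_exp b l x \<partial>lborel)"
begin

abbreviation h :: "'a \<Rightarrow> real" where "h \<equiv> stretched_exp b l"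

definition z :: real where "z = (\<integral>x. h x \<partial>lborel)"

lemma h0: "0 < h x" "0 \<le> h x" and h1: "h x \<le> 1"
  using b by (auto simp: stretched_exp_bounds less_imp_le)

lemma h_int: "integrable lborel h" by (rule integrable_stretched_exp[OF b l])

lemma mu_sets: "sets \<mu> = sets borel" by (rule prob_measuresD(1)[OF \<mu>])

lemma mu_space [simp]: "space \<mu> = UNIV" by (rule prob_measuresD(3)[OF \<mu>])

sublocale prob_space \<mu> by (rule prob_measuresD(2)[OF \<mu>])

lemma exp_h_int:
  assumes [measurable]: "\<phi> \<in> borel_measurable borel" and B: "\<And>x. \<phi> x \<le> B"
  shows "integrable lborel (\<lambda>x. exp (\<phi> x) * h x)"
proof (rule Bochner_Integration.integrable_bound[of _ "\<lambda>x. exp B * h x"])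
  show "integrable lborel (\<lambda>x. exp B * h x)" using h_int by simp
qed (use B h0 in \<open>auto simp: abs_mult intro!: mult_right_mono\<close>)

lemma exp_h_pos:
  assumes [measurable]: "\<phi> \<in> borel_measurable borel" and B: "\<And>x. \<phi> x \<le> B"
  shows "0 < (\<integral>x. exp (\<phi> x) * h x \<partial>lborel)"
proof -
  have "0 \<le> (\<integral>x. exp (\<phi> x) * h x \<partial>lborel)" using h0 by (intro integral_nonneg_AE) auto
  moreover have "(\<integral>x. exp (\<phi> x) * h x \<partial>lborel) \<noteq> 0"
  proof
    assume "(\<integral>x. exp (\<phi> x) * h x \<partial>lborel) = 0"
    then have "AE x in lborel. exp (\<phi> x) * h x = 0"
      using exp_h_int[of \<phi> B] B h0 by (subst (asm) integral_nonneg_eq_0_iff_AE) auto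
    then have "AE x in (lborel :: 'a measure). False" using h0 by (auto simp: less_imp_neq[symmetric])
    then obtain N where "UNIV \<subseteq> N" "emeasure (lborel :: 'a measure) N = 0" by (rule AE_E) auto
    then show False using emeasure_lborel_UNIV[where 'a = 'a] by (simp add: top.extremum_unique)
  qed
  ultimately show ?thesis by simp
qed

lemma z_pos: "0 < z"
  using exp_h_pos[of "\<lambda>_. 0" 0] by (simp add: z_def)

lemma dual_le:
  assumes "continuous_on UNIV \<phi>" "bounded (range \<phi>)" "(\<integral>x. exp (\<phi> x) * h x \<partial>lborel) \<le> K"
  shows "(\<integral>x. \<phi> x \<partial>\<mu>) \<le> c + ln K"
proof -
  obtain B where "\<And>x. \<phi> x \<le> B" using assms(2) by (auto simp: bounded_iff abs_le_iff)
  then have "0 < (\<integral>x. exp (\<phi> x) * h x \<partial>lborel)"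
    using borel_measurable_continuous_onI[OF assms(1)] by (intro exp_h_pos) auto
  then have "ln (\<integral>x. exp (\<phi> x) * h x \<partial>lborel) \<le> ln K" using assms(3) by simp
  then show ?thesis using dual[OF assms(1,2)] by linarith
qed

text \<open>Test with truncations of \<open>s * norm x\<close>: for \<open>s < b\<close> the
  function \<open>exp (s * norm x)\<close> is still integrable against the reference density, as
  \<open>l \<ge> 1\<close>.\<close>

lemma first_moment: "\<mu> \<in> prob_measures_p 1"
proof -
  note [measurable_cong] = mu_sets
  obtain s where s: "0 < s" "s < b" using b dense by blast
  define K where "K = (\<integral>x. exp (s * norm x) * h x \<partial>lborel)"
  have Kint: "integrable lborel (\<lambda>x. exp (s * norm x) * h x)"
    using s by (intro integrable_exp_stretched l) auto
  let ?\<phi> = "\<lambda>N x. min (s * norm x) (real N)"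
  have \<phi>B: "norm (?\<phi> N x) \<le> real N" for N :: nat and x 
  proof -
    have "0 \<le> s * norm x" using s by simp
    then show ?thesis by (simp add: min_def)
  qed
  have bound: "(\<integral>x. ?\<phi> N x \<partial>\<mu>) \<le> c + ln K" for N :: nat
  proof (rule dual_le)
    show "continuous_on UNIV (?\<phi> N)" by (intro continuous_intros)
    show "bounded (range (?\<phi> N))" using \<phi>B by (intro boundedI[of _ "real N"]) auto
    show "(\<integral>x. exp (?\<phi> N x) * h x \<partial>lborel) \<le> K" unfolding K_def
      using h0 by (intro integral_mono Kint exp_h_int[of _ "real N"]) (auto intro!: mult_right_mono)
  qed
  have "(\<integral>\<^sup>+x. ennreal (s * norm x) \<partial>\<mu>) = (\<integral>\<^sup>+x. (SUP N. ennreal (?\<phi> N x)) \<partial>\<mu>)"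
  proof (intro nn_integral_cong antisym)
    fix x
    obtain N :: nat where "s * norm x \<le> real N" using real_arch_simple by blast
    then show "ennreal (s * norm x) \<le> (SUP N. ennreal (?\<phi> N x))"
      by (intro SUP_upper2[of N]) (auto simp: min_def)
    show "(SUP N. ennreal (?\<phi> N x)) \<le> ennreal (s * norm x)" by (intro SUP_least ennreal_leI) auto
  qed
  also have "\<dots> = (SUP N. \<integral>\<^sup>+x. ennreal (?\<phi> N x) \<partial>\<mu>)"
  proof (rule nn_integral_monotone_convergence_SUP)
    show "incseq (\<lambda>N x. ennreal (?\<phi> N x))"
      unfolding incseq_def le_fun_def by (intro allI impI ennreal_leI min.mono order_refl) simp
  qed measurable
  also have "\<dots> \<le> ennreal (c + ln K)"
  proof (intro SUP_least)
    fix N :: nat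
    have "integrable \<mu> (?\<phi> N)" using \<phi>B by (intro integrable_const_bound[of _ "real N"]) auto
    then show "(\<integral>\<^sup>+x. ennreal (?\<phi> N x) \<partial>\<mu>) \<le> ennreal (c + ln K)"
      using bound s by (subst nn_integral_eq_integral) (auto intro!: ennreal_leI)
  qed
  finally have "(\<integral>\<^sup>+x. ennreal (s) * ennreal (norm x) \<partial>\<mu>) \<le> ennreal (c + ln K)"
    using s by (simp add: ennreal_mult[symmetric])
  then have "ennreal (s) * (\<integral>\<^sup>+x. ennreal (norm x) \<partial>\<mu>) < \<infinity>"
    by (subst (asm) nn_integral_cmult) (auto simp: less_top[symmetric] top_unique)
  then have "(\<integral>\<^sup>+x. ennreal (norm x) \<partial>\<mu>) < \<infinity>" using s by (auto simp: ennreal_mult_less_top)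
  then show ?thesis using \<mu> by (simp add: prob_measures_p_def)
qed

text \<open>Test with continuous approximations from below of \<open>N\<close> times the indicator
  of \<open>U\<close>. The exponential adds at most \<open>exp N\<close> times the volume of
  \<open>U\<close> to the integral \<open>z\<close>, and this is at most \<open>1\<close>.\<close>

lemma open_bound:
  assumes U: "open U" "emeasure lborel U < ennreal (exp (- real N))"
  shows "real N * measure \<mu> U \<le> c + ln (z + 1)"
proof -
  note [measurable_cong] = mu_sets
  have UN: "U \<noteq> UNIV" using U(2) by auto
  let ?f = "\<lambda>j x. min 1 (real j * infdist x (- U))"
  have fc: "continuous_on UNIV (?f j)" for j :: nat by (intro continuous_intros)
  have [measurable]: "(\<lambda>x. infdist x (- U)) \<in> borel_measurable borel"
    by (intro borel_measurable_continuous_onI continuous_intros)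
  have f01: "0 \<le> ?f j x" "?f j x \<le> 1" for j :: nat and x by (auto simp: infdist_nonneg)
  have fU: "?f j x = 0" if "x \<notin> U" for j :: nat and x using that by simp
  have flim: "(\<lambda>j. ?f j x) \<longlonglongrightarrow> indicator U x" for x
  proof (cases "x \<in> U")
    case True
    then have pos: "infdist x (- U) > 0"
      using U UN by (intro infdist_pos_not_in_closed) auto
    have "\<forall>\<^sub>F k in sequentially. 1 / infdist x (- U) \<le> real k"
      by (rule eventually_sequentiallyI[of "nat \<lceil>1 / infdist x (- U)\<rceil>"]) linarith
    then have "\<forall>\<^sub>F k in sequentially. ?f k x = 1"
      by eventually_elim (use pos in \<open>simp add: field_simps min_absorb1\<close>)
    then show ?thesis using True by (simp add: tendsto_eventually)
  next
    case False
    then show ?thesis by simp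
  qed
  have [measurable]: "U \<in> sets borel" using U by simp
  have mU: "measure lborel U \<le> exp (- real N)"
    using U(2) by (simp add: measure_def) (metis enn2real_leI exp_ge_zero less_imp_le)
  have Ufin: "emeasure lborel U < \<infinity>" using order_less_trans[OF U(2) ennreal_less_top] by simp
  have "(\<integral>x. real N * ?f j x \<partial>\<mu>) \<le> c + ln (z + 1)" for j :: nat
  proof (rule dual_le)
    show "continuous_on UNIV (\<lambda>x. real N * ?f j x)" by (intro continuous_intros)
    show "bounded (range (\<lambda>x. real N * ?f j x))"
      using f01 by (intro boundedI[of _ "real N"]) (auto simp: abs_mult mult_left_le)
    have "(\<integral>x. exp (real N * ?f j x) * h x \<partial>lborel) \<le> (\<integral>x. h x + exp (real N) * indicator U x \<partial>lborel)"
    proof (intro integral_mono)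
      show "integrable lborel (\<lambda>x. exp (real N * ?f j x) * h x)"
        using f01 by (intro exp_h_int[of _ "real N"]) (auto simp: mult_left_le)
      show "integrable lborel (\<lambda>x. h x + exp (real N) * indicator U x)"
        using h_int Ufin by (intro Bochner_Integration.integrable_add integrable_mult_right integrable_real_indicator) auto
      fix x
      show "exp (real N * ?f j x) * h x \<le> h x + exp (real N) * indicator U x"
      proof (cases "x \<in> U")
        case True
        have "exp (real N * ?f j x) * h x \<le> exp (real N) * 1"
          using f01(2)[of j x] h0 h1 by (intro mult_mono) (auto simp: mult_left_le)
        then show ?thesis using True h0(2)[of x] by simp
      next
        case False
        then show ?thesis by (simp add: fU)
      qed
    qed
    also have "\<dots> = z + exp (real N) * measure lborel U"
      using h_int Ufin by (subst Bochner_Integration.integral_add) (auto simp: z_def)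
    also have "\<dots> \<le> z + exp (real N) * exp (- real N)"
      using mU by (intro add_left_mono mult_left_mono) auto
    finally show "(\<integral>x. exp (real N * ?f j x) * h x \<partial>lborel) \<le> z + 1" by (simp add: exp_minus)
  qed
  moreover have "(\<lambda>j. \<integral>x. real N * ?f j x \<partial>\<mu>) \<longlonglongrightarrow> (\<integral>x. real N * indicator U x \<partial>\<mu>)"
  proof (rule integral_dominated_convergence[where w = "\<lambda>_. real N"])
    show "AE x in \<mu>. (\<lambda>j. real N * ?f j x) \<longlonglongrightarrow> real N * indicator U x"
      by (intro AE_I2 tendsto_mult tendsto_const flim)
    show "AE x in \<mu>. norm (real N * ?f j x) \<le> real N" for j
      using f01[of j] by (intro AE_I2) (simp add: abs_mult mult_left_le)
  qed auto
  ultimately have "(\<integral>x. real N * indicator U x \<partial>\<mu>) \<le> c + ln (z + 1)"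
    by (intro LIMSEQ_le_const2[of "\<lambda>j. \<integral>x. real N * ?f j x \<partial>\<mu>"]) auto
  then show ?thesis by simp
qed

text \<open>A Lebesgue null set lies in open sets of volume below \<open>exp (- N)\<close> for every
  \<open>N\<close>, so \<open>N\<close> times its \<open>\<mu>\<close>-measure stays
  bounded.\<close>

lemma abs_cont: "absolutely_continuous lborel \<mu>"
  unfolding absolutely_continuous_def
proof
  fix A :: "'a set" assume "A \<in> null_sets lborel"
  then have A: "A \<in> sets borel" "emeasure lborel A = 0" by (auto simp: null_sets_def)
  have "measure \<mu> A * real N \<le> c + ln (z + 1)" for N
  proof -
    obtain U where U: "open U" "A \<subseteq> U" "emeasure lborel (U - A) < ennreal (exp (- real N))"
      using outer_regular_lborel[OF A(1), of "exp (- real N)"] by auto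
    have "emeasure lborel U = emeasure lborel (U - A)"
      using A U by (subst emeasure_Diff_null_set) (auto simp: null_sets_def)
    then have "real N * measure \<mu> U \<le> c + ln (z + 1)" using U by (intro open_bound) auto
    moreover have "measure \<mu> A \<le> measure \<mu> U" using U A mu_sets by (intro finite_measure_mono) auto
    ultimately show ?thesis using mult_left_mono[of "measure \<mu> A" "measure \<mu> U" "real N"] by (simp add: mult.commute)
  qed
  then have "measure \<mu> A \<le> 0"
    using reals_Archimedean3[of "measure \<mu> A"] by (metis mult.commute not_le)
  then show "A \<in> null_sets \<mu>" using A mu_sets by (auto simp: null_sets_def emeasure_eq_measure measure_le_0_iff)
qed

lemma ex_density: "\<exists>f\<in>borel_measurable lborel. density lborel f = \<mu>"
  using sigma_finite_measure.density_RN_deriv[OF lborel.sigma_finite_measure_axioms abs_cont] mu_sets by (intro bexI[of _ "RN_deriv lborel \<mu>"]) auto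

text \<open>A Borel function is a limit of continuous ones off a Lebesgue null set. Absolute
  continuity makes this set \<open>\<mu>\<close>-null as well, so both sides pass to the limit by
  dominated convergence.\<close>

lemma dual_borel:
  assumes \<psi> [measurable]: "\<psi> \<in> borel_measurable borel" and B: "\<And>x. \<bar>\<psi> x\<bar> \<le> B"
  shows "(\<integral>x. \<psi> x \<partial>\<mu>) \<le> c + ln (\<integral>x. exp (\<psi> x) * h x \<partial>lborel)"
proof -
  note [measurable_cong] = mu_sets
  have "\<psi> \<in> borel_measurable lebesgue" using \<psi> by (intro borel_measurable_if_D measurable_completion) simp_all
  then have "\<psi> measurable_on UNIV" by (intro lebesgue_measurable_imp_measurable_on_real) auto
  then obtain N g where N: "negligible N" and g: "\<And>n. continuous_on UNIV (g n)"
    and lim: "\<And>x. x \<notin> N \<Longrightarrow> (\<lambda>n. g n x) \<longlonglongrightarrow> \<psi> x"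
    by (auto simp: measurable_on_def)
  define f where "f n x = max (- B) (min B (g n x))" for n :: nat and x
  have B0: "0 \<le> B" using B[of 0] by linarith
  have fc: "continuous_on UNIV (f n)" for n unfolding f_def by (intro continuous_intros g)
  have [measurable]: "f n \<in> borel_measurable borel" for n by (rule borel_measurable_continuous_onI[OF fc])
  have fB: "\<bar>f n x\<bar> \<le> B" for n x using B0 by (auto simp: f_def)
  have "AE x in lebesgue. x \<notin> N" using N by (simp add: negligible_iff_null_sets AE_not_in)
  then have AEN: "AE x in lborel. x \<notin> N" by (simp add: AE_completion_iff)
  have flim: "(\<lambda>n. f n x) \<longlonglongrightarrow> \<psi> x" if "x \<notin> N" for x
  proof -
    have "(\<lambda>n. f n x) \<longlonglongrightarrow> max (- B) (min B (\<psi> x))"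
      unfolding f_def by (intro tendsto_intros lim that)
    moreover have "max (- B) (min B (\<psi> x)) = \<psi> x" using B[of x] by (auto simp: min_def max_def abs_le_iff)
    ultimately show ?thesis by simp
  qed
  have AEmu: "AE x in \<mu>. x \<notin> N"
    using AEN by (subst density_dens[OF \<mu> ex_density, symmetric]) (auto simp: AE_density)
  have 1: "(\<lambda>n. \<integral>x. f n x \<partial>\<mu>) \<longlonglongrightarrow> (\<integral>x. \<psi> x \<partial>\<mu>)"
  proof (rule integral_dominated_convergence[where w = "\<lambda>_. B"])
    show "AE x in \<mu>. (\<lambda>n. f n x) \<longlonglongrightarrow> \<psi> x" using AEmu by eventually_elim (rule flim)
  qed (use fB in auto)
  have 2: "(\<lambda>n. \<integral>x. exp (f n x) * h x \<partial>lborel) \<longlonglongrightarrow> (\<integral>x. exp (\<psi> x) * h x \<partial>lborel)"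
  proof (rule integral_dominated_convergence[where w = "\<lambda>x. exp B * h x"])
    show "AE x in lborel. (\<lambda>n. exp (f n x) * h x) \<longlonglongrightarrow> exp (\<psi> x) * h x"
      using AEN by eventually_elim (intro tendsto_intros flim)
    show "AE x in lborel. norm (exp (f n x) * h x) \<le> exp B * h x" for n
      using fB[of n] h0 by (intro AE_I2) (auto simp: abs_mult abs_le_iff intro!: mult_right_mono)
  qed (use h_int in auto)
  have pos: "0 < (\<integral>x. exp (\<psi> x) * h x \<partial>lborel)" using B by (intro exp_h_pos[of _ B]) (auto simp: abs_le_iff)
  have "(\<lambda>n. c + ln (\<integral>x. exp (f n x) * h x \<partial>lborel)) \<longlonglongrightarrow> c + ln (\<integral>x. exp (\<psi> x) * h x \<partial>lborel)"
    using pos by (intro tendsto_intros tendsto_ln 2) auto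
  moreover have "(\<integral>x. f n x \<partial>\<mu>) \<le> c + ln (\<integral>x. exp (f n x) * h x \<partial>lborel)" for n
    using fB by (intro dual fc) (auto intro!: boundedI[of _ B])
  ultimately show ?thesis using LIMSEQ_le[OF 1] by blast
qed

text \<open>The optimal test function is the logarithm \<open>u\<close> of the density of
  \<open>\<mu>\<close> relative to the reference density. It is unbounded, and meaningless where
  \<open>dens \<mu>\<close> vanishes, so truncations are inserted and then removed by monotone
  convergence. The resulting bound on the integral of \<open>u\<close> passes to the entropy because
  \<open>u\<close> exceeds \<open>ln (dens \<mu>)\<close> by
  \<open>b * norm x powr l\<close>.\<close>

lemma entropy_le: "entropy_functional \<mu> \<le> ereal c"
proof -
  note [measurable_cong] = mu_sets
  let ?p = "dens \<mu>"
  define u where "u x = ln (?p x) + b * norm x powr l" for x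
  have u: "u x = ln (?p x / h x)" if "0 < ?p x" for x
    using that h0 by (simp add: u_def stretched_exp_def ln_div)
  have [measurable]: "u \<in> borel_measurable borel" unfolding u_def by measurable
  note di = integrable_density_iff[OF \<mu> ex_density]
  have p_int: "integrable lborel ?p" "(\<integral>x. ?p x \<partial>lborel) = 1"
    using di(1)[of "\<lambda>_. 1"] di(2)[of "\<lambda>_. 1"] prob_space by auto
  have AEp: "AE x in \<mu>. 0 < ?p x"
    by (subst density_dens[OF \<mu> ex_density, symmetric]) (auto simp: AE_density)
  \<comment> \<open>With \<open>t = h / p\<close> the integrand \<open>- (p * u)\<close> equals
    \<open>p * ln t\<close>, which is at most \<open>p * t = h\<close>; so the negative part is
    integrable.\<close>
  have uneg: "integrable \<mu> (\<lambda>x. max 0 (- u x))"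
  proof (subst di(1), measurable, rule Bochner_Integration.integrable_bound[OF h_int], measurable, intro AE_I2)
    fix x
    have "?p x * max 0 (- u x) \<le> h x"
    proof (cases "?p x = 0 \<or> 0 \<le> u x")
      case True
      then show ?thesis using h0(2)[of x] by auto
    next
      case False
      then have p: "0 < ?p x" using dens_nonneg[of \<mu> x] by linarith
      define t where "t = h x / ?p x"
      have t: "0 < t" "?p x * t = h x" using p h0 by (auto simp: t_def)
      have "- u x = ln t" using p h0 by (simp add: u t_def ln_div)
      also have "\<dots> \<le> t" using ln_le_minus_one[OF t(1)] by simp
      finally have "?p x * (- u x) \<le> ?p x * t" using p by (intro mult_left_mono) auto
      then show ?thesis using False t(2) by (simp add: max_def)
    qed
    then show "norm (?p x * max 0 (- u x)) \<le> norm (h x)" using h0(2)[of x] by simp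
  qed
  define un where "un = (\<integral>x. max 0 (- u x) \<partial>\<mu>)"
  \<comment> \<open>The value \<open>- k\<close> where the density vanishes ensures
    \<open>exp (\<psi> k) * h \<le> p + exp (- k) * h\<close> everywhere, and the right-hand side
    integrates to \<open>1 + exp (- k) * z\<close>.\<close>
  define \<psi> where "\<psi> k x = (if ?p x = 0 then - real k else max (- real k) (min (real k) (u x)))" for k x
  have [measurable]: "\<psi> k \<in> borel_measurable borel" for k unfolding \<psi>_def by measurable
  have \<psi>B: "\<bar>\<psi> k x\<bar> \<le> real k" for k x by (auto simp: \<psi>_def)
  have \<psi>bound: "(\<integral>x. \<psi> k x \<partial>\<mu>) \<le> c + exp (- real k) * z" for k
  proof -
    have "(\<integral>x. exp (\<psi> k x) * h x \<partial>lborel) \<le> (\<integral>x. ?p x + exp (- real k) * h x \<partial>lborel)"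
    proof (intro integral_mono)
      show "integrable lborel (\<lambda>x. exp (\<psi> k x) * h x)"
        using \<psi>B[of k] by (intro exp_h_int[of _ "real k"]) (auto simp: abs_le_iff)
      show "integrable lborel (\<lambda>x. ?p x + exp (- real k) * h x)" using p_int h_int by simp
      fix x
      show "exp (\<psi> k x) * h x \<le> ?p x + exp (- real k) * h x"
      proof (cases "?p x = 0 \<or> u x < - real k")
        case True
        then have "\<psi> k x = - real k" by (auto simp: \<psi>_def)
        then show ?thesis by simp
      next
        case False
        then have p: "0 < ?p x" using dens_nonneg[of \<mu> x] by linarith
        have "exp (\<psi> k x) * h x \<le> exp (u x) * h x" using False h0 by (intro mult_right_mono) (auto simp: \<psi>_def)
        also have "\<dots> = ?p x" using p h0[of x] by (simp add: u)
        finally show ?thesis using h0(2)[of x] by (simp add: add_increasing2)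
      qed
    qed
    also have "\<dots> = 1 + exp (- real k) * z" using p_int h_int by (simp add: z_def)
    finally have le: "(\<integral>x. exp (\<psi> k x) * h x \<partial>lborel) \<le> 1 + exp (- real k) * z" .
    have pos: "0 < (\<integral>x. exp (\<psi> k x) * h x \<partial>lborel)"
      using \<psi>B[of k] by (intro exp_h_pos[of _ "real k"]) (auto simp: abs_le_iff)
    have "ln (\<integral>x. exp (\<psi> k x) * h x \<partial>lborel) \<le> ln (1 + exp (- real k) * z)" using pos le by simp
    also have "\<dots> \<le> exp (- real k) * z" using z_pos by (intro ln_add_one_self_le_self) auto
    finally show ?thesis using dual_borel[of "\<psi> k" "real k"] \<psi>B by fastforce
  qed
  have \<psi>int: "integrable \<mu> (\<psi> k)" for k using \<psi>B by (intro integrable_const_bound[of _ "real k"]) auto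
  have trunc: "(\<integral>x. min (real k) (max 0 (u x)) \<partial>\<mu>) \<le> c + exp (- real k) * z + un"
    and trunc_int: "integrable \<mu> (\<lambda>x. min (real k) (max 0 (u x)))" for k
  proof -
    show int: "integrable \<mu> (\<lambda>x. min (real k) (max 0 (u x)))"
      by (intro integrable_const_bound[of _ "real k"]) auto
    have "(\<integral>x. min (real k) (max 0 (u x)) \<partial>\<mu>) \<le> (\<integral>x. \<psi> k x + max 0 (- u x) \<partial>\<mu>)"
      using AEp by (intro integral_mono_AE int Bochner_Integration.integrable_add \<psi>int uneg) (auto simp: \<psi>_def elim!: eventually_mono)
    also have "\<dots> = (\<integral>x. \<psi> k x \<partial>\<mu>) + un" using \<psi>int uneg by (simp add: un_def)
    finally show "(\<integral>x. min (real k) (max 0 (u x)) \<partial>\<mu>) \<le> c + exp (- real k) * z + un" using \<psi>bound[of k] by linarith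
  qed
  have tail_small: "\<exists>j\<ge>k. c + exp (- real j) * z + un < c + un + e" if e: "0 < e" for e and k :: nat
  proof -
    have "(\<lambda>j. c + exp (- real j) * z + un) \<longlonglongrightarrow> c + 0 * z + un"
      by (intro tendsto_intros filterlim_compose[OF exp_at_bot] filterlim_compose[OF filterlim_uminus_at_bot_at_top] filterlim_real_sequentially)
    then have "\<forall>\<^sub>F j in sequentially. c + exp (- real j) * z + un < c + un + e"
      using e by (intro order_tendstoD(2)) auto
    then show ?thesis
      using eventually_happens'[OF sequentially_bot eventually_conj[OF eventually_ge_at_top[of k]]] by blast
  qed
  have cun: "0 \<le> c + un + e" if e: "0 < e" for e
  proof -
    obtain j where "c + exp (- real j) * z + un < c + un + e" using tail_small[OF e] by blast
    moreover have "0 \<le> (\<integral>x. min (real j) (max 0 (u x)) \<partial>\<mu>)" by (intro integral_nonneg_AE) auto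
    ultimately show ?thesis using trunc[of j] by linarith
  qed
  have upos: "(\<integral>\<^sup>+x. ennreal (max 0 (u x)) \<partial>\<mu>) \<le> ennreal (c + un + e)" if e: "0 < e" for e
  proof -
    have "(\<integral>\<^sup>+x. ennreal (max 0 (u x)) \<partial>\<mu>) = (\<integral>\<^sup>+x. (SUP k::nat. ennreal (min (real k) (max 0 (u x)))) \<partial>\<mu>)"
    proof (intro nn_integral_cong antisym)
      fix x
      obtain k :: nat where "max 0 (u x) \<le> real k" using real_arch_simple by blast
      then show "ennreal (max 0 (u x)) \<le> (SUP k::nat. ennreal (min (real k) (max 0 (u x))))"
        by (intro SUP_upper2[of k]) (auto simp: min_absorb2)
      show "(SUP k::nat. ennreal (min (real k) (max 0 (u x)))) \<le> ennreal (max 0 (u x))"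
        by (intro SUP_least ennreal_leI) auto
    qed
    also have "\<dots> = (SUP k::nat. \<integral>\<^sup>+x. ennreal (min (real k) (max 0 (u x))) \<partial>\<mu>)"
    proof (rule nn_integral_monotone_convergence_SUP)
      show "incseq (\<lambda>k x. ennreal (min (real k) (max 0 (u x))))"
        unfolding incseq_def le_fun_def by (intro allI impI ennreal_leI min.mono order_refl) simp
    qed measurable
    also have "\<dots> \<le> ennreal (c + un + e)"
    proof (intro SUP_least)
      fix k :: nat
      \<comment> \<open>A fixed truncation level \<open>k\<close> is compared with a larger level
        \<open>j\<close>, at which the error \<open>exp (- j) * z\<close> has dropped below
        \<open>e\<close>.\<close>
      obtain j where j: "k \<le> j" "c + exp (- real j) * z + un < c + un + e"
        using tail_small[OF e] by blast
      have "(\<integral>\<^sup>+x. ennreal (min (real k) (max 0 (u x))) \<partial>\<mu>) \<le> (\<integral>\<^sup>+x. ennreal (min (real j) (max 0 (u x))) \<partial>\<mu>)"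
        using j by (intro nn_integral_mono ennreal_leI) auto
      also have "\<dots> = ennreal (\<integral>x. min (real j) (max 0 (u x)) \<partial>\<mu>)"
        by (intro nn_integral_eq_integral trunc_int) auto
      also have "\<dots> \<le> ennreal (c + un + e)" using trunc[of j] j(2) by (intro ennreal_leI) linarith
      finally show "(\<integral>\<^sup>+x. ennreal (min (real k) (max 0 (u x))) \<partial>\<mu>) \<le> ennreal (c + un + e)" .
    qed
    finally show ?thesis .
  qed
  have up_int: "integrable \<mu> (\<lambda>x. max 0 (u x))"
    using order_le_less_trans[OF upos[of 1]] by (intro integrableI_nonneg) auto
  have u_int: "integrable \<mu> u"
    using Bochner_Integration.integrable_diff[OF up_int uneg] by (rule Bochner_Integration.integrable_cong[THEN iffD1, rotated -1]) auto
  have "(\<integral>x. u x \<partial>\<mu>) = (\<integral>x. max 0 (u x) - max 0 (- u x) \<partial>\<mu>)" by (intro Bochner_Integration.integral_cong) auto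
  also have "\<dots> = (\<integral>x. max 0 (u x) \<partial>\<mu>) - un" using up_int uneg by (simp add: un_def)
  also have "(\<integral>x. max 0 (u x) \<partial>\<mu>) \<le> c + un"
  proof (rule field_le_epsilon)
    fix e :: real assume e: "0 < e"
    have "ennreal (\<integral>x. max 0 (u x) \<partial>\<mu>) \<le> ennreal (c + un + e)"
      using upos[OF e] nn_integral_eq_integral[OF up_int] by auto
    then show "(\<integral>x. max 0 (u x) \<partial>\<mu>) \<le> c + un + e" using cun[OF e] by simp
  qed
  finally have u_le: "(\<integral>x. u x \<partial>\<mu>) \<le> c" by simp
  have pos_fin: "(\<integral>\<^sup>+x. ennreal (?p x * ln (?p x)) \<partial>lborel) < \<infinity>"
  proof -
    have "(\<integral>\<^sup>+x. ennreal (?p x * ln (?p x)) \<partial>lborel) \<le> (\<integral>\<^sup>+x. ennreal (?p x * max 0 (u x)) \<partial>lborel)"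
    proof (intro nn_integral_mono ennreal_leI mult_left_mono)
      fix x :: 'a
      have "0 \<le> b * norm x powr l" using b by simp
      then show "ln (?p x) \<le> max 0 (u x)" by (simp add: u_def le_max_iff_disj)
    qed simp
    also have "\<dots> < \<infinity>"
      using up_int by (subst (asm) di(1)) (auto dest!: integrableD(2) simp: less_top)
    finally show ?thesis .
  qed
  note neg_fin = neg_entropy_finite[OF first_moment ex_density]
  have "entropy_functional \<mu> < \<infinity>"
    unfolding entropy_functional_unfold[OF first_moment ex_density] using pos_fin neg_fin
    by (cases "\<integral>\<^sup>+x. ennreal (?p x * ln (?p x)) \<partial>lborel"; cases "\<integral>\<^sup>+x. ennreal (- (?p x * ln (?p x))) \<partial>lborel") auto
  note ent = entropy_functional_finiteD[OF this]
  have "(\<integral>x. ln (?p x) \<partial>\<mu>) \<le> (\<integral>x. u x \<partial>\<mu>)"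
    using b by (intro integral_mono ent(3) u_int) (auto simp: u_def)
  then show ?thesis using ent(4) u_le by simp
qed

end

subsection \<open>Independent samples\<close>

locale iid_sample =
  fixes \<mu> :: "'a::euclidean_space measure"
  assumes \<mu>: "\<mu> \<in> prob_measures"
begin

definition Q :: "nat \<Rightarrow> (nat \<Rightarrow> 'a) measure" where "Q n = (\<Pi>\<^sub>M i\<in>{..<n}. \<mu>)"

sublocale prob_space \<mu> by (rule prob_measuresD(2)[OF \<mu>])

lemma mu_sets: "sets \<mu> = sets borel" and mu_space: "space \<mu> = UNIV"
  by (rule prob_measuresD[OF \<mu>])+

lemma sets_Q: "sets (Q n) = sets (config_space n)"
  unfolding Q_def by (intro sets_PiM_cong) (auto simp: mu_sets)

lemma prob_Q: "prob_space (Q n)"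
  unfolding Q_def by (rule prob_space_PiM) (rule prob_space_axioms)

lemma measurable_Q_component: "i < n \<Longrightarrow> (\<lambda>x. x i) \<in> borel_measurable (Q n)"
  by (subst measurable_cong_sets[OF sets_Q refl]) simp

lemma measurable_Q_pair:
  "i < n \<Longrightarrow> j < n \<Longrightarrow> (\<lambda>x. (x i, x j)) \<in> measurable (Q n) (borel \<Otimes>\<^sub>M borel)"
  by (intro measurable_Pair measurable_Q_component)

lemma distr_Q_component: "i < n \<Longrightarrow> distr (Q n) borel (\<lambda>x. x i) = \<mu>"
proof -
  assume i: "i < n"
  have "distr (Q n) borel (\<lambda>x. x i) = distr (Q n) \<mu> (\<lambda>x. x i)"
    by (intro distr_cong) (auto simp: mu_sets)
  also have "\<dots> = \<mu>"
    unfolding Q_def using i prob_space_axioms by (intro distr_PiM_component) auto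
  finally show ?thesis .
qed

text \<open>Second moments and the mean energy involve distinct coordinates only in pairs; this is
  their joint law.\<close>

lemma distr_Q_pair:
  assumes ij: "i < n" "j < n" "i \<noteq> j"
  shows "distr (Q n) (borel \<Otimes>\<^sub>M borel) (\<lambda>x. (x i, x j)) = \<mu> \<Otimes>\<^sub>M \<mu>"
proof (rule pair_measure_eqI[symmetric])
  interpret pq: product_prob_space "\<lambda>_. \<mu>" "{..<n}"
    by (rule product_prob_spaceI) (rule prob_space_axioms)
  show "sigma_finite_measure \<mu>" "sigma_finite_measure \<mu>" by unfold_locales
  show "sets (\<mu> \<Otimes>\<^sub>M \<mu>) = sets (distr (Q n) (borel \<Otimes>\<^sub>M borel) (\<lambda>x. (x i, x j)))"
    using sets_pair_measure_cong[OF mu_sets mu_sets] by simp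
  fix A B assume AB: "A \<in> sets \<mu>" "B \<in> sets \<mu>"
  note [measurable_cong] = sets_Q
  have "(\<lambda>x. (x i, x j)) -` (A \<times> B) \<inter> space (Q n) = {x \<in> space (Q n). \<forall>k\<in>{i, j}. x k \<in> (if k = i then A else B)}"
    using ij by auto
  moreover have "emeasure (Q n) \<dots> = (\<Prod>k\<in>{i, j}. emeasure \<mu> (if k = i then A else B))"
    unfolding Q_def using ij AB by (intro pq.emeasure_PiM_Collect) auto
  moreover note measurable_Q_pair[OF ij(1,2)]
  ultimately show "emeasure \<mu> A * emeasure \<mu> B = emeasure (distr (Q n) (borel \<Otimes>\<^sub>M borel) (\<lambda>x. (x i, x j))) (A \<times> B)"
    using ij AB mu_sets by (subst emeasure_distr) auto
qed

lemma Q_component: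
  fixes g :: "'a \<Rightarrow> real"
  assumes i: "i < n" and [measurable]: "g \<in> borel_measurable borel"
  shows "integrable \<mu> g \<Longrightarrow> integrable (Q n) (\<lambda>x. g (x i))"
    and "(\<integral>x. g (x i) \<partial>Q n) = (\<integral>x. g x \<partial>\<mu>)"
    and "A \<in> sets borel \<Longrightarrow> measure (Q n) {x \<in> space (Q n). x i \<in> A} = measure \<mu> A"
proof -
  note [measurable_cong] = sets_Q
  note m = measurable_Q_component[OF i]
  show "integrable \<mu> g \<Longrightarrow> integrable (Q n) (\<lambda>x. g (x i))"
    using distr_Q_component[OF i] integrable_distr[OF m, of g] by simp
  show "(\<integral>x. g (x i) \<partial>Q n) = (\<integral>x. g x \<partial>\<mu>)"
    using distr_Q_component[OF i] integral_distr[OF m, of g] by simp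
  show "A \<in> sets borel \<Longrightarrow> measure (Q n) {x \<in> space (Q n). x i \<in> A} = measure \<mu> A"
    using distr_Q_component[OF i] measure_distr[OF m, of A] by (simp add: vimage_def Int_def conj_commute)
qed

text \<open>The cross terms vanish by independence and zero mean, and each of the \<open>n\<close>
  diagonal terms is at most \<open>B\<^sup>2\<close>.\<close>

lemma second_moment_sum:
  fixes h :: "'a \<Rightarrow> real"
  assumes [measurable]: "h \<in> borel_measurable borel" and B: "\<And>x. \<bar>h x\<bar> \<le> B" and mean: "(\<integral>x. h x \<partial>\<mu>) = 0"
  shows "integrable (Q n) (\<lambda>x. (\<Sum>i<n. h (x i))\<^sup>2)" "(\<integral>x. (\<Sum>i<n. h (x i))\<^sup>2 \<partial>Q n) \<le> real n * B\<^sup>2"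
proof -
  note [measurable_cong] = sets_Q mu_sets
  interpret Qn: prob_space "Q n" by (rule prob_Q)
  interpret pp: pair_prob_space \<mu> \<mu> ..
  have B0: "0 \<le> B" using B[of undefined] by linarith
  have int: "integrable (Q n) (\<lambda>x. h (x i) * h (x j))" if "i < n" "j < n" for i j
  proof (rule Qn.integrable_const_bound[of _ "B * B"])
    show "AE x in Q n. norm (h (x i) * h (x j)) \<le> B * B"
      using B B0 by (intro AE_I2) (auto simp: abs_mult intro!: mult_mono)
    show "(\<lambda>x. h (x i) * h (x j)) \<in> borel_measurable (Q n)"
      using measurable_Q_component[OF that(1)] measurable_Q_component[OF that(2)] by measurable
  qed
  have sq: "(\<Sum>i<n. h (x i))\<^sup>2 = (\<Sum>i<n. \<Sum>j<n. h (x i) * h (x j))" for x :: "nat \<Rightarrow> 'a"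
    by (simp add: power2_eq_square sum_product)
  show "integrable (Q n) (\<lambda>x. (\<Sum>i<n. h (x i))\<^sup>2)"
    unfolding sq by (intro Bochner_Integration.integrable_sum int) auto
  have cross: "(\<integral>x. h (x i) * h (x j) \<partial>Q n) \<le> (if i = j then B\<^sup>2 else 0)" if ij: "i < n" "j < n" for i j
  proof (cases "i = j")
    case True
    have "(\<integral>x. h (x i) * h (x j) \<partial>Q n) \<le> B * B"
    proof (rule Qn.integral_le_const[OF int[OF ij]], intro AE_I2)
      fix x show "h (x i) * h (x j) \<le> B * B"
        using mult_mono[OF B[of "x i"] B[of "x j"] B0 abs_ge_zero] abs_ge_self[of "h (x i) * h (x j)"]
        by (simp add: abs_mult)
    qed
    then show ?thesis using True by (simp add: power2_eq_square)
  next
    case False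
    note m = measurable_Q_pair[OF ij]
    have "(\<integral>x. h (x i) * h (x j) \<partial>Q n) = (\<integral>z. h (fst z) * h (snd z) \<partial>distr (Q n) (borel \<Otimes>\<^sub>M borel) (\<lambda>x. (x i, x j)))"
      by (subst integral_distr[OF m]) auto
    also have "\<dots> = (\<integral>z. h (fst z) * h (snd z) \<partial>(\<mu> \<Otimes>\<^sub>M \<mu>))" by (simp add: distr_Q_pair[OF ij False])
    also have "\<dots> = (\<integral>x. \<integral>y. h x * h y \<partial>\<mu> \<partial>\<mu>)"
    proof (subst pp.integral_fst'[symmetric])
      show "integrable (\<mu> \<Otimes>\<^sub>M \<mu>) (\<lambda>z. h (fst z) * h (snd z))"
        using B B0 by (intro pp.integrable_const_bound[of _ "B * B"]) (auto simp: abs_mult intro!: mult_mono)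
    qed simp
    also have "\<dots> = 0" by (simp add: mean)
    finally show ?thesis using False by simp
  qed
  have "(\<integral>x. (\<Sum>i<n. h (x i))\<^sup>2 \<partial>Q n) = (\<Sum>i<n. \<Sum>j<n. \<integral>x. h (x i) * h (x j) \<partial>Q n)"
  proof -
    have "(\<integral>x. (\<Sum>j<n. h (x i) * h (x j)) \<partial>Q n) = (\<Sum>j<n. \<integral>x. h (x i) * h (x j) \<partial>Q n)" if "i < n" for i
      using that by (intro Bochner_Integration.integral_sum int) auto
    moreover have "(\<integral>x. (\<Sum>i<n. h (x i))\<^sup>2 \<partial>Q n) = (\<Sum>i<n. \<integral>x. (\<Sum>j<n. h (x i) * h (x j)) \<partial>Q n)"
      unfolding sq by (intro Bochner_Integration.integral_sum Bochner_Integration.integrable_sum int) auto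
    ultimately show ?thesis by simp
  qed
  also have "\<dots> \<le> (\<Sum>i<n. \<Sum>j<n. if i = j then B\<^sup>2 else 0)" using cross by (intro sum_mono) auto
  also have "\<dots> = real n * B\<^sup>2" by simp
  finally show "(\<integral>x. (\<Sum>i<n. h (x i))\<^sup>2 \<partial>Q n) \<le> real n * B\<^sup>2" .
qed

text \<open>Stated with measurable covers of the exceptional sets, so that no measurability is needed of \<open>A\<close>.\<close>

definition asymp_sure :: "(nat \<Rightarrow> (nat \<Rightarrow> 'a) \<Rightarrow> bool) \<Rightarrow> bool" where
  "asymp_sure A \<longleftrightarrow> (\<forall>\<epsilon>>0. \<forall>\<^sub>F n in sequentially. \<exists>B\<in>sets (Q n). {x \<in> space (Q n). \<not> A n x} \<subseteq> B \<and> measure (Q n) B \<le> \<epsilon>)"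

lemma asymp_sure_mono:
  assumes "asymp_sure A" and "\<forall>\<^sub>F n in sequentially. \<forall>x\<in>space (Q n). A n x \<longrightarrow> A' n x"
  shows "asymp_sure A'"
  unfolding asymp_sure_def
proof (intro allI impI)
  fix \<epsilon> :: real assume "0 < \<epsilon>"
  then have "\<forall>\<^sub>F n in sequentially. \<exists>B\<in>sets (Q n). {x \<in> space (Q n). \<not> A n x} \<subseteq> B \<and> measure (Q n) B \<le> \<epsilon>"
    using assms(1) by (auto simp: asymp_sure_def)
  then show "\<forall>\<^sub>F n in sequentially. \<exists>B\<in>sets (Q n). {x \<in> space (Q n). \<not> A' n x} \<subseteq> B \<and> measure (Q n) B \<le> \<epsilon>"
    using assms(2) by eventually_elim blast
qed

lemma asymp_sure_conj:
  assumes "asymp_sure A" "asymp_sure A'"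
  shows "asymp_sure (\<lambda>n x. A n x \<and> A' n x)"
  unfolding asymp_sure_def
proof (intro allI impI)
  fix \<epsilon> :: real assume "0 < \<epsilon>"
  then have "0 < \<epsilon> / 2" by simp
  then have "\<forall>\<^sub>F n in sequentially. \<exists>B\<in>sets (Q n). {x \<in> space (Q n). \<not> A n x} \<subseteq> B \<and> measure (Q n) B \<le> \<epsilon> / 2"
    "\<forall>\<^sub>F n in sequentially. \<exists>B\<in>sets (Q n). {x \<in> space (Q n). \<not> A' n x} \<subseteq> B \<and> measure (Q n) B \<le> \<epsilon> / 2"
    by (rule assms[unfolded asymp_sure_def, rule_format])+
  then show "\<forall>\<^sub>F n in sequentially. \<exists>B\<in>sets (Q n). {x \<in> space (Q n). \<not> (A n x \<and> A' n x)} \<subseteq> B \<and> measure (Q n) B \<le> \<epsilon>"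
  proof eventually_elim
    case (elim n)
    then obtain B B' where B: "B \<in> sets (Q n)" "{x \<in> space (Q n). \<not> A n x} \<subseteq> B" "measure (Q n) B \<le> \<epsilon> / 2"
      and B': "B' \<in> sets (Q n)" "{x \<in> space (Q n). \<not> A' n x} \<subseteq> B'" "measure (Q n) B' \<le> \<epsilon> / 2" by blast
    then have "measure (Q n) (B \<union> B') \<le> \<epsilon>" using measure_Un_le[of B "Q n" B'] by simp
    then show ?case using B B' by (intro bexI[of _ "B \<union> B'"]) auto
  qed
qed

lemma asymp_sure_True: "asymp_sure (\<lambda>n x. True)"
  unfolding asymp_sure_def by (intro allI impI always_eventually bexI[of _ "{}"]) auto

lemma asymp_sure_finite_ball:
  assumes "finite I" "\<And>i. i \<in> I \<Longrightarrow> asymp_sure (A i)"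
  shows "asymp_sure (\<lambda>n x. \<forall>i\<in>I. A i n x)"
  using assms by (induction I) (auto intro: asymp_sure_True asymp_sure_conj)

lemma asymp_sureI_measure:
  assumes m: "\<And>n. {x \<in> space (Q n). \<not> A n x} \<in> sets (Q n)"
    and "\<And>\<epsilon>. 0 < \<epsilon> \<Longrightarrow> \<forall>\<^sub>F n in sequentially. measure (Q n) {x \<in> space (Q n). \<not> A n x} \<le> \<epsilon>"
  shows "asymp_sure A"
  unfolding asymp_sure_def
proof (intro allI impI)
  fix \<epsilon> :: real assume "0 < \<epsilon>"
  from assms(2)[OF this]
  show "\<forall>\<^sub>F n in sequentially. \<exists>B\<in>sets (Q n). {x \<in> space (Q n). \<not> A n x} \<subseteq> B \<and> measure (Q n) B \<le> \<epsilon>"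
    by eventually_elim (use m in blast)
qed

lemma truncation_error:
  fixes g :: "'a \<Rightarrow> real"
  assumes g: "integrable \<mu> g" and [measurable]: "g \<in> borel_measurable borel" and e: "0 < e"
  obtains M where "0 \<le> M" "(\<integral>x. \<bar>g x - max (- M) (min M (g x))\<bar> \<partial>\<mu>) < e"
proof -
  note [measurable_cong] = mu_sets
  have "(\<lambda>k. \<integral>x. \<bar>g x - max (- real k) (min (real k) (g x))\<bar> \<partial>\<mu>) \<longlonglongrightarrow> (\<integral>x. 0 \<partial>\<mu>)"
  proof (rule integral_dominated_convergence[where w = "\<lambda>x. \<bar>g x\<bar>"])
    show "AE x in \<mu>. (\<lambda>k. \<bar>g x - max (- real k) (min (real k) (g x))\<bar>) \<longlonglongrightarrow> 0"
    proof (intro AE_I2 tendsto_eventually)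
      fix x
      obtain N :: nat where N: "\<bar>g x\<bar> \<le> real N" using real_arch_simple by blast
      show "\<forall>\<^sub>F k in sequentially. \<bar>g x - max (- real k) (min (real k) (g x))\<bar> = 0"
        by (rule eventually_sequentiallyI[of N]) (use N in \<open>auto simp: min_def max_def\<close>)
    qed
    show "AE x in \<mu>. norm \<bar>g x - max (- real k) (min (real k) (g x))\<bar> \<le> \<bar>g x\<bar>" for k
      by (intro AE_I2) (auto simp: min_def max_def)
  qed (use g in auto)
  then have "\<forall>\<^sub>F k in sequentially. (\<integral>x. \<bar>g x - max (- real k) (min (real k) (g x))\<bar> \<partial>\<mu>) < e"
    using e by (intro order_tendstoD(2)) auto
  then obtain k where "(\<integral>x. \<bar>g x - max (- real k) (min (real k) (g x))\<bar> \<partial>\<mu>) < e"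
    using eventually_happens'[OF sequentially_bot] by blast
  then show ?thesis using that[of "real k"] by simp
qed

text \<open>As \<open>g\<close> is merely integrable, it is truncated at a level \<open>M\<close>:
  Chebyshev's inequality treats the bounded centered part \<open>h\<close>, Markov's inequality the
  remainder \<open>r\<close>, whose mean is small.\<close>

lemma weak_law_of_large_numbers:
  fixes g :: "'a \<Rightarrow> real"
  assumes g: "integrable \<mu> g" and gm [measurable]: "g \<in> borel_measurable borel" and \<delta>: "0 < \<delta>"
  shows "asymp_sure (\<lambda>n x. \<bar>(\<Sum>i<n. g (x i)) / real n - (\<integral>x. g x \<partial>\<mu>)\<bar> < \<delta>)"
proof (rule asymp_sureI_measure)
  note [measurable_cong] = sets_Q mu_sets
  let ?m = "\<integral>x. g x \<partial>\<mu>"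
  show bad_meas: "{x \<in> space (Q n). \<not> \<bar>(\<Sum>i<n. g (x i)) / real n - ?m\<bar> < \<delta>} \<in> sets (Q n)" for n
    by measurable
  fix \<epsilon> :: real assume \<epsilon>: "0 < \<epsilon>"
  \<comment> \<open>\<open>\<delta> / 4\<close> limits the change of the mean caused by truncation;
    \<open>\<delta> * \<epsilon> / 8\<close> makes Markov's inequality at level
    \<open>\<delta> / 4\<close> give \<open>\<epsilon> / 2\<close>.\<close>
  define e where "e = min (\<delta> / 4) (\<delta> * \<epsilon> / 8)"
  have e: "0 < e" using \<delta> \<epsilon> by (simp add: e_def)
  obtain M where M: "0 \<le> M" "(\<integral>x. \<bar>g x - max (- M) (min M (g x))\<bar> \<partial>\<mu>) < e"
    using truncation_error[OF g gm e] by blast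
  define t where "t x = max (- M) (min M (g x))" for x
  define r where "r x = \<bar>g x - t x\<bar>" for x
  define h where "h x = t x - (\<integral>x. t x \<partial>\<mu>)" for x
  have [measurable]: "t \<in> borel_measurable borel" "r \<in> borel_measurable borel" "h \<in> borel_measurable borel"
    unfolding t_def r_def h_def by measurable
  have tB: "\<bar>t x\<bar> \<le> M" for x using M(1) by (auto simp: t_def)
  have t_int: "integrable \<mu> t" by (intro integrable_const_bound[of _ M]) (use tB in auto)
  have r_int: "integrable \<mu> r" unfolding r_def using g t_int by auto
  have r_le: "(\<integral>x. r x \<partial>\<mu>) < e" using M(2) by (simp add: r_def t_def)
  have diff: "\<bar>?m - (\<integral>x. t x \<partial>\<mu>)\<bar> \<le> (\<integral>x. r x \<partial>\<mu>)"
    using integral_abs_bound[of \<mu> "\<lambda>x. g x - t x"] g t_int by (simp add: r_def)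
  have mt: "\<bar>\<integral>x. t x \<partial>\<mu>\<bar> \<le> M"
  proof -
    have "\<bar>\<integral>x. t x \<partial>\<mu>\<bar> \<le> (\<integral>x. \<bar>t x\<bar> \<partial>\<mu>)" by (rule integral_abs_bound)
    also have "\<dots> \<le> M" using t_int tB by (intro integral_le_const) auto
    finally show ?thesis .
  qed
  have hB: "\<bar>h x\<bar> \<le> 2 * M" for x using tB[of x] mt unfolding h_def by linarith
  have h_mean: "(\<integral>x. h x \<partial>\<mu>) = 0" unfolding h_def using t_int by (simp add: prob_space)
  show "\<forall>\<^sub>F n in sequentially. measure (Q n) {x \<in> space (Q n). \<not> \<bar>(\<Sum>i<n. g (x i)) / real n - ?m\<bar> < \<delta>} \<le> \<epsilon>"
  \<comment> \<open>Chebyshev's inequality at level \<open>\<delta> / 4\<close> gives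
    \<open>16 * (2 * M)\<^sup>2 / (n * \<delta>\<^sup>2)\<close>, which is at most
    \<open>\<epsilon> / 2\<close> from this index on.\<close>
  proof (rule eventually_sequentiallyI[of "nat \<lceil>32 * (2 * M)\<^sup>2 / (\<delta>\<^sup>2 * \<epsilon>)\<rceil> + 1"])
    fix n assume n: "nat \<lceil>32 * (2 * M)\<^sup>2 / (\<delta>\<^sup>2 * \<epsilon>)\<rceil> + 1 \<le> n"
    then have n0: "0 < real n" by simp
    have nlarge: "32 * (2 * M)\<^sup>2 / (\<delta>\<^sup>2 * \<epsilon>) \<le> real n" using n by linarith
    interpret Qn: prob_space "Q n" by (rule prob_Q)
    define Y where "Y x = (\<Sum>i<n. r (x i)) / real n" for x :: "nat \<Rightarrow> 'a"
    define Z where "Z x = (\<Sum>i<n. h (x i))\<^sup>2 / (real n)\<^sup>2" for x :: "nat \<Rightarrow> 'a"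
    have [measurable]: "Y \<in> borel_measurable (Q n)" "Z \<in> borel_measurable (Q n)" unfolding Y_def Z_def by measurable
    have Y_int: "integrable (Q n) Y" "(\<integral>x. Y x \<partial>Q n) < e"
    proof -
      show "integrable (Q n) Y" unfolding Y_def
        by (intro integrable_divide Bochner_Integration.integrable_sum Q_component(1) r_int) auto
      have "(\<integral>x. Y x \<partial>Q n) = (\<Sum>i<n. (\<integral>x. r x \<partial>\<mu>)) / real n"
        unfolding Y_def using r_int Q_component(1,2)[of _ n r] by (simp add: Bochner_Integration.integral_sum)
      then show "(\<integral>x. Y x \<partial>Q n) < e" using r_le n0 by simp
    qed
    have Z_int: "integrable (Q n) Z" "(\<integral>x. Z x \<partial>Q n) \<le> (2 * M)\<^sup>2 / real n"
    proof -
      show "integrable (Q n) Z" unfolding Z_def using second_moment_sum(1)[OF _ hB h_mean] by auto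
      have "(\<integral>x. Z x \<partial>Q n) \<le> real n * (2 * M)\<^sup>2 / (real n)\<^sup>2"
        unfolding Z_def using second_moment_sum(2)[OF _ hB h_mean, of n] by (simp add: divide_right_mono)
      then show "(\<integral>x. Z x \<partial>Q n) \<le> (2 * M)\<^sup>2 / real n" using n0 by (simp add: power2_eq_square)
    qed
    have sub: "{x \<in> space (Q n). \<not> \<bar>(\<Sum>i<n. g (x i)) / real n - ?m\<bar> < \<delta>}
        \<subseteq> {x \<in> space (Q n). \<delta> / 4 \<le> Y x} \<union> {x \<in> space (Q n). (\<delta> / 4)\<^sup>2 \<le> Z x}"
    proof safe
      fix x assume big: "\<not> \<bar>(\<Sum>i<n. g (x i)) / real n - ?m\<bar> < \<delta>" and "\<not> (\<delta> / 4)\<^sup>2 \<le> Z x"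
      then have "((\<Sum>i<n. h (x i)) / real n)\<^sup>2 < (\<delta> / 4)\<^sup>2" by (simp add: Z_def power_divide)
      then have "\<bar>(\<Sum>i<n. h (x i)) / real n\<bar>\<^sup>2 < (\<delta> / 4)\<^sup>2" by (simp only: power2_abs)
      then have hs: "\<bar>(\<Sum>i<n. h (x i)) / real n\<bar> < \<delta> / 4"
        by (rule power_less_imp_less_base) (use \<delta> in simp)
      have "(\<Sum>i<n. g (x i)) / real n - ?m = (\<Sum>i<n. g (x i) - t (x i)) / real n + (\<Sum>i<n. h (x i)) / real n + ((\<integral>x. t x \<partial>\<mu>) - ?m)"
        using n0 by (simp add: h_def sum_subtractf diff_divide_distrib)
      moreover have "\<bar>(\<Sum>i<n. g (x i) - t (x i)) / real n\<bar> \<le> Y x"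
        unfolding Y_def r_def abs_divide using n0 by (auto intro!: divide_right_mono sum_abs)
      moreover have "\<bar>?m - (\<integral>x. t x \<partial>\<mu>)\<bar> < \<delta> / 4" using diff r_le by (simp add: e_def)
      ultimately show "\<delta> / 4 \<le> Y x" using big hs \<delta> by linarith
    qed
    have mY: "measure (Q n) {x \<in> space (Q n). \<delta> / 4 \<le> Y x} \<le> \<epsilon> / 2"
    proof -
      have "measure (Q n) {x \<in> space (Q n). \<delta> / 4 \<le> Y x} \<le> (\<integral>x. Y x \<partial>Q n) / (\<delta> / 4)"
        using \<delta> by (intro integral_Markov_inequality_measure[OF Y_int(1), where A = "{}"]) (auto simp: Y_def r_def sum_nonneg)
      also have "\<dots> \<le> (\<delta> * \<epsilon> / 8) / (\<delta> / 4)" using Y_int(2) \<delta> by (intro divide_right_mono) (auto simp: e_def)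
      also have "\<dots> = \<epsilon> / 2" using \<delta> by simp
      finally show ?thesis .
    qed
    have mZ: "measure (Q n) {x \<in> space (Q n). (\<delta> / 4)\<^sup>2 \<le> Z x} \<le> \<epsilon> / 2"
    proof -
      have "measure (Q n) {x \<in> space (Q n). (\<delta> / 4)\<^sup>2 \<le> Z x} \<le> (\<integral>x. Z x \<partial>Q n) / (\<delta> / 4)\<^sup>2"
        using \<delta> by (intro integral_Markov_inequality_measure[OF Z_int(1), where A = "{}"]) (auto simp: Z_def)
      also have "\<dots> \<le> ((2 * M)\<^sup>2 / real n) / (\<delta> / 4)\<^sup>2" using Z_int(2) by (intro divide_right_mono) auto
      also have "\<dots> \<le> \<epsilon> / 2"
      proof -
        obtain K where K: "K = (2 * M)\<^sup>2" by blast
        have "32 * K \<le> real n * (\<delta>\<^sup>2 * \<epsilon>)"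
          using nlarge \<delta> \<epsilon> unfolding K[symmetric] by (simp add: pos_divide_le_eq)
        then show ?thesis unfolding K[symmetric] using n0 \<delta> by (simp add: power_divide field_simps)
      qed
      finally show ?thesis .
    qed
    have "measure (Q n) {x \<in> space (Q n). \<not> \<bar>(\<Sum>i<n. g (x i)) / real n - ?m\<bar> < \<delta>}
        \<le> measure (Q n) ({x \<in> space (Q n). \<delta> / 4 \<le> Y x} \<union> {x \<in> space (Q n). (\<delta> / 4)\<^sup>2 \<le> Z x})"
      using sub by (intro Qn.finite_measure_mono) auto
    also have "\<dots> \<le> \<epsilon>" using mY mZ measure_Un_le[of "{x \<in> space (Q n). \<delta> / 4 \<le> Y x}" "Q n" "{x \<in> space (Q n). (\<delta> / 4)\<^sup>2 \<le> Z x}"] by auto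
    finally show "measure (Q n) {x \<in> space (Q n). \<not> \<bar>(\<Sum>i<n. g (x i)) / real n - ?m\<bar> < \<delta>} \<le> \<epsilon>" .
  qed
qed

end

section \<open>Recentered samples\<close>

definition center :: "nat \<Rightarrow> (nat \<Rightarrow> 'a::euclidean_space) \<Rightarrow> nat \<Rightarrow> 'a" where
  "center n x = (\<lambda>i\<in>{..<n}. x i - (\<Sum>j<n. x j) /\<^sub>R real n)"

locale centered_sample = iid_sample +
  assumes moment1: "\<mu> \<in> prob_measures_p 1" and mean0: "(\<integral>x. x \<partial>\<mu>) = 0"
begin

lemma sample_mean:
  assumes d: "0 < d"
  shows "asymp_sure (\<lambda>n x. norm ((\<Sum>j<n. x j) /\<^sub>R real n) < d)"
proof -
  let ?D = "real DIM('a)"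
  have D: "0 < d / ?D" using d by simp
  note int = integrable_id[OF moment1 order_refl]
  have "asymp_sure (\<lambda>n x. \<forall>b\<in>Basis. \<bar>(\<Sum>i<n. x i \<bullet> b) / real n - (\<integral>x. x \<bullet> b \<partial>\<mu>)\<bar> < d / ?D)"
  proof (rule asymp_sure_finite_ball)
    fix b :: 'a
    have "integrable \<mu> (\<lambda>x. x \<bullet> b)" by (intro integrable_inner_left int)
    then show "asymp_sure (\<lambda>n x. \<bar>(\<Sum>i<n. x i \<bullet> b) / real n - (\<integral>x. x \<bullet> b \<partial>\<mu>)\<bar> < d / ?D)"
      using D by (intro weak_law_of_large_numbers[where g = "\<lambda>x. x \<bullet> b"]) measurable
  qed simp
  then show ?thesis
  proof (rule asymp_sure_mono, intro always_eventually allI ballI impI)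
    fix n :: nat and x :: "nat \<Rightarrow> 'a"
    assume *: "\<forall>b\<in>Basis. \<bar>(\<Sum>i<n. x i \<bullet> b) / real n - (\<integral>x. x \<bullet> b \<partial>\<mu>)\<bar> < d / ?D"
    have zero: "(\<integral>x. x \<bullet> b \<partial>\<mu>) = 0" for b 
      unfolding integral_inner_left[OF int] mean0 by (rule inner_zero_left)
    let ?m = "(\<Sum>j<n. x j) /\<^sub>R real n"
    have "norm ?m \<le> (\<Sum>b\<in>Basis. \<bar>?m \<bullet> b\<bar>)" by (rule norm_le_l1)
    also have "\<dots> < (\<Sum>b\<in>(Basis :: 'a set). d / ?D)"
    proof (rule sum_strict_mono)
      fix b :: 'a assume b: "b \<in> Basis"
      have "?m \<bullet> b = (\<Sum>i<n. x i \<bullet> b) / real n" by (simp add: inner_sum_left divide_inverse mult.commute)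
      then show "\<bar>?m \<bullet> b\<bar> < d / ?D" using * b zero[of b] by auto
    qed auto
    also have "\<dots> = d" by simp
    finally show "norm ?m < d" .
  qed
qed

text \<open>Recentering moves all points by one small vector, the sample mean. A test function is
  uniformly continuous only on bounded sets, so the share of sample points far out is measured by a
  second test function, the complement of a cutoff, to which the law of large numbers also
  applies.\<close>

lemma centered_empirical_in_weak_nbhd:
  assumes V: "openin weak_topology V" and \<mu>V: "\<mu> \<in> V"
  shows "asymp_sure (\<lambda>n x. empirical_measure n (center n x) \<in> V)"
  using V \<mu>V
proof (induction rule: openin_weak_induct)
  case (Int A B)
  then show ?case using asymp_sure_conj by simp
next
  case (Union K)
  then obtain A where "A \<in> K" "\<mu> \<in> A" by blast
  show ?case
    by (rule asymp_sure_mono[OF Union(1)[OF \<open>A \<in> K\<close> \<open>\<mu> \<in> A\<close>]])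
       (use \<open>A \<in> K\<close> in \<open>auto intro!: always_eventually\<close>)
next
  case (Basis f V)
  note [measurable] = borel_measurable_continuous_onI[OF Basis(1)]
  note [measurable_cong] = mu_sets
  obtain B where B: "\<And>x. \<bar>f x\<bar> \<le> B" using Basis(2) by (auto simp: bounded_iff)
  have B0: "0 \<le> B" using B[of 0] by linarith
  have "(\<integral>x. f x \<partial>\<mu>) \<in> V" using Basis by auto
  then obtain e where e: "e > 0" "ball (\<integral>x. f x \<partial>\<mu>) e \<subseteq> V"
    using \<open>open V\<close> by (meson openE)
  \<comment> \<open>The share of far points is at most \<open>2 * q\<close>: \<open>q\<close> for
    its mean and \<open>q\<close> for the fluctuation. It costs \<open>4 * B * q\<close>, at most
    \<open>e / 4\<close>.\<close>
  define q where "q = e / (16 * (B + 1))"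
  have q: "0 < q" using e B0 by (simp add: q_def)
  have "(B + 1) * q = e / 16" using B0 by (simp add: q_def field_simps)
  then have Bq: "B * q \<le> e / 16" using q by (simp add: algebra_simps)
  have "(\<lambda>n. \<integral>x. 1 - cutoff (real n) x \<partial>\<mu>) \<longlonglongrightarrow> (\<integral>x. 1 - 1 \<partial>\<mu>)"
  proof (rule integral_dominated_convergence[where w = "\<lambda>_. 1"])
    show "AE x in \<mu>. (\<lambda>n. 1 - cutoff (real n) x) \<longlonglongrightarrow> 1 - 1"
      by (intro AE_I2 tendsto_diff tendsto_const cutoff_tendsto)
  qed (auto simp: abs_le_iff)
  then have "\<forall>\<^sub>F n in sequentially. (\<integral>x. 1 - cutoff (real n) x \<partial>\<mu>) < q"
    using q by (intro order_tendstoD(2)) auto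
  then obtain k where k: "(\<integral>x. 1 - cutoff (real k) x \<partial>\<mu>) < q"
    using eventually_happens'[OF sequentially_bot] by blast
  define T where "T = real k"
  have "uniformly_continuous_on (cball 0 (T + 2)) f"
    by (intro compact_uniformly_continuous continuous_on_subset[OF Basis(1)]) auto
  then obtain d' where d': "d' > 0" "\<And>x y. norm x \<le> T + 2 \<Longrightarrow> norm y \<le> T + 2 \<Longrightarrow> dist y x < d' \<Longrightarrow> dist (f y) (f x) < e / 4"
    using e unfolding uniformly_continuous_on_def by (metis mem_cball_0 divide_pos_pos zero_less_numeral)
  define d where "d = min d' 1"
  have d: "0 < d" using d' by (simp add: d_def)
  have int_f: "integrable \<mu> f" using integrable_bounded_cont[OF \<mu> _ Basis(2)] by simp
  have int_c: "integrable \<mu> (\<lambda>x. 1 - cutoff T x)" by (intro integrable_const_bound[of _ 1]) (auto simp: abs_le_iff)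
  have "asymp_sure (\<lambda>n x. norm ((\<Sum>j<n. x j) /\<^sub>R real n) < d \<and>
      (\<bar>(\<Sum>i<n. f (x i)) / real n - (\<integral>x. f x \<partial>\<mu>)\<bar> < e / 4 \<and>
       \<bar>(\<Sum>i<n. 1 - cutoff T (x i)) / real n - (\<integral>x. 1 - cutoff T x \<partial>\<mu>)\<bar> < q))"
    using d e q int_f int_c by (intro asymp_sure_conj sample_mean weak_law_of_large_numbers) auto
  then show ?case
  proof (rule asymp_sure_mono, intro eventually_sequentiallyI[of 1] ballI impI)
    fix n :: nat and x :: "nat \<Rightarrow> 'a" assume n: "1 \<le> n"
    let ?m = "(\<Sum>j<n. x j) /\<^sub>R real n"
    assume A: "norm ?m < d \<and> (\<bar>(\<Sum>i<n. f (x i)) / real n - (\<integral>x. f x \<partial>\<mu>)\<bar> < e / 4 \<and>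
       \<bar>(\<Sum>i<n. 1 - cutoff T (x i)) / real n - (\<integral>x. 1 - cutoff T x \<partial>\<mu>)\<bar> < q)"
    have pt: "\<bar>f (x i - ?m) - f (x i)\<bar> \<le> e / 4 + 2 * B * (1 - cutoff T (x i))" for i
    proof (cases "norm (x i) < T + 1")
      case True
      have "norm (x i - ?m) \<le> norm (x i) + norm ?m" by (rule norm_triangle_ineq4)
      then have "dist (f (x i - ?m)) (f (x i)) < e / 4"
        using True A by (intro d'(2)) (auto simp: d_def dist_norm)
      moreover have "0 \<le> 2 * B * (1 - cutoff T (x i))" using B0 by simp
      ultimately show ?thesis unfolding dist_real_def by linarith
    next
      case False
      then have "2 * B * (1 - cutoff T (x i)) = 2 * B" by (simp add: cutoff_eq_0)
      then show ?thesis using B[of "x i - ?m"] B[of "x i"] e by linarith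
    qed
    have "\<bar>(\<Sum>i<n. f (x i - ?m)) / real n - (\<Sum>i<n. f (x i)) / real n\<bar>
        = \<bar>\<Sum>i<n. f (x i - ?m) - f (x i)\<bar> / real n"
      by (simp add: sum_subtractf diff_divide_distrib[symmetric])
    also have "\<dots> \<le> (\<Sum>i<n. e / 4 + 2 * B * (1 - cutoff T (x i))) / real n"
      by (intro divide_right_mono order_trans[OF sum_abs] sum_mono pt) simp
    also have "\<dots> = e / 4 + 2 * B * ((\<Sum>i<n. 1 - cutoff T (x i)) / real n)"
      using n by (simp add: sum.distrib sum_distrib_left[symmetric] add_divide_distrib del: sum_subtractf)
    also have "\<dots> \<le> e / 4 + 2 * B * (2 * q)"
    proof (intro add_left_mono mult_left_mono)
      show "(\<Sum>i<n. 1 - cutoff T (x i)) / real n \<le> 2 * q" using A k unfolding T_def by linarith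
    qed (use B0 in simp)
    also have "\<dots> \<le> e / 2" using Bq by simp
    finally have "\<bar>(\<Sum>i<n. f (x i - ?m)) / real n - (\<integral>x. f x \<partial>\<mu>)\<bar> < e" using A e(1) by linarith
    moreover have "(\<integral>y. f y \<partial>empirical_measure n (center n x)) = (\<Sum>i<n. f (x i - ?m)) / real n"
      by (simp add: integral_empirical center_def)
    ultimately have "(\<integral>y. f y \<partial>empirical_measure n (center n x)) \<in> ball (\<integral>x. f x \<partial>\<mu>) e"
      by (simp add: dist_real_def abs_minus_commute)
    then show "empirical_measure n (center n x) \<in> {\<mu> \<in> prob_measures. (\<integral>x. f x \<partial>\<mu>) \<in> V}"
      using e(2) n by auto
  qed
qed auto

text \<open>Recentering costs the factor \<open>2 powr l\<close> of \<open>norm_add_powr_le\<close>.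
  Of the added \<open>2\<close>, one unit absorbs the \<open>l\<close>-th power of the sample mean
  and the other the fluctuation of the empirical moment.\<close>

lemma centered_empirical_in_moment_ball:
  assumes l: "1 \<le> l" and int: "integrable \<mu> (\<lambda>x. norm x powr l)"
  shows "asymp_sure (\<lambda>n x. empirical_measure n (center n x) \<in> moment_ball l (2 powr l * ((\<integral>x. norm x powr l \<partial>\<mu>) + 2)))"
proof -
  let ?I = "\<integral>x. norm x powr l \<partial>\<mu>"
  have "asymp_sure (\<lambda>n x. norm ((\<Sum>j<n. x j) /\<^sub>R real n) < 1 \<and> \<bar>(\<Sum>i<n. norm (x i) powr l) / real n - ?I\<bar> < 1)"
    using int by (intro asymp_sure_conj sample_mean weak_law_of_large_numbers) auto
  then show ?thesis
  proof (rule asymp_sure_mono, intro eventually_sequentiallyI[of 1] ballI impI)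
    fix n :: nat and x :: "nat \<Rightarrow> 'a" assume n: "1 \<le> n"
    let ?m = "(\<Sum>j<n. x j) /\<^sub>R real n"
    assume A: "norm ?m < 1 \<and> \<bar>(\<Sum>i<n. norm (x i) powr l) / real n - ?I\<bar> < 1"
    have m1: "norm ?m powr l \<le> 1" using A l powr_mono2[of l "norm ?m" 1] by simp
    have "(\<Sum>i<n. norm (x i - ?m) powr l) \<le> (\<Sum>i<n. 2 powr l * (norm (x i) powr l + 1))"
    proof (rule sum_mono)
      fix i
      have "norm (x i - ?m) powr l \<le> 2 powr l * (norm (x i) powr l + norm ?m powr l)"
        using norm_add_powr_le[of l "x i" "- ?m"] l by simp
      also have "\<dots> \<le> 2 powr l * (norm (x i) powr l + 1)" using m1 by (intro mult_left_mono) auto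
      finally show "norm (x i - ?m) powr l \<le> 2 powr l * (norm (x i) powr l + 1)" .
    qed
    also have "\<dots> = 2 powr l * ((\<Sum>i<n. norm (x i) powr l) + real n)"
      by (simp add: sum_distrib_left[symmetric] sum.distrib)
    finally have "(\<Sum>i<n. norm (x i - ?m) powr l) / real n \<le> 2 powr l * ((\<Sum>i<n. norm (x i) powr l) + real n) / real n"
      by (intro divide_right_mono) auto
    also have "\<dots> = 2 powr l * ((\<Sum>i<n. norm (x i) powr l) / real n + 1)" using n by (simp add: field_simps)
    also have "\<dots> \<le> 2 powr l * (?I + 2)" using A by (intro mult_left_mono) auto
    finally have "(\<Sum>i<n. norm (x i - ?m) powr l) / real n \<le> 2 powr l * (?I + 2)" .
    then have "(\<integral>\<^sup>+y. ennreal (norm y powr l) \<partial>empirical_measure n (center n x)) \<le> ennreal (2 powr l * (?I + 2))"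
      by (subst nn_integral_empirical) (auto simp: center_def intro!: ennreal_leI)
    then show "empirical_measure n (center n x) \<in> moment_ball l (2 powr l * (?I + 2))"
      using n by (simp add: moment_ball_def)
  qed
qed

end

subsection \<open>Exponential bounds for the Gibbs weights\<close>

lemma lower_semicontinuous_imp_borel:
  fixes W :: "'a::euclidean_space \<Rightarrow> real"
  assumes "lower_semicontinuous W" shows "W \<in> borel_measurable borel"
proof -
  have "open {x. c < W x}" for c
    unfolding open_subopen[of "{x. c < W x}"]
  proof (intro ballI)
    fix x assume "x \<in> {x. c < W x}"
    then obtain T where "open T" "x \<in> T" "\<forall>y\<in>T. c < W y"
      using assms unfolding lower_semicontinuous_def eventually_nhds by blast
    then show "\<exists>T. open T \<and> x \<in> T \<and> T \<subseteq> {x. c < W x}" by (intro exI[of _ T]) auto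
  qed
  then show ?thesis by (intro borel_measurableI_greater) (simp add: borel_open)
qed

text \<open>Constants and powers of \<open>n\<close> are absorbed by an arbitrarily small loss in
  the rate; all polynomial factors are disposed of in this way.\<close>

lemma eventually_subexponential:
  fixes c c' K :: real
  assumes "c < c'"
  shows "\<forall>\<^sub>F n in sequentially. K * real n ^ D * exp (- real n * c') \<le> exp (- real n * c)"
proof -
  define \<delta> where "\<delta> = c' - c"
  have \<delta>: "\<delta> > 0" using assms by (simp add: \<delta>_def)
  have lim: "filterlim (\<lambda>n. \<delta> * real n) at_top sequentially"
    using \<delta> by (intro filterlim_tendsto_pos_mult_at_top[OF tendsto_const] filterlim_real_sequentially)
  have "(\<lambda>n. K / \<delta> ^ D * ((\<delta> * real n) ^ D / exp (\<delta> * real n))) \<longlonglongrightarrow> K / \<delta> ^ D * 0"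
    by (intro tendsto_intros filterlim_compose[OF tendsto_power_div_exp_0 lim])
  then have "\<forall>\<^sub>F n in sequentially. K / \<delta> ^ D * ((\<delta> * real n) ^ D / exp (\<delta> * real n)) < 1"
    by (intro order_tendstoD(2)) auto
  then show ?thesis
  proof eventually_elim
    case (elim n)
    then have "K * real n ^ D * exp (- (\<delta> * real n)) < 1"
      using \<delta> by (simp add: power_mult_distrib exp_minus field_simps)
    then have "K * real n ^ D * exp (- (\<delta> * real n)) * exp (- real n * c) \<le> 1 * exp (- real n * c)"
      by (intro mult_right_mono) auto
    then show ?case by (simp add: mult.assoc exp_add[symmetric] \<delta>_def algebra_simps)
  qed
qed

text \<open>The decomposition of the potential is condensed into a single growth bound with leading
  constant \<open>a\<close> and additive error \<open>C\<close>.\<close>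

locale gibbs =
  fixes W :: "'a::euclidean_space \<Rightarrow> real" and \<sigma> l a C :: real
  assumes \<sigma>: "0 < \<sigma>\<^sup>2" and W0: "\<And>x. 0 \<le> W x" and W_lsc: "lower_semicontinuous W"
    and l: "1 \<le> l" and a: "0 < a" and growth: "\<And>x. a * norm x powr l - C \<le> W x"
begin

definition \<beta> :: real where "\<beta> = 2 / \<sigma>\<^sup>2"
text \<open>\<open>b0\<close> and \<open>C0\<close> are the constants of
  \<open>energy_lower_bound\<close>. The factor \<open>1 / 2\<close> is that of the interaction
  energy; \<open>2 powr l\<close> is the loss in \<open>centered_pair_moment\<close>.\<close>

definition b0 :: real where "b0 = \<beta> * a / (2 * 2 powr l)"
definition C0 :: real where "C0 = \<beta> * C / 2"
definition weight :: "nat \<Rightarrow> (nat \<Rightarrow> 'a) \<Rightarrow> real" where "weight n x = exp (- (\<beta> * real n * pair_energy W n x))"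
text \<open>Unnormalised, and meaningful for every \<open>A\<close> since \<open>nn_integral\<close>
  is monotone without measurability. Measurability, recorded by \<open>observable\<close>, enters
  with additivity, changes of variables and the passage to probabilities.\<close>

definition mass :: "nat \<Rightarrow> 'a measure set \<Rightarrow> ennreal" where
  "mass n A = (\<integral>\<^sup>+x. ennreal (weight n x) * indicator A (empirical_measure n x) \<partial>centered_lebesgue n)"
definition observable :: "'a measure set \<Rightarrow> bool" where
  "observable A \<longleftrightarrow> (\<forall>n>0. {x \<in> space (config_space n). empirical_measure n x \<in> A} \<in> sets (config_space n))"

lemma \<beta>: "0 < \<beta>" using \<sigma> by (simp add: \<beta>_def)
lemma b0: "0 < b0" using \<beta> a by (simp add: b0_def)

lemma W_borel [measurable]: "W \<in> borel_measurable borel"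
  by (rule lower_semicontinuous_imp_borel[OF W_lsc])

lemma pair_energy_nonneg: "0 \<le> pair_energy W n x"
  unfolding pair_energy_def using W0 by (intro divide_nonneg_nonneg sum_nonneg) auto

lemma pair_energy_borel [measurable]: "pair_energy W n \<in> borel_measurable (config_space n)"
  unfolding pair_energy_def by measurable

lemma weight_borel [measurable]: "weight n \<in> borel_measurable (config_space n)"
  unfolding weight_def by measurable

lemma boltzmann_weight: "boltzmann_weight W \<sigma> n x = ennreal (weight n x)"
  by (simp add: boltzmann_weight_eq[OF W_borel W0] weight_def \<beta>_def)

lemma observable_indicator:
  assumes "observable A" "0 < n"
  shows "(\<lambda>x. indicator A (empirical_measure n x) :: ennreal) \<in> borel_measurable (config_space n)"
proof -
  have "{x \<in> space (config_space n). empirical_measure n x \<in> A} \<in> sets (config_space n)"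
    using assms by (simp add: observable_def)
  then show ?thesis by (rule borel_measurable_indicator') 
qed

lemma observable_weak_open: "openin weak_topology U \<Longrightarrow> observable U"
  unfolding observable_def by (intro allI impI measurable_empirical_preimage[OF continuous_map_empirical_weak])

lemma observable_wasserstein_open: "openin (wasserstein_topology p) U \<Longrightarrow> 1 \<le> p \<Longrightarrow> observable U"
  unfolding observable_def by (intro allI impI measurable_empirical_preimage[OF continuous_map_empirical_wasserstein])

lemma observable_Compl: "observable A \<Longrightarrow> observable (- A)"
  unfolding observable_def
proof (intro allI impI)
  fix n :: nat assume *: "\<forall>n>0. {x \<in> space (config_space n). empirical_measure n x \<in> A} \<in> sets (config_space n)" "0 < n"
  have "{x \<in> space (config_space n). empirical_measure n x \<in> - A}
      = space (config_space n) - {x \<in> space (config_space n). empirical_measure n x \<in> A}" by auto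
  then show "{x \<in> space (config_space n). empirical_measure n x \<in> - A} \<in> sets (config_space n)" using * by auto
qed

lemma observable_Int: "observable A \<Longrightarrow> observable B \<Longrightarrow> observable (A \<inter> B)"
  unfolding observable_def
proof (intro allI impI)
  fix n :: nat assume *: "\<forall>n>0. {x \<in> space (config_space n). empirical_measure n x \<in> A} \<in> sets (config_space n)"
    "\<forall>n>0. {x \<in> space (config_space n). empirical_measure n x \<in> B} \<in> sets (config_space n)" "0 < n"
  have "{x \<in> space (config_space n). empirical_measure n x \<in> A \<inter> B}
      = {x \<in> space (config_space n). empirical_measure n x \<in> A} \<inter> {x \<in> space (config_space n). empirical_measure n x \<in> B}" by auto
  then show "{x \<in> space (config_space n). empirical_measure n x \<in> A \<inter> B} \<in> sets (config_space n)" using * by auto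
qed

lemma observable_Un: "observable A \<Longrightarrow> observable B \<Longrightarrow> observable (A \<union> B)"
  using observable_Compl[OF observable_Int[OF observable_Compl observable_Compl], of A B] by simp

lemma observable_weak_closed: "closedin weak_topology A \<Longrightarrow> observable A"
proof -
  assume A: "closedin weak_topology A"
  have o: "observable (topspace weak_topology - A)" "observable (topspace weak_topology)"
    using A by (auto intro!: observable_weak_open)
  have "A = topspace weak_topology \<inter> - (topspace weak_topology - A)" using closedin_subset[OF A] by auto
  then show ?thesis using observable_Int[OF o(2) observable_Compl[OF o(1)]] by simp
qed

lemma mass_mono: "A \<subseteq> B \<Longrightarrow> mass n A \<le> mass n B"
  unfolding mass_def by (intro nn_integral_mono mult_left_mono) (auto simp: indicator_def)

lemma mass_Un:
  assumes "observable A" "observable B" "0 < n"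
  shows "mass n (A \<union> B) \<le> mass n A + mass n B"
proof -
  note [measurable] = observable_indicator[OF assms(1,3)] observable_indicator[OF assms(2,3)]
  have "mass n (A \<union> B) \<le> (\<integral>\<^sup>+x. ennreal (weight n x) * indicator A (empirical_measure n x)
      + ennreal (weight n x) * indicator B (empirical_measure n x) \<partial>centered_lebesgue n)"
    unfolding mass_def by (intro nn_integral_mono) (auto simp: indicator_def)
  also have "\<dots> = mass n A + mass n B" unfolding mass_def by (subst nn_integral_add) auto
  finally show ?thesis .
qed

lemma mass_eq_fill_last:
  assumes "observable A" "0 < n"
  shows "mass n A = ennreal (sqrt (real n) ^ DIM('a)) *
    (\<integral>\<^sup>+x. ennreal (weight n (fill_last n x)) * indicator A (empirical_measure n (fill_last n x)) \<partial>config_lborel (n - 1))"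
proof -
  note [measurable] = observable_indicator[OF assms]
  show ?thesis unfolding mass_def using assms(2) by (subst nn_integral_centered_lebesgue) auto
qed

text \<open>The growth bound is summed over all pairs and \<open>centered_pair_moment\<close> over
  all \<open>i\<close>: centering converts a translation invariant energy into confinement of the
  individual points.\<close>

lemma energy_lower_bound:
  assumes x: "(\<Sum>i<n. x i) = 0" and n: "0 < n"
  shows "b0 * (\<Sum>i<n. norm (x i) powr l) - C0 * real n \<le> \<beta> * real n * pair_energy W n x"
proof -
  have "(\<Sum>i<n. (norm (x i) / 2) powr l) \<le> (\<Sum>i<n. (\<Sum>j<n. norm (x i - x j) powr l) / real n)"
    by (intro sum_mono centered_pair_moment[OF x _ l]) simp
  then have "(\<Sum>i<n. norm (x i) powr l) / 2 powr l \<le> (\<Sum>i<n. \<Sum>j<n. norm (x i - x j) powr l) / real n"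
    by (simp add: powr_divide sum_divide_distrib)
  then have 1: "real n * ((\<Sum>i<n. norm (x i) powr l) / 2 powr l) \<le> (\<Sum>i<n. \<Sum>j<n. norm (x i - x j) powr l)"
    using n by (simp add: field_simps)
  have "a * (real n * ((\<Sum>i<n. norm (x i) powr l) / 2 powr l)) - (real n)\<^sup>2 * C
      \<le> a * (\<Sum>i<n. \<Sum>j<n. norm (x i - x j) powr l) - (real n)\<^sup>2 * C"
    using 1 a by (intro diff_right_mono mult_left_mono) auto
  also have "\<dots> = (\<Sum>i<n. \<Sum>j<n. a * norm (x i - x j) powr l - C)"
    by (simp add: sum_subtractf sum_distrib_left power2_eq_square)
  also have "\<dots> \<le> (\<Sum>i<n. \<Sum>j<n. W (x i - x j))" by (intro sum_mono growth)
  finally have "\<beta> / (2 * real n) * (a * (real n * ((\<Sum>i<n. norm (x i) powr l) / 2 powr l)) - (real n)\<^sup>2 * C)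
      \<le> \<beta> / (2 * real n) * (\<Sum>i<n. \<Sum>j<n. W (x i - x j))"
    using \<beta> by (intro mult_left_mono) auto
  moreover have "\<beta> / (2 * real n) * (\<Sum>i<n. \<Sum>j<n. W (x i - x j)) = \<beta> * real n * pair_energy W n x"
    using n by (simp add: pair_energy_def power2_eq_square)
  moreover have "\<beta> / (2 * real n) * (a * (real n * ((\<Sum>i<n. norm (x i) powr l) / 2 powr l)) - (real n)\<^sup>2 * C)
      = b0 * (\<Sum>i<n. norm (x i) powr l) - C0 * real n"
    using n by (simp add: b0_def C0_def power2_eq_square field_simps)
  ultimately show ?thesis by simp
qed

lemma AE_centered:
  assumes n: "0 < n"
  shows "AE x in (centered_lebesgue n :: (nat \<Rightarrow> 'a) measure). x \<in> centered_configurations n"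
proof -
  let ?N = "space (config_space n) - centered_configurations n :: (nat \<Rightarrow> 'a) set"
  have N: "?N \<in> sets (config_space n)" using centered_configurations_sets[of n] by (rule sets.compl_sets)
  have "(\<integral>\<^sup>+x. indicator ?N x \<partial>centered_lebesgue n)
      = ennreal (sqrt (real n) ^ DIM('a)) * (\<integral>\<^sup>+x. indicator ?N (fill_last n x) \<partial>config_lborel (n - 1))"
    using N by (intro nn_integral_centered_lebesgue n borel_measurable_indicator)
  also have "(\<integral>\<^sup>+x. indicator ?N (fill_last n x) \<partial>config_lborel (n - 1)) = (\<integral>\<^sup>+(x :: nat \<Rightarrow> 'a). 0 \<partial>config_lborel (n - 1))"
    using fill_last_centered[OF n, where 'a = 'a] by (intro nn_integral_cong) (auto simp: indicator_def)
  finally have "emeasure (centered_lebesgue n) ?N = 0" using N by simp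
  then show ?thesis using N
    by (intro AE_I[of _ _ ?N]) (auto simp: space_centered_lebesgue)
qed

lemma mass_le:
  fixes \<phi> :: "'a \<Rightarrow> real"
  assumes b: "0 < b" and [measurable]: "\<phi> \<in> borel_measurable borel" and B: "\<And>x. \<phi> x \<le> B"
    and w: "\<And>x. (\<Sum>i<n. x i) = 0 \<Longrightarrow> empirical_measure n x \<in> A \<Longrightarrow>
       weight n x \<le> exp (- real n * k) * (\<Prod>i<n. exp (\<phi> (x i)) * stretched_exp b l (x i))"
    and n: "0 < n"
  shows "mass n A \<le> ennreal (exp (- real n * k) * (sqrt (real n) ^ DIM('a) *
    (exp B * (\<integral>x. exp (\<phi> x) * stretched_exp b l x \<partial>lborel) ^ (n - 1))))"
proof -
  let ?g = "\<lambda>x. exp (\<phi> x) * stretched_exp b l x"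
  have g0: "0 \<le> ?g x" for x by (simp add: stretched_exp_bounds less_imp_le)
  have gB: "?g x \<le> exp B" for x
    using B[of x] b stretched_exp_bounds(2)[of b l x] stretched_exp_bounds(1)[of b l x]
      mult_mono[of "exp (\<phi> x)" "exp B" "stretched_exp b l x" 1] by simp
  have "integrable lborel (\<lambda>x. exp B * stretched_exp b l x :: real)"
    using integrable_stretched_exp[OF b l] by simp
  then have g_int: "integrable lborel ?g"
    by (rule Bochner_Integration.integrable_bound)
       (use B in \<open>auto simp: abs_mult stretched_exp_bounds(1) less_imp_le intro!: mult_right_mono\<close>)
  have "mass n A \<le> (\<integral>\<^sup>+x. ennreal (exp (- real n * k)) * (\<Prod>i<n. ennreal (?g (x i))) \<partial>centered_lebesgue n)"
    unfolding mass_def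
  proof (rule nn_integral_mono_AE, use AE_centered[OF n] in eventually_elim)
    fix x :: "nat \<Rightarrow> 'a" assume x: "x \<in> centered_configurations n"
    show "ennreal (weight n x) * indicator A (empirical_measure n x) \<le> ennreal (exp (- real n * k)) * (\<Prod>i<n. ennreal (?g (x i)))"
    proof (cases "empirical_measure n x \<in> A")
      case True
      then have "weight n x \<le> exp (- real n * k) * (\<Prod>i<n. ?g (x i))"
        using x by (intro w) (auto simp: centered_configurations_def)
      then have "ennreal (weight n x) \<le> ennreal (exp (- real n * k) * (\<Prod>i<n. ?g (x i)))" by (rule ennreal_leI)
      also have "\<dots> = ennreal (exp (- real n * k)) * (\<Prod>i<n. ennreal (?g (x i)))"
        using g0 by (simp add: ennreal_mult prod_nonneg prod_ennreal)
      finally show ?thesis using True by simp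
    qed simp
  qed
  also have "\<dots> = ennreal (exp (- real n * k)) * (\<integral>\<^sup>+x. (\<Prod>i<n. ennreal (?g (x i))) \<partial>centered_lebesgue n)"
    by (rule nn_integral_cmult) measurable
  also have "\<dots> \<le> ennreal (exp (- real n * k)) * (ennreal (sqrt (real n) ^ DIM('a)) * (ennreal (exp B) * (\<integral>\<^sup>+x. ennreal (?g x) \<partial>lborel) ^ (n - 1)))"
    using gB by (intro mult_left_mono nn_integral_centered_prod_le[OF n]) (auto intro!: ennreal_leI)
  also have "(\<integral>\<^sup>+x. ennreal (?g x) \<partial>lborel) = ennreal (\<integral>x. ?g x \<partial>lborel)"
    using g_int g0 by (intro nn_integral_eq_integral) auto
  also have "ennreal (exp (- real n * k)) * (ennreal (sqrt (real n) ^ DIM('a)) * (ennreal (exp B) * ennreal (\<integral>x. ?g x \<partial>lborel) ^ (n - 1)))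
     = ennreal (exp (- real n * k) * (sqrt (real n) ^ DIM('a) * (exp B * (\<integral>x. ?g x \<partial>lborel) ^ (n - 1))))"
  proof -
    have "0 \<le> (\<integral>x. ?g x \<partial>lborel)" using g0 by (intro integral_nonneg_AE) auto
    then show ?thesis by (simp add: ennreal_mult ennreal_power)
  qed
  finally show ?thesis .
qed

text \<open>The free integrations give \<open>I ^ (n - 1)\<close>. What remains, a power of
  \<open>n\<close> and a constant, fits into the gap between \<open>c\<close> and
  \<open>k - ln I\<close>.\<close>

lemma mass_eventually_le:
  fixes \<phi> :: "'a \<Rightarrow> real"
  assumes b: "0 < b" and \<phi> [measurable]: "\<phi> \<in> borel_measurable borel" and B: "\<And>x. \<bar>\<phi> x\<bar> \<le> B"
    and w: "\<And>n x. 0 < n \<Longrightarrow> (\<Sum>i<n. x i) = 0 \<Longrightarrow> empirical_measure n x \<in> A \<Longrightarrow>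
       weight n x \<le> exp (- real n * k) * (\<Prod>i<n. exp (\<phi> (x i)) * stretched_exp b l (x i))"
    and c: "c < k - ln (\<integral>x. exp (\<phi> x) * stretched_exp b l x \<partial>lborel)"
  shows "\<forall>\<^sub>F n in sequentially. mass n A \<le> ennreal (exp (- real n * c))"
proof -
  define I where "I = (\<integral>x. exp (\<phi> x) * stretched_exp b l x \<partial>lborel)"
  have I: "0 < I"
  proof -
    have int: "integrable lborel (stretched_exp b l :: 'a \<Rightarrow> real)" by (rule integrable_stretched_exp[OF b l])
    have pos: "0 < (\<integral>x. stretched_exp b l x \<partial>(lborel :: 'a measure))"
    proof -
      have "0 \<le> (\<integral>x. stretched_exp b l x \<partial>(lborel :: 'a measure))"
        by (intro integral_nonneg_AE) (auto simp: stretched_exp_bounds less_imp_le)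
      moreover have "(\<integral>x. stretched_exp b l x \<partial>(lborel :: 'a measure)) \<noteq> 0"
      proof
        assume "(\<integral>x. stretched_exp b l x \<partial>(lborel :: 'a measure)) = 0"
        then have "AE x in (lborel :: 'a measure). stretched_exp b l x = 0"
          using int by (subst (asm) integral_nonneg_eq_0_iff_AE) (auto simp: stretched_exp_bounds less_imp_le)
        then have "AE x in (lborel :: 'a measure). False"
          by eventually_elim (auto simp: stretched_exp_def)
        then obtain N where "UNIV \<subseteq> N" "emeasure (lborel :: 'a measure) N = 0" by (rule AE_E) auto
        then show False using emeasure_lborel_UNIV[where 'a = 'a] by (simp add: top.extremum_unique)
      qed
      ultimately show ?thesis by simp
    qed
    have le: "exp (\<phi> x) \<le> exp B" "exp (- B) \<le> exp (\<phi> x)" for x using B[of x] by auto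
    have "integrable lborel (\<lambda>x. exp (\<phi> x) * stretched_exp b l x)"
      by (rule Bochner_Integration.integrable_bound[of _ "\<lambda>x. exp B * stretched_exp b l x"])
         (use int le in \<open>auto simp: abs_mult stretched_exp_bounds(1) less_imp_le intro!: mult_right_mono\<close>)
    moreover have "integrable lborel (\<lambda>x :: 'a. exp (- B) * stretched_exp b l x :: real)" using int by simp
    moreover have "exp (- B) * stretched_exp b l x \<le> exp (\<phi> x) * stretched_exp b l x" for x :: 'a
      by (intro mult_right_mono le) (simp add: stretched_exp_bounds(1) less_imp_le)
    ultimately have "(\<integral>x. exp (- B) * stretched_exp b l x \<partial>(lborel :: 'a measure)) \<le> I"
      unfolding I_def by (intro integral_mono)
    then show ?thesis using pos by (auto intro: less_le_trans[rotated])
  qed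
  have "\<forall>\<^sub>F n in sequentially. exp B / I * real n ^ DIM('a) * exp (- real n * (k - ln I)) \<le> exp (- real n * c)"
    using c by (intro eventually_subexponential) (simp add: I_def)
  then show ?thesis using eventually_ge_at_top[of 1]
  proof eventually_elim
    case (elim n)
    have "mass n A \<le> ennreal (exp (- real n * k) * (sqrt (real n) ^ DIM('a) * (exp B * I ^ (n - 1))))"
      unfolding I_def using elim(2) B by (intro mass_le b \<phi> w) (auto simp: abs_le_iff)
    also have "\<dots> \<le> ennreal (exp (- real n * c))"
    proof (rule ennreal_leI)
      have "I ^ n = exp (real n * ln I)" using I by (simp add: exp_of_nat_mult)
      moreover have "I ^ (n - 1) = I ^ n / I" using I elim(2) by (simp add: power_diff)
      ultimately have "exp (- real n * k) * (sqrt (real n) ^ DIM('a) * (exp B * I ^ (n - 1)))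
          = exp B / I * sqrt (real n) ^ DIM('a) * exp (- real n * (k - ln I))"
        by (simp add: right_diff_distrib exp_diff exp_minus field_simps)
      also have "\<dots> \<le> exp B / I * real n ^ DIM('a) * exp (- real n * (k - ln I))"
      proof (intro mult_right_mono mult_left_mono power_mono)
        show "sqrt (real n) \<le> real n" using elim(2) by (intro real_le_lsqrt) (auto simp: power2_eq_square)
      qed (use I in auto)
      also have "\<dots> \<le> exp (- real n * c)" by (rule elim(1))
      finally show "exp (- real n * k) * (sqrt (real n) ^ DIM('a) * (exp B * I ^ (n - 1))) \<le> exp (- real n * c)" .
    qed
    finally show ?case .
  qed
qed

section \<open>The large deviation upper bound\<close>

text \<open>The share \<open>\<epsilon>\<close> of the energy is replaced by its confining lower
  bound, which factorises over the points; the share \<open>1 - \<epsilon>\<close> is kept for the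
  semicontinuity argument.\<close>

lemma weight_le_stretched:
  assumes x: "(\<Sum>i<n. x i) = 0" and n: "0 < n" and \<epsilon>: "0 \<le> \<epsilon>" "\<epsilon> \<le> 1"
  shows "weight n x \<le> exp (- real n * ((1 - \<epsilon>) * \<beta> * pair_energy W n x - \<epsilon> * C0)) * (\<Prod>i<n. stretched_exp (\<epsilon> * b0) l (x i))"
proof -
  have "\<epsilon> * (b0 * (\<Sum>i<n. norm (x i) powr l) - C0 * real n) \<le> \<epsilon> * (\<beta> * real n * pair_energy W n x)"
    using energy_lower_bound[OF x n] \<epsilon> by (intro mult_left_mono) auto
  moreover have "(\<Prod>i<n. stretched_exp (\<epsilon> * b0) l (x i)) = exp (- (\<epsilon> * (b0 * (\<Sum>i<n. norm (x i) powr l))))"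
    by (simp add: stretched_exp_def exp_sum[symmetric] sum_negf sum_distrib_left mult.assoc)
  ultimately show ?thesis
    by (simp add: weight_def exp_add[symmetric] algebra_simps)
qed

text \<open>Outside the moment ball one half of the confinement is kept for integrability, while the
  other half yields a factor \<open>exp (- n * b0 * R / 2)\<close>, which beats any prescribed rate
  for large \<open>R\<close>.\<close>

lemma exponential_tightness:
  obtains R where "0 \<le> R" "\<forall>\<^sub>F n in sequentially. mass n (- moment_ball l R) \<le> ennreal (exp (- real n * L))"
proof -
  let ?I = "\<integral>x. exp 0 * stretched_exp (b0 / 2) l x \<partial>(lborel :: 'a measure)"
  \<comment> \<open>The summand \<open>1\<close> provides the strict gap demanded by
    \<open>mass_eventually_le\<close>.\<close>
  define R where "R = max 0 (2 * (L + 1 + C0 + ln ?I) / b0)"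
  have "\<forall>\<^sub>F n in sequentially. mass n (- moment_ball l R) \<le> ennreal (exp (- real n * L))"
  proof (rule mass_eventually_le[where b = "b0 / 2" and \<phi> = "\<lambda>_. 0" and B = 0 and k = "b0 / 2 * R - C0"])
    have "2 * (L + 1 + C0 + ln ?I) / b0 \<le> R" by (simp add: R_def)
    then have "L + 1 + C0 + ln ?I \<le> b0 / 2 * R" using b0 by (simp add: field_simps)
    then show "L < b0 / 2 * R - C0 - ln ?I" by simp
    fix n and x :: "nat \<Rightarrow> 'a" assume n: "0 < n" and x: "(\<Sum>i<n. x i) = 0" and A: "empirical_measure n x \<in> - moment_ball l R"
    have "real n * R \<le> (\<Sum>i<n. norm (x i) powr l)"
    proof (rule ccontr)
      assume "\<not> ?thesis"
      then have "(\<Sum>i<n. norm (x i) powr l) / real n \<le> R" using n by (simp add: field_simps)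
      then have "empirical_measure n x \<in> moment_ball l R"
        using n by (simp add: moment_ball_def nn_integral_empirical ennreal_leI)
      then show False using A by simp
    qed
    then have "b0 / 2 * (real n * R) \<le> b0 / 2 * (\<Sum>i<n. norm (x i) powr l)" using b0 by (intro mult_left_mono) auto
    then have "- (\<beta> * real n * pair_energy W n x) \<le> - real n * (b0 / 2 * R - C0) + - (b0 / 2 * (\<Sum>i<n. norm (x i) powr l))"
      using energy_lower_bound[OF x n] by (simp add: algebra_simps)
    moreover have "(\<Prod>i<n. exp 0 * stretched_exp (b0 / 2) l (x i)) = exp (- (b0 / 2 * (\<Sum>i<n. norm (x i) powr l)))"
      by (simp add: stretched_exp_def exp_sum[symmetric] sum_negf sum_distrib_left)
    ultimately show "weight n x \<le> exp (- real n * (b0 / 2 * R - C0)) * (\<Prod>i<n. exp 0 * stretched_exp (b0 / 2) l (x i))"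
      by (simp only: weight_def exp_add[symmetric] exp_le_cancel_iff)
  qed (use b0 in auto)
  then show ?thesis using that[of R] by (simp add: R_def)
qed

text \<open>
  A fraction \<open>\<epsilon>\<close> of the interaction provides confinement; the rest is bounded below by lower
  semicontinuity, and the test function \<open>\<phi>\<close> accounts for the entropy.
\<close>

lemma local_upper_bound:
  assumes \<mu>: "\<mu> \<in> prob_measures" and c: "ereal c < free_energy W \<sigma> \<mu>"
  obtains U where "openin weak_topology U" "\<mu> \<in> U"
    "\<forall>\<^sub>F n in sequentially. mass n U \<le> ennreal (exp (- real n * c))"
\<comment> \<open>If no neighbourhood of \<open>\<mu>\<close> has mass decaying at rate
  \<open>c\<close>, then every test function obeys the dual inequality, as a violation would itself
  define such a neighbourhood. The dual inequality in turn bounds the free energy by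
  \<open>c\<close>.\<close>
proof (rule ccontr)
  note obt = that
  assume "\<not> thesis"
  then have no: False if "openin weak_topology U" "\<mu> \<in> U"
    "\<forall>\<^sub>F n in sequentially. mass n U \<le> ennreal (exp (- real n * c))" for U
    using obt[OF that] \<open>\<not> thesis\<close> by blast
  have ent: "entropy_functional \<mu> \<le> ereal (c + \<epsilon> * C0 - (1 - \<epsilon>) * \<beta> * w)"
    if \<epsilon>: "0 < \<epsilon>" "\<epsilon> < 1" and w: "w = 0 \<or> ennreal w < interaction_energy W \<mu>" "0 \<le> w" for \<epsilon> w
  proof -
    obtain U1 where U1: "openin weak_topology U1" "\<mu> \<in> U1" "\<And>n x. 0 < n \<Longrightarrow> empirical_measure n x \<in> U1 \<Longrightarrow> w \<le> pair_energy W n x"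
    proof (cases "w = 0")
      case True
      then show ?thesis using that[of prob_measures] \<mu> pair_energy_nonneg openin_topspace[of weak_topology]
        by (auto simp: topspace_weak_topology)
    next
      case False
      then have "ennreal w < interaction_energy W \<mu>" using w by simp
      then obtain U where U: "openin weak_topology U" "\<mu> \<in> U" "\<And>\<nu>. \<nu> \<in> U \<Longrightarrow> ennreal w < interaction_energy W \<nu>"
        using interaction_energy_weak_lsc[OF W0 W_lsc \<mu>] by blast
      show ?thesis
      proof (rule that[OF U(1,2)])
        fix n and x :: "nat \<Rightarrow> 'a" assume "empirical_measure n x \<in> U"
        then have "ennreal w < ennreal (pair_energy W n x)"
          using U(3) by (simp add: interaction_energy_empirical[OF W_borel W0, symmetric])
        then show "w \<le> pair_energy W n x" using w(2) by (simp add: ennreal_less_iff)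
      qed
    qed
    interpret dual_entropy_bound \<mu> "\<epsilon> * b0" l "c + \<epsilon> * C0 - (1 - \<epsilon>) * \<beta> * w"
    proof
      show "\<mu> \<in> prob_measures" "0 < \<epsilon> * b0" "1 \<le> l" using \<mu> \<epsilon> b0 l by auto
      fix \<phi> :: "'a \<Rightarrow> real" assume \<phi>: "continuous_on UNIV \<phi>" "bounded (range \<phi>)"
      let ?I = "\<integral>x. exp (\<phi> x) * stretched_exp (\<epsilon> * b0) l x \<partial>lborel"
      show "(\<integral>x. \<phi> x \<partial>\<mu>) \<le> c + \<epsilon> * C0 - (1 - \<epsilon>) * \<beta> * w + ln ?I"
      proof (rule ccontr)
        assume "\<not> ?thesis"
        then have gap: "0 < (\<integral>x. \<phi> x \<partial>\<mu>) - (c + \<epsilon> * C0 - (1 - \<epsilon>) * \<beta> * w + ln ?I)" by simp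
        \<comment> \<open>One half of the violation becomes the margin of the neighbourhood, the
          other half the strict gap in the rate.\<close>
        define \<eta> where "\<eta> = ((\<integral>x. \<phi> x \<partial>\<mu>) - (c + \<epsilon> * C0 - (1 - \<epsilon>) * \<beta> * w + ln ?I)) / 2"
        have \<eta>: "0 < \<eta>" using gap by (simp add: \<eta>_def)
        obtain B where B: "\<And>x. \<bar>\<phi> x\<bar> \<le> B" using \<phi>(2) by (auto simp: bounded_iff)
        define m where "m = (\<integral>x. \<phi> x \<partial>\<mu>) - \<eta>"
        define U where "U = U1 \<inter> {\<nu> \<in> prob_measures. (\<integral>x. \<phi> x \<partial>\<nu>) \<in> {m<..}}"
        show False
        proof (rule no)
          show "openin weak_topology U" unfolding U_def by (intro openin_Int U1(1) openin_weak_basic \<phi>) auto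
          show "\<mu> \<in> U" using U1(2) \<mu> \<eta> by (simp add: U_def m_def)
          show "\<forall>\<^sub>F n in sequentially. mass n U \<le> ennreal (exp (- real n * c))"
          proof (rule mass_eventually_le[where b = "\<epsilon> * b0" and \<phi> = \<phi> and B = B and k = "(1 - \<epsilon>) * \<beta> * w - \<epsilon> * C0 + m"])
            show "c < (1 - \<epsilon>) * \<beta> * w - \<epsilon> * C0 + m - ln ?I" using \<eta> by (simp add: m_def \<eta>_def field_simps)
            fix n and x :: "nat \<Rightarrow> 'a" assume n: "0 < n" and x: "(\<Sum>i<n. x i) = 0" and xU: "empirical_measure n x \<in> U"
            have "m < (\<Sum>i<n. \<phi> (x i)) / real n"
              using xU by (simp add: U_def integral_empirical borel_measurable_continuous_onI[OF \<phi>(1)])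
            then have 1: "0 \<le> (\<Sum>i<n. \<phi> (x i)) - real n * m" using n by (simp add: field_simps)
            have "w \<le> pair_energy W n x" using xU by (intro U1(3) n) (simp add: U_def)
            then have "(1 - \<epsilon>) * \<beta> * w \<le> (1 - \<epsilon>) * \<beta> * pair_energy W n x"
              using \<epsilon> \<beta> by (intro mult_left_mono mult_nonneg_nonneg) simp_all
            then have "real n * ((1 - \<epsilon>) * \<beta> * w) \<le> real n * ((1 - \<epsilon>) * \<beta> * pair_energy W n x)" by (rule mult_left_mono) simp
            then have 2: "exp (- real n * ((1 - \<epsilon>) * \<beta> * pair_energy W n x - \<epsilon> * C0))
                \<le> exp (- real n * ((1 - \<epsilon>) * \<beta> * w - \<epsilon> * C0 + m) + (\<Sum>i<n. \<phi> (x i)))"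
              using 1 by (simp add: algebra_simps)
            have "weight n x \<le> exp (- real n * ((1 - \<epsilon>) * \<beta> * pair_energy W n x - \<epsilon> * C0)) * (\<Prod>i<n. stretched_exp (\<epsilon> * b0) l (x i))"
              using \<epsilon> by (intro weight_le_stretched x n) auto
            also have "\<dots> \<le> exp (- real n * ((1 - \<epsilon>) * \<beta> * w - \<epsilon> * C0 + m) + (\<Sum>i<n. \<phi> (x i))) * (\<Prod>i<n. stretched_exp (\<epsilon> * b0) l (x i))"
              by (intro mult_right_mono 2 prod_nonneg) (simp add: stretched_exp_bounds less_imp_le)
            also have "\<dots> = exp (- real n * ((1 - \<epsilon>) * \<beta> * w - \<epsilon> * C0 + m)) * (\<Prod>i<n. exp (\<phi> (x i)) * stretched_exp (\<epsilon> * b0) l (x i))"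
              by (simp only: exp_add exp_sum[OF finite_lessThan] prod.distrib mult.assoc)
            finally show "weight n x \<le> exp (- real n * ((1 - \<epsilon>) * \<beta> * w - \<epsilon> * C0 + m)) * (\<Prod>i<n. exp (\<phi> (x i)) * stretched_exp (\<epsilon> * b0) l (x i))" .
          qed (use \<epsilon> b0 B borel_measurable_continuous_onI[OF \<phi>(1)] in auto)
        qed
      qed
    qed
    show ?thesis by (rule entropy_le)
  qed
  have ent': "entropy_functional \<mu> \<le> ereal (c - \<beta> * w)"
    if w: "w = 0 \<or> ennreal w < interaction_energy W \<mu>" "0 \<le> w" for w
  proof -
    \<comment> \<open>The confining share tends to \<open>0\<close>; the sequence starts at
      \<open>1 / 2\<close> to keep it below \<open>1\<close>.\<close>
    have "(\<lambda>k. ereal (c + inverse (real (Suc (Suc k))) * C0 - (1 - inverse (real (Suc (Suc k)))) * \<beta> * w)) \<longlonglongrightarrow> ereal (c + 0 * C0 - (1 - 0) * \<beta> * w)"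
      by (intro tendsto_intros LIMSEQ_Suc[OF LIMSEQ_inverse_real_of_nat])
    moreover have "entropy_functional \<mu> \<le> ereal (c + inverse (real (Suc (Suc k))) * C0 - (1 - inverse (real (Suc (Suc k)))) * \<beta> * w)" for k
      using w by (intro ent) (auto simp: inverse_eq_divide)
    ultimately have "entropy_functional \<mu> \<le> ereal (c + 0 * C0 - (1 - 0) * \<beta> * w)"
      by (intro LIMSEQ_le_const) blast+
    then show ?thesis by simp
  qed
  have "free_energy W \<sigma> \<mu> \<le> ereal c"
  proof -
    have "entropy_functional \<mu> \<le> ereal c" using ent'[of 0] by simp
    then obtain s where s: "entropy_functional \<mu> = ereal s"
      using entropy_functional_gt_MInf[of \<mu>] by (cases "entropy_functional \<mu>") auto
    show ?thesis
    proof (cases "interaction_energy W \<mu>")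
      \<comment> \<open>With infinite energy \<open>w\<close> could be taken arbitrarily large,
        which contradicts the finite value \<open>s\<close> of the entropy.\<close>
      case top
      define w where "w = max 0 ((c - s + 1) / \<beta>)"
      have "(c - s + 1) / \<beta> \<le> w" by (simp add: w_def)
      then have "c - s + 1 \<le> \<beta> * w" using \<beta> by (simp add: field_simps)
      moreover have "s \<le> c - \<beta> * w" using ent'[of w] top s by (simp add: w_def)
      ultimately show ?thesis by simp
    next
      case (real e)
      have "s \<le> c - \<beta> * e"
      proof (rule field_le_epsilon)
        fix \<delta> :: real assume \<delta>: "0 < \<delta>"
        define w where "w = max 0 (e - \<delta> / \<beta>)"
        have "w = 0 \<or> ennreal w < ennreal e" using real \<delta> \<beta> by (auto simp: w_def ennreal_less_iff max_def)
        then have "s \<le> c - \<beta> * w" using ent'[of w] real s by (simp add: w_def)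
        moreover have "\<beta> * (e - \<delta> / \<beta>) \<le> \<beta> * w" using \<beta> by (intro mult_left_mono) (auto simp: w_def)
        ultimately show "s \<le> c - \<beta> * e + \<delta>" using \<beta> by (simp add: right_diff_distrib)
      qed
      then show ?thesis using real s by (simp add: free_energy_def \<beta>_def)
    qed
  qed
  then show False using c by simp
qed

lemma finite_cover_upper_bound:
  fixes K :: "'a measure set"
  assumes K: "compactin X K"
    and loc: "\<And>\<mu>. \<mu> \<in> K \<Longrightarrow> \<exists>U. openin X U \<and> \<mu> \<in> U \<and> observable U \<and> (\<forall>\<^sub>F n in sequentially. mass n U \<le> ennreal (exp (- real n * c)))"
  obtains V N where "K \<subseteq> V" "observable V" "\<forall>\<^sub>F n in sequentially. mass n V \<le> ennreal (real N * exp (- real n * c))"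
proof -
  define good where "good U \<longleftrightarrow> openin X U \<and> observable U \<and> (\<forall>\<^sub>F n in sequentially. mass n U \<le> ennreal (exp (- real n * c)))" for U
  have "\<forall>U\<in>Collect good. openin X U" by (auto simp: good_def)
  moreover have "K \<subseteq> \<Union>(Collect good)"
  proof
    fix \<mu> assume "\<mu> \<in> K"
    from loc[OF this] show "\<mu> \<in> \<Union>(Collect good)" by (auto simp: good_def)
  qed
  ultimately
  obtain F where F: "finite F" "F \<subseteq> Collect good" "K \<subseteq> \<Union>F"
    using K unfolding compactin_def by (metis (no_types, lifting))
  have "observable (\<Union>F) \<and> (\<forall>\<^sub>F n in sequentially. mass n (\<Union>F) \<le> ennreal (real (card F) * exp (- real n * c)))"
    using F(1,2)
  proof (induction F)
    case empty
    have "mass n {} = 0" for n by (simp add: mass_def)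
    then show ?case by (auto simp: observable_def)
  next
    case (insert U F)
    then have IH: "observable (\<Union>F)" "\<forall>\<^sub>F n in sequentially. mass n (\<Union>F) \<le> ennreal (real (card F) * exp (- real n * c))"
      and U: "observable U" "\<forall>\<^sub>F n in sequentially. mass n U \<le> ennreal (exp (- real n * c))" by (auto simp: good_def)
    have "\<forall>\<^sub>F n in sequentially. mass n (\<Union>(insert U F)) \<le> ennreal (real (card (insert U F)) * exp (- real n * c))"
      using IH(2) U(2) eventually_gt_at_top[of 0]
    proof eventually_elim
      case (elim n)
      have "mass n (\<Union>(insert U F)) \<le> mass n U + mass n (\<Union>F)" using mass_Un[OF U(1) IH(1) elim(3)] by simp
      also have "\<dots> \<le> ennreal (exp (- real n * c)) + ennreal (real (card F) * exp (- real n * c))" by (intro add_mono elim)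
      also have "\<dots> = ennreal (real (card (insert U F)) * exp (- real n * c))"
        using insert by (subst ennreal_plus[symmetric]) (auto simp: algebra_simps)
      finally show ?case .
    qed
    then show ?case using observable_Un[OF U(1) IH(1)] by simp
  qed
  then show ?thesis using that[of "\<Union>F" "card F"] F(3) by blast
qed

text \<open>Formulated for a topology \<open>X\<close> whose open sets include the traces of weak
  ones and in which moment balls cut \<open>A\<close> in compact sets, so that it serves weak and
  Wasserstein closed sets alike. Finitely many local bounds cover the compact part, exponential
  tightness the rest.\<close>

lemma upper_bound:
  fixes A :: "'a measure set"
  assumes cpt: "\<And>R. 0 \<le> R \<Longrightarrow> compactin X (A \<inter> moment_ball l R)"
    and fin: "\<And>U. openin weak_topology U \<Longrightarrow> openin X (U \<inter> topspace X) \<and> observable (U \<inter> topspace X)"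
    and A: "\<And>\<mu>. \<mu> \<in> A \<Longrightarrow> \<mu> \<in> prob_measures \<and> ereal c < free_energy W \<sigma> \<mu>"
    and c': "c' < c"
  shows "\<forall>\<^sub>F n in sequentially. mass n A \<le> ennreal (exp (- real n * c'))"
proof -
  obtain R where R: "0 \<le> R" "\<forall>\<^sub>F n in sequentially. mass n (- moment_ball l R) \<le> ennreal (exp (- real n * c))"
    using exponential_tightness by blast
  have obs: "observable (- moment_ball l R)"
    using l by (intro observable_Compl observable_weak_closed closedin_moment_ball) auto
  obtain V N where V: "A \<inter> moment_ball l R \<subseteq> V" "observable V" "\<forall>\<^sub>F n in sequentially. mass n V \<le> ennreal (real N * exp (- real n * c))"
  proof (rule finite_cover_upper_bound[OF cpt[OF R(1)], of c])
    fix \<mu> assume \<mu>: "\<mu> \<in> A \<inter> moment_ball l R"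
    then obtain U where U: "openin weak_topology U" "\<mu> \<in> U" "\<forall>\<^sub>F n in sequentially. mass n U \<le> ennreal (exp (- real n * c))"
      using A local_upper_bound[of \<mu> c] by blast
    have "\<forall>\<^sub>F n in sequentially. mass n (U \<inter> topspace X) \<le> ennreal (exp (- real n * c))"
      using U(3) by eventually_elim (rule order_trans[OF mass_mono], auto)
    moreover have "\<mu> \<in> topspace X" using compactin_subset_topspace[OF cpt[OF R(1)]] \<mu> by auto
    ultimately show "\<exists>U. openin X U \<and> \<mu> \<in> U \<and> observable U \<and> (\<forall>\<^sub>F n in sequentially. mass n U \<le> ennreal (exp (- real n * c)))"
      using fin[OF U(1)] U(2) by blast
  qed auto
  have "\<forall>\<^sub>F n in sequentially. (real N + 1) * real n ^ 0 * exp (- real n * c) \<le> exp (- real n * c')"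
    using c' by (rule eventually_subexponential)
  then show ?thesis using V(3) R(2) eventually_gt_at_top[of 0]
  proof eventually_elim
    case (elim n)
    have "mass n A \<le> mass n (V \<union> - moment_ball l R)" using V(1) by (intro mass_mono) auto
    also have "\<dots> \<le> mass n V + mass n (- moment_ball l R)" by (rule mass_Un[OF V(2) obs elim(4)])
    also have "\<dots> \<le> ennreal (real N * exp (- real n * c)) + ennreal (exp (- real n * c))" by (intro add_mono elim)
    also have "\<dots> = ennreal ((real N + 1) * exp (- real n * c))" by (subst ennreal_plus[symmetric]) (auto simp: algebra_simps)
    also have "\<dots> \<le> ennreal (exp (- real n * c'))" using elim(1) by (intro ennreal_leI) simp
    finally show ?case .
  qed
qed

end

subsection \<open>The large deviation lower bound\<close>

context iid_sample
begin

lemma Q_eq_density: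
  assumes [measurable]: "p \<in> borel_measurable borel" and p: "density lborel p = \<mu>"
  shows "Q n = density (config_lborel n) (\<lambda>x. \<Prod>i<n. p (x i))"
proof -
  interpret pm: product_sigma_finite "\<lambda>_::nat. \<mu>" by unfold_locales
  show ?thesis unfolding Q_def
  proof (rule pm.PiM_eqI[symmetric])
    show "sets (density (config_lborel n) (\<lambda>x. \<Prod>i<n. p (x i))) = sets (\<Pi>\<^sub>M i\<in>{..<n}. \<mu>)"
      using sets_Q[of n] by (simp add: Q_def sets_PiM_lborel)
    fix A assume A: "\<And>i. i \<in> {..<n} \<Longrightarrow> A i \<in> sets \<mu>"
    have [measurable]: "A i \<in> sets borel" if "i < n" for i using A[of i] that by (simp add: mu_sets)
    have PA: "Pi\<^sub>E {..<n} A \<in> sets (config_lborel n)"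
      using A by (auto simp: sets_PiM_lborel mu_sets intro!: sets_PiM_I_finite)
    have "emeasure (density (config_lborel n) (\<lambda>x. \<Prod>i<n. p (x i))) (Pi\<^sub>E {..<n} A)
        = (\<integral>\<^sup>+x. (\<Prod>i<n. p (x i)) * indicator (Pi\<^sub>E {..<n} A) x \<partial>config_lborel n)"
      using PA by (intro emeasure_density) auto
    also have "\<dots> = (\<integral>\<^sup>+x. (\<Prod>i<n. p (x i) * indicator (A i) (x i)) \<partial>config_lborel n)"
    proof (rule nn_integral_cong)
      fix x :: "nat \<Rightarrow> 'a" assume "x \<in> space (config_lborel n)"
      then have "x \<in> Pi\<^sub>E {..<n} A \<longleftrightarrow> (\<forall>i<n. x i \<in> A i)" by (auto simp: space_PiM PiE_def Pi_def)
      then have "indicator (Pi\<^sub>E {..<n} A) x = (\<Prod>i<n. indicator (A i) (x i) :: ennreal)"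
        by (auto simp: indicator_def)
      then show "(\<Prod>i<n. p (x i)) * indicator (Pi\<^sub>E {..<n} A) x = (\<Prod>i<n. p (x i) * indicator (A i) (x i))"
        by (simp add: prod.distrib)
    qed
    also have "\<dots> = (\<Prod>i<n. \<integral>\<^sup>+x. p x * indicator (A i) x \<partial>lborel)"
      by (intro lborel_product.product_nn_integral_prod) auto
    also have "\<dots> = (\<Prod>i<n. emeasure \<mu> (A i))"
      unfolding p[symmetric] by (intro prod.cong refl emeasure_density[symmetric]) auto
    finally show "emeasure (density (config_lborel n) (\<lambda>x. \<Prod>i<n. p (x i))) (Pi\<^sub>E {..<n} A) = (\<Prod>i<n. emeasure \<mu> (A i))" .
  qed simp
qed

lemma AE_Q_components:
  assumes "AE y in \<mu>. P y"
  shows "AE x in Q n. \<forall>i<n. P (x i)"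
proof -
  have "AE x in Q n. \<forall>i\<in>{..<n}. P (x i)"
  proof (rule AE_finite_allI)
    fix i assume "i \<in> {..<n}"
    then have i: "i < n" by simp
    have "AE y in distr (Q n) borel (\<lambda>x. x i). P y" unfolding distr_Q_component[OF i] by (rule assms)
    then show "AE x in Q n. P (x i)" by (rule AE_distrD[OF measurable_Q_component[OF i]])
  qed simp
  then show ?thesis by eventually_elim auto
qed

lemma asymp_sure_AE:
  assumes "\<And>n. AE x in Q n. A n x" shows "asymp_sure A"
  unfolding asymp_sure_def
proof (intro allI impI always_eventually)
  fix \<epsilon> :: real and n :: nat assume "0 < \<epsilon>"
  obtain N where "{x \<in> space (Q n). \<not> A n x} \<subseteq> N" "emeasure (Q n) N = 0" "N \<in> sets (Q n)"
    using assms[of n] by (rule AE_E)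
  then show "\<exists>B\<in>sets (Q n). {x \<in> space (Q n). \<not> A n x} \<subseteq> B \<and> measure (Q n) B \<le> \<epsilon>"
    using \<open>0 < \<epsilon>\<close> by (intro bexI[of _ N]) (auto simp: measure_def)
qed

text \<open>A single log-density is \<open>o(n)\<close> in probability, by Markov's inequality. This
  makes the density of the last point negligible, which \<open>centered_disintegration\<close>
  leaves behind as a weight.\<close>

lemma asymp_sure_component_ge:
  fixes g :: "'a \<Rightarrow> real"
  assumes g: "integrable \<mu> g" and [measurable]: "g \<in> borel_measurable borel" and \<delta>: "0 < \<delta>"
  shows "asymp_sure (\<lambda>n x. 0 < n \<longrightarrow> - \<delta> * real n < g (x (n - 1)))"
proof (rule asymp_sureI_measure)
  note [measurable_cong] = mu_sets
  have eq: "{x \<in> space (Q n). \<not> (0 < n \<longrightarrow> - \<delta> * real n < g (x (n - 1)))}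
      = (if n = 0 then {} else {x \<in> space (Q n). x (n - 1) \<in> {y. g y \<le> - \<delta> * real n}})" for n
    by auto
  have S: "{y. g y \<le> - \<delta> * real n} \<in> sets borel" for n by measurable
  show "{x \<in> space (Q n). \<not> (0 < n \<longrightarrow> - \<delta> * real n < g (x (n - 1)))} \<in> sets (Q n)" for n
    unfolding eq using measurable_sets[OF measurable_Q_component[of "n - 1" n] S[of n]]
    by (auto simp: vimage_def Int_def conj_commute)
  fix \<epsilon> :: real assume \<epsilon>: "0 < \<epsilon>"
  let ?I = "\<integral>y. \<bar>g y\<bar> \<partial>\<mu>"
  have "(\<lambda>n. ?I / \<delta> * inverse (real n)) \<longlonglongrightarrow> ?I / \<delta> * 0"
    by (intro tendsto_intros lim_inverse_n)
  then have "\<forall>\<^sub>F n in sequentially. ?I / \<delta> * inverse (real n) < \<epsilon>"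
    using \<epsilon> by (intro order_tendstoD(2)) auto
  then show "\<forall>\<^sub>F n in sequentially. measure (Q n) {x \<in> space (Q n). \<not> (0 < n \<longrightarrow> - \<delta> * real n < g (x (n - 1)))} \<le> \<epsilon>"
    using eventually_gt_at_top[of 0]
  proof eventually_elim
    case (elim n)
    have "measure (Q n) {x \<in> space (Q n). \<not> (0 < n \<longrightarrow> - \<delta> * real n < g (x (n - 1)))}
        = measure \<mu> {y. g y \<le> - \<delta> * real n}"
      unfolding eq using elim(2) Q_component(3)[of "n - 1" n g, OF _ _ S[of n]] by simp
    also have "\<dots> \<le> measure \<mu> {y \<in> space \<mu>. \<delta> * real n \<le> \<bar>g y\<bar>}"
      using \<delta> by (intro finite_measure_mono) (auto simp: mu_space)
    also have "\<dots> \<le> ?I / (\<delta> * real n)"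
      using g \<delta> elim(2) by (intro integral_Markov_inequality_measure[where A = "space \<mu>"]) auto
    also have "\<dots> \<le> \<epsilon>" using elim by (simp add: divide_inverse mult.assoc)
    finally show ?case .
  qed
qed

end

lemma center_shift:
  assumes "0 < n"
  shows "center n (\<lambda>i\<in>{..<n}. x i + t) = center n x"
proof -
  have "(\<Sum>j<n. if j < n then x j + t else undefined) = (\<Sum>j<n. x j) + real n *\<^sub>R t"
    by (simp add: sum.distrib sum_constant_scaleR)
  then show ?thesis using assms by (auto simp: center_def restrict_def fun_eq_iff scaleR_add_right)
qed

lemma center_centered:
  "x \<in> centered_configurations n \<Longrightarrow> center n x = x"
  by (auto simp: center_def centered_configurations_def restrict_def fun_eq_iff PiE_def extensional_def)

lemma measurable_center [measurable]: "center n \<in> measurable (config_space n) (config_space n)"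
  unfolding center_def by measurable

context gibbs
begin

text \<open>Pairs of distinct indices follow the product law and contribute at most the energy of
  \<open>\<mu>\<close>; the \<open>n\<close> diagonal terms contribute
  \<open>W 0 / (2 * n)\<close>.\<close>

lemma pair_energy_expectation:
  assumes \<mu>: "\<mu> \<in> prob_measures" and n: "0 < n"
  shows "(\<integral>\<^sup>+x. ennreal (pair_energy W n x) \<partial>iid_sample.Q \<mu> n) \<le> interaction_energy W \<mu> + ennreal (W 0 / (2 * real n))"
proof -
  interpret iid_sample \<mu> by unfold_locales (rule \<mu>)
  interpret pp: pair_prob_space \<mu> \<mu> ..
  note [measurable_cong] = mu_sets sets_Q
  let ?J = "\<integral>\<^sup>+x. \<integral>\<^sup>+y. ennreal (W (x - y)) \<partial>\<mu> \<partial>\<mu>"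
  have "(\<integral>\<^sup>+x. ennreal (W (x i - x j)) \<partial>Q n) \<le> ?J + (if i = j then ennreal (W 0) else 0)" if ij: "i < n" "j < n" for i j
  proof (cases "i = j")
    case True
    interpret Qn: prob_space "Q n" by (rule prob_Q)
    show ?thesis using True by (simp add: Qn.emeasure_space_1)
  next
    case False
    have "(\<integral>\<^sup>+x. ennreal (W (x i - x j)) \<partial>Q n)
        = (\<integral>\<^sup>+z. ennreal (W (fst z - snd z)) \<partial>distr (Q n) (borel \<Otimes>\<^sub>M borel) (\<lambda>x. (x i, x j)))"
      using measurable_Q_pair[OF ij] by (subst nn_integral_distr) auto
    also have "\<dots> = (\<integral>\<^sup>+z. ennreal (W (fst z - snd z)) \<partial>(\<mu> \<Otimes>\<^sub>M \<mu>))" by (simp add: distr_Q_pair[OF ij False])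
    also have "\<dots> = ?J" by (subst nn_integral_fst[symmetric]) auto
    finally show ?thesis by simp
  qed
  then have "(\<Sum>i<n. \<Sum>j<n. \<integral>\<^sup>+x. ennreal (W (x i - x j)) \<partial>Q n) \<le> (\<Sum>i<n. \<Sum>j<n. ?J + (if i = j then ennreal (W 0) else 0))"
    by (intro sum_mono) auto
  also have "\<dots> = ennreal ((real n)\<^sup>2) * ?J + ennreal (real n * W 0)"
    using W0 by (simp add: sum.distrib power2_eq_square ennreal_mult ennreal_of_nat_eq_real_of_nat mult.assoc distrib_left)
  finally have sum: "(\<Sum>i<n. \<Sum>j<n. \<integral>\<^sup>+x. ennreal (W (x i - x j)) \<partial>Q n) \<le> ennreal ((real n)\<^sup>2) * ?J + ennreal (real n * W 0)" .
  have "(\<integral>\<^sup>+x. ennreal (pair_energy W n x) \<partial>Q n) = (\<integral>\<^sup>+x. ennreal (1 / (2 * (real n)\<^sup>2)) * (\<Sum>i<n. \<Sum>j<n. ennreal (W (x i - x j))) \<partial>Q n)"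
    using W0 by (intro nn_integral_cong) (simp add: pair_energy_def sum_nonneg ennreal_mult[symmetric])
  also have "\<dots> = ennreal (1 / (2 * (real n)\<^sup>2)) * (\<Sum>i<n. \<Sum>j<n. \<integral>\<^sup>+x. ennreal (W (x i - x j)) \<partial>Q n)"
    by (simp add: nn_integral_cmult nn_integral_sum)
  also have "\<dots> \<le> ennreal (1 / (2 * (real n)\<^sup>2)) * (ennreal ((real n)\<^sup>2) * ?J + ennreal (real n * W 0))"
    by (intro mult_left_mono sum) simp
  also have "\<dots> = ennreal (1 / (2 * (real n)\<^sup>2) * (real n)\<^sup>2) * ?J + ennreal (1 / (2 * (real n)\<^sup>2) * (real n * W 0))"
  proof -
    have "ennreal (1 / (2 * (real n)\<^sup>2) * (real n)\<^sup>2) = ennreal (1 / (2 * (real n)\<^sup>2)) * ennreal ((real n)\<^sup>2)"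
      "ennreal (1 / (2 * (real n)\<^sup>2) * (real n * W 0)) = ennreal (1 / (2 * (real n)\<^sup>2)) * ennreal (real n * W 0)"
      using W0 by (intro ennreal_mult; simp)+
    then show ?thesis by (simp only: distrib_left mult.assoc)
  qed
  also have "1 / (2 * (real n)\<^sup>2) * (real n)\<^sup>2 = inverse 2" using n by (simp add: field_simps)
  also have "1 / (2 * (real n)\<^sup>2) * (real n * W 0) = W 0 / (2 * real n)" using n by (simp add: power2_eq_square)
  also have "ennreal (inverse 2) * ?J = interaction_energy W \<mu>"
  proof -
    have "ennreal (inverse 2) = inverse (ennreal 2)" by (subst inverse_ennreal) auto
    then show ?thesis by (simp only: interaction_energy_def divide_ennreal_def mult.commute ennreal_numeral)
  qed
  finally show ?thesis .
qed

text \<open>A finite double integral leaves some \<open>x0\<close> at which the integral of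
  \<open>W (x0 - y)\<close> is finite, and the growth of \<open>W\<close> bounds the
  \<open>l\<close>-th moment about that point.\<close>

lemma finite_energy_moment:
  assumes \<mu>: "\<mu> \<in> prob_measures" and e: "interaction_energy W \<mu> < \<infinity>"
  shows "integrable \<mu> (\<lambda>x. norm x powr l)"
proof -
  interpret iid_sample \<mu> by unfold_locales (rule \<mu>)
  note [measurable_cong] = mu_sets
  have "(\<integral>\<^sup>+x. \<integral>\<^sup>+y. ennreal (W (x - y)) \<partial>\<mu> \<partial>\<mu>) \<noteq> \<infinity>"
    using e by (auto simp: interaction_energy_def ennreal_top_divide)
  then have "AE x in \<mu>. (\<integral>\<^sup>+y. ennreal (W (x - y)) \<partial>\<mu>) \<noteq> \<infinity>"
    by (intro nn_integral_PInf_AE) measurable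
  then obtain x0 where x0: "(\<integral>\<^sup>+y. ennreal (W (x0 - y)) \<partial>\<mu>) \<noteq> \<infinity>"
    using AE_contr by blast
  have "integrable \<mu> (\<lambda>y. W (x0 - y))"
    using x0 W0 by (intro integrableI_nonneg) (auto simp: less_top)
  then have "integrable \<mu> (\<lambda>y. 2 powr l * ((W (x0 - y) + \<bar>C\<bar>) / a + norm x0 powr l))" by simp
  then show ?thesis
  proof (rule Bochner_Integration.integrable_bound)
    show "AE y in \<mu>. norm (norm y powr l) \<le> norm (2 powr l * ((W (x0 - y) + \<bar>C\<bar>) / a + norm x0 powr l))"
    proof (rule AE_I2)
      fix y
      have "norm y powr l \<le> 2 powr l * (norm (x0 - y) powr l + norm x0 powr l)"
        using norm_add_powr_le[of l "y - x0" x0] l by (simp add: norm_minus_commute)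
      moreover have "norm (x0 - y) powr l \<le> (W (x0 - y) + \<bar>C\<bar>) / a"
        using growth[of "x0 - y"] a by (simp add: field_simps)
      then have "2 powr l * (norm (x0 - y) powr l + norm x0 powr l) \<le> 2 powr l * ((W (x0 - y) + \<bar>C\<bar>) / a + norm x0 powr l)"
        by (intro mult_left_mono) auto
      ultimately have "norm y powr l \<le> 2 powr l * ((W (x0 - y) + \<bar>C\<bar>) / a + norm x0 powr l)" by linarith
      then show "norm (norm y powr l) \<le> norm (2 powr l * ((W (x0 - y) + \<bar>C\<bar>) / a + norm x0 powr l))"
        using order_trans[OF _ abs_ge_self] by (simp only: real_norm_def abs_of_nonneg powr_ge_zero)
    qed
  qed measurable
qed

text \<open>Markov's inequality: the mean energy is eventually at most
  \<open>e + \<delta> / 2\<close>, so a value of \<open>e + \<delta>\<close> or more cannot be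
  almost sure.\<close>

lemma low_energy_probability:
  assumes \<mu>: "\<mu> \<in> prob_measures" and e: "interaction_energy W \<mu> = ennreal e" "0 \<le> e" and \<delta>: "0 < \<delta>"
  shows "\<forall>\<^sub>F n in sequentially. \<delta> / 2 / (e + \<delta>) \<le> measure (iid_sample.Q \<mu> n) {x \<in> space (iid_sample.Q \<mu> n). pair_energy W n x < e + \<delta>}"
proof -
  interpret iid_sample \<mu> by unfold_locales (rule \<mu>)
  have "(\<lambda>n. W 0 / 2 * inverse (real n)) \<longlonglongrightarrow> W 0 / 2 * 0" by (intro tendsto_intros lim_inverse_n)
  then have "\<forall>\<^sub>F n in sequentially. W 0 / 2 * inverse (real n) < \<delta> / 2"
    by (rule order_tendstoD(2)) (simp add: \<delta>)
  then show ?thesis using eventually_gt_at_top[of 0]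
  proof eventually_elim
    case (elim n)
    interpret Qn: prob_space "Q n" by (rule prob_Q)
    note [measurable_cong] = sets_Q
    have le: "(\<integral>\<^sup>+x. ennreal (pair_energy W n x) \<partial>Q n) \<le> ennreal (e + \<delta> / 2)"
    proof -
      have "(\<integral>\<^sup>+x. ennreal (pair_energy W n x) \<partial>Q n) \<le> ennreal e + ennreal (W 0 / (2 * real n))"
        using pair_energy_expectation[OF \<mu> elim(2)] e by simp
      also have "\<dots> = ennreal (e + W 0 / (2 * real n))" using e W0 by simp
      also have "\<dots> \<le> ennreal (e + \<delta> / 2)" 
      proof (rule ennreal_leI)
        have "W 0 / (2 * real n) = W 0 / 2 * inverse (real n)" by (simp add: field_simps)
        then show "e + W 0 / (2 * real n) \<le> e + \<delta> / 2" using elim(1) by linarith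
      qed
      finally show ?thesis .
    qed
    have int: "integrable (Q n) (pair_energy W n)"
      using order_le_less_trans[OF le ennreal_less_top] pair_energy_nonneg by (intro integrableI_nonneg) auto
    have "(\<integral>x. pair_energy W n x \<partial>Q n) \<le> e + \<delta> / 2"
    proof -
      have "ennreal (\<integral>x. pair_energy W n x \<partial>Q n) \<le> ennreal (e + \<delta> / 2)"
        using le nn_integral_eq_integral[OF int] pair_energy_nonneg by simp
      then show ?thesis using e \<delta> by (subst (asm) ennreal_le_iff) auto
    qed
    moreover have "measure (Q n) {x \<in> space (Q n). e + \<delta> \<le> pair_energy W n x} \<le> (\<integral>x. pair_energy W n x \<partial>Q n) / (e + \<delta>)"
      using int pair_energy_nonneg e \<delta> by (intro integral_Markov_inequality_measure[where A = "space (Q n)"]) auto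
    moreover have "measure (Q n) {x \<in> space (Q n). pair_energy W n x < e + \<delta>}
        = 1 - measure (Q n) {x \<in> space (Q n). e + \<delta> \<le> pair_energy W n x}"
    proof -
      have "{x \<in> space (Q n). e + \<delta> \<le> pair_energy W n x} \<in> sets (Q n)" by measurable
      moreover have "{x \<in> space (Q n). pair_energy W n x < e + \<delta>} = space (Q n) - {x \<in> space (Q n). e + \<delta> \<le> pair_energy W n x}" by auto
      ultimately show ?thesis by (simp only: Qn.prob_compl)
    qed
    moreover have "(\<integral>x. pair_energy W n x \<partial>Q n) / (e + \<delta>) \<le> (e + \<delta> / 2) / (e + \<delta>)"
      using calculation(1) e \<delta> by (intro divide_right_mono) auto
    moreover have "1 - (e + \<delta> / 2) / (e + \<delta>) = \<delta> / 2 / (e + \<delta>)" using e \<delta> by (simp add: field_simps)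
    ultimately show ?case by linarith
  qed
qed

text \<open>
  Sampling from \<open>\<mu>\<close> itself: Markov's inequality makes the energy at most \<open>e + \<delta>\<close> with a
  probability that is merely bounded away from \<open>0\<close>, which is all that is needed, while every other
  requirement holds with probability tending to \<open>1\<close>.
\<close>

lemma lower_bound:
  assumes \<mu>: "\<mu> \<in> prob_measures" and mean: "(\<integral>x. x \<partial>\<mu>) = 0" and F: "free_energy W \<sigma> \<mu> < ereal c"
  obtains R where "0 \<le> R" "\<mu> \<in> moment_ball l R" "\<And>V. openin weak_topology V \<Longrightarrow> \<mu> \<in> V \<Longrightarrow>
    \<forall>\<^sub>F n in sequentially. ennreal (exp (- real n * c)) \<le> mass n (V \<inter> moment_ball l R)"
proof -
  have ent: "entropy_functional \<mu> < \<infinity>"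
  proof (rule ccontr)
    assume "\<not> ?thesis"
    then show False using F by (simp add: free_energy_def)
  qed
  note D = entropy_functional_finiteD[OF ent]
  interpret centered_sample \<mu> by unfold_locales (use \<mu> mean D(1) in auto)
  define S where "S = (\<integral>x. ln (dens \<mu> x) \<partial>\<mu>)"
  have S: "entropy_functional \<mu> = ereal S" using D(4) by (simp add: S_def)
  have en: "interaction_energy W \<mu> < \<infinity>"
    using F S \<beta> by (cases "interaction_energy W \<mu>") (auto simp: free_energy_def \<beta>_def)
  then obtain e where e: "0 \<le> e" "interaction_energy W \<mu> = ennreal e"
    by (cases "interaction_energy W \<mu>") auto
  have Sc: "S + \<beta> * e < c" using F S e by (simp add: free_energy_def \<beta>_def)
  \<comment> \<open>\<open>\<beta> + 2\<close> counts the losses: \<open>\<beta> * \<delta>\<close>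
    in the energy, \<open>\<delta>\<close> in the mean log-density and \<open>\<delta>\<close> at
    the last point. Together they use up half of the gap.\<close>
  define \<delta> where "\<delta> = (c - S - \<beta> * e) / (2 * (\<beta> + 2))"
  have \<delta>: "0 < \<delta>" using Sc \<beta> by (simp add: \<delta>_def)
  have gap: "\<beta> * (e + \<delta>) + (S + \<delta>) + \<delta> < c"
  proof -
    have "(\<beta> + 2) * \<delta> = (c - S - \<beta> * e) / 2" using \<beta> by (simp add: \<delta>_def field_simps)
    then show ?thesis using Sc by (simp add: algebra_simps)
  qed
  define \<rho> where "\<rho> = \<delta> / 2 / (e + \<delta>)"
  have \<rho>: "0 < \<rho>" using \<delta> e by (simp add: \<rho>_def)
  define p where "p = dens \<mu>"
  have p [measurable]: "p \<in> borel_measurable borel" and p0: "\<And>x. 0 \<le> p x" by (simp_all add: p_def)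
  have dp: "density lborel (\<lambda>x. ennreal (p x)) = \<mu>" unfolding p_def by (rule density_dens[OF \<mu> D(2)])
  have int_ln: "integrable \<mu> (\<lambda>x. ln (p x))" unfolding p_def by (rule D(3))
  have pos: "AE x in \<mu>. 0 < p x"
  proof -
    have "AE x in density lborel (\<lambda>x. ennreal (p x)). 0 < p x" by (subst AE_density) auto
    then show ?thesis unfolding dp .
  qed
  note mom = finite_energy_moment[OF \<mu> en]
  define R where "R = 2 powr l * ((\<integral>x. norm x powr l \<partial>\<mu>) + 2)"
  have R: "0 \<le> R" by (simp add: R_def)
  have ball: "\<mu> \<in> moment_ball l R"
  proof -
    let ?I = "\<integral>x. norm x powr l \<partial>\<mu>"
    have "1 \<le> 2 powr l" using l by (intro ge_one_powr_ge_zero) auto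
    then have "1 * (?I + 2) \<le> R" unfolding R_def by (intro mult_right_mono) auto
    then show ?thesis using \<mu> mom by (simp add: moment_ball_def nn_integral_eq_integral ennreal_leI)
  qed
  show ?thesis
  proof (rule that[OF R ball])
    fix V assume V: "openin weak_topology V" "\<mu> \<in> V"
    define A where "A = V \<inter> moment_ball l R"
    have obsA: "observable A"
      unfolding A_def using l V by (intro observable_Int observable_weak_open observable_weak_closed closedin_moment_ball) auto
    \<comment> \<open>All requirements except low energy; each is asymptotically sure, so they can
      be imposed simultaneously.\<close>
    define good where "good n x \<longleftrightarrow> (empirical_measure n (center n x) \<in> V \<and> empirical_measure n (center n x) \<in> moment_ball l R)
      \<and> (\<bar>(\<Sum>i<n. ln (p (x i))) / real n - S\<bar> < \<delta> \<and> ((0 < n \<longrightarrow> - \<delta> * real n < ln (p (x (n - 1)))) \<and> (\<forall>i<n. 0 < p (x i))))" for n x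
    have "asymp_sure good"
      unfolding good_def
    proof (intro asymp_sure_conj)
      show "asymp_sure (\<lambda>n x. empirical_measure n (center n x) \<in> V)" by (rule centered_empirical_in_weak_nbhd[OF V])
      show "asymp_sure (\<lambda>n x. empirical_measure n (center n x) \<in> moment_ball l R)"
        unfolding R_def by (rule centered_empirical_in_moment_ball[OF l mom])
      show "asymp_sure (\<lambda>n x. \<bar>(\<Sum>i<n. ln (p (x i))) / real n - S\<bar> < \<delta>)"
        unfolding S_def p_def[symmetric] using int_ln \<delta> by (intro weak_law_of_large_numbers) auto
      show "asymp_sure (\<lambda>n x. 0 < n \<longrightarrow> - \<delta> * real n < ln (p (x (n - 1))))"
        using int_ln \<delta> by (intro asymp_sure_component_ge) auto
      show "asymp_sure (\<lambda>n x. \<forall>i<n. 0 < p (x i))"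
        by (intro asymp_sure_AE AE_Q_components pos)
    qed
    then have "\<forall>\<^sub>F n in sequentially. \<exists>B\<in>sets (Q n). {x \<in> space (Q n). \<not> good n x} \<subseteq> B \<and> measure (Q n) B \<le> \<rho> / 2"
      using \<rho> half_gt_zero[OF \<rho>] unfolding asymp_sure_def by blast
    moreover have "\<forall>\<^sub>F n in sequentially. \<rho> \<le> measure (Q n) {x \<in> space (Q n). pair_energy W n x < e + \<delta>}"
      unfolding \<rho>_def by (rule low_energy_probability[OF \<mu> e(2,1) \<delta>])
    moreover define k where "k = \<beta> * (e + \<delta>) + (S + \<delta>) + \<delta>"
    have "\<forall>\<^sub>F n in sequentially. 2 / \<rho> * real n ^ DIM('a) * exp (- real n * (c - k)) \<le> exp (- real n * 0)"
      using gap by (intro eventually_subexponential) (simp add: k_def)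
    ultimately show "\<forall>\<^sub>F n in sequentially. ennreal (exp (- real n * c)) \<le> mass n (V \<inter> moment_ball l R)"
      using eventually_ge_at_top[of 2]
    proof eventually_elim
      case (elim n)
      then have n: "2 \<le> n" "0 < n" by auto
      interpret Qn: prob_space "Q n" by (rule prob_Q)
      note [measurable_cong] = sets_Q
      from elim(1) obtain B where B: "B \<in> sets (Q n)" "{x \<in> space (Q n). \<not> good n x} \<subseteq> B" "measure (Q n) B \<le> \<rho> / 2" by blast
      define E1 where "E1 = {x \<in> space (Q n). pair_energy W n x < e + \<delta>}"
      have E1: "E1 \<in> sets (Q n)" unfolding E1_def by measurable
      \<comment> \<open>Low energy has probability at least \<open>\<rho>\<close> and the
        exceptional cover \<open>B\<close> at most \<open>\<rho> / 2\<close>, so at least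
        \<open>\<rho> / 2\<close> remains.\<close>
      define E where "E = E1 - B"
      have E: "E \<in> sets (Q n)" using E1 B by (auto simp: E_def)
      have "measure (Q n) E1 \<le> measure (Q n) (E \<union> B)"
        using E1 B E by (intro Qn.finite_measure_mono) (auto simp: E_def)
      also have "\<dots> \<le> measure (Q n) E + measure (Q n) B" using E B by (intro measure_Un_le)
      finally have QE: "\<rho> / 2 \<le> measure (Q n) E" using elim(2) B(3) by (simp add: E1_def)
      \<comment> \<open>The event is tested on the recentered configuration, which makes
        \<open>f\<close> translation invariant as \<open>centered_disintegration\<close>
        requires.\<close>
      define f where "f x = ennreal (weight n x) * indicator A (empirical_measure n (center n x))" for x
      note [measurable] = measurable_compose[OF measurable_center observable_indicator[OF obsA n(2)]]
      have fm [measurable]: "f \<in> borel_measurable (config_space n)"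
        unfolding f_def by measurable
      have "f (\<lambda>i\<in>{..<n}. x i + t) = f x" for x t
        using n by (simp add: f_def center_shift weight_def pair_energy_def)
      then have dis: "(\<integral>\<^sup>+x. f x * ennreal (p (x (n - 1))) \<partial>config_lborel n)
          = ennreal (real n ^ DIM('a)) * (\<integral>\<^sup>+x. f (fill_last n x) \<partial>config_lborel (n - 1))"
      proof (intro centered_disintegration n)
        have "(\<integral>\<^sup>+x. ennreal (p x) \<partial>lborel) = emeasure (density lborel (\<lambda>x. ennreal (p x))) UNIV"
          by (subst emeasure_density) auto
        then show "(\<integral>\<^sup>+x. ennreal (p x) \<partial>lborel) = 1"
          using emeasure_space_1 by (simp add: dp mu_space)
      qed auto
      \<comment> \<open>Change of measure. On \<open>E\<close> the product density is at most
        \<open>exp (n * (S + \<delta>))\<close>, the weight at least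
        \<open>exp (- (n * \<beta> * (e + \<delta>)))\<close> and the density of the last point at
        least \<open>exp (- (n * \<delta>))\<close>; the three exponents combine to
        \<open>n * k\<close>.\<close>
      have pt: "(\<Prod>i<n. ennreal (p (x i))) * indicator E x \<le> ennreal (exp (real n * k)) * (f x * ennreal (p (x (n - 1))))"
        if x: "x \<in> space (config_lborel n)" for x
      proof (cases "x \<in> E")
        case True
        then have xQ: "x \<in> space (Q n)" and w: "pair_energy W n x < e + \<delta>" and nB: "x \<notin> B" by (auto simp: E_def E1_def)
        then have g: "good n x" using B(2) by auto
        have "(\<Prod>i<n. p (x i)) = exp (\<Sum>i<n. ln (p (x i)))"
          using g by (simp add: good_def exp_sum)
        also have "\<dots> \<le> exp (real n * (S + \<delta>))"
        proof -
          have "(\<Sum>i<n. ln (p (x i))) / real n < S + \<delta>" using g by (auto simp: good_def)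
          then show ?thesis using n by (simp add: field_simps)
        qed
        finally have 1: "(\<Prod>i<n. p (x i)) \<le> exp (real n * (S + \<delta>))" .
        have "\<beta> * real n * pair_energy W n x \<le> \<beta> * real n * (e + \<delta>)" using w \<beta> by (intro mult_left_mono) auto
        then have 2: "exp (- (real n * (\<beta> * (e + \<delta>)))) \<le> weight n x" by (simp add: weight_def mult_ac)
        have "0 < p (x (n - 1))" using g n by (simp add: good_def)
        then have "p (x (n - 1)) = exp (ln (p (x (n - 1))))" by simp
        moreover have "- (real n * \<delta>) < ln (p (x (n - 1)))" using g n by (auto simp: good_def mult.commute)
        ultimately have 3: "exp (- (real n * \<delta>)) \<le> p (x (n - 1))" by (metis exp_le_cancel_iff less_imp_le)
        have "exp (real n * (S + \<delta>)) = exp (real n * k) * (exp (- (real n * (\<beta> * (e + \<delta>)))) * exp (- (real n * \<delta>)))"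
          by (simp add: exp_add[symmetric] k_def algebra_simps)
        also have "\<dots> \<le> exp (real n * k) * (weight n x * p (x (n - 1)))"
          using 2 3 by (intro mult_left_mono mult_mono) (auto simp: weight_def)
        finally have "(\<Prod>i<n. p (x i)) \<le> exp (real n * k) * (weight n x * p (x (n - 1)))" using 1 by linarith
        then have "ennreal (\<Prod>i<n. p (x i)) \<le> ennreal (exp (real n * k) * (weight n x * p (x (n - 1))))" by (rule ennreal_leI)
        then show ?thesis
          using True g p0 by (simp add: f_def A_def good_def prod_ennreal ennreal_mult weight_def)
      qed simp
      have "ennreal (\<rho> / 2) \<le> emeasure (Q n) E" using QE by (simp add: Qn.emeasure_eq_measure)
      also have "\<dots> = (\<integral>\<^sup>+x. (\<Prod>i<n. ennreal (p (x i))) * indicator E x \<partial>config_lborel n)"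
        using E dp by (subst Q_eq_density[where p = "\<lambda>x. ennreal (p x)"]) (auto simp: emeasure_density sets_Q sets_PiM_lborel)
      also have "\<dots> \<le> (\<integral>\<^sup>+x. ennreal (exp (real n * k)) * (f x * ennreal (p (x (n - 1)))) \<partial>config_lborel n)"
        by (intro nn_integral_mono pt)
      also have "\<dots> = ennreal (exp (real n * k)) * (\<integral>\<^sup>+x. f x * ennreal (p (x (n - 1))) \<partial>config_lborel n)"
        using n by (intro nn_integral_cmult) simp
      also have "\<dots> = ennreal (exp (real n * k)) * (ennreal (real n ^ DIM('a)) * (1 * (\<integral>\<^sup>+x. f (fill_last n x) \<partial>config_lborel (n - 1))))"
        by (simp only: dis mult_1_left)
      \<comment> \<open>The area factor is at least \<open>1\<close>; inserting it completes the
        integral to the mass on centered configurations.\<close>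
      also have "\<dots> \<le> ennreal (exp (real n * k)) * (ennreal (real n ^ DIM('a)) * (ennreal (sqrt (real n) ^ DIM('a)) * (\<integral>\<^sup>+x. f (fill_last n x) \<partial>config_lborel (n - 1))))"
        using n by (intro mult_left_mono mult_right_mono) (auto simp: one_le_power)
      also have "(\<integral>\<^sup>+x. f (fill_last n x) \<partial>config_lborel (n - 1))
          = (\<integral>\<^sup>+x. ennreal (weight n (fill_last n x)) * indicator A (empirical_measure n (fill_last n x)) \<partial>config_lborel (n - 1))"
        using n by (intro nn_integral_cong) (simp add: f_def center_centered[OF fill_last_centered])
      also have "ennreal (sqrt (real n) ^ DIM('a)) * \<dots> = mass n A" by (rule mass_eq_fill_last[OF obsA n(2), symmetric])
      finally have main: "ennreal (\<rho> / 2) \<le> ennreal (exp (real n * k)) * (ennreal (real n ^ DIM('a)) * mass n A)" .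
      have small: "2 / \<rho> * exp (- real n * c) * exp (real n * k) * real n ^ DIM('a) \<le> 1"
      proof -
        have "exp (- real n * (c - k)) = exp (- real n * c) * exp (real n * k)"
          by (simp add: exp_add[symmetric] algebra_simps)
        then show ?thesis using elim(3) by (simp add: mult_ac)
      qed
      have "ennreal (exp (- real n * c)) = ennreal (2 / \<rho> * exp (- real n * c)) * ennreal (\<rho> / 2)"
        using \<rho> by (simp add: ennreal_mult[symmetric])
      also have "\<dots> \<le> ennreal (2 / \<rho> * exp (- real n * c)) * (ennreal (exp (real n * k)) * (ennreal (real n ^ DIM('a)) * mass n A))"
        by (intro mult_left_mono main) simp
      also have "\<dots> = ennreal (2 / \<rho> * exp (- real n * c) * exp (real n * k) * real n ^ DIM('a)) * mass n A"
      proof -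
        have "ennreal (a * b * c) = ennreal a * (ennreal b * ennreal c)" if "0 \<le> a" "0 \<le> b" "0 \<le> c" for a b c :: real
          using that by (simp add: ennreal_mult mult.assoc)
        from this[of "2 / \<rho> * exp (- real n * c)" "exp (real n * k)" "real n ^ DIM('a)"] show ?thesis
          using \<rho> by (simp add: mult.assoc)
      qed
      also have "\<dots> \<le> ennreal 1 * mass n A" by (intro mult_right_mono ennreal_leI small) simp
      finally show ?case by (simp add: A_def)
    qed
  qed
qed

end

subsection \<open>Translation invariance\<close>

lemma translate_in_prob_measures:
  assumes "\<mu> \<in> prob_measures" shows "translate y \<mu> \<in> prob_measures"
proof -
  interpret prob_space \<mu> by (rule prob_measuresD(2)[OF assms])
  note [measurable_cong] = prob_measuresD(1)[OF assms]
  have "prob_space (distr \<mu> borel (\<lambda>x. x + y))" by (rule prob_space_distr) measurable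
  then show ?thesis by (simp add: prob_measures_def translate_def)
qed

lemma nn_integral_translate:
  assumes "\<mu> \<in> prob_measures" and [measurable]: "f \<in> borel_measurable borel"
  shows "(\<integral>\<^sup>+x. f x \<partial>translate y \<mu>) = (\<integral>\<^sup>+x. f (x + y) \<partial>\<mu>)"
proof -
  note [measurable_cong] = prob_measuresD(1)[OF assms(1)]
  show ?thesis unfolding translate_def by (rule nn_integral_distr) auto
qed

lemma translate_0:
  assumes "\<mu> \<in> prob_measures" shows "translate 0 \<mu> = \<mu>"
proof -
  have "distr \<mu> borel (\<lambda>x. x) = \<mu>" using prob_measuresD(1)[OF assms] by (intro distr_id2) simp
  then show ?thesis by (simp add: translate_def)
qed

lemma translate_translate:
  assumes "\<mu> \<in> prob_measures" shows "translate y (translate z \<mu>) = translate (z + y) \<mu>"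
proof -
  note [measurable_cong] = prob_measuresD(1)[OF assms]
  show ?thesis unfolding translate_def by (subst distr_distr) (auto simp: comp_def add.assoc)
qed

lemma interaction_energy_translate:
  assumes \<mu>: "\<mu> \<in> prob_measures" and [measurable]: "W \<in> borel_measurable borel"
  shows "interaction_energy W (translate y \<mu>) = interaction_energy W \<mu>"
proof -
  interpret prob_space \<mu> by (rule prob_measuresD(2)[OF \<mu>])
  note [measurable_cong] = prob_measuresD(1)[OF \<mu>]
  have "(\<integral>\<^sup>+x. (\<integral>\<^sup>+z. ennreal (W (x - z)) \<partial>translate y \<mu>) \<partial>translate y \<mu>)
      = (\<integral>\<^sup>+x. (\<integral>\<^sup>+z. ennreal (W (x - (z + y))) \<partial>\<mu>) \<partial>translate y \<mu>)"
    by (simp add: nn_integral_translate[OF \<mu>])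
  also have "\<dots> = (\<integral>\<^sup>+x. (\<integral>\<^sup>+z. ennreal (W (x + y - (z + y))) \<partial>\<mu>) \<partial>\<mu>)"
    by (rule nn_integral_translate[OF \<mu>]) measurable
  finally show ?thesis by (simp add: interaction_energy_def)
qed

lemma translate_in_prob_measures_p:
  assumes \<mu>: "\<mu> \<in> prob_measures_p p" and p: "0 \<le> p"
  shows "translate y \<mu> \<in> prob_measures_p p"
proof -
  note \<mu>' = prob_measures_pD[OF \<mu>]
  interpret prob_space \<mu> by (rule prob_measuresD(2)[OF \<mu>'(1)])
  note [measurable_cong] = prob_measuresD(1)[OF \<mu>'(1)]
  have "integrable \<mu> (\<lambda>x. 2 powr p * (norm x powr p + norm y powr p))" using integrable_moment[OF \<mu>] by simp
  then have "integrable \<mu> (\<lambda>x. norm (x + y) powr p)"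
    by (rule Bochner_Integration.integrable_bound)
       (auto intro!: AE_I2 order_trans[OF norm_add_powr_le[OF p]])
  then have "(\<integral>\<^sup>+x. ennreal (norm (x + y) powr p) \<partial>\<mu>) < \<infinity>" by (simp add: nn_integral_eq_integral)
  then show ?thesis
    by (simp add: prob_measures_p_def translate_in_prob_measures \<mu>' nn_integral_translate)
qed

text \<open>By translation invariance of Lebesgue measure the shifted density is a density of the
  translate. Uniqueness up to null sets identifies it with the chosen version
  \<open>dens\<close>.\<close>

lemma entropy_functional_translate_aux:
  assumes \<mu>: "\<mu> \<in> prob_measures_p 1" and ex: "\<exists>f\<in>borel_measurable lborel. density lborel f = \<mu>"
  shows "\<exists>f\<in>borel_measurable lborel. density lborel f = translate y \<mu>"
    and "AE x in lborel. dens (translate y \<mu>) x = dens \<mu> (x - y)"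
proof -
  note \<mu>' = prob_measures_pD(1)[OF \<mu>]
  note [measurable_cong] = prob_measuresD(1)[OF \<mu>']
  have eq: "density lborel (\<lambda>x. ennreal (dens \<mu> (x - y))) = translate y \<mu>"
  proof (rule measure_eqI)
    fix A assume "A \<in> sets (density lborel (\<lambda>x. ennreal (dens \<mu> (x - y))))"
    then have A [measurable]: "A \<in> sets borel" by simp
    have "emeasure (density lborel (\<lambda>x. ennreal (dens \<mu> (x - y)))) A = (\<integral>\<^sup>+x. ennreal (dens \<mu> (x - y)) * indicator A x \<partial>lborel)"
      by (rule emeasure_density) auto
    also have "\<dots> = (\<integral>\<^sup>+x. ennreal (dens \<mu> x) * indicator A (x + y) \<partial>lborel)"
      by (subst nn_integral_lborel_affine[where c = 1 and t = y]) (auto simp: add.commute)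
    also have "\<dots> = (\<integral>\<^sup>+x. indicator A (x + y) \<partial>density lborel (\<lambda>x. ennreal (dens \<mu> x)))"
      by (subst nn_integral_density) auto
    also have "\<dots> = (\<integral>\<^sup>+x. indicator A x \<partial>translate y \<mu>)"
      by (simp add: density_dens[OF \<mu>' ex] nn_integral_translate[OF \<mu>'])
    also have "\<dots> = emeasure (translate y \<mu>) A" by (simp add: translate_def)
    finally show "emeasure (density lborel (\<lambda>x. ennreal (dens \<mu> (x - y)))) A = emeasure (translate y \<mu>) A" .
  qed (simp add: translate_def)
  then show ex': "\<exists>f\<in>borel_measurable lborel. density lborel f = translate y \<mu>"
    by (intro bexI[of _ "\<lambda>x. ennreal (dens \<mu> (x - y))"]) auto
  interpret T: prob_space "translate y \<mu>" by (rule prob_measuresD(2)[OF translate_in_prob_measures[OF \<mu>']])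
  have "AE x in lborel. ennreal (dens (translate y \<mu>) x) = ennreal (dens \<mu> (x - y))"
  proof (rule sigma_finite_measure.density_unique[OF lborel.sigma_finite_measure_axioms])
    show "density lborel (\<lambda>x. ennreal (dens (translate y \<mu>) x)) = density lborel (\<lambda>x. ennreal (dens \<mu> (x - y)))"
      unfolding eq by (rule density_dens[OF translate_in_prob_measures[OF \<mu>'] ex'])
  qed auto
  then show "AE x in lborel. dens (translate y \<mu>) x = dens \<mu> (x - y)" by simp
qed

lemma entropy_functional_translate:
  assumes \<mu>: "\<mu> \<in> prob_measures"
  shows "entropy_functional (translate y \<mu>) = entropy_functional \<mu>"
proof -
  let ?D = "\<lambda>\<mu>. \<mu> \<in> prob_measures_p 1 \<and> (\<exists>f\<in>borel_measurable lborel. density lborel f = \<mu>)"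
  have T: "?D (translate z \<nu>)" if "?D \<nu>" for z and \<nu> :: "'a measure"
    using that translate_in_prob_measures_p[of \<nu> 1 z] entropy_functional_translate_aux(1)[of \<nu> z] by auto
  show ?thesis
  proof (cases "?D \<mu>")
    case True
    note AE = entropy_functional_translate_aux(2)[of \<mu> y]
    have "(\<integral>\<^sup>+x. ennreal (h (dens (translate y \<mu>) x)) \<partial>lborel) = (\<integral>\<^sup>+x. ennreal (h (dens \<mu> x)) \<partial>lborel)"
      if [measurable]: "h \<in> borel_measurable borel" for h :: "real \<Rightarrow> real"
    proof -
      have "(\<integral>\<^sup>+x. ennreal (h (dens (translate y \<mu>) x)) \<partial>lborel) = (\<integral>\<^sup>+x. ennreal (h (dens \<mu> (x - y))) \<partial>lborel)"
        using AE True by (intro nn_integral_cong_AE) auto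
      also have "\<dots> = (\<integral>\<^sup>+x. ennreal (h (dens \<mu> x)) \<partial>lborel)"
        by (subst nn_integral_lborel_affine[where c = 1 and t = y]) auto
      finally show ?thesis .
    qed
    from this[of "\<lambda>t. t * ln t"] this[of "\<lambda>t. - (t * ln t)"] show ?thesis
      using True T[OF True] unfolding entropy_functional_def Let_def dens_def[symmetric] by simp
  next
    case False
    have "\<not> ?D (translate y \<mu>)"
    proof
      assume "?D (translate y \<mu>)"
      from T[OF this, of "- y"] have "?D \<mu>" by (simp add: translate_translate[OF \<mu>] translate_0[OF \<mu>])
      with False show False by simp
    qed
    with False show ?thesis unfolding entropy_functional_def by (simp only: if_False)
  qed
qed

lemma free_energy_translate:
  assumes "\<mu> \<in> prob_measures" "W \<in> borel_measurable borel"
  shows "free_energy W \<sigma> (translate y \<mu>) = free_energy W \<sigma> \<mu>"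
  using assms by (simp add: free_energy_def entropy_functional_translate interaction_energy_translate)

lemma orbit_translate:
  assumes "\<mu> \<in> prob_measures" shows "orbit (translate y \<mu>) = orbit \<mu>"
proof -
  have "range (\<lambda>z. translate z (translate y \<mu>)) = (\<lambda>z. translate z \<mu>) ` range (\<lambda>z. y + z)"
    by (simp only: translate_translate[OF assms] image_image)
  also have "range (\<lambda>z. y + z) = UNIV" by (rule surj_plus)
  finally show ?thesis by (simp only: orbit_def)
qed

lemma orbit_free_energy_orbit:
  assumes "\<mu> \<in> prob_measures" "W \<in> borel_measurable borel"
  shows "orbit_free_energy W \<sigma> (orbit \<mu>) = free_energy W \<sigma> \<mu>"
proof -
  have "free_energy W \<sigma> ` orbit \<mu> = {free_energy W \<sigma> \<mu>}"
    unfolding orbit_def image_image by (simp add: free_energy_translate[OF assms])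
  then show ?thesis by (simp add: orbit_free_energy_def)
qed

lemma centered_representative:
  assumes \<mu>: "\<mu> \<in> prob_measures_p 1"
  obtains y where "(\<integral>x. x \<partial>translate y \<mu>) = 0"
proof
  note \<mu>' = prob_measures_pD(1)[OF \<mu>]
  interpret prob_space \<mu> by (rule prob_measuresD(2)[OF \<mu>'])
  note [measurable_cong] = prob_measuresD(1)[OF \<mu>']
  have "(\<integral>x. x \<partial>translate (- (\<integral>x. x \<partial>\<mu>)) \<mu>) = (\<integral>x. x + - (\<integral>x. x \<partial>\<mu>) \<partial>\<mu>)"
    unfolding translate_def by (rule integral_distr) auto
  also have "\<dots> = 0" using integrable_id[OF \<mu>] prob_space by (subst Bochner_Integration.integral_add) auto
  finally show "(\<integral>x. x \<partial>translate (- (\<integral>x. x \<partial>\<mu>)) \<mu>) = 0" .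
qed

lemma topspace_orbit_topology: "topspace orbit_topology = orbit ` prob_measures"
  by (simp add: orbit_topology_def topspace_quotient_topology topspace_weak_topology)

lemma openin_orbit_topology:
  "openin orbit_topology G \<longleftrightarrow> G \<subseteq> orbit ` prob_measures \<and> openin weak_topology {\<mu> \<in> prob_measures. orbit \<mu> \<in> G}"
  by (simp add: orbit_topology_def openin_quotient_topology topspace_weak_topology)

lemma continuous_map_orbit: "continuous_map weak_topology orbit_topology orbit"
  unfolding continuous_map topspace_weak_topology topspace_orbit_topology by (auto simp: openin_orbit_topology)

subsection \<open>The laws of the empirical measure\<close>

context gibbs
begin

lemma observable_UNIV: "observable UNIV"
  unfolding observable_def by auto

lemma weight_pos: "0 < weight n x" by (simp add: weight_def)

lemma weight_le_stretched_full:
  assumes "(\<Sum>i<n. x i) = 0" "0 < n"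
  shows "weight n x \<le> exp (- real n * (- C0)) * (\<Prod>i<n. exp 0 * stretched_exp b0 l (x i))"
  using weight_le_stretched[OF assms, of 1] by simp

lemma mass_UNIV_finite: "0 < n \<Longrightarrow> mass n UNIV < \<infinity>"
  using mass_le[where A = UNIV and \<phi> = "\<lambda>_. 0" and B = 0, OF b0 _ _ weight_le_stretched_full]
  by (fastforce intro: order_le_less_trans)

text \<open>The weight never vanishes, and the space of free points has nonzero volume; for
  \<open>n = 1\<close> this volume is the empty product \<open>1\<close>.\<close>

lemma mass_UNIV_pos:
  assumes n: "0 < n" shows "0 < mass n UNIV"
proof (rule ccontr)
  assume "\<not> ?thesis"
  then have "(\<integral>\<^sup>+x. ennreal (weight n (fill_last n x)) \<partial>config_lborel (n - 1)) = 0"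
    using n mass_eq_fill_last[OF observable_UNIV n] by simp
  then have "AE x in config_lborel (n - 1). ennreal (weight n (fill_last n x)) = 0"
    using measurable_compose[OF measurable_fill_last[OF n] weight_borel]
    by (subst (asm) nn_integral_0_iff_AE) auto
  then have "(\<integral>\<^sup>+x. 1 \<partial>(config_lborel (n - 1) :: (nat \<Rightarrow> 'a) measure)) = (\<integral>\<^sup>+x. 0 \<partial>(config_lborel (n - 1) :: (nat \<Rightarrow> 'a) measure))"
    using weight_pos by (intro nn_integral_cong_AE) (auto simp: ennreal_eq_0_iff not_le[symmetric])
  moreover have "emeasure (config_lborel (n - 1) :: (nat \<Rightarrow> 'a) measure) (Pi\<^sub>E {..<n - 1} (\<lambda>_. UNIV)) = (\<Prod>i<n - 1. \<infinity>)"
    by (subst lborel_product.emeasure_PiM) auto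
  ultimately show False by (simp add: space_PiM)
qed

lemma mass_cong:
  assumes "0 < n" "\<And>x. x \<in> centered_configurations n \<Longrightarrow> empirical_measure n x \<in> A \<longleftrightarrow> empirical_measure n x \<in> B"
  shows "mass n A = mass n B"
  unfolding mass_def
proof (rule nn_integral_cong_AE)
  show "AE x in centered_lebesgue n. ennreal (weight n x) * indicator A (empirical_measure n x)
      = ennreal (weight n x) * indicator B (empirical_measure n x)"
    using AE_centered[OF assms(1)] by eventually_elim (simp add: assms(2) indicator_def)
qed

lemma partition_function_eq: "partition_function W \<sigma> n = mass n UNIV"
  by (simp add: partition_function_def boltzmann_weight mass_def)

lemma gibbs_measure_eq: "gibbs_measure W \<sigma> n = density (centered_lebesgue n) (\<lambda>x. ennreal (weight n x) / mass n UNIV)"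
  by (simp add: gibbs_measure_def boltzmann_weight partition_function_eq)

lemma sets_gibbs [simp]: "sets (gibbs_measure W \<sigma> n) = sets (config_space n)"
  and space_gibbs [simp]: "space (gibbs_measure W \<sigma> n) = space (config_space n)"
  by (simp_all add: gibbs_measure_eq)

lemma emeasure_gibbs:
  assumes A: "observable A" and n: "0 < n"
  shows "emeasure (gibbs_measure W \<sigma> n) {x \<in> space (config_space n). empirical_measure n x \<in> A} = mass n A / mass n UNIV"
proof -
  let ?S = "{x \<in> space (config_space n). empirical_measure n x \<in> A}"
  have S [measurable]: "?S \<in> sets (config_space n)" using A n by (simp add: observable_def)
  note [measurable] = observable_indicator[OF A n]
  have "emeasure (gibbs_measure W \<sigma> n) ?S = (\<integral>\<^sup>+x. ennreal (weight n x) / mass n UNIV * indicator ?S x \<partial>centered_lebesgue n)"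
    unfolding gibbs_measure_eq using S by (intro emeasure_density) auto
  also have "\<dots> = (\<integral>\<^sup>+x. ennreal (weight n x) * indicator A (empirical_measure n x) / mass n UNIV \<partial>centered_lebesgue n)"
    by (intro nn_integral_cong) (auto simp: indicator_def)
  also have "\<dots> = mass n A / mass n UNIV" unfolding mass_def by (intro nn_integral_divide) auto
  finally show ?thesis .
qed

lemma prob_space_gibbs:
  assumes n: "0 < n" shows "prob_space (gibbs_measure W \<sigma> n)"
proof (rule prob_spaceI)
  show "emeasure (gibbs_measure W \<sigma> n) (space (gibbs_measure W \<sigma> n)) = 1"
    using emeasure_gibbs[OF observable_UNIV n] mass_UNIV_pos[OF n] mass_UNIV_finite[OF n] by (simp add: ennreal_divide_self)
qed

lemma AE_gibbs_centered:
  assumes n: "0 < n" shows "AE x in gibbs_measure W \<sigma> n. x \<in> centered_configurations n"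
proof -
  have "AE x in centered_lebesgue n. 0 < ennreal (weight n x) / mass n UNIV \<longrightarrow> x \<in> centered_configurations n"
    using AE_centered[OF n] by eventually_elim simp
  then show ?thesis unfolding gibbs_measure_eq by (subst AE_density) auto
qed

lemma space_borel_of [simp]: "space (borel_of X) = topspace X"
  unfolding borel_of_def by (rule space_measure_of) (auto dest: openin_subset)

lemma sets_borel_of: "sets (borel_of X) = sigma_sets (topspace X) {U. openin X U}"
  unfolding borel_of_def by (rule sets_measure_of) (auto dest: openin_subset)

lemma open_or_closed_in_borel_of: "openin X A \<or> closedin X A \<Longrightarrow> A \<in> sets (borel_of X)"
proof (elim disjE)
  assume "closedin X A"
  then have "topspace X - A \<in> sets (borel_of X)" by (auto simp: sets_borel_of)
  then have "topspace X - (topspace X - A) \<in> sets (borel_of X)" using sets.compl_sets[of _ "borel_of X"] by force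
  moreover have "topspace X - (topspace X - A) = A" using closedin_subset[OF \<open>closedin X A\<close>] by auto
  ultimately show ?thesis by simp
qed (auto simp: sets_borel_of)

section \<open>Laws on topologies whose open sets are traces of observable sets\<close>

context
  fixes X :: "'a measure topology" and n :: nat
  assumes n: "0 < n"
    and top: "\<And>x. x \<in> centered_configurations n \<Longrightarrow> empirical_measure n x \<in> topspace X"
    and obs: "\<And>U. openin X U \<Longrightarrow> \<exists>U'. observable U' \<and> U = U' \<inter> topspace X"
begin

private abbreviation "M \<equiv> restrict_space (gibbs_measure W \<sigma> n) (centered_configurations n)"

private lemma cc: "centered_configurations n \<inter> space (gibbs_measure W \<sigma> n) = centered_configurations n"
  by (auto simp: centered_configurations_def space_PiM)

private lemma prob_M: "prob_space M"
proof (rule prob_space_restrict_space)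
  interpret prob_space "gibbs_measure W \<sigma> n" by (rule prob_space_gibbs[OF n])
  show "centered_configurations n \<in> sets (gibbs_measure W \<sigma> n)" by simp
  then show "emeasure (gibbs_measure W \<sigma> n) (centered_configurations n) = 1"
    by (rule emeasure_eq_1_AE[OF _ AE_gibbs_centered[OF n]])
qed

private lemma preimage:
  assumes A: "observable A" and S: "S = {x \<in> centered_configurations n. empirical_measure n x \<in> A}"
  shows "S \<in> sets M" "emeasure M S = mass n A / mass n UNIV"
proof -
  let ?T = "{x \<in> space (config_space n). empirical_measure n x \<in> A}"
  have T: "?T \<in> sets (config_space n)" using A n by (simp add: observable_def)
  have S': "S = centered_configurations n \<inter> ?T" unfolding S using cc[unfolded space_gibbs] by blast
  have Sm: "S \<in> sets (gibbs_measure W \<sigma> n)" unfolding S' using T by auto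
  show "S \<in> sets M" using Sm S' by (subst sets_restrict_space_iff) (auto simp: cc)
  have "emeasure M S = emeasure (gibbs_measure W \<sigma> n) S" using S' by (intro emeasure_restrict_space) (auto simp: cc)
  also have "\<dots> = emeasure (gibbs_measure W \<sigma> n) ?T"
    using AE_gibbs_centered[OF n] Sm T by (intro emeasure_eq_AE) (auto simp: S' elim: eventually_mono)
  finally show "emeasure M S = mass n A / mass n UNIV" by (simp add: emeasure_gibbs[OF A n])
qed

private lemma measurable_empirical: "empirical_measure n \<in> measurable M (borel_of X)"
  unfolding borel_of_def
proof (rule measurable_measure_of)
  show "{U. openin X U} \<subseteq> Pow (topspace X)" by (auto dest: openin_subset)
  show "empirical_measure n \<in> space M \<rightarrow> topspace X" using top by (auto simp: space_restrict_space)
  fix U assume "U \<in> {U. openin X U}"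
  then obtain U' where U': "observable U'" "U = U' \<inter> topspace X" using obs by auto
  show "empirical_measure n -` U \<inter> space M \<in> sets M"
    by (rule preimage(1)[OF U'(1)]) (use top cc in \<open>auto simp: U'(2) space_restrict_space\<close>)
qed

lemma empirical_law_props:
  shows "prob_space (empirical_law W \<sigma> X n)" "space (empirical_law W \<sigma> X n) = topspace X"
    "sets (empirical_law W \<sigma> X n) = sets (borel_of X)"
  unfolding empirical_law_def
  using prob_space.prob_space_distr[OF prob_M measurable_empirical] by auto

text \<open>Closed sets are complements of traces, hence traces themselves. Since almost every
  configuration is centered and has its empirical measure in \<open>topspace X\<close>, a set and
  any observable set with the same trace have equal mass.\<close>

lemma measure_empirical_law:
  assumes A: "openin X A \<or> closedin X A"
  shows "measure (empirical_law W \<sigma> X n) A = enn2real (mass n A / mass n UNIV)"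
proof -
  obtain A' where A': "observable A'" "A = A' \<inter> topspace X"
    using A
  proof (elim disjE)
    assume "closedin X A"
    then obtain U' where U': "observable U'" "topspace X - A = U' \<inter> topspace X" using obs[of "topspace X - A"] by auto
    have "A = - U' \<inter> topspace X" using U'(2) closedin_subset[OF \<open>closedin X A\<close>] by auto
    then show ?thesis using that[of "- U'"] observable_Compl[OF U'(1)] by auto
  qed (use obs that in blast)
  have "emeasure (empirical_law W \<sigma> X n) A = emeasure M (empirical_measure n -` A \<inter> space M)"
    unfolding empirical_law_def by (rule emeasure_distr[OF measurable_empirical open_or_closed_in_borel_of[OF A]])
  also have "\<dots> = mass n A' / mass n UNIV"
    by (rule preimage(2)[OF A'(1)]) (use top cc in \<open>auto simp: A'(2) space_restrict_space\<close>)
  also have "mass n A' = mass n A" using n top by (intro mass_cong) (auto simp: A'(2))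
  finally show ?thesis by (simp add: measure_def)
qed

end

section \<open>Lower boundedness of the free energy\<close>

lemma mass_UNIV_le:
  obtains K where "\<forall>\<^sub>F n in sequentially. mass n UNIV \<le> ennreal (exp (- real n * K))"
proof
  show "\<forall>\<^sub>F n in sequentially. mass n UNIV \<le> ennreal (exp (- real n * (- C0 - ln (\<integral>x. exp 0 * stretched_exp b0 l x \<partial>(lborel :: 'a measure)) - 1)))"
    by (rule mass_eventually_le[where \<phi> = "\<lambda>_. 0" and B = 0 and k = "- C0" and b = b0]) (use b0 weight_le_stretched_full in auto)
qed

text \<open>The device by which mass bounds speak about the free energy: a lower bound of rate
  \<open>c\<close> and an upper bound of rate \<open>k\<close> on the same masses force
  \<open>k \<le> c\<close>.\<close>

lemma exp_rate_le:
  assumes "\<forall>\<^sub>F n in sequentially. ennreal (exp (- real n * c)) \<le> m n" "\<forall>\<^sub>F n in sequentially. m n \<le> ennreal (exp (- real n * k))"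
  shows "k \<le> c"
proof -
  have "\<forall>\<^sub>F n in sequentially. k \<le> c"
    using assms eventually_gt_at_top[of 0]
  proof eventually_elim
    case (elim n)
    then have "ennreal (exp (- real n * c)) \<le> ennreal (exp (- real n * k))" by (intro order_trans[OF elim(1,2)])
    then have "real n * k \<le> real n * c" by (simp add: ennreal_le_iff)
    then show ?case using elim(3) by simp
  qed
  then show ?thesis by simp
qed

text \<open>\<open>lower_bound\<close> starts from a centered measure. Finite free energy provides a
  first moment, and translating to mean \<open>0\<close> changes neither the free energy nor the
  orbit.\<close>

lemma centered_version:
  assumes \<mu>: "\<mu> \<in> prob_measures" and F: "free_energy W \<sigma> \<mu> < \<infinity>"
  obtains \<nu> where "\<nu> \<in> prob_measures" "(\<integral>x. x \<partial>\<nu>) = 0" "free_energy W \<sigma> \<nu> = free_energy W \<sigma> \<mu>" "orbit \<nu> = orbit \<mu>"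
proof -
  have "entropy_functional \<mu> < \<infinity>"
  proof (rule ccontr)
    assume "\<not> ?thesis"
    then show False using F by (simp add: free_energy_def)
  qed
  then obtain y where "(\<integral>x. x \<partial>translate y \<mu>) = 0" using centered_representative entropy_functional_finiteD(1) by blast
  then show ?thesis
    using that[of "translate y \<mu>"] \<mu> by (simp add: translate_in_prob_measures free_energy_translate orbit_translate)
qed

text \<open>A measure with free energy below the rate \<open>K\<close> of the total mass would,
  through \<open>lower_bound\<close> on the whole space, make that mass too large.\<close>

lemma free_energy_lower_bound:
  obtains K where "ereal K \<le> min_free_energy W \<sigma>"
proof -
  obtain K where K: "\<forall>\<^sub>F n in sequentially. mass n UNIV \<le> ennreal (exp (- real n * K))" by (rule mass_UNIV_le)
  have "ereal K \<le> free_energy W \<sigma> \<mu>" if \<mu>: "\<mu> \<in> prob_measures" for \<mu>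
  proof (rule ccontr)
    assume "\<not> ?thesis"
    then have "free_energy W \<sigma> \<mu> < ereal K" by (simp only: not_le)
    then obtain c where c: "free_energy W \<sigma> \<mu> < ereal c" "ereal c < ereal K" using ereal_dense2 by blast
    then obtain \<nu> where \<nu>: "\<nu> \<in> prob_measures" "(\<integral>x. x \<partial>\<nu>) = 0" "free_energy W \<sigma> \<nu> < ereal c"
      using centered_version[OF \<mu>] by (metis less_ereal.simps(4) less_trans)
    obtain R where "\<And>V. openin weak_topology V \<Longrightarrow> \<nu> \<in> V \<Longrightarrow>
        \<forall>\<^sub>F n in sequentially. ennreal (exp (- real n * c)) \<le> mass n (V \<inter> moment_ball l R)"
      using lower_bound[OF \<nu>] by blast
    from this[OF openin_topspace] have "\<forall>\<^sub>F n in sequentially. ennreal (exp (- real n * c)) \<le> mass n UNIV"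
      using \<nu>(1) by (auto simp: topspace_weak_topology elim!: eventually_mono intro: order_trans[OF _ mass_mono])
    from exp_rate_le[OF this K] c show False by simp
  qed
  then have "ereal K \<le> min_free_energy W \<sigma>" unfolding min_free_energy_def by (rule INF_greatest)
  then show ?thesis by (rule that)
qed

end

subsection \<open>Assembling the large deviation principles\<close>

text \<open>With a real value \<open>f\<close> the difference \<open>J x - ereal f\<close> is never
  of the form \<open>\<infinity> - \<infinity>\<close>.\<close>

locale gibbs_finite = gibbs +
  fixes f :: real
  assumes f: "min_free_energy W \<sigma> = ereal f"
begin

lemma free_energy_ge: "\<mu> \<in> prob_measures \<Longrightarrow> ereal f \<le> free_energy W \<sigma> \<mu>"
  unfolding f[symmetric] min_free_energy_def by (rule INF_lower)

text \<open>Together with \<open>partition_upper\<close> this identifies \<open>f\<close> as the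
  exponential rate of the partition function, so that normalising shifts every rate by
  \<open>f\<close>.\<close>

lemma partition_lower:
  assumes c: "f < c"
  shows "\<forall>\<^sub>F n in sequentially. ennreal (exp (- real n * c)) \<le> mass n UNIV"
proof -
  have "(INF \<mu>\<in>prob_measures. free_energy W \<sigma> \<mu>) < ereal c" using f c by (simp add: min_free_energy_def)
  then obtain \<mu> where \<mu>: "\<mu> \<in> prob_measures" "free_energy W \<sigma> \<mu> < ereal c" by (auto simp: INF_less_iff)
  then obtain \<nu> where \<nu>: "\<nu> \<in> prob_measures" "(\<integral>x. x \<partial>\<nu>) = 0" "free_energy W \<sigma> \<nu> < ereal c"
    using centered_version[OF \<mu>(1)] by (metis less_ereal.simps(4) less_trans)
  obtain R where "\<And>V. openin weak_topology V \<Longrightarrow> \<nu> \<in> V \<Longrightarrow>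
      \<forall>\<^sub>F n in sequentially. ennreal (exp (- real n * c)) \<le> mass n (V \<inter> moment_ball l R)"
    using lower_bound[OF \<nu>] by blast
  from this[OF openin_topspace] show ?thesis
    using \<nu>(1) by (auto simp: topspace_weak_topology elim!: eventually_mono intro: order_trans[OF _ mass_mono])
qed

lemma partition_upper:
  assumes c: "c < f"
  shows "\<forall>\<^sub>F n in sequentially. mass n UNIV \<le> ennreal (exp (- real n * c))"
proof -
  obtain c' where c': "c < c'" "c' < f" using c dense by blast
  have "\<forall>\<^sub>F n in sequentially. mass n prob_measures \<le> ennreal (exp (- real n * c))"
  proof (rule upper_bound[OF _ _ _ c'(1), where X = weak_topology])
    fix R :: real assume "0 \<le> R"
    then show "compactin weak_topology (prob_measures \<inter> moment_ball l R :: 'a measure set)"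
      using compactin_moment_ball[OF l] by (simp add: moment_ball_def Int_def conj_ac)
  next
    fix U :: "'a measure set" assume "openin weak_topology U"
    then show "openin weak_topology (U \<inter> topspace weak_topology) \<and> observable (U \<inter> topspace weak_topology)"
      by (auto intro!: observable_weak_open)
  next
    fix \<mu> :: "'a measure" assume \<mu>: "\<mu> \<in> prob_measures"
    then show "\<mu> \<in> prob_measures \<and> ereal c' < free_energy W \<sigma> \<mu>"
      using less_le_trans[OF _ free_energy_ge[OF \<mu>], of "ereal c'"] c' by simp
  qed
  then show ?thesis using eventually_gt_at_top[of 0]
  proof eventually_elim
    case (elim n)
    have "mass n UNIV = mass n prob_measures" using elim(2) by (intro mass_cong) auto
    then show ?case using elim(1) by simp
  qed
qed

lemma mass_ratio:
  assumes "0 < n"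
  obtains m z where "mass n A = ennreal m" "0 \<le> m" "mass n UNIV = ennreal z" "0 < z" "enn2real (mass n A / mass n UNIV) = m / z"
proof -
  note fin = mass_UNIV_finite[OF assms] and pos = mass_UNIV_pos[OF assms]
  have "mass n A < \<infinity>" using fin mass_mono[of A UNIV n] by (simp add: le_less_trans)
  then obtain m where m: "mass n A = ennreal m" "0 \<le> m" by (cases "mass n A") auto
  obtain z where z: "mass n UNIV = ennreal z" "0 \<le> z" using fin by (cases "mass n UNIV") auto
  then have "0 < z" using pos by simp
  then show ?thesis using that[OF m z(1)] m z by (simp add: divide_ennreal)
qed

lemma liminf_bound:
  assumes r: "\<And>n. 2 \<le> n \<Longrightarrow> r n = enn2real (mass n A / mass n UNIV)"
    and c: "\<forall>\<^sub>F n in sequentially. ennreal (exp (- real n * c)) \<le> mass n A"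
  shows "ereal (f - c) \<le> liminf (\<lambda>n. ereal (1 / real n) * ln_ereal (r n))"
proof (rule ereal_le_epsilon2)
  fix \<epsilon> :: real assume \<epsilon>: "0 < \<epsilon>"
  then have less: "f - \<epsilon> < f" by simp
  have "\<forall>\<^sub>F n in sequentially. ereal (f - \<epsilon> - c) \<le> ereal (1 / real n) * ln_ereal (r n)"
    using c partition_upper[OF less] eventually_ge_at_top[of 2]
  proof eventually_elim
    case (elim n)
    then have n: "0 < n" by simp
    obtain m z where mz: "mass n A = ennreal m" "0 \<le> m" "mass n UNIV = ennreal z" "0 < z" "enn2real (mass n A / mass n UNIV) = m / z"
      using mass_ratio[OF n] by blast
    have "exp (- real n * c) \<le> m" using elim(1) mz by simp
    moreover from this have m0: "0 < m" using less_le_trans[OF exp_gt_zero] by blast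
    ultimately have "- real n * c \<le> ln m" by (simp add: ln_ge_iff)
    moreover have "ln z \<le> - real n * (f - \<epsilon>)"
    proof -
      have "z \<le> exp (- real n * (f - \<epsilon>))" using elim(2) \<epsilon> mz by simp
      then have "ln z \<le> ln (exp (- real n * (f - \<epsilon>)))" using mz by (subst ln_le_cancel_iff) auto
      then show ?thesis by simp
    qed
    ultimately have "real n * (f - \<epsilon> - c) \<le> ln m - ln z" by (simp add: algebra_simps)
    then have "f - \<epsilon> - c \<le> 1 / real n * ln (m / z)" using n m0 mz by (simp add: ln_div field_simps)
    moreover have "ln_ereal (r n) = ereal (ln (m / z))" using m0 mz elim by (simp add: r ln_ereal_def divide_le_0_iff)
    ultimately show ?case by simp
  qed
  then have "ereal (f - \<epsilon> - c) \<le> liminf (\<lambda>n. ereal (1 / real n) * ln_ereal (r n))" by (rule Liminf_bounded)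
  then have "ereal (f - \<epsilon> - c) + ereal \<epsilon> \<le> liminf (\<lambda>n. ereal (1 / real n) * ln_ereal (r n)) + ereal \<epsilon>"
    by (rule add_right_mono)
  then show "ereal (f - c) \<le> liminf (\<lambda>n. ereal (1 / real n) * ln_ereal (r n)) + ereal \<epsilon>" by simp
qed

lemma limsup_bound:
  assumes r: "\<And>n. 2 \<le> n \<Longrightarrow> r n = enn2real (mass n A / mass n UNIV)"
    and c: "\<forall>\<^sub>F n in sequentially. mass n A \<le> ennreal (exp (- real n * c))"
  shows "limsup (\<lambda>n. ereal (1 / real n) * ln_ereal (r n)) \<le> ereal (f - c)"
proof (rule ereal_le_epsilon2)
  fix \<epsilon> :: real assume \<epsilon>: "0 < \<epsilon>"
  then have less: "f < f + \<epsilon>" by simp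
  have "\<forall>\<^sub>F n in sequentially. ereal (1 / real n) * ln_ereal (r n) \<le> ereal (f + \<epsilon> - c)"
    using c partition_lower[OF less] eventually_ge_at_top[of 2]
  proof eventually_elim
    case (elim n)
    then have n: "0 < n" by simp
    obtain m z where mz: "mass n A = ennreal m" "0 \<le> m" "mass n UNIV = ennreal z" "0 < z" "enn2real (mass n A / mass n UNIV) = m / z"
      using mass_ratio[OF n] by blast
    show ?case
    proof (cases "m = 0")
      case True
      then show ?thesis using mz elim n by (simp add: r ln_ereal_def)
    next
      case False
      then have m0: "0 < m" using mz by simp
      have "m \<le> exp (- real n * c)" using elim(1) mz by simp
      then have "ln m \<le> ln (exp (- real n * c))" using m0 by (subst ln_le_cancel_iff) auto
      moreover have "- real n * (f + \<epsilon>) \<le> ln z"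
        using elim(2) \<epsilon> mz by (simp add: ln_ge_iff)
      ultimately have "ln m - ln z \<le> real n * (f + \<epsilon> - c)" by (simp add: algebra_simps)
      then have "1 / real n * ln (m / z) \<le> f + \<epsilon> - c" using n m0 mz by (simp add: ln_div field_simps)
      moreover have "ln_ereal (r n) = ereal (ln (m / z))" using m0 mz elim by (simp add: r ln_ereal_def divide_le_0_iff)
      ultimately show ?thesis by simp
    qed
  qed
  then have "limsup (\<lambda>n. ereal (1 / real n) * ln_ereal (r n)) \<le> ereal (f + \<epsilon> - c)" by (rule Limsup_bounded)
  then show "limsup (\<lambda>n. ereal (1 / real n) * ln_ereal (r n)) \<le> ereal (f - c) + ereal \<epsilon>" by (simp add: algebra_simps)
qed

text \<open>Common frame of both principles: \<open>pre\<close> translates events in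
  \<open>X\<close> into sets of measures, whose masses are compared with the unshifted rate
  \<open>J\<close>. In the lower bound each point of the open set is treated on its own.\<close>

lemma satisfies_LDPI:
  fixes X :: "'x topology" and P :: "nat \<Rightarrow> 'x measure" and J :: "'x \<Rightarrow> ereal" and pre :: "'x set \<Rightarrow> 'a measure set"
  assumes law: "\<And>n. 2 \<le> n \<Longrightarrow> prob_space (P n) \<and> space (P n) = topspace X \<and> sets (P n) = sets (borel_of X)"
    and mass: "\<And>n A. 2 \<le> n \<Longrightarrow> openin X A \<or> closedin X A \<Longrightarrow> measure (P n) A = enn2real (mass n (pre A) / mass n UNIV)"
    and low: "\<And>G x c. openin X G \<Longrightarrow> x \<in> G \<Longrightarrow> J x < ereal c \<Longrightarrow> \<forall>\<^sub>F n in sequentially. ennreal (exp (- real n * c)) \<le> mass n (pre G)"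
    and up: "\<And>A c c'. closedin X A \<Longrightarrow> (\<And>x. x \<in> A \<Longrightarrow> ereal c < J x) \<Longrightarrow> c' < c \<Longrightarrow> \<forall>\<^sub>F n in sequentially. mass n (pre A) \<le> ennreal (exp (- real n * c'))"
    and J: "\<And>x. x \<in> topspace X \<Longrightarrow> ereal f \<le> J x"
  shows "satisfies_LDP X P (\<lambda>x. J x - ereal f)"
  unfolding satisfies_LDP_def
proof (intro conjI allI impI)
  fix G assume G: "openin X G"
  let ?L = "liminf (\<lambda>n. ereal (1 / real n) * ln_ereal (measure (P n) G))"
  have "- ?L \<le> J x - ereal f" if x: "x \<in> G" for x
  proof (cases "J x")
    case (real t)
    have "ereal (f - t) \<le> ?L"
    proof (rule ereal_le_epsilon2)
      fix \<epsilon> :: real assume "0 < \<epsilon>"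
      then have "\<forall>\<^sub>F n in sequentially. ennreal (exp (- real n * (t + \<epsilon>))) \<le> mass n (pre G)"
        using real by (intro low[OF G x]) simp
      then have "ereal (f - (t + \<epsilon>)) \<le> ?L" by (intro liminf_bound) (use mass G in auto)
      then have "ereal (f - (t + \<epsilon>)) + ereal \<epsilon> \<le> ?L + ereal \<epsilon>" by (rule add_right_mono)
      then show "ereal (f - t) \<le> ?L + ereal \<epsilon>" by simp
    qed
    then have "- ?L \<le> - ereal (f - t)" by (simp only: ereal_minus_le_minus)
    then show ?thesis using real by simp
  next
    case MInf
    then show ?thesis using J[of x] x openin_subset[OF G] by auto
  qed simp
  then have "- ?L \<le> (INF x\<in>G. J x - ereal f)" by (rule INF_greatest)
  then show "- (INF x\<in>G. J x - ereal f) \<le> ?L" using ereal_minus_le_minus by (metis ereal_uminus_uminus)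
next
  fix A assume A: "closedin X A"
  let ?L = "limsup (\<lambda>n. ereal (1 / real n) * ln_ereal (measure (P n) A))"
  show "?L \<le> - (INF x\<in>A. J x - ereal f)"
  proof (rule ccontr)
    assume "\<not> ?thesis"
    then have "- ?L < (INF x\<in>A. J x - ereal f)" by (metis ereal_minus_less_minus ereal_uminus_uminus not_le)
    then obtain c where c: "- ?L < ereal c" "ereal c < (INF x\<in>A. J x - ereal f)" using ereal_dense2 by blast
    \<comment> \<open>A second level is inserted because \<open>up\<close> turns the level
      \<open>c'\<close> into a strictly smaller rate \<open>c\<close>, and this rate must still
      exceed \<open>- ?L\<close>.\<close>
    obtain c' where c': "ereal c < ereal c'" "ereal c' < (INF x\<in>A. J x - ereal f)" using c(2) ereal_dense2 by blast
    have "ereal (c' + f) < J x" if "x \<in> A" for x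
    proof -
      have "ereal c' < J x - ereal f" using c'(2) that by (rule less_INF_D)
      then show ?thesis by (cases "J x") (auto simp: algebra_simps)
    qed
    then have "\<forall>\<^sub>F n in sequentially. mass n (pre A) \<le> ennreal (exp (- real n * (c + f)))"
      using c'(1) by (intro up[OF A]) auto
    then have "?L \<le> ereal (f - (c + f))" by (intro limsup_bound) (use mass A in auto)
    then have "- ereal (- c) \<le> - ?L" by (simp only: ereal_minus_le_minus) simp
    then show False using c(1) by simp
  qed
qed (use law in auto)

lemma good_rate_functionI:
  assumes J: "\<And>x. x \<in> topspace X \<Longrightarrow> ereal f \<le> J x" and fin: "x0 \<in> topspace X" "J x0 < \<infinity>"
    and cpt: "\<And>c. compactin X {x \<in> topspace X. J x \<le> ereal c}"
  shows "good_rate_function X (\<lambda>x. J x - ereal f)"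
  unfolding good_rate_function_def
proof (intro conjI ballI allI)
  fix x assume "x \<in> topspace X"
  from J[OF this] show "0 \<le> J x - ereal f" by (simp add: ereal_le_minus_iff)
next
  show "\<exists>x\<in>topspace X. J x - ereal f \<noteq> \<infinity>" using fin by (intro bexI[of _ x0]) (cases "J x0"; auto)+
next
  fix c :: real
  have "J x - ereal f \<le> ereal c \<longleftrightarrow> J x \<le> ereal (c + f)" for x
    by (cases "J x") (auto simp: algebra_simps)
  then show "compactin X {x \<in> topspace X. J x - ereal f \<le> ereal c}" using cpt[of "c + f"] by simp
qed

end

context gibbs_finite
begin

text \<open>
  The level sets of the free energy are obtained from both large deviation estimates: a centered
  measure of small free energy charges its neighbourhoods, which exponential tightness and the
  local upper bound forbid outside a moment ball and near measures of larger free energy.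
\<close>

definition centered_level :: "real \<Rightarrow> 'a measure set" where
  "centered_level c = {\<mu> \<in> prob_measures. (\<integral>x. x \<partial>\<mu>) = 0 \<and> free_energy W \<sigma> \<mu> \<le> ereal c}"

lemma level_set_moment_ball:
  obtains R where "0 \<le> R"
    "centered_level c \<subseteq> moment_ball l R"
proof -
  \<comment> \<open>Tightness at rate \<open>c + 2\<close> will clash with the lower bound at rate
    \<open>c + 1\<close>.\<close>
  obtain R where R: "0 \<le> R" "\<forall>\<^sub>F n in sequentially. mass n (- moment_ball l R) \<le> ennreal (exp (- real n * (c + 2)))"
    by (rule exponential_tightness)
  have "\<mu> \<in> moment_ball l R" if \<mu>: "\<mu> \<in> prob_measures" "(\<integral>x. x \<partial>\<mu>) = 0" and F: "free_energy W \<sigma> \<mu> \<le> ereal c" for \<mu>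
  proof (rule ccontr)
    assume n: "\<mu> \<notin> moment_ball l R"
    have "free_energy W \<sigma> \<mu> < ereal (c + 1)" using F by (rule order_le_less_trans) simp
    then obtain R' where R': "\<And>V. openin weak_topology V \<Longrightarrow> \<mu> \<in> V \<Longrightarrow>
        \<forall>\<^sub>F n in sequentially. ennreal (exp (- real n * (c + 1))) \<le> mass n (V \<inter> moment_ball l R')"
      using lower_bound[OF \<mu>] by blast
    have "openin weak_topology (topspace weak_topology - moment_ball l R :: 'a measure set)"
      using l by (intro openin_diff closedin_moment_ball) auto
    from R'[OF this] n \<mu>(1)
    have "\<forall>\<^sub>F n in sequentially. ennreal (exp (- real n * (c + 1))) \<le> mass n ((topspace weak_topology - moment_ball l R) \<inter> moment_ball l R')"
      by (simp add: topspace_weak_topology)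
    then have "\<forall>\<^sub>F n in sequentially. ennreal (exp (- real n * (c + 1))) \<le> mass n (- moment_ball l R)"
      by (rule eventually_mono) (erule order_trans, rule mass_mono, blast)
    from exp_rate_le[OF this R(2)] show False by simp
  qed
  then have "centered_level c \<subseteq> moment_ball l R" unfolding centered_level_def by blast
  then show ?thesis by (rule that[OF R(1)])
qed

lemma high_energy_nbhd:
  assumes \<mu>: "\<mu> \<in> prob_measures" and c: "ereal c < free_energy W \<sigma> \<mu>"
  obtains U where "openin weak_topology U" "\<mu> \<in> U"
    "U \<inter> centered_level c = {}"
proof -
  obtain c1 where c1: "ereal c < ereal c1" "ereal c1 < free_energy W \<sigma> \<mu>" using c ereal_dense2 by blast
  obtain U where U: "openin weak_topology U" "\<mu> \<in> U" "\<forall>\<^sub>F n in sequentially. mass n U \<le> ennreal (exp (- real n * c1))"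
    using local_upper_bound[OF \<mu> c1(2)] by blast
  have False if \<nu>: "\<nu> \<in> U" "\<nu> \<in> prob_measures" "(\<integral>x. x \<partial>\<nu>) = 0" and F: "free_energy W \<sigma> \<nu> \<le> ereal c" for \<nu>
  proof -
    \<comment> \<open>At the midpoint the lower bound for \<open>\<nu>\<close> applies, while the
      mass of \<open>U\<close> decays at the faster rate \<open>c1\<close>.\<close>
    have "free_energy W \<sigma> \<nu> < ereal ((c + c1) / 2)" using F by (rule order_le_less_trans) (use c1(1) in simp)
    then obtain R where "\<And>V. openin weak_topology V \<Longrightarrow> \<nu> \<in> V \<Longrightarrow>
        \<forall>\<^sub>F n in sequentially. ennreal (exp (- real n * ((c + c1) / 2))) \<le> mass n (V \<inter> moment_ball l R)"
      using lower_bound[OF \<nu>(2,3)] by blast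
    from this[OF U(1) \<nu>(1)] have "\<forall>\<^sub>F n in sequentially. ennreal (exp (- real n * ((c + c1) / 2))) \<le> mass n U"
      by (rule eventually_mono) (auto intro: order_trans[OF _ mass_mono])
    from exp_rate_le[OF this U(3)] c1(1) show False by simp
  qed
  then have "U \<inter> centered_level c = {}" unfolding centered_level_def by blast
  then show ?thesis by (rule that[OF U(1,2)])
qed

text \<open>A nonempty level set of the free energy is translation invariant, hence not weakly
  compact before passing to orbits. Compactness is shown for the weak closure \<open>T\<close> of
  the centered level and pushed down by \<open>orbit\<close>. The closure is taken because for
  \<open>l = 1\<close> a weak limit of centered measures need not be centered; its members still
  have free energy at most \<open>c\<close>, so they represent orbits in the level set.\<close>

lemma orbit_level_compact: "compactin orbit_topology {A \<in> topspace orbit_topology. orbit_free_energy W \<sigma> A \<le> ereal c}"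
proof -
  let ?S = "centered_level c"
  obtain R where R: "0 \<le> R" "centered_level c \<subseteq> moment_ball l R"
    by (rule level_set_moment_ball[of c])
  define T where "T = weak_topology closure_of ?S"
  have TR: "T \<subseteq> moment_ball l R"
    unfolding T_def using R(2) l by (intro closure_of_minimal closedin_moment_ball) auto
  have T: "compactin weak_topology T"
    using closed_compactin[OF compactin_moment_ball[OF l R(1)] TR] by (simp add: T_def)
  have FT: "free_energy W \<sigma> \<mu> \<le> ereal c" if \<mu>T: "\<mu> \<in> T" for \<mu>
  proof (rule ccontr)
    assume "\<not> ?thesis"
    moreover have \<mu>: "\<mu> \<in> prob_measures" using \<mu>T TR by (auto simp: moment_ball_def)
    ultimately obtain U where U: "openin weak_topology U" "\<mu> \<in> U"
      "U \<inter> centered_level c = {}"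
      using high_energy_nbhd[OF \<mu>, of c] by (auto simp: not_le)
    obtain \<nu> where "\<nu> \<in> ?S" "\<nu> \<in> U" using \<mu>T U(1,2) unfolding T_def in_closure_of by blast
    then show False using U(3) by auto
  qed
  have "{A \<in> topspace orbit_topology. orbit_free_energy W \<sigma> A \<le> ereal c} = orbit ` T"
  proof (intro equalityI subsetI)
    fix A assume "A \<in> {A \<in> topspace orbit_topology. orbit_free_energy W \<sigma> A \<le> ereal c}"
    then obtain \<mu> where \<mu>: "\<mu> \<in> prob_measures" "A = orbit \<mu>" "free_energy W \<sigma> \<mu> \<le> ereal c"
      by (auto simp: topspace_orbit_topology orbit_free_energy_orbit)
    have "free_energy W \<sigma> \<mu> < \<infinity>" using \<mu>(3) by (rule order_le_less_trans) simp
    then obtain \<nu> where \<nu>: "\<nu> \<in> prob_measures" "(\<integral>x. x \<partial>\<nu>) = 0" "free_energy W \<sigma> \<nu> = free_energy W \<sigma> \<mu>" "orbit \<nu> = orbit \<mu>"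
      using centered_version[OF \<mu>(1)] by blast
    then have "\<nu> \<in> ?S" using \<mu>(3) by (simp add: centered_level_def)
    then have "\<nu> \<in> T" unfolding T_def using closure_of_subset[of ?S weak_topology] by (auto simp: topspace_weak_topology centered_level_def)
    then show "A \<in> orbit ` T" using \<nu>(4) \<mu>(2) by auto
  next
    fix A assume "A \<in> orbit ` T"
    then obtain \<mu> where \<mu>: "\<mu> \<in> T" "A = orbit \<mu>" by auto
    then have "\<mu> \<in> prob_measures" using TR by (auto simp: moment_ball_def)
    then show "A \<in> {A \<in> topspace orbit_topology. orbit_free_energy W \<sigma> A \<le> ereal c}"
      using FT[OF \<mu>(1)] by (auto simp: \<mu>(2) topspace_orbit_topology orbit_free_energy_orbit)
  qed
  then show ?thesis using image_compactin[OF T continuous_map_orbit] by simp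
qed

theorem orbit_LDP:
  "satisfies_LDP orbit_topology (orbit_law W \<sigma>) (\<lambda>A. orbit_free_energy W \<sigma> A - ereal f)"
  "good_rate_function orbit_topology (\<lambda>A. orbit_free_energy W \<sigma> A - ereal f)"
proof -
  have J: "ereal f \<le> orbit_free_energy W \<sigma> A" if "A \<in> topspace orbit_topology" for A
    using that free_energy_ge by (auto simp: topspace_orbit_topology orbit_free_energy_orbit)
  define pre :: "'a measure set set \<Rightarrow> 'a measure set" where "pre G = {\<mu> \<in> prob_measures. orbit \<mu> \<in> G}" for G
  have pre_open: "openin weak_topology (pre G)" if "openin orbit_topology G" for G
    using that by (simp add: openin_orbit_topology pre_def)
  have pre_closed: "closedin weak_topology (pre A)" if "closedin orbit_topology A" for A
    using closedin_continuous_map_preimage[OF continuous_map_orbit that] by (simp add: pre_def topspace_weak_topology)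
  have obs: "\<exists>U'. observable U' \<and> U = U' \<inter> topspace weak_topology" if "openin weak_topology U" for U :: "'a measure set"
    using that openin_subset[OF that] by (intro exI[of _ U]) (auto intro: observable_weak_open)
  have top: "empirical_measure n x \<in> topspace weak_topology" if "0 < n" for n and x :: "nat \<Rightarrow> 'a"
    using that by (simp add: topspace_weak_topology)
  note props = empirical_law_props[OF _ top obs] and measure = measure_empirical_law[OF _ top obs]
  have orb: "orbit \<in> measurable (empirical_law W \<sigma> weak_topology n) (borel_of orbit_topology)" if n: "0 < n" for n
    unfolding borel_of_def
  proof (rule measurable_measure_of)
    show "{U. openin orbit_topology U} \<subseteq> Pow (topspace orbit_topology)" by (auto dest: openin_subset)
    show "orbit \<in> space (empirical_law W \<sigma> weak_topology n) \<rightarrow> topspace orbit_topology"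
      using props(2)[OF n] n by (auto simp: topspace_weak_topology topspace_orbit_topology)
    fix U :: "'a measure set set" assume "U \<in> {U. openin orbit_topology U}"
    then have "pre U \<in> sets (borel_of weak_topology)" using pre_open by (intro open_or_closed_in_borel_of) simp
    moreover have "orbit -` U \<inter> space (empirical_law W \<sigma> weak_topology n) = pre U"
      using props(2)[OF n] n by (auto simp: pre_def topspace_weak_topology)
    ultimately show "orbit -` U \<inter> space (empirical_law W \<sigma> weak_topology n) \<in> sets (empirical_law W \<sigma> weak_topology n)"
      using props(3)[OF n] n by simp
  qed
  show "satisfies_LDP orbit_topology (orbit_law W \<sigma>) (\<lambda>A. orbit_free_energy W \<sigma> A - ereal f)"
  proof (rule satisfies_LDPI[where pre = pre])
    fix n :: nat assume "2 \<le> n" then have n: "0 < n" by simp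
    show "prob_space (orbit_law W \<sigma> n) \<and> space (orbit_law W \<sigma> n) = topspace orbit_topology \<and> sets (orbit_law W \<sigma> n) = sets (borel_of orbit_topology)"
      unfolding orbit_law_def using prob_space.prob_space_distr[OF props(1)[OF n] orb[OF n]] n by auto
    fix A :: "'a measure set set" assume A: "openin orbit_topology A \<or> closedin orbit_topology A"
    have "measure (orbit_law W \<sigma> n) A = measure (empirical_law W \<sigma> weak_topology n) (orbit -` A \<inter> space (empirical_law W \<sigma> weak_topology n))"
      unfolding orbit_law_def by (rule measure_distr[OF orb[OF n] open_or_closed_in_borel_of[OF A]])
    also have "orbit -` A \<inter> space (empirical_law W \<sigma> weak_topology n) = pre A"
      using props(2)[OF n] n by (auto simp: pre_def topspace_weak_topology)
    also have "measure (empirical_law W \<sigma> weak_topology n) (pre A) = enn2real (mass n (pre A) / mass n UNIV)"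
      using A n pre_open pre_closed by (intro measure) auto
    finally show "measure (orbit_law W \<sigma> n) A = enn2real (mass n (pre A) / mass n UNIV)" .
  next
    fix G x c assume G: "openin orbit_topology G" and x: "x \<in> G" and c: "orbit_free_energy W \<sigma> x < ereal c"
    obtain \<mu> where \<mu>: "\<mu> \<in> prob_measures" "x = orbit \<mu>" using G x by (auto simp: openin_orbit_topology)
    then have "free_energy W \<sigma> \<mu> < ereal c" using c by (simp add: orbit_free_energy_orbit)
    moreover from this have "free_energy W \<sigma> \<mu> < \<infinity>" by (rule less_trans) simp
    ultimately obtain \<nu> where \<nu>: "\<nu> \<in> prob_measures" "(\<integral>x. x \<partial>\<nu>) = 0" "free_energy W \<sigma> \<nu> < ereal c" "orbit \<nu> = orbit \<mu>"
      using centered_version[OF \<mu>(1)] by metis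
    obtain R where "\<And>V. openin weak_topology V \<Longrightarrow> \<nu> \<in> V \<Longrightarrow>
        \<forall>\<^sub>F n in sequentially. ennreal (exp (- real n * c)) \<le> mass n (V \<inter> moment_ball l R)"
      using lower_bound[OF \<nu>(1-3)] by blast
    \<comment> \<open>A preimage under \<open>orbit\<close> is translation invariant, so the
      centered representative stays in it.\<close>
    moreover have "\<nu> \<in> pre G" using \<nu> \<mu> x by (simp add: pre_def)
    ultimately have "\<forall>\<^sub>F n in sequentially. ennreal (exp (- real n * c)) \<le> mass n (pre G \<inter> moment_ball l R)"
      using pre_open[OF G] by blast
    then show "\<forall>\<^sub>F n in sequentially. ennreal (exp (- real n * c)) \<le> mass n (pre G)"
      by (rule eventually_mono) (erule order_trans, rule mass_mono, blast)
  next
    fix A c c' assume A: "closedin orbit_topology A" and c: "\<And>x. x \<in> A \<Longrightarrow> ereal c < orbit_free_energy W \<sigma> x" "c' < c"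
    show "\<forall>\<^sub>F n in sequentially. mass n (pre A) \<le> ennreal (exp (- real n * c'))"
    proof (rule upper_bound[OF _ _ _ c(2), where X = weak_topology])
      show "compactin weak_topology (pre A \<inter> moment_ball l R)" if "0 \<le> R" for R
        by (rule closed_Int_compactin[OF pre_closed[OF A] compactin_moment_ball[OF l that]])
      show "openin weak_topology (U \<inter> topspace weak_topology) \<and> observable (U \<inter> topspace weak_topology)"
        if "openin weak_topology U" for U :: "'a measure set"
        using that by (auto intro!: observable_weak_open)
      show "\<mu> \<in> prob_measures \<and> ereal c < free_energy W \<sigma> \<mu>" if "\<mu> \<in> pre A" for \<mu>
        using that c(1)[of "orbit \<mu>"] by (simp add: pre_def orbit_free_energy_orbit)
    qed
  qed (rule J)
  obtain \<mu> where \<mu>: "\<mu> \<in> prob_measures" "free_energy W \<sigma> \<mu> < \<infinity>"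
    using f by (metis INF_less_iff less_ereal.simps(4) min_free_energy_def)
  show "good_rate_function orbit_topology (\<lambda>A. orbit_free_energy W \<sigma> A - ereal f)"
  proof (rule good_rate_functionI)
    show "orbit \<mu> \<in> topspace orbit_topology" "orbit_free_energy W \<sigma> (orbit \<mu>) < \<infinity>"
      using \<mu> by (auto simp: topspace_orbit_topology orbit_free_energy_orbit)
  qed (use J orbit_level_compact in auto)
qed

theorem wasserstein_LDP:
  assumes p: "1 \<le> p" "p < l"
  shows "satisfies_LDP (centered_wasserstein_topology p) (empirical_law W \<sigma> (centered_wasserstein_topology p))
      (\<lambda>\<mu>. free_energy W \<sigma> \<mu> - ereal f)"
    "good_rate_function (centered_wasserstein_topology p) (\<lambda>\<mu>. free_energy W \<sigma> \<mu> - ereal f)"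
proof -
  let ?X = "centered_wasserstein_topology p :: 'a measure topology"
  have tX: "\<mu> \<in> topspace ?X \<longleftrightarrow> \<mu> \<in> prob_measures_p p \<and> (\<integral>x. x \<partial>\<mu>) = 0" for \<mu>
    by (simp add: topspace_centered_wasserstein centered_prob_measures_p_def)
  have tXp: "\<mu> \<in> prob_measures" if "\<mu> \<in> topspace ?X" for \<mu>
    using that prob_measures_pD(1) unfolding tX by blast
  have sub: "\<exists>U'. openin (wasserstein_topology p) U' \<and> U = U' \<inter> topspace ?X" if "openin ?X U" for U
    using that openin_subset[of "wasserstein_topology p"]
    by (auto simp: centered_wasserstein_topology_def openin_subtopology topspace_subtopology)
  have weak_sub: "openin ?X (U \<inter> topspace ?X)" if U: "openin weak_topology U" for U
    using openin_wasserstein_of_weak[OF U p(1)]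
    by (auto simp: centered_wasserstein_topology_def openin_subtopology topspace_wasserstein_topology intro!: exI[of _ "U \<inter> prob_measures_p p"])
  have J: "ereal f \<le> free_energy W \<sigma> \<mu>" if "\<mu> \<in> topspace ?X" for \<mu> using free_energy_ge[OF tXp[OF that]] .
  have obs: "\<exists>U'. observable U' \<and> U = U' \<inter> topspace ?X" if "openin ?X U" for U
    using sub[OF that] observable_wasserstein_open p(1) by blast
  have top: "empirical_measure n x \<in> topspace ?X" if "0 < n" "x \<in> centered_configurations n" for n x
    using that by (simp add: tX empirical_in_prob_measures_p integral_id_empirical centered_configurations_def)
  have cpt: "compactin ?X (A \<inter> moment_ball l R)" if A: "closedin ?X A" and R: "0 \<le> R" for A R
  proof -
    have "A \<inter> moment_ball l R = A \<inter> (moment_ball l R \<inter> centered_prob_measures_p p)"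
      using closedin_subset[OF A] by (auto simp: topspace_centered_wasserstein)
    then show ?thesis using closed_Int_compactin[OF A compactin_centered_wasserstein_moment_ball[OF R p]] by simp
  qed
  show "satisfies_LDP ?X (empirical_law W \<sigma> ?X) (\<lambda>\<mu>. free_energy W \<sigma> \<mu> - ereal f)"
  proof (rule satisfies_LDPI[where pre = "\<lambda>A. A"])
    fix n :: nat assume "2 \<le> n" then have n: "0 < n" by simp
    show "prob_space (empirical_law W \<sigma> ?X n) \<and> space (empirical_law W \<sigma> ?X n) = topspace ?X \<and> sets (empirical_law W \<sigma> ?X n) = sets (borel_of ?X)"
      using empirical_law_props[OF n top[OF n] obs] by blast
    show "measure (empirical_law W \<sigma> ?X n) A = enn2real (mass n A / mass n UNIV)" if "openin ?X A \<or> closedin ?X A" for A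
      using measure_empirical_law[OF n top[OF n] obs that] by blast
  next
    fix G \<mu> c assume G: "openin ?X G" and \<mu>: "\<mu> \<in> G" and c: "free_energy W \<sigma> \<mu> < ereal c"
    have \<mu>X: "\<mu> \<in> topspace ?X" using openin_subset[OF G] \<mu> by auto
    obtain G' where G': "openin (wasserstein_topology p) G'" "G = G' \<inter> topspace ?X" using sub[OF G] by blast
    obtain r where r: "0 < r" "{\<nu> \<in> prob_measures_p p. wasserstein_dist p \<mu> \<nu> < r} \<subseteq> G'"
      using G' \<mu> by (auto simp: openin_wasserstein_topology)
    obtain R where R: "0 \<le> R" "\<mu> \<in> moment_ball l R" "\<And>V. openin weak_topology V \<Longrightarrow> \<mu> \<in> V \<Longrightarrow>
        \<forall>\<^sub>F n in sequentially. ennreal (exp (- real n * c)) \<le> mass n (V \<inter> moment_ball l R)"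
      using lower_bound[OF tXp[OF \<mu>X] _ c] \<mu>X by (auto simp: tX)
    obtain V where V: "openin weak_topology V" "\<mu> \<in> V"
      "\<And>\<nu>. \<nu> \<in> V \<Longrightarrow> \<nu> \<in> moment_ball l R \<Longrightarrow> wasserstein_dist p \<mu> \<nu> < r"
      using weak_nbhd_in_wasserstein_ball[OF R(2,1) p r(1)] by blast
    \<comment> \<open>\<open>lower_bound\<close> already restricts to the moment ball, inside which
      the weak neighbourhood \<open>V\<close> is contained in the Wasserstein ball.\<close>
    have VG: "V \<inter> moment_ball l R \<subseteq> G'" using V(3) r(2) moment_ball_subset_p[OF p R(1)] by blast
    show "\<forall>\<^sub>F n in sequentially. ennreal (exp (- real n * c)) \<le> mass n G"
      using R(3)[OF V(1,2)] eventually_gt_at_top[of 0]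
    proof eventually_elim
      case (elim n)
      \<comment> \<open>Empirical measures of centered configurations lie in the centered space, so
        \<open>G'\<close> and its trace \<open>G\<close> have the same mass.\<close>
      have "mass n G' = mass n G" using top[OF elim(2)] by (intro mass_cong elim) (simp add: G'(2))
      then show ?case using order_trans[OF elim(1) mass_mono[OF VG]] by simp
    qed
  next
    fix A c c' assume A: "closedin ?X A" and c: "\<And>\<mu>. \<mu> \<in> A \<Longrightarrow> ereal c < free_energy W \<sigma> \<mu>" "c' < c"
    show "\<forall>\<^sub>F n in sequentially. mass n A \<le> ennreal (exp (- real n * c'))"
    \<comment> \<open>Covers are taken in the full Wasserstein topology, where the traces of weakly
      open sets are observable; compactness in the centered subspace carries over to it.\<close>
    proof (rule upper_bound[OF _ _ _ c(2), where X = "wasserstein_topology p"])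
      show "compactin (wasserstein_topology p) (A \<inter> moment_ball l R)" if "0 \<le> R" for R
        using cpt[OF A that] by (simp add: centered_wasserstein_topology_def compactin_subtopology)
      show "openin (wasserstein_topology p) (U \<inter> topspace (wasserstein_topology p)) \<and> observable (U \<inter> topspace (wasserstein_topology p))"
        if "openin weak_topology U" for U :: "'a measure set"
        using openin_wasserstein_of_weak[OF that p(1)] observable_wasserstein_open[OF _ p(1)] by (simp add: topspace_wasserstein_topology)
      show "\<mu> \<in> prob_measures \<and> ereal c < free_energy W \<sigma> \<mu>" if "\<mu> \<in> A" for \<mu>
        using that c(1) closedin_subset[OF A] tXp by blast
    qed
  qed (rule J)
  obtain \<mu> where \<mu>: "\<mu> \<in> prob_measures" "free_energy W \<sigma> \<mu> < \<infinity>"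
    using f by (metis INF_less_iff less_ereal.simps(4) min_free_energy_def)
  obtain \<nu> where \<nu>: "\<nu> \<in> prob_measures" "(\<integral>x. x \<partial>\<nu>) = 0" "free_energy W \<sigma> \<nu> < \<infinity>"
    using centered_version[OF \<mu>] \<mu>(2) by metis
  \<comment> \<open>Finite free energy puts the centered \<open>\<nu>\<close> into some moment ball
    of order \<open>l\<close>, hence gives it a finite \<open>p\<close>-th moment.\<close>
  have \<nu>X: "\<nu> \<in> topspace ?X"
  proof -
    obtain c where c: "free_energy W \<sigma> \<nu> \<le> ereal c" using \<nu>(3) by (cases "free_energy W \<sigma> \<nu>") auto
    obtain R where R: "0 \<le> R" "centered_level c \<subseteq> moment_ball l R"
      by (rule level_set_moment_ball[of c])
    show ?thesis
      using R(2) \<nu>(1,2) c moment_ball_subset_p[OF p R(1)] unfolding tX centered_level_def by blast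
  qed
  show "good_rate_function ?X (\<lambda>\<mu>. free_energy W \<sigma> \<mu> - ereal f)"
  proof (rule good_rate_functionI[where J = "free_energy W \<sigma>", OF J \<nu>X \<nu>(3)])
    fix c
    let ?S = "{\<mu> \<in> topspace ?X. free_energy W \<sigma> \<mu> \<le> ereal c}"
    have "openin ?X (topspace ?X - ?S)"
    proof (subst openin_subopen, intro ballI)
      fix \<mu> assume \<mu>: "\<mu> \<in> topspace ?X - ?S"
      then have "ereal c < free_energy W \<sigma> \<mu>" by (auto simp: not_le)
      then obtain U where U: "openin weak_topology U" "\<mu> \<in> U"
        "U \<inter> centered_level c = {}"
        using high_energy_nbhd[OF tXp, of \<mu> c] \<mu> by blast
      have "U \<inter> topspace ?X \<subseteq> topspace ?X - ?S" using U(3) tXp tX by (auto simp: centered_level_def)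
      then show "\<exists>T. openin ?X T \<and> \<mu> \<in> T \<and> T \<subseteq> topspace ?X - ?S"
        using weak_sub[OF U(1)] U(2) \<mu> by (intro exI[of _ "U \<inter> topspace ?X"]) auto
    qed
    then have S: "closedin ?X ?S" unfolding closedin_def by auto
    obtain R where R: "0 \<le> R" "centered_level c \<subseteq> moment_ball l R"
      by (rule level_set_moment_ball[of c])
    have "?S \<inter> moment_ball l R = ?S" using R(2) tXp tX by (auto simp: centered_level_def)
    then show "compactin ?X ?S" using cpt[OF S R(1)] by simp
  qed
qed

end

section \<open>Reduction of the hypotheses on the potential\<close>

lemma lower_semicontinuous_add:
  fixes g h :: "'a::t2_space \<Rightarrow> real"
  assumes "lower_semicontinuous g" "continuous_on UNIV h"
  shows "lower_semicontinuous (\<lambda>x. g x + h x)"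
  unfolding lower_semicontinuous_def
proof (intro allI impI)
  fix x c assume c: "c < g x + h x"
  define d where "d = (g x + h x - c) / 2"
  have d: "0 < d" using c by (simp add: d_def)
  have "\<forall>\<^sub>F y in nhds x. g x - d < g y" using assms(1) d by (simp add: lower_semicontinuous_def)
  moreover have "\<forall>\<^sub>F y in nhds x. h x - d < h y"
  proof -
    have "isCont h x" using assms(2) by (simp add: continuous_on_eq_continuous_at)
    then have "filterlim h (nhds (h x)) (nhds x)" unfolding isCont_def tendsto_at_iff_tendsto_nhds .
    then show ?thesis by (rule order_tendstoD(1)) (use d in simp)
  qed
  ultimately show "\<forall>\<^sub>F y in nhds x. c < g y + h y"
    by eventually_elim (simp add: d_def field_simps)
qed

text \<open>Beyond \<open>T\<close> the term \<open>k * t powr l\<close> dominates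
  \<open>M * t powr l'\<close>, as \<open>T powr (l - l') \<ge> M / k\<close>; below
  \<open>T\<close> a constant suffices.\<close>

lemma powr_lower_order_bound:
  fixes k l l' M :: real
  assumes l': "0 \<le> l'" "l' < l" and k: "0 < k" and M: "0 \<le> M"
  obtains C where "\<And>t. 0 \<le> t \<Longrightarrow> M * (1 + t powr l') \<le> k * t powr l + C"
proof -
  define T where "T = max 1 ((M / k) powr (1 / (l - l')))"
  have T: "1 \<le> T" by (simp add: T_def)
  have "M * (1 + t powr l') \<le> k * t powr l + M * (1 + T powr l')" if t: "0 \<le> t" for t
  proof (cases "t \<le> T")
    case True
    then have "M * (1 + t powr l') \<le> M * (1 + T powr l')" using t l' M by (intro mult_left_mono add_left_mono powr_mono2) auto
    then show ?thesis using k by (simp add: add_increasing)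
  next
    case False
    then have t0: "0 < t" "(M / k) powr (1 / (l - l')) \<le> t" using T by (auto simp: T_def)
    have "M / k = ((M / k) powr (1 / (l - l'))) powr (l - l')" using l' M k by (simp add: powr_powr)
    also have "\<dots> \<le> t powr (l - l')" using t0 l' by (intro powr_mono2) auto
    finally have "M \<le> k * t powr (l - l')" using k by (simp add: field_simps)
    then have "M * t powr l' \<le> k * t powr (l - l') * t powr l'" by (intro mult_right_mono) auto
    also have "\<dots> = k * t powr l" by (simp add: powr_add[symmetric] mult.assoc)
    finally have "M * t powr l' \<le> k * t powr l" .
    moreover have "0 \<le> M * T powr l'" using M by simp
    ultimately show ?thesis by (simp add: distrib_left)
  qed
  then show ?thesis by (rule that)
qed

theorem corollary2p18:
  fixes W Ws Wf :: "'a::euclidean_space \<Rightarrow> real" and \<sigma> l \<kappa> :: real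
  assumes sigma: "\<sigma>\<^sup>2 > 0"
    and W_nonneg: "\<And>x. 0 \<le> W x"
    and W_decomp: "\<And>x. W x = Ws x + Wf x"
    and Ws_nonneg: "\<And>x. 0 \<le> Ws x"
    and Ws_even: "\<And>x. Ws (- x) = Ws x"
    and Ws_lsc: "lower_semicontinuous Ws"
    and l: "1 \<le> l"
    and kappa: "0 < \<kappa>"
    and Ws_growth: "\<And>x. 2 * \<kappa> * norm x powr l \<le> Ws x"
    and Ws_dilation: "\<And>\<epsilon> x. 0 < \<epsilon> \<Longrightarrow> \<epsilon> < 1 \<Longrightarrow> Ws ((1 - \<epsilon>) *\<^sub>R x) \<le> (1 - \<epsilon>) * Ws x"
    and Wf_even: "\<And>x. Wf (- x) = Wf x"
    and Wf_cont: "continuous_on UNIV Wf"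
    and Wf_growth1: "l = 1 \<Longrightarrow> bounded (range Wf)"
    and Wf_growth: "1 < l \<Longrightarrow>
          \<exists>l'. 0 \<le> l' \<and> l' < l \<and> bounded (range (\<lambda>x. Wf x / (1 + norm x powr l')))"
  shows "(\<forall>n\<ge>2. 0 < partition_function W \<sigma> n \<and> partition_function W \<sigma> n < \<infinity> \<and>
            prob_space (gibbs_measure W \<sigma> n))
    \<and> (min_free_energy W \<sigma> < \<infinity> \<longrightarrow>
        (satisfies_LDP orbit_topology (orbit_law W \<sigma>)
            (\<lambda>A. orbit_free_energy W \<sigma> A - min_free_energy W \<sigma>)
          \<and> good_rate_function orbit_topology
            (\<lambda>A. orbit_free_energy W \<sigma> A - min_free_energy W \<sigma>))
      \<and> (1 < l \<longrightarrow> (\<forall>p. 1 \<le> p \<and> p < l \<longrightarrow>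
            satisfies_LDP (centered_wasserstein_topology p)
              (empirical_law W \<sigma> (centered_wasserstein_topology p))
              (\<lambda>\<mu>. free_energy W \<sigma> \<mu> - min_free_energy W \<sigma>)
          \<and> good_rate_function (centered_wasserstein_topology p)
              (\<lambda>\<mu>. free_energy W \<sigma> \<mu> - min_free_energy W \<sigma>))))"
proof -
  have W_eq: "W = (\<lambda>x. Ws x + Wf x)" using W_decomp by auto
  have lsc: "lower_semicontinuous W" unfolding W_eq by (rule lower_semicontinuous_add[OF Ws_lsc Wf_cont])
  \<comment> \<open>One half of the growth constant \<open>2 * \<kappa>\<close> of \<open>Ws\<close>
    absorbs the negative part of \<open>Wf\<close> up to a constant; the other half is the
    confinement left to \<open>W\<close>.\<close>
  have "\<exists>C. \<forall>x. - Wf x \<le> \<kappa> * norm x powr l + C"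
  proof (cases "l = 1")
    case True
    then obtain M where "\<forall>y\<in>range Wf. norm y \<le> M" using Wf_growth1 unfolding bounded_iff by blast
    then have M: "\<bar>Wf x\<bar> \<le> M" for x by simp
    have "- Wf x \<le> \<kappa> * norm x powr l + M" for x
    proof -
      have "0 \<le> \<kappa> * norm x powr l" using kappa by simp
      then show ?thesis using M[of x] by linarith
    qed
    then show ?thesis by blast
  next
    case False
    then obtain l' where l': "0 \<le> l'" "l' < l" "bounded (range (\<lambda>x. Wf x / (1 + norm x powr l')))"
      using Wf_growth l by (metis order_le_less)
    then obtain M where "\<forall>y\<in>range (\<lambda>x. Wf x / (1 + norm x powr l')). norm y \<le> M" unfolding bounded_iff by blast
    then have M: "\<bar>Wf x / (1 + norm x powr l')\<bar> \<le> M" for x by simp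
    have M0: "0 \<le> M" using order_trans[OF abs_ge_zero M] .
    obtain C where C: "\<And>t. 0 \<le> t \<Longrightarrow> M * (1 + t powr l') \<le> \<kappa> * t powr l + C"
      using powr_lower_order_bound[OF l'(1,2) kappa M0] by blast
    have "- Wf x \<le> \<kappa> * norm x powr l + C" for x
    proof -
      have pos: "0 < 1 + norm x powr l'" by (simp add: add_pos_nonneg)
      have "\<bar>Wf x\<bar> / (1 + norm x powr l') \<le> M" using M[of x] pos by (simp add: abs_divide)
      then have "\<bar>Wf x\<bar> \<le> M * (1 + norm x powr l')" using pos by (simp add: pos_divide_le_eq)
      then show ?thesis using C[OF norm_ge_zero[of x]] by linarith
    qed
    then show ?thesis by blast
  qed
  then obtain C where C: "\<And>x. - Wf x \<le> \<kappa> * norm x powr l + C" by blast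
  interpret gibbs W \<sigma> l \<kappa> C
  proof
    show "0 < \<sigma>\<^sup>2" "0 \<le> W x" "lower_semicontinuous W" "1 \<le> l" "0 < \<kappa>" for x
      by (rule sigma W_nonneg lsc l kappa)+
    show "\<kappa> * norm x powr l - C \<le> W x" for x using C[of x] Ws_growth[of x] W_decomp[of x] by linarith
  qed
  have "satisfies_LDP orbit_topology (orbit_law W \<sigma>) (\<lambda>A. orbit_free_energy W \<sigma> A - min_free_energy W \<sigma>)
      \<and> good_rate_function orbit_topology (\<lambda>A. orbit_free_energy W \<sigma> A - min_free_energy W \<sigma>)
      \<and> (\<forall>p. 1 \<le> p \<and> p < l \<longrightarrow>
            satisfies_LDP (centered_wasserstein_topology p)
              (empirical_law W \<sigma> (centered_wasserstein_topology p))
              (\<lambda>\<mu>. free_energy W \<sigma> \<mu> - min_free_energy W \<sigma>)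
          \<and> good_rate_function (centered_wasserstein_topology p)
              (\<lambda>\<mu>. free_energy W \<sigma> \<mu> - min_free_energy W \<sigma>))"
    if fin: "min_free_energy W \<sigma> < \<infinity>"
  proof -
    \<comment> \<open>Bounded below by the mass estimates and not \<open>\<infinity>\<close> by
      assumption, the infimum is a real number.\<close>
    obtain K where "ereal K \<le> min_free_energy W \<sigma>" by (rule free_energy_lower_bound)
    then obtain f where f: "min_free_energy W \<sigma> = ereal f" using fin by (cases "min_free_energy W \<sigma>") auto
    interpret gibbs_finite W \<sigma> l \<kappa> C f by unfold_locales (rule f)
    show ?thesis unfolding f using orbit_LDP wasserstein_LDP by blast
  qed
  then show ?thesis
    using mass_UNIV_pos mass_UNIV_finite prob_space_gibbs by (simp add: partition_function_eq)
qed

end
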